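(* Let $2\leq k\in\mathbb{Z}$, $N\geq1$, $\chi$ a Dirichlet character modulo $N$. Suppose that $g=\sum_{n=1}^\infty c_g(n)q^n\in S_k(\Gamma_0(N),\overline{\chi})$ is a normalized newform, and that $f\in H_{2-k}(\Gamma_0(N),\chi)$ is good for $g$. If $p\nmid N$ is a prime with $c_g(p)=0$, then $c_f^+(n)$ is algebraic for every integer $n$ with $\mathrm{ord}_p(n)$ odd.
   Context: $z=x+iy\in\mathbb{H}$, $q=e^{2\pi iz}$. $H_{2-k}(\Gamma_0(N),\chi)$ is the space of harmonic weak Maass forms of weight $2-k$: smooth $f:\mathbb{H}\to\mathbb{C}$ with $f(\frac{az+b}{cz+d})=\chi(d)(cz+d)^{2-k}f(z)$ for $\begin{pmatrix}a&b\\c&d\end{pmatrix}\in\Gamma_0(N)$, annihilated by $\Delta_{2-k}=-y^2(\partial_x^2+\partial_y^2)+i(2-k)y(\partial_x+i\partial_y)$, and such that at each cusp there is a principal part $P\in\mathbb{C}[q^{-1}]$ (in the local uniformizer) with $f-P=O(e^{-\varepsilon y})$ as $y\to\infty$. Such $f$ has an expansion $f=\sum_{n\gg-\infty}c_f^+(n)q^n+\sum_{n<0}c_f^-(n)\Gamma(k-1,4\pi|n|y)q^n$. $\xi_w(f)=2iy^w\overline{\partial f/\partial\bar z}$. $F_g$ is the field generated over $\mathbb{Q}$ by the coefficients of $g$, $\|g\|$ its Petersson norm. $f$ is good for $g$ if: (i) the principal part of $f$ at $\infty$ lies in $F_g[q^{-1}]$; (ii) the principal parts of $f$ at the other cusps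 of $\Gamma_0(N)$ are constant; (iii) $\xi_{2-k}(f)=\|g\|^{-2}g$. *)

theory Defs
  imports
    "HOL-Analysis.Analysis"
    "HOL-Library.Landau_Symbols"
    "HOL-Algebra.Generated_Fields"
    "HOL-Algebra.Algebraic_Closure_Type"
begin

hide_const (open) Divisibility.prime up_ring.coeff

text \<open>
  Functions on the upper half plane are total functions of type
  \<^typ>\<open>complex \<Rightarrow> complex\<close>; everything below only depends on their values on \<open>uhp\<close>.
\<close>

definition uhp :: "complex set" where
  "uhp = {z. Im z > 0}"

subsection \<open>The modular group and its congruence subgroups\<close>

definition SL2Z :: "(int^2^2) set" where
  "SL2Z = {\<gamma>. det \<gamma> = 1}"

definition Gamma0 :: "nat \<Rightarrow> (int^2^2) set" where
  "Gamma0 N = {\<gamma> \<in> SL2Z. int N dvd \<gamma> $ 2 $ 1}"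

definition mat_act :: "int^2^2 \<Rightarrow> complex \<Rightarrow> complex" where
  "mat_act \<gamma> = moebius (of_int (\<gamma> $ 1 $ 1)) (of_int (\<gamma> $ 1 $ 2))
                        (of_int (\<gamma> $ 2 $ 1)) (of_int (\<gamma> $ 2 $ 2))"

definition aut_factor :: "int^2^2 \<Rightarrow> complex \<Rightarrow> complex" where
  "aut_factor \<gamma> z = of_int (\<gamma> $ 2 $ 1) * z + of_int (\<gamma> $ 2 $ 2)"

definition slash :: "int \<Rightarrow> (complex \<Rightarrow> complex) \<Rightarrow> int^2^2 \<Rightarrow> complex \<Rightarrow> complex" where
  "slash w f \<gamma> z = aut_factor \<gamma> z powi (- w) * f (mat_act \<gamma> z)"

definition dirichlet_character :: "nat \<Rightarrow> (int \<Rightarrow> complex) \<Rightarrow> bool" where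
  "dirichlet_character N chi \<longleftrightarrow>
     (\<forall>a b. chi (a * b) = chi a * chi b) \<and>
     (\<forall>a. chi (a + int N) = chi a) \<and>
     (\<forall>a. chi a \<noteq> 0 \<longleftrightarrow> coprime a (int N))"

definition modular_transform :: "int \<Rightarrow> nat \<Rightarrow> (int \<Rightarrow> complex) \<Rightarrow> (complex \<Rightarrow> complex) \<Rightarrow> bool" where
  "modular_transform w N chi f \<longleftrightarrow>
     (\<forall>\<gamma>\<in>Gamma0 N. \<forall>z\<in>uhp.
        f (mat_act \<gamma> z) = chi (\<gamma> $ 2 $ 2) * aut_factor \<gamma> z powi w * f z)"

subsection \<open>Cusp forms\<close>

definition has_q_expansion :: "nat \<Rightarrow> (nat \<Rightarrow> complex) \<Rightarrow> (complex \<Rightarrow> complex) \<Rightarrow> bool" where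
  "has_q_expansion h a f \<longleftrightarrow>
     (\<forall>z\<in>uhp. (\<lambda>n. a n * exp (2 * of_real pi * \<i> * z / of_nat h) ^ n) sums f z)"

text \<open>
  At the cusp \<open>\<gamma>\<infinity>\<close> we expand in \<open>q\<^sub>N = exp (2 \<pi> i z / N)\<close> rather than in the uniformizer
  attached to the width of the cusp. For \<open>f\<close> of level \<open>N\<close> with any nebentypus, \<open>f|\<gamma>\<close> is
  \<open>N\<close>-periodic, so this treats regular and irregular cusps alike.
\<close>

definition cusp_forms :: "int \<Rightarrow> nat \<Rightarrow> (int \<Rightarrow> complex) \<Rightarrow> (complex \<Rightarrow> complex) set" where
  "cusp_forms k N chi =
     {f. f holomorphic_on uhp \<and> modular_transform k N chi f \<and>
         (\<forall>\<gamma>\<in>SL2Z. \<exists>a. a 0 = 0 \<and> has_q_expansion N a (slash k f \<gamma>))}"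

text \<open>The coefficients \<open>c\<^sub>g(n)\<close> of the expansion of \<open>g\<close> at \<open>\<infinity>\<close>, which are unique if they exist.\<close>

definition q_coeff :: "(complex \<Rightarrow> complex) \<Rightarrow> nat \<Rightarrow> complex" where
  "q_coeff g = (THE c. has_q_expansion 1 c g)"

definition coeff_field :: "(complex \<Rightarrow> complex) \<Rightarrow> complex set" where
  "coeff_field g = generate_field (ring_of_type_algebra :: complex ring) (range (q_coeff g))"

subsection \<open>The Petersson inner product\<close>

text \<open>
  The integral over \<open>\<Gamma>\<^sub>0(N)\<setminus>\<H>\<close> is not divided by the index of \<open>\<Gamma>\<^sub>0(N)\<close>. It is computed on the
  fundamental domain consisting of the translates \<open>\<gamma>F\<close>, where \<open>F\<close> is the standard fundamental
  domain of \<open>SL\<^sub>2(\<int>)\<close> and \<open>\<gamma>\<close> runs through representatives of \<open>\<Gamma>\<^sub>0(N)\<setminus>SL\<^sub>2(\<int>)\<close>;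
  as the integrand is \<open>\<Gamma>\<^sub>0(N)\<close>-invariant, the choice of representatives does not matter.
\<close>

definition std_fund_domain :: "complex set" where
  "std_fund_domain = {z \<in> uhp. \<bar>Re z\<bar> \<le> 1/2 \<and> cmod z \<ge> 1}"

definition Gamma0_cosets :: "nat \<Rightarrow> (int^2^2) set set" where
  "Gamma0_cosets N = (\<lambda>\<gamma>. (\<lambda>\<delta>. \<delta> ** \<gamma>) ` Gamma0 N) ` SL2Z"

definition petersson_inner ::
    "int \<Rightarrow> nat \<Rightarrow> (complex \<Rightarrow> complex) \<Rightarrow> (complex \<Rightarrow> complex) \<Rightarrow> complex" where
  "petersson_inner k N g h =
     (\<Sum>C\<in>Gamma0_cosets N. let \<gamma> = (SOME \<gamma>. \<gamma> \<in> C) in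
        set_lebesgue_integral lborel std_fund_domain
          (\<lambda>z. g (mat_act \<gamma> z) * cnj (h (mat_act \<gamma> z))
                 * of_real (Im (mat_act \<gamma> z) powi k) / of_real ((Im z)\<^sup>2)))"

definition petersson_norm :: "int \<Rightarrow> nat \<Rightarrow> (complex \<Rightarrow> complex) \<Rightarrow> real" where
  "petersson_norm k N g = sqrt (Re (petersson_inner k N g g))"

subsection \<open>Newforms\<close>

text \<open>
  For \<open>gcd(a, N) > 1\<close> the factor \<open>chi(a)\<close> vanishes, so for primes \<open>p\<close> dividing \<open>N\<close>
  the operator below is the usual \<open>U\<^sub>p\<close>.
\<close>

definition hecke :: "int \<Rightarrow> (int \<Rightarrow> complex) \<Rightarrow> nat \<Rightarrow> (complex \<Rightarrow> complex) \<Rightarrow> complex \<Rightarrow> complex" where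
  "hecke k chi n f z =
     of_nat n powi (k - 1) *
     (\<Sum>d | d dvd n. \<Sum>b<d.
        chi (int (n div d)) * of_nat d powi (- k) * f ((of_nat (n div d) * z + of_nat b) / of_nat d))"

text \<open>
  The oldspace of \<open>S\<^sub>k(\<Gamma>\<^sub>0(N), chi)\<close> is spanned by the forms \<open>h(dz)\<close>, where \<open>h\<close> has proper level
  \<open>M | N\<close>, \<open>dM | N\<close>, and the nebentypus of \<open>h\<close> is a character modulo \<open>M\<close> inducing \<open>chi\<close>.
\<close>

inductive_set old_cusp_forms :: "int \<Rightarrow> nat \<Rightarrow> (int \<Rightarrow> complex) \<Rightarrow> (complex \<Rightarrow> complex) set"
  for k N chi where
  zero: "(\<lambda>z. 0) \<in> old_cusp_forms k N chi"
| lift: "\<lbrakk>M * d dvd N; M < N; dirichlet_character M \<psi>; \<And>a. coprime a (int N) \<Longrightarrow> \<psi> a = chi a;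
          h \<in> cusp_forms k M \<psi>\<rbrakk> \<Longrightarrow> (\<lambda>z. h (of_nat d * z)) \<in> old_cusp_forms k N chi"
| add: "\<lbrakk>f \<in> old_cusp_forms k N chi; h \<in> old_cusp_forms k N chi\<rbrakk>
          \<Longrightarrow> (\<lambda>z. f z + h z) \<in> old_cusp_forms k N chi"
| scale: "f \<in> old_cusp_forms k N chi \<Longrightarrow> (\<lambda>z. c * f z) \<in> old_cusp_forms k N chi"

definition new_cusp_forms :: "int \<Rightarrow> nat \<Rightarrow> (int \<Rightarrow> complex) \<Rightarrow> (complex \<Rightarrow> complex) set" where
  "new_cusp_forms k N chi =
     {g \<in> cusp_forms k N chi. \<forall>h\<in>old_cusp_forms k N chi. petersson_inner k N g h = 0}"

definition normalized_newform :: "int \<Rightarrow> nat \<Rightarrow> (int \<Rightarrow> complex) \<Rightarrow> (complex \<Rightarrow> complex) \<Rightarrow> bool" where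
  "normalized_newform k N chi g \<longleftrightarrow>
     g \<in> new_cusp_forms k N chi \<and>
     (\<forall>n\<ge>1. \<exists>ev. \<forall>z\<in>uhp. hecke k chi n g z = ev * g z) \<and>
     q_coeff g 1 = 1"

subsection \<open>Harmonic weak Maass forms\<close>

definition partial_x :: "(complex \<Rightarrow> complex) \<Rightarrow> complex \<Rightarrow> complex" where
  "partial_x f z = frechet_derivative f (at z) 1"

definition partial_y :: "(complex \<Rightarrow> complex) \<Rightarrow> complex \<Rightarrow> complex" where
  "partial_y f z = frechet_derivative f (at z) \<i>"

fun times_diff_uhp :: "nat \<Rightarrow> (complex \<Rightarrow> complex) \<Rightarrow> bool" where
  "times_diff_uhp 0 f \<longleftrightarrow> continuous_on uhp f"
| "times_diff_uhp (Suc n) f \<longleftrightarrow>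
     f differentiable_on uhp \<and> times_diff_uhp n (partial_x f) \<and> times_diff_uhp n (partial_y f)"

definition smooth_uhp :: "(complex \<Rightarrow> complex) \<Rightarrow> bool" where
  "smooth_uhp f \<longleftrightarrow> (\<forall>n. times_diff_uhp n f)"

definition hyp_laplacian :: "int \<Rightarrow> (complex \<Rightarrow> complex) \<Rightarrow> complex \<Rightarrow> complex" where
  "hyp_laplacian w f z =
     - of_real ((Im z)\<^sup>2) * (partial_x (partial_x f) z + partial_y (partial_y f) z)
     + \<i> * of_int w * of_real (Im z) * (partial_x f z + \<i> * partial_y f z)"

definition dbar :: "(complex \<Rightarrow> complex) \<Rightarrow> complex \<Rightarrow> complex" where
  "dbar f z = (partial_x f z + \<i> * partial_y f z) / 2"

definition xi_op :: "int \<Rightarrow> (complex \<Rightarrow> complex) \<Rightarrow> complex \<Rightarrow> complex" where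
  "xi_op w f z = 2 * \<i> * of_real (Im z powi w) * cnj (dbar f z)"

text \<open>
  \<open>P\<close> is evaluated at the inverse of \<open>exp (2 \<pi> i z / h)\<close>, so the constant term of a principal part
  is included. The estimate is for \<open>y \<rightarrow> \<infinity>\<close>, uniformly in \<open>x\<close>.
\<close>

definition principal_part :: "nat \<Rightarrow> complex poly \<Rightarrow> (complex \<Rightarrow> complex) \<Rightarrow> bool" where
  "principal_part h P f \<longleftrightarrow>
     (\<exists>\<epsilon>>0. (\<lambda>z. f z - poly P (exp (- 2 * of_real pi * \<i> * z / of_nat h)))
               \<in> O[filtercomap Im at_top](\<lambda>z. of_real (exp (- \<epsilon> * Im z))))"

definition harmonic_maass_forms ::
    "int \<Rightarrow> nat \<Rightarrow> (int \<Rightarrow> complex) \<Rightarrow> (complex \<Rightarrow> complex) set" where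
  "harmonic_maass_forms w N chi =
     {f. smooth_uhp f \<and> modular_transform w N chi f \<and>
         (\<forall>z\<in>uhp. hyp_laplacian w f z = 0) \<and>
         (\<forall>\<gamma>\<in>SL2Z. \<exists>P. principal_part N P (slash w f \<gamma>))}"

definition upper_inc_Gamma :: "real \<Rightarrow> real \<Rightarrow> real" where
  "upper_inc_Gamma s x = integral {x..} (\<lambda>t. t powr (s - 1) * exp (- t))"

definition maass_expansion ::
    "int \<Rightarrow> (complex \<Rightarrow> complex) \<Rightarrow> (int \<Rightarrow> complex) \<Rightarrow> (int \<Rightarrow> complex) \<Rightarrow> bool" where
  "maass_expansion k f cp cm \<longleftrightarrow>
     (\<exists>m. \<forall>n<m. cp n = 0) \<and>
     (\<forall>z\<in>uhp. \<exists>A B.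
        ((\<lambda>n. cp n * exp (2 * of_real pi * \<i> * of_int n * z)) has_sum A) UNIV \<and>
        ((\<lambda>n. cm n * of_real (upper_inc_Gamma (of_int (k - 1)) (4 * pi * \<bar>of_int n\<bar> * Im z))
                * exp (2 * of_real pi * \<i> * of_int n * z)) has_sum B) {..<0} \<and>
        f z = A + B)"

text \<open>The coefficients \<open>c\<^sub>f\<^sup>+(n)\<close> of \<open>f \<in> H\<^sub>2\<^sub>-\<^sub>k(\<Gamma>\<^sub>0(N), chi)\<close>; they are uniquely determined by \<open>f\<close>.\<close>

definition c_plus :: "int \<Rightarrow> (complex \<Rightarrow> complex) \<Rightarrow> int \<Rightarrow> complex" where
  "c_plus k f = (THE cp. \<exists>cm. maass_expansion k f cp cm)"

text \<open>
  A cusp \<open>\<gamma>\<infinity>\<close> is equivalent to \<open>\<infinity>\<close> modulo \<open>\<Gamma>\<^sub>0(N)\<close> iff \<open>\<gamma> \<in> \<Gamma>\<^sub>0(N)\<close>, since \<open>\<Gamma>\<^sub>0(N)\<close> contains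
  the stabilizer of \<open>\<infinity>\<close> in \<open>SL\<^sub>2(\<int>)\<close>.
\<close>

definition good_for :: "int \<Rightarrow> nat \<Rightarrow> (complex \<Rightarrow> complex) \<Rightarrow> (complex \<Rightarrow> complex) \<Rightarrow> bool" where
  "good_for k N f g \<longleftrightarrow>
     (\<exists>P. principal_part 1 P f \<and> (\<forall>i. coeff P i \<in> coeff_field g)) \<and>
     (\<forall>\<gamma>\<in>SL2Z - Gamma0 N. \<exists>a. principal_part N [:a:] (slash (2 - k) f \<gamma>)) \<and>
     (\<forall>z\<in>uhp. xi_op (2 - k) f z = of_real (petersson_norm k N g powi (- 2)) * g z)"

end

theory Submission
  imports Defs "HOL-Complex_Analysis.Complex_Analysis"
begin

text \<open>
  A complex number killed by every derivation \<open>\<delta>\<close> of \<open>\<complex>\<close> is algebraic, so it suffices to show that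
  \<open>\<delta>\<close> kills the coefficients in question. Let \<open>\<delta>\<close> act on power series coefficientwise.

  There is a modular form \<open>d \<noteq> 0\<close> of level \<open>N\<close> with algebraic coefficients such that \<open>d F\<close> is, for
  every form \<open>F\<close> of level \<open>N\<close>, a combination of finitely many forms with algebraic coefficients: interpolate
  with Eisenstein series of weight 3, which separate the cosets of \<open>\<Gamma>(N)\<close>, and use traces to level 1.
  Applied to the powers of \<open>F\<close>, this shows that \<open>d (\<delta> F)\<^sup>n\<close> is a form for every \<open>n\<close>, so that
  \<open>\<delta> F\<close> is again a modular form. Moreover, \<open>\<delta>\<close> kills the eigenvalues of a newform \<open>g\<close>, since otherwise
  \<open>g\<close>, \<open>\<delta> g\<close>, \<open>\<delta>\<^sup>2 g\<close>, ... would form an infinite Jordan chain of a Hecke operator in a space of finite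
  dimension.

  If \<open>c\<^sub>g(p) = 0\<close>, then the non-holomorphic part of \<open>f|T\<^sub>p\<close> vanishes. So \<open>f|T\<^sub>p\<close> is weakly holomorphic
  of weight \<open>2 - k \<le> 0\<close>, and \<open>\<delta>\<close> kills its polar parts at all cusps and its constant term at \<open>\<infinity>\<close>.
  Hence \<open>\<delta> (f|T\<^sub>p)\<close> is a holomorphic form of nonpositive weight that vanishes at \<open>\<infinity>\<close>, that is, zero.
  The coefficients of \<open>f|T\<^sub>p\<close> are \<open>c\<^sup>+(p n) + \<chi>(p) p\<^sup>1\<^sup>-\<^sup>k c\<^sup>+(n / p)\<close>, and the claim follows by induction
  on the power of \<open>p\<close> dividing \<open>n\<close>.
\<close>

text \<open>A derivation of \<complex> is in general discontinuous, so nothing bounds the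
  coefficients of \<delta> F, and the mere convergence of this series is the main obstacle. The
  denominator d alone would leave possible poles of \<delta> F at the zeros of d. A pole of order e
  would give d (\<delta> F)^n a pole of order n e minus the order of vanishing of d, which is
  positive for large n; this is why all powers are considered. Weight 3 is the least weight in which
  the Eisenstein series converge absolutely, and being odd it separates a matrix from its negative,
  which no even weight does. Goodness only makes the principal parts of f at the other cusps
  constant, and these constants may be transcendental, so \<delta> (f|T_p) is not known to vanish
  there. The norm to level 1 overcomes this: it vanishes at oo as soon as one of its factors
  does.\<close>

hide_const (open) up_ring.monom Polynomials.degree Polynomials.lead_coeff

section \<open>Derivations of \<complex> and algebraic numbers\<close>

locale derivation =
  fixes \<delta> :: "complex \<Rightarrow> complex"
  assumes add: "\<delta> (x + y) = \<delta> x + \<delta> y"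
    and mult: "\<delta> (x * y) = \<delta> x * y + x * \<delta> y"

text \<open>A derivation on a subring of \<complex>, encoded by its graph so that extension is
  inclusion and chains have unions. Reading (a, a') as a + a' eps with eps^2 = 0, it is a subring of
  the dual numbers; by closure under differences, single-valuedness need only be required over
  0.\<close>

definition derivation_graph :: "(complex \<times> complex) set \<Rightarrow> bool" where
  "derivation_graph G \<longleftrightarrow> (1, 0) \<in> G \<and>
     (\<forall>a a' b b'. (a, a') \<in> G \<longrightarrow> (b, b') \<in> G \<longrightarrow>
        (a + b, a' + b') \<in> G \<and> (a * b, a' * b + a * b') \<in> G) \<and>
     (\<forall>a a'. (a, a') \<in> G \<longrightarrow> (- a, - a') \<in> G) \<and>
     (\<forall>b. (0, b) \<in> G \<longrightarrow> b = 0)"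

lemma derivation_graphD:
  assumes "derivation_graph G"
  shows "(1, 0) \<in> G"
    and "(a, a') \<in> G \<Longrightarrow> (b, b') \<in> G \<Longrightarrow> (a + b, a' + b') \<in> G"
    and "(a, a') \<in> G \<Longrightarrow> (b, b') \<in> G \<Longrightarrow> (a * b, a' * b + a * b') \<in> G"
    and "(a, a') \<in> G \<Longrightarrow> (- a, - a') \<in> G"
    and "(0, b) \<in> G \<Longrightarrow> b = 0"
  using assms unfolding derivation_graph_def by blast+

lemma derivation_graph_0: "derivation_graph G \<Longrightarrow> (0, 0) \<in> G"
  using derivation_graphD(1,2,4)[of G] by (metis add.right_inverse)

lemma derivation_graph_unique:
  assumes G: "derivation_graph G" and "(a, a') \<in> G" "(a, a'') \<in> G"
  shows "a' = a''"
proof -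
  have "(a + - a, a' + - a'') \<in> G"
    using assms derivation_graphD(2,4)[OF G] by blast
  then show ?thesis
    using derivation_graphD(5)[OF G] by fastforce
qed

definition dual_poly :: "(complex \<times> complex) set \<Rightarrow> complex poly \<Rightarrow> complex poly \<Rightarrow> bool" where
  "dual_poly G p p' \<longleftrightarrow> (\<forall>i. (coeff p i, coeff p' i) \<in> G)"

lemma dual_poly_mult:
  assumes G: "derivation_graph G" and p: "dual_poly G p p'" and q: "dual_poly G q q'"
  shows "dual_poly G (p * q) (p' * q + p * q')"
  unfolding dual_poly_def
proof
  fix i
  have sum: "(\<Sum>j\<in>J. f j, \<Sum>j\<in>J. f' j) \<in> G"
    if "finite J" "\<And>j. j \<in> J \<Longrightarrow> (f j, f' j) \<in> G" for J :: "nat set" and f f'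
    using that
    by (induction J rule: finite_induct)
       (auto intro: derivation_graphD[OF G] derivation_graph_0[OF G])
  have "(\<Sum>j\<le>i. coeff p j * coeff q (i - j),
         \<Sum>j\<le>i. coeff p' j * coeff q (i - j) + coeff p j * coeff q' (i - j)) \<in> G"
    using p q by (intro sum) (auto simp: dual_poly_def intro: derivation_graphD[OF G])
  then show "(coeff (p * q) i, coeff (p' * q + p * q') i) \<in> G"
    by (simp add: coeff_mult sum.distrib)
qed

lemma dual_poly_add:
  assumes G: "derivation_graph G" and p: "dual_poly G p p'" and q: "dual_poly G q q'"
  shows "dual_poly G (p + q) (p' + q')"
  using assms derivation_graphD(2)[OF G] unfolding dual_poly_def by simp

lemma dual_poly_minus:
  assumes G: "derivation_graph G" and p: "dual_poly G p p'"
  shows "dual_poly G (- p) (- p')"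
  using assms derivation_graphD(4)[OF G] unfolding dual_poly_def by simp

lemma dual_poly_monom:
  assumes "derivation_graph G" "(a, a') \<in> G"
  shows "dual_poly G (monom a i) (monom a' i)"
  using assms derivation_graph_0 unfolding dual_poly_def by auto

text \<open>The eps-part of the value of p + p' eps at y + \<eta> eps, where eps^2 = 0.\<close>

definition dual_eval :: "complex \<Rightarrow> complex \<Rightarrow> complex poly \<Rightarrow> complex poly \<Rightarrow> complex" where
  "dual_eval y \<eta> p p' = poly p' y + poly (pderiv p) y * \<eta>"

lemma dual_eval_mult:
  "dual_eval y \<eta> (p * q) (p' * q + p * q') = dual_eval y \<eta> p p' * poly q y + poly p y * dual_eval y \<eta> q q'"
  by (simp add: dual_eval_def pderiv_mult algebra_simps)

lemma dual_eval_add: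
  "dual_eval y \<eta> (p + q) (p' + q') = dual_eval y \<eta> p p' + dual_eval y \<eta> q q'"
  by (simp add: dual_eval_def pderiv_add algebra_simps)

lemma dual_eval_minus: "dual_eval y \<eta> (- p) (- p') = - dual_eval y \<eta> p p'"
  by (simp add: dual_eval_def pderiv_minus algebra_simps)

text \<open>
  A derivation extends from a ring to the ring generated by one more element \<open>y\<close>, with value \<open>\<eta>\<close>
  at \<open>y\<close>, as soon as this respects the algebraic relations satisfied by \<open>y\<close>.
\<close>

lemma derivation_graph_extend:
  assumes G: "derivation_graph G"
    and rel: "\<And>p p'. dual_poly G p p' \<Longrightarrow> poly p y = 0 \<Longrightarrow> dual_eval y \<eta> p p' = 0"
  obtains G' where "derivation_graph G'" "G \<subseteq> G'" "(y, \<eta>) \<in> G'"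
proof
  define G' where "G' = {(poly p y, dual_eval y \<eta> p p') | p p'. dual_poly G p p'}"
  show "G \<subseteq> G'"
  proof clarify
    fix a a' assume "(a, a') \<in> G"
    then have "dual_poly G [:a:] [:a':]"
      using dual_poly_monom[OF G, of a a' 0] by (simp add: monom_0)
    then have "(poly [:a:] y, dual_eval y \<eta> [:a:] [:a':]) \<in> G'"
      unfolding G'_def by blast
    then show "(a, a') \<in> G'"
      by (simp add: dual_eval_def pderiv_pCons)
  qed
  show "(y, \<eta>) \<in> G'"
  proof -
    have "dual_poly G [:0, 1:] 0"
      using dual_poly_monom[OF G derivation_graphD(1)[OF G], of 1] by (simp add: monom_altdef)
    then have "(poly [:0, 1:] y, dual_eval y \<eta> [:0, 1:] 0) \<in> G'"
      unfolding G'_def by blast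
    then show ?thesis
      by (simp add: dual_eval_def pderiv_pCons)
  qed
  show "derivation_graph G'"
    unfolding derivation_graph_def
  proof (intro conjI allI impI)
    show "(1, 0) \<in> G'"
      using derivation_graphD(1)[OF G] \<open>G \<subseteq> G'\<close> by auto
  next
    fix a a' b b' assume "(a, a') \<in> G'" "(b, b') \<in> G'"
    then obtain p p' q q' where *: "a = poly p y" "a' = dual_eval y \<eta> p p'" "dual_poly G p p'"
      "b = poly q y" "b' = dual_eval y \<eta> q q'" "dual_poly G q q'"
      unfolding G'_def by blast
    have "(poly (p + q) y, dual_eval y \<eta> (p + q) (p' + q')) \<in> G'"
      unfolding G'_def using dual_poly_add[OF G *(3,6)] by blast
    then show "(a + b, a' + b') \<in> G'"
      using * by (simp add: dual_eval_add)
    have "(poly (p * q) y, dual_eval y \<eta> (p * q) (p' * q + p * q')) \<in> G'"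
      unfolding G'_def using dual_poly_mult[OF G *(3,6)] by blast
    then show "(a * b, a' * b + a * b') \<in> G'"
      using * by (simp add: dual_eval_mult)
  next
    fix a a' assume "(a, a') \<in> G'"
    then obtain p p' where *: "a = poly p y" "a' = dual_eval y \<eta> p p'" "dual_poly G p p'"
      unfolding G'_def by blast
    have "(poly (- p) y, dual_eval y \<eta> (- p) (- p')) \<in> G'"
      unfolding G'_def using dual_poly_minus[OF G *(3)] by blast
    then show "(- a, - a') \<in> G'"
      using * by (simp add: dual_eval_minus)
  next
    fix b assume "(0, b) \<in> G'"
    then show "b = 0"
      unfolding G'_def using rel by force
  qed
qed

text \<open>If y satisfies no nontrivial relation over the domain of \<open>G\<close>, any value is
  admissible. Otherwise a relation p of least degree has a nonzero derivative at y, as the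
  characteristic is 0, and this determines \<eta>. Every other relation reduces to p by
  pseudo-division, the domain being only a ring.\<close>

lemma derivation_graph_extend_exists:
  assumes G: "derivation_graph G"
  obtains \<eta> where "\<And>p p'. dual_poly G p p' \<Longrightarrow> poly p y = 0 \<Longrightarrow> dual_eval y \<eta> p p' = 0"
proof (cases "\<exists>p p'. dual_poly G p p' \<and> p \<noteq> 0 \<and> poly p y = 0")
  case False
  have "dual_eval y 0 p p' = 0" if "dual_poly G p p'" "poly p y = 0" for p p'
  proof -
    have "p = 0"
      using that False by blast
    moreover from this have "p' = 0"
      using that(1) G by (auto simp: dual_poly_def poly_eq_iff dest: derivation_graphD(5)[OF G])
    ultimately show ?thesis
      by (simp add: dual_eval_def)
  qed
  then show ?thesis
    using that by blast
next
  case True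
  define Q where "Q = (\<lambda>d. \<exists>p p'. dual_poly G p p' \<and> p \<noteq> 0 \<and> poly p y = 0 \<and> degree p = d)"
  define d where "d = (LEAST d. Q d)"
  have "\<exists>d. Q d"
    using True unfolding Q_def by blast
  then have "Q d"
    unfolding d_def by (metis LeastI_ex)
  then obtain p p' where p: "dual_poly G p p'" "p \<noteq> 0" "poly p y = 0" "degree p = d"
    unfolding Q_def by blast
  have min: "q = 0" if "dual_poly G q q'" "poly q y = 0" "degree q < d" for q q'
    using that not_less_Least[of "degree q" Q] unfolding Q_def d_def by blast
  have p'y: "poly (pderiv p) y \<noteq> 0"
  proof
    assume *: "poly (pderiv p) y = 0"
    have "dual_poly G (pderiv p) (pderiv p')"
      unfolding dual_poly_def
    proof
      fix i
      have n: "(of_nat n * a, of_nat n * a') \<in> G" if "(a, a') \<in> G" for n a a'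
        using that
        by (induction n)
           (auto simp: algebra_simps intro: derivation_graph_0[OF G] derivation_graphD(2)[OF G])
      show "(coeff (pderiv p) i, coeff (pderiv p') i) \<in> G"
        using p(1) n unfolding dual_poly_def coeff_pderiv by blast
    qed
    moreover have "degree p \<noteq> 0"
      using p(2,3) by (metis degree_eq_zeroE pCons_0_0 poly_pCons mult_zero_right add.right_neutral poly_0)
    ultimately have "pderiv p = 0"
      using * min p(4) by (simp add: degree_pderiv)
    then show False
      using \<open>degree p \<noteq> 0\<close> by (simp add: pderiv_eq_0_iff)
  qed
  define \<eta> where "\<eta> = - poly p' y / poly (pderiv p) y"
  have ev_p: "dual_eval y \<eta> p p' = 0"
    using p'y by (simp add: dual_eval_def \<eta>_def)
  have "dual_eval y \<eta> q q' = 0" if "dual_poly G q q'" "poly q y = 0" for q q'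
    using that
  proof (induction "degree q" arbitrary: q q' rule: less_induct)
    case less
    show ?case
    proof (cases "q = 0")
      case True
      moreover from this have "q' = 0"
        using less.prems(1) by (auto simp: dual_poly_def poly_eq_iff dest: derivation_graphD(5)[OF G])
      ultimately show ?thesis
        by (simp add: dual_eval_def)
    next
      case False
      then have deg: "degree q \<ge> d"
        using less.prems min by (meson not_le)
      define l where "l = lead_coeff p"
      define l' where "l' = coeff p' (degree p)"
      define m where "m = lead_coeff q"
      define m' where "m' = coeff q' (degree q)"
      define e where "e = degree q - d"
      have lG: "(l, l') \<in> G" "(m, m') \<in> G"
        using p(1) less.prems(1) unfolding dual_poly_def l_def l'_def m_def m'_def by auto
      define q1 where "q1 = monom l 0 * q"
      define q1' where "q1' = monom l' 0 * q + monom l 0 * q'"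
      define q2 where "q2 = monom m e * p"
      define q2' where "q2' = monom m' e * p + monom m e * p'"
      have G12: "dual_poly G q1 q1'" "dual_poly G q2 q2'"
        unfolding q1_def q1'_def q2_def q2'_def
        by (intro dual_poly_mult[OF G] dual_poly_monom[OF G] lG less.prems(1) p(1))+
      \<comment> \<open>Pseudo-division: l q - m X^e p loses the leading term, and since p
        contributes 0, its \<open>dual_eval\<close> is l times that of q.\<close>
      define r where "r = q1 + - q2"
      define r' where "r' = q1' + - q2'"
      have Gr: "dual_poly G r r'"
        unfolding r_def r'_def
        by (intro dual_poly_add[OF G] dual_poly_minus[OF G] G12)
      have ry: "poly r y = 0"
        using less.prems(2) p(3) by (simp add: r_def q1_def q2_def)
      have l0: "l \<noteq> 0" "m \<noteq> 0"
        using p(2) False by (auto simp: l_def m_def)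
      have ev_r: "dual_eval y \<eta> r r' = l * dual_eval y \<eta> q q'"
      proof -
        have "dual_eval y \<eta> q1 q1' = l * dual_eval y \<eta> q q'"
          by (simp only: q1_def q1'_def dual_eval_mult) (simp add: less.prems(2) poly_monom)
        moreover have "dual_eval y \<eta> q2 q2' = 0"
          by (simp only: q2_def q2'_def dual_eval_mult) (simp add: p(3) ev_p)
        ultimately show ?thesis
          by (simp only: r_def r'_def dual_eval_add dual_eval_minus) simp
      qed
      have "r = 0 \<or> degree r < degree q"
      proof -
        have "degree r \<le> degree q"
        proof -
          have "degree q1 \<le> degree q"
            using degree_mult_le[of "monom l 0" q] by (simp add: q1_def monom_0)
          moreover have "degree q2 \<le> degree q"
            using degree_mult_le[of "monom m e" p] p(4) deg degree_monom_le[of m e]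
            unfolding q2_def e_def by linarith
          ultimately show ?thesis
            unfolding r_def by (metis degree_add_le degree_minus)
        qed
        moreover have "coeff r (degree q) = 0"
        proof -
          have "coeff q2 (degree q) = m * l"
            using deg p(4) by (simp add: q2_def coeff_monom_mult e_def l_def)
          moreover have "coeff q1 (degree q) = l * m"
            by (simp add: q1_def m_def monom_0)
          ultimately show ?thesis
            by (simp add: r_def)
        qed
        ultimately show ?thesis
          by (metis le_neq_implies_less leading_coeff_0_iff)
      qed
      then have "dual_eval y \<eta> r r' = 0"
      proof
        assume "r = 0"
        moreover from this have "r' = 0"
          using Gr by (auto simp: dual_poly_def poly_eq_iff dest: derivation_graphD(5)[OF G])
        ultimately show ?thesis
          by (simp add: dual_eval_def)
      qed (use less.hyps Gr ry in blast)
      then show ?thesis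
        using ev_r l0 by simp
    qed
  qed
  then show ?thesis
    using that by blast
qed

lemma derivation_graph_Union:
  assumes C: "subset.chain {G. derivation_graph G} C" "C \<noteq> {}"
  shows "derivation_graph (\<Union>C)"
proof -
  have C': "\<And>G. G \<in> C \<Longrightarrow> derivation_graph G" and tot: "\<And>G H. G \<in> C \<Longrightarrow> H \<in> C \<Longrightarrow> G \<subseteq> H \<or> H \<subseteq> G"
    using C(1) by (auto simp: subset_chain_def)
  have two: "\<exists>G\<in>C. u \<in> G \<and> v \<in> G" if uv: "u \<in> \<Union>C" "v \<in> \<Union>C" for u v
  proof -
    obtain G H where "G \<in> C" "u \<in> G" "H \<in> C" "v \<in> H"
      using uv by blast
    with tot[of G H] show ?thesis
      by blast
  qed
  show ?thesis
    unfolding derivation_graph_def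
  proof (intro conjI allI impI)
    show "(1, 0) \<in> \<Union>C"
      using C(2) C' derivation_graphD(1) by blast
  next
    fix a a' b b' assume "(a, a') \<in> \<Union>C" "(b, b') \<in> \<Union>C"
    then obtain G where G: "G \<in> C" "(a, a') \<in> G" "(b, b') \<in> G"
      using two by blast
    then show "(a + b, a' + b') \<in> \<Union>C" "(a * b, a' * b + a * b') \<in> \<Union>C"
      using derivation_graphD(2,3)[OF C'[OF G(1)]] by blast+
  next
    fix a a' assume "(a, a') \<in> \<Union>C"
    then show "(- a, - a') \<in> \<Union>C"
      using derivation_graphD(4) C' by blast
  next
    fix b assume "(0, b) \<in> \<Union>C"
    then show "b = 0"
      using derivation_graphD(5) C' by blast
  qed
qed

lemma derivation_graph_Ints: "derivation_graph ((\<lambda>x. (x, 0)) ` \<int>)"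
  unfolding derivation_graph_def by auto

text \<open>A transcendental x satisfies no relation over \<int>, so the zero derivation of \<int>
  extends to x with value 1. Zorn's lemma yields a maximal extension, and its domain is all of
  \<complex> because any single y can be adjoined.\<close>

theorem algebraicI_derivation:
  fixes x :: complex
  assumes "\<And>\<delta>. derivation \<delta> \<Longrightarrow> \<delta> x = 0"
  shows "algebraic x"
proof (rule ccontr)
  assume x: "\<not> algebraic x"
  have "dual_eval x 1 p p' = 0"
    if "dual_poly ((\<lambda>x. (x, 0)) ` \<int>) p p'" "poly p x = 0" for p p'
  proof -
    have "\<And>i. coeff p i \<in> \<int>" and p': "\<And>i. coeff p' i = 0"
      using that(1) unfolding dual_poly_def by auto
    then have "p = 0"
      using x that(2) algebraicI by blast
    moreover have "p' = 0"
      using p' by (simp add: poly_eq_iff)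
    ultimately show ?thesis
      by (simp add: dual_eval_def)
  qed
  then obtain G0 where G0: "derivation_graph G0" "(x, 1) \<in> G0"
    using derivation_graph_extend[OF derivation_graph_Ints, of x 1] by blast
  define Gs where "Gs = {G. derivation_graph G \<and> G0 \<subseteq> G}"
  have "\<exists>M\<in>Gs. \<forall>Y\<in>Gs. M \<subseteq> Y \<longrightarrow> Y = M"
  proof (rule subset_Zorn)
    fix C assume C: "subset.chain Gs C"
    show "\<exists>U\<in>Gs. \<forall>Y\<in>C. Y \<subseteq> U"
    proof (cases "C = {}")
      case True
      then show ?thesis
        using G0 unfolding Gs_def by blast
    next
      case False
      have "subset.chain {G. derivation_graph G} C"
        using C by (auto simp: subset_chain_def Gs_def)
      then have "derivation_graph (\<Union>C)"
        using derivation_graph_Union False by blast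
      moreover have "G0 \<subseteq> H" if "H \<in> C" for H
        using C that by (auto simp: subset_chain_def Gs_def)
      then have "G0 \<subseteq> \<Union>C"
        using False by blast
      ultimately show ?thesis
        unfolding Gs_def by blast
    qed
  qed
  then obtain M where M: "derivation_graph M" "G0 \<subseteq> M"
    and max: "\<And>Y. derivation_graph Y \<Longrightarrow> M \<subseteq> Y \<Longrightarrow> Y = M"
    unfolding Gs_def by (auto intro: subset_trans)
  have "\<exists>\<eta>. (y, \<eta>) \<in> M" for y
  proof -
    obtain \<eta> where "\<And>p p'. dual_poly M p p' \<Longrightarrow> poly p y = 0 \<Longrightarrow> dual_eval y \<eta> p p' = 0"
      using derivation_graph_extend_exists[OF M(1)] by blast
    then obtain M' where "derivation_graph M'" "M \<subseteq> M'" "(y, \<eta>) \<in> M'"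
      using derivation_graph_extend[OF M(1)] by blast
    then show ?thesis
      using max by blast
  qed
  then obtain \<delta> where \<delta>: "\<And>y. (y, \<delta> y) \<in> M"
    by metis
  have eq: "(a, b) \<in> M \<Longrightarrow> \<delta> a = b" for a b
    using derivation_graph_unique[OF M(1)] \<delta> by blast
  have "derivation \<delta>"
    by unfold_locales (auto intro!: eq derivation_graphD[OF M(1)] \<delta>)
  moreover have "\<delta> x = 1"
    using eq G0 M by blast
  ultimately show False
    using assms by fastforce
qed

context derivation
begin

lemma \<delta>_0 [simp]: "\<delta> 0 = 0"
  using add[of 0 0] by simp

lemma \<delta>_1 [simp]: "\<delta> 1 = 0"
  using mult[of 1 1] by simp

lemma \<delta>_minus [simp]: "\<delta> (- x) = - \<delta> x"
  using add[of x "- x"] by (simp add: eq_neg_iff_add_eq_0 add.commute)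

lemma \<delta>_diff: "\<delta> (x - y) = \<delta> x - \<delta> y"
  using add[of x "- y"] by simp

lemma \<delta>_sum: "\<delta> (\<Sum>i\<in>I. f i) = (\<Sum>i\<in>I. \<delta> (f i))"
  by (induction I rule: infinite_finite_induct) (auto simp: add)

lemma \<delta>_of_nat [simp]: "\<delta> (of_nat n) = 0"
  by (induction n) (auto simp: add)

lemma \<delta>_of_int [simp]: "\<delta> (of_int n) = 0"
  by (cases n rule: int_diff_cases) (simp add: \<delta>_diff)

lemma \<delta>_numeral [simp]: "\<delta> (numeral n) = 0"
  using \<delta>_of_nat[of "numeral n"] by simp

lemma \<delta>_power: "\<delta> (x ^ n) = of_nat n * x ^ (n - 1) * \<delta> x"
proof (induction n)
  case (Suc n)
  then show ?case
    by (cases n) (auto simp: mult algebra_simps)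
qed auto

lemma const_mult: "\<delta> x = 0 \<Longrightarrow> \<delta> y = 0 \<Longrightarrow> \<delta> (x * y) = 0"
  by (simp add: mult)

lemma const_power: "\<delta> x = 0 \<Longrightarrow> \<delta> (x ^ n) = 0"
  by (simp add: \<delta>_power)

text \<open>This makes roots of unity constant, among them \<i> and the nonzero values of Dirichlet
  characters.\<close>

lemma const_root: "\<delta> (x ^ n) = 0 \<Longrightarrow> n > 0 \<Longrightarrow> \<delta> x = 0"
  by (cases "x = 0") (auto simp: \<delta>_power)

lemma const_inverse: "\<delta> x = 0 \<Longrightarrow> \<delta> (inverse x) = 0"
proof (cases "x = 0")
  case False
  assume "\<delta> x = 0"
  then show ?thesis
    using mult[of x "inverse x"] False by simp
qed auto

lemma const_divide: "\<delta> x = 0 \<Longrightarrow> \<delta> y = 0 \<Longrightarrow> \<delta> (x / y) = 0"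
  by (simp add: divide_inverse const_mult const_inverse)

lemma const_powi: "\<delta> x = 0 \<Longrightarrow> \<delta> (x powi n) = 0"
  by (simp add: power_int_def const_power const_inverse)

lemma const_sum: "(\<And>i. i \<in> I \<Longrightarrow> \<delta> (f i) = 0) \<Longrightarrow> \<delta> (\<Sum>i\<in>I. f i) = 0"
  by (simp add: \<delta>_sum)

end

section \<open>The exponential q on the upper half plane and the limit Im z to infinity\<close>

definition qq :: "nat \<Rightarrow> complex \<Rightarrow> complex" where
  "qq h z = exp (2 * of_real pi * \<i> * z / of_nat h)"

lemma uhp_iff [simp]: "z \<in> uhp \<longleftrightarrow> Im z > 0"
  by (simp add: uhp_def)

lemma open_uhp: "open uhp"
  unfolding uhp_def by (rule open_halfspace_Im_gt)

lemma connected_uhp: "connected uhp"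
  unfolding uhp_def by (intro convex_connected convex_halfspace_Im_gt)

lemma qq_nonzero [simp]: "qq h z \<noteq> 0"
  by (simp add: qq_def)

lemma norm_qq: "cmod (qq h z) = exp (- 2 * pi * Im z / h)"
  by (simp add: qq_def)

lemma norm_qq_less_1: "h > 0 \<Longrightarrow> Im z > 0 \<Longrightarrow> cmod (qq h z) < 1"
  by (simp add: norm_qq)

lemma qq_add: "qq h (z + w) = qq h z * qq h w"
  by (simp add: qq_def distrib_left add_divide_distrib exp_add)

lemma qq_eq_1_iff: "h > 0 \<Longrightarrow> qq h z = 1 \<longleftrightarrow> (\<exists>n::int. z = of_int n * of_nat h)"
  unfolding qq_def exp_eq_1
  by (auto simp: field_simps complex_eq_iff)
     (metis Im_complex_of_real mult.commute of_real_of_int_eq of_real_of_nat_eq)?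

lemma qq_period [simp]: "h > 0 \<Longrightarrow> qq h (z + of_nat h) = qq h z"
  using qq_eq_1_iff[of h "of_nat h"] by (subst qq_add) (metis mult.right_neutral mult_1 of_int_1)

lemma qq_Ln:
  fixes w :: complex and h :: nat
  assumes "h > 0" "w \<noteq> 0"
  shows "qq h (of_nat h / (2 * of_real pi * \<i>) * Ln w) = w"
  using assms by (simp add: qq_def)

lemma Im_qq_Ln:
  fixes w :: complex and h :: nat
  assumes "w \<noteq> 0"
  shows "Im (of_nat h / (2 * of_real pi * \<i>) * Ln w) = - real h / (2 * pi) * ln (cmod w)"
proof -
  have "of_nat h / (2 * of_real pi * \<i>) * Ln w = - \<i> * of_real (real h / (2 * pi)) * Ln w"
    by (simp add: field_simps)
  then show ?thesis
    using assms by simp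
qed

lemma qq_surjE:
  assumes "h > 0" "w \<noteq> 0" "cmod w < 1"
  obtains z where "Im z > 0" "qq h z = w"
proof
  show "Im (of_nat h / (2 * of_real pi * \<i>) * Ln w) > 0"
    unfolding Im_qq_Ln[OF assms(2)] using assms by (simp add: field_simps mult_less_0_iff)
qed (rule qq_Ln[OF assms(1,2)])

lemma qq_power: "m > 0 \<Longrightarrow> qq (h * m) z ^ m = qq h z"
  by (simp add: qq_def exp_of_nat_mult [symmetric] field_simps)

lemma tendsto_qq: "h > 0 \<Longrightarrow> (qq h \<longlongrightarrow> 0) (filtercomap Im at_top)"
proof -
  assume h: "h > 0"
  have "((\<lambda>y. exp (- 2 * pi * y / h)) \<longlongrightarrow> 0) at_top"
    using h by real_asymp
  then have "((\<lambda>z. exp (- 2 * pi * Im z / h)) \<longlongrightarrow> 0) (filtercomap Im at_top)"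
    by (rule filterlim_compose[OF _ filterlim_filtercomap])
  then show ?thesis
    by (subst tendsto_norm_zero_iff [symmetric]) (simp add: norm_qq)
qed

lemma eventually_Im_at_top:
  "eventually P (filtercomap Im at_top) \<longleftrightarrow> (\<exists>Y. \<forall>z. Im z \<ge> Y \<longrightarrow> P z)"
  unfolding eventually_filtercomap_at_top_linorder by blast

lemma eventually_uhp: "eventually (\<lambda>z. z \<in> uhp) (filtercomap Im at_top)"
  unfolding eventually_Im_at_top by (intro exI[of _ 1]) auto

lemma filtercomap_Im_at_top_neq_bot: "filtercomap Im at_top \<noteq> bot"
proof
  assume "filtercomap Im at_top = bot"
  then have "eventually (\<lambda>z. False) (filtercomap Im at_top)"
    by simp
  then obtain Y where "\<forall>z. Im z \<ge> Y \<longrightarrow> False"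
    unfolding eventually_Im_at_top by blast
  then show False
    using complex.sel(2) by (metis order_refl)
qed

subsection \<open>Power series in \<open>q\<close>\<close>

text \<open>The expansion is a formal power series, so that a derivation can be applied to its
  coefficients before anything is known about the convergence of the result. The radius condition
  guarantees that \<open>eval_fps\<close> is the actual sum on the whole unit disc.\<close>

definition qexp :: "nat \<Rightarrow> (complex \<Rightarrow> complex) \<Rightarrow> complex fps \<Rightarrow> bool" where
  "qexp h F c \<longleftrightarrow> fps_conv_radius c \<ge> 1 \<and> (\<forall>z\<in>uhp. F z = eval_fps c (qq h z))"

lemma qexp_eval: "qexp h F c \<Longrightarrow> Im z > 0 \<Longrightarrow> F z = eval_fps c (qq h z)"
  by (simp add: qexp_def)

lemma qexp_radius: "qexp h F c \<Longrightarrow> cmod w < 1 \<Longrightarrow> ereal (cmod w) < fps_conv_radius c"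
  unfolding qexp_def by (meson ereal_less(3) less_le_trans)

lemma qexp_radius_qq: "qexp h F c \<Longrightarrow> h > 0 \<Longrightarrow> Im z > 0 \<Longrightarrow> ereal (cmod (qq h z)) < fps_conv_radius c"
  using qexp_radius norm_qq_less_1 by blast

lemma qexp_iff:
  assumes "h > 0"
  shows "qexp h F c \<longleftrightarrow> has_q_expansion h (fps_nth c) F"
proof
  assume c: "qexp h F c"
  then show "has_q_expansion h (fps_nth c) F"
    unfolding has_q_expansion_def
    using sums_eval_fps qexp_radius_qq[OF c assms] qexp_eval[OF c]
    by (fastforce simp: qq_def)
next
  assume *: "has_q_expansion h (fps_nth c) F"
  have **: "(\<lambda>n. fps_nth c n * qq h z ^ n) sums F z" if "Im z > 0" for z
    using * that by (simp add: has_q_expansion_def qq_def)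
  have "fps_conv_radius c \<ge> 1"
    unfolding fps_conv_radius_def
  proof (rule conv_radius_geI_ex)
    fix r :: real assume r: "0 < r" "ereal r < 1"
    then obtain z where "Im z > 0" "qq h z = of_real r"
      using qq_surjE[of h "of_real r"] assms by auto
    then show "\<exists>z. cmod z = r \<and> summable (\<lambda>n. fps_nth c n * z ^ n)"
      using ** r by (metis less_imp_le norm_of_real real_norm_def abs_of_pos sums_summable)
  qed
  moreover have "F z = eval_fps c (qq h z)" if "Im z > 0" for z
    using **[OF that] by (simp add: eval_fps_def sums_iff)
  ultimately show "qexp h F c"
    by (simp add: qexp_def)
qed

lemma has_q_expansion_qexp: "h > 0 \<Longrightarrow> has_q_expansion h a F \<Longrightarrow> qexp h F (Abs_fps a)"
  by (simp add: qexp_iff has_q_expansion_def)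

lemma isCont_eval_fps_0: "fps_conv_radius c > 0 \<Longrightarrow> isCont (eval_fps c) 0"
  using continuous_on_eval_fps[of c]
    continuous_on_eq_continuous_at[OF open_eball, of 0 "fps_conv_radius c" "eval_fps c"]
  by (auto simp: zero_ereal_def)

lemma qexp_tendsto:
  assumes "qexp h F c" "h > 0"
  shows "(F \<longlongrightarrow> fps_nth c 0) (filtercomap Im at_top)"
proof -
  have "fps_conv_radius c > 0"
    using qexp_radius[OF assms(1), of 0] by (simp add: zero_ereal_def)
  then have "((\<lambda>z. eval_fps c (qq h z)) \<longlongrightarrow> eval_fps c 0) (filtercomap Im at_top)"
    using isCont_tendsto_compose[OF isCont_eval_fps_0 tendsto_qq] assms(2) by blast
  moreover have "eventually (\<lambda>z. eval_fps c (qq h z) = F z) (filtercomap Im at_top)"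
    using eventually_uhp by eventually_elim (use assms(1) in \<open>auto simp: qexp_eval\<close>)
  ultimately show ?thesis
    by (simp add: filterlim_cong eval_fps_at_0)
qed

lemma qexp_unique:
  assumes F: "qexp h F c" and G: "qexp h F c'" and h: "h > 0"
  shows "c = c'"
proof (rule eval_fps_eqD)
  show r: "fps_conv_radius c > 0" "fps_conv_radius c' > 0"
    using qexp_radius[OF F, of 0] qexp_radius[OF G, of 0] by (simp_all add: zero_ereal_def)
  have eq: "eval_fps c w = eval_fps c' w" if w: "w \<noteq> 0" "cmod w < 1" for w
  proof -
    obtain z where "Im z > 0" "qq h z = w"
      using qq_surjE[OF h w] by blast
    then show ?thesis
      using qexp_eval[OF F, of z] qexp_eval[OF G, of z] by simp
  qed
  \<comment> \<open>The point 0 is not a value of \<open>qq h\<close>; it is reached as the limit at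
    infinite height.\<close>
  have "eval_fps c 0 = eval_fps c' 0"
    using tendsto_unique[OF filtercomap_Im_at_top_neq_bot qexp_tendsto[OF F h] qexp_tendsto[OF G h]]
    by (simp add: eval_fps_at_0)
  then have "eval_fps c w = eval_fps c' w" if "w \<in> ball 0 1" for w
    using eq that by (cases "w = 0") auto
  then show "\<forall>\<^sub>F z in nhds 0. eval_fps c z = eval_fps c' z"
    using eventually_nhds_in_open[of "ball (0::complex) 1" 0] by (auto elim: eventually_mono)
qed

lemma qexp_holomorphic_disc: "qexp h F c \<Longrightarrow> eval_fps c holomorphic_on ball 0 1"
  by (intro holomorphic_on_eval_fps) (auto simp: qexp_radius)

lemma holomorphic_qq: "qq h holomorphic_on A"
  unfolding qq_def by (cases "h = 0") (auto intro!: holomorphic_intros)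

lemma qexp_holomorphic:
  assumes F: "qexp h F c" and h: "h > 0"
  shows "F holomorphic_on uhp"
proof -
  have "eval_fps c \<circ> qq h holomorphic_on uhp"
    by (rule holomorphic_on_compose_gen[OF holomorphic_qq qexp_holomorphic_disc[OF F]])
       (auto simp: norm_qq_less_1 h)
  then show ?thesis
    by (rule holomorphic_transform) (simp add: qexp_eval[OF F])
qed

lemma qexp_cong: "(\<And>z. Im z > 0 \<Longrightarrow> F z = G z) \<Longrightarrow> qexp h F c \<longleftrightarrow> qexp h G c"
  by (simp add: qexp_def)

lemma qexp_fps_const: "qexp h (\<lambda>z. a) (fps_const a)"
  by (simp add: qexp_def)

lemma qexp_0: "qexp h (\<lambda>z. 0) 0" and qexp_1: "qexp h (\<lambda>z. 1) 1"
  by (simp_all add: qexp_def)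

lemma qexp_add:
  assumes F: "qexp h F a" and G: "qexp h G b" and h: "h > 0"
  shows "qexp h (\<lambda>z. F z + G z) (a + b)"
proof -
  have "1 \<le> min (fps_conv_radius a) (fps_conv_radius b)"
    using F G by (simp add: qexp_def)
  then have "1 \<le> fps_conv_radius (a + b)"
    using fps_conv_radius_add[of a b] by (rule order_trans)
  then show ?thesis
    using qexp_radius_qq[OF F h] qexp_radius_qq[OF G h] qexp_eval[OF F] qexp_eval[OF G]
    by (simp add: qexp_def eval_fps_add)
qed

lemma qexp_diff:
  assumes F: "qexp h F a" and G: "qexp h G b" and h: "h > 0"
  shows "qexp h (\<lambda>z. F z - G z) (a - b)"
proof -
  have "1 \<le> min (fps_conv_radius a) (fps_conv_radius b)"
    using F G by (simp add: qexp_def)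
  then have "1 \<le> fps_conv_radius (a - b)"
    using fps_conv_radius_diff[of a b] by (rule order_trans)
  then show ?thesis
    using qexp_radius_qq[OF F h] qexp_radius_qq[OF G h] qexp_eval[OF F] qexp_eval[OF G]
    by (simp add: qexp_def eval_fps_diff)
qed

lemma qexp_mult:
  assumes F: "qexp h F a" and G: "qexp h G b" and h: "h > 0"
  shows "qexp h (\<lambda>z. F z * G z) (a * b)"
proof -
  have "1 \<le> min (fps_conv_radius a) (fps_conv_radius b)"
    using F G by (simp add: qexp_def)
  then have "1 \<le> fps_conv_radius (a * b)"
    using fps_conv_radius_mult[of a b] by (rule order_trans)
  then show ?thesis
    using qexp_radius_qq[OF F h] qexp_radius_qq[OF G h] qexp_eval[OF F] qexp_eval[OF G]
    by (simp add: qexp_def eval_fps_mult)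
qed

lemma qexp_cmult: "qexp h F a \<Longrightarrow> h > 0 \<Longrightarrow> qexp h (\<lambda>z. x * F z) (fps_const x * a)"
  using qexp_mult[OF qexp_fps_const] by blast

lemma qexp_power: "qexp h F a \<Longrightarrow> h > 0 \<Longrightarrow> qexp h (\<lambda>z. F z ^ n) (a ^ n)"
  by (induction n) (auto intro: qexp_1 qexp_mult)

lemma qexp_sum:
  "(\<And>i. i \<in> I \<Longrightarrow> qexp h (F i) (a i)) \<Longrightarrow> h > 0 \<Longrightarrow> qexp h (\<lambda>z. \<Sum>i\<in>I. F i z) (\<Sum>i\<in>I. a i)"
  by (induction I rule: infinite_finite_induct) (auto intro: qexp_0 qexp_add)

lemma qexp_prod:
  "(\<And>i. i \<in> I \<Longrightarrow> qexp h (F i) (a i)) \<Longrightarrow> h > 0 \<Longrightarrow> qexp h (\<lambda>z. \<Prod>i\<in>I. F i z) (\<Prod>i\<in>I. a i)"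
  by (induction I rule: infinite_finite_induct) (auto intro: qexp_1 qexp_mult)

lemma qexp_qq: "h > 0 \<Longrightarrow> qexp h (qq h) fps_X"
  by (simp add: qexp_def)

lemma qexp_eq_0_iff:
  assumes "qexp h F a" "h > 0"
  shows "a = 0 \<longleftrightarrow> (\<forall>z\<in>uhp. F z = 0)"
proof
  assume "\<forall>z\<in>uhp. F z = 0"
  then have "qexp h F 0"
    by (subst qexp_cong[where G = "\<lambda>z. 0"]) (auto simp: qexp_0)
  then show "a = 0"
    using qexp_unique assms by blast
qed (use assms in \<open>auto simp: qexp_eval\<close>)

text \<open>F and G agree on the nonempty open set where H does not vanish, hence everywhere by
  analytic continuation.\<close>

lemma holomorphic_mult_cancel:
  assumes F: "F holomorphic_on uhp" and G: "G holomorphic_on uhp" and H: "H holomorphic_on uhp"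
    and nz: "\<exists>z\<in>uhp. H z \<noteq> 0" and eq: "\<And>z. Im z > 0 \<Longrightarrow> H z * F z = H z * G z"
    and z: "Im z > 0"
  shows "F z = G z"
proof -
  obtain w where w: "w \<in> uhp" "H w \<noteq> 0"
    using nz by blast
  define U where "U = uhp \<inter> H -` (- {0})"
  have "open U"
    unfolding U_def using holomorphic_on_imp_continuous_on[OF H] open_uhp
    by (intro continuous_open_preimage) auto
  moreover have "w \<in> U"
    using w by (simp add: U_def)
  moreover have "F z = G z" if "z \<in> U" for z
    using eq[of z] that by (simp add: U_def)
  ultimately show ?thesis
    using analytic_continuation_open[of U uhp F G z] open_uhp connected_uhp F G z
    by (metis IntD1 U_def empty_iff subsetI uhp_iff)
qed

text \<open>The substitution of X^m for X, which rewrites an expansion in \<open>qq h\<close> as one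
  in \<open>qq (h * m)\<close>.\<close>

definition fps_spread :: "nat \<Rightarrow> complex fps \<Rightarrow> complex fps" where
  "fps_spread m c = Abs_fps (\<lambda>n. if m dvd n then fps_nth c (n div m) else 0)"

lemma fps_spread_nth: "fps_nth (fps_spread m c) n = (if m dvd n then fps_nth c (n div m) else 0)"
  by (simp add: fps_spread_def)

lemma qexp_spread:
  assumes F: "qexp h F c" and h: "h > 0" and m: "m > 0"
  shows "qexp (h * m) F (fps_spread m c)"
proof -
  have "(\<lambda>n. fps_nth (fps_spread m c) n * qq (h * m) z ^ n) sums F z" if z: "Im z > 0" for z
  proof -
    have "(\<lambda>n. fps_nth c n * qq h z ^ n) sums F z"
      using F h z by (auto simp: qexp_iff has_q_expansion_def qq_def)
    then have "(\<lambda>n. (\<lambda>n. fps_nth (fps_spread m c) n * qq (h * m) z ^ n) (m * n)) sums F z"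
      using m by (simp add: fps_spread_nth power_mult qq_power)
    then show ?thesis
      using m by (subst (asm) sums_mono_reindex) (auto simp: strict_mono_def fps_spread_nth)
  qed
  then have "has_q_expansion (h * m) (fps_nth (fps_spread m c)) F"
    by (simp add: has_q_expansion_def qq_def)
  then show ?thesis
    using h m by (simp add: qexp_iff)
qed

lemma qexp_of_disc:
  assumes "\<phi> holomorphic_on ball 0 1" "h > 0" "\<And>z. Im z > 0 \<Longrightarrow> F z = \<phi> (qq h z)"
  shows "qexp h F (fps_expansion \<phi> 0)"
proof -
  have *: "\<phi> holomorphic_on eball 0 1"
    using assms(1) by (simp add: one_ereal_def)
  show ?thesis
    unfolding qexp_def
    using conv_radius_fps_expansion[OF *] eval_fps_expansion'[OF *] norm_qq_less_1[OF assms(2)] assms(3)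
    by (simp add: one_ereal_def)
qed

lemma periodic_int:
  assumes "\<And>z. Im z > 0 \<Longrightarrow> F (z + of_nat h) = F z" "Im z > 0"
  shows "F (z + of_int n * of_nat h) = F z"
proof -
  have *: "F (z + of_nat n * of_nat h) = F z" if "Im z > 0" for n :: nat and z
    using that
  proof (induction n)
    case (Suc n)
    then show ?case
      using assms(1)[of "z + of_nat n * of_nat h"] by (simp add: algebra_simps)
  qed auto
  show ?thesis
  proof (cases "n \<ge> 0")
    case True
    then show ?thesis
      using *[of z "nat n"] assms(2) by simp
  next
    case False
    then show ?thesis
      using *[of "z + of_int n * of_nat h" "nat (- n)"] assms(2) by simp
  qed
qed

text \<open>By periodicity F factors through the punctured disc, and the bound near q = 0 makes the
  singularity removable.\<close>

lemma qexp_exists: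
  assumes h: "h > 0" and F: "F holomorphic_on uhp"
    and per: "\<And>z. Im z > 0 \<Longrightarrow> F (z + of_nat h) = F z"
    and bd: "\<And>z. Im z \<ge> Y \<Longrightarrow> cmod (F z) \<le> B"
  obtains c where "qexp h F c"
proof -
  define a where "a = of_nat h / (2 * of_real pi * \<i>)"
  define \<phi> where "\<phi> w = F (a * Ln w)" for w
  have \<phi>: "\<phi> (qq h z) = F z" if z: "Im z > 0" for z
  proof -
    define z' where "z' = a * Ln (qq h z)"
    have z': "qq h z' = qq h z" "Im z' > 0"
      using qq_Ln[OF h qq_nonzero[of h z]] Im_qq_Ln[OF qq_nonzero[of h z], of h] h z
      unfolding z'_def a_def by (simp_all add: norm_qq)
    have "qq h (z' - z) = 1"
      using qq_add[of h "z' - z" z] z'(1) by simp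
    then obtain n :: int where "z' - z = of_int n * of_nat h"
      using h by (auto simp: qq_eq_1_iff)
    then have "z' = z + of_int n * of_nat h"
      by (simp add: algebra_simps)
    then show ?thesis
      using periodic_int[of F h z n, OF per z] by (simp add: \<phi>_def z'_def)
  qed
  have "\<exists>f'. (\<phi> has_field_derivative f') (at w)" if w: "w \<in> ball 0 1" "w \<noteq> 0" for w
  proof -
    \<comment> \<open>A branch of the logarithm near w, as \<open>Ln\<close> is discontinuous along
      its cut; by periodicity \<phi> does not depend on the branch.\<close>
    define L where "L u = a * (Ln (u / w) + Ln w)" for u
    define U where "U = {u. Re (u / w) > 0} \<inter> (ball 0 1 - {0})"
    have "open {u. Re (u / w) > 0}"
      using w by (intro open_Collect_less continuous_intros) auto
    then have U: "open U" "w \<in> U"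
      using w unfolding U_def by auto
    have qL: "qq h (L u) = u" if "u \<in> U" for u
      using h w that by (auto simp: qq_def L_def a_def exp_add U_def)
    have ImL: "Im (L u) > 0" if "u \<in> U" for u
      using norm_qq[of h "L u"] qL[OF that] that h
      unfolding U_def by (auto simp: zero_less_divide_iff zero_less_mult_iff)
    have "L holomorphic_on U"
      unfolding L_def U_def using w
      by (intro holomorphic_intros) (auto simp: complex_nonpos_Reals_iff)
    then have "F \<circ> L holomorphic_on U"
      by (rule holomorphic_on_compose_gen[OF _ F]) (auto simp: ImL)
    then have "\<phi> holomorphic_on U"
      by (rule holomorphic_transform) (metis ImL \<phi> comp_apply qL)
    then show ?thesis
      using U by (meson holomorphic_on_open)
  qed
  then have "\<phi> holomorphic_on ball 0 1 - {0}"
    by (subst holomorphic_on_open) auto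
  moreover have "\<forall>\<^sub>F w in at 0. cmod (\<phi> w) \<le> B"
  proof -
    define r where "r = exp (- 2 * pi * max Y 1 / h)"
    have "cmod (\<phi> w) \<le> B" if w: "w \<noteq> 0" "cmod w < r" for w
    proof -
      have "r < 1"
        using h by (simp add: r_def field_simps)
      then obtain z where z: "Im z > 0" "qq h z = w"
        using qq_surjE[OF h w(1)] w(2) by auto
      have "- 2 * pi * Im z / h < - 2 * pi * max Y 1 / h"
        using w(2) z(2) norm_qq[of h z] unfolding r_def by simp
      then have "Im z \<ge> Y"
        using h by (simp add: divide_less_cancel)
      then show ?thesis
        using bd \<phi> z by metis
    qed
    then show ?thesis
      unfolding eventually_at by (intro exI[of _ r]) (auto simp: r_def)
  qed
  ultimately obtain g where g: "g holomorphic_on ball 0 1" "\<And>z. z \<in> ball 0 1 - {0} \<Longrightarrow> g z = \<phi> z"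
    using holomorphic_on_extend_bounded[of \<phi> "ball 0 1" 0] by auto
  have "F z = g (qq h z)" if "Im z > 0" for z
    using g(2)[of "qq h z"] \<phi>[OF that] norm_qq_less_1[OF h that] by simp
  then show ?thesis
    using qexp_of_disc[OF g(1) h] that by blast
qed

text \<open>G can vanish only at q = 0, so after cancelling a power of X its series is zero-free on
  the disc. The hypothesis on the coefficients of \<open>a\<close> lets the same power be cancelled
  from F.\<close>

lemma qexp_divide:
  assumes F: "qexp h F a" and G: "qexp h G b" and h: "h > 0"
    and nz: "\<And>z. Im z > 0 \<Longrightarrow> G z \<noteq> 0" and sub: "\<And>i. i < subdegree b \<Longrightarrow> fps_nth a i = 0"
  obtains c where "qexp h (\<lambda>z. F z / G z) c" "c * b = a"
proof -
  define m where "m = subdegree b"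
  have b0: "b \<noteq> 0"
    using qexp_eq_0_iff[OF G h] nz[of \<i>] by force
  define a' where "a' = fps_shift m a"
  define b' where "b' = fps_shift m b"
  have rad: "fps_conv_radius a' \<ge> 1" "fps_conv_radius b' \<ge> 1"
    using F G by (auto simp: a'_def b'_def qexp_def)
  have ab: "a = a' * fps_X ^ m" "b = b' * fps_X ^ m"
  proof -
    have "a = 0 \<or> m \<le> subdegree a"
      using sub m_def by (metis not_le nth_subdegree_nonzero)
    then show "a = a' * fps_X ^ m"
      by (auto simp: a'_def fps_shift_times_fps_X_power)
    show "b = b' * fps_X ^ m"
      by (simp add: b'_def m_def fps_shift_times_fps_X_power)
  qed
  have ev: "eval_fps a w = eval_fps a' w * w ^ m" "eval_fps b w = eval_fps b' w * w ^ m"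
    if "cmod w < 1" for w
    using that rad
    by (subst ab, subst eval_fps_mult; simp; metis ereal_less(3) less_le_trans)+
  have b'nz: "eval_fps b' w \<noteq> 0" if w: "cmod w < 1" for w
  proof (cases "w = 0")
    case True
    then show ?thesis
      using b0 by (simp add: eval_fps_at_0 b'_def m_def)
  next
    case False
    obtain z where "Im z > 0" "qq h z = w"
      using qq_surjE[OF h False w] by blast
    then show ?thesis
      using nz[of z] ev(2)[OF w] qexp_eval[OF G] by auto
  qed
  have r: "ereal (cmod w) < fps_conv_radius a'" "ereal (cmod w) < fps_conv_radius b'" if "cmod w < 1" for w
    using that rad by (meson ereal_less(3) less_le_trans)+
  have hol: "(\<lambda>w. eval_fps a' w / eval_fps b' w) holomorphic_on ball 0 1"
    using b'nz r by (intro holomorphic_on_divide holomorphic_on_eval_fps) auto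
  have "F z / G z = eval_fps a' (qq h z) / eval_fps b' (qq h z)" if z: "Im z > 0" for z
    using ev[OF norm_qq_less_1[OF h z]] qexp_eval[OF F z] qexp_eval[OF G z] by simp
  then have c: "qexp h (\<lambda>z. F z / G z) (fps_expansion (\<lambda>w. eval_fps a' w / eval_fps b' w) 0)"
    by (intro qexp_of_disc hol h)
  have "qexp h (\<lambda>z. F z / G z * G z) (fps_expansion (\<lambda>w. eval_fps a' w / eval_fps b' w) 0 * b)"
    by (rule qexp_mult[OF c G h])
  then have "qexp h F (fps_expansion (\<lambda>w. eval_fps a' w / eval_fps b' w) 0 * b)"
    by (subst (asm) qexp_cong[where G = F]) (auto simp: nz)
  then show ?thesis
    using that[OF c] qexp_unique[OF _ F h] by blast
qed

text \<open>In terms of orders of vanishing, (n + 1) ord a >= n ord b for all n, which forces ord a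
  >= ord b.\<close>

lemma holomorphic_divide_of_powers:
  assumes S: "open S" "connected S" and a: "a holomorphic_on S" and b: "b holomorphic_on S"
    and b0: "w1 \<in> S" "b w1 \<noteq> 0"
    and powers: "\<And>n. \<exists>c. c holomorphic_on S \<and> (\<forall>w\<in>S. a w ^ Suc n = b w ^ n * c w)"
  obtains g where "g holomorphic_on S" "\<And>w. w \<in> S \<Longrightarrow> a w = b w * g w"
proof -
  have loc: "\<exists>U g. open U \<and> w0 \<in> U \<and> U \<subseteq> S \<and> g holomorphic_on U \<and>
      (\<forall>w\<in>U. w \<noteq> w0 \<longrightarrow> b w \<noteq> 0 \<and> g w = a w / b w)" if w0: "w0 \<in> S" for w0
  proof (cases "b w0 = 0")
    case False
    define U0 where "U0 = S \<inter> b -` (- {0})"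
    have "open U0"
      unfolding U0_def using b S(1)
      by (intro continuous_open_preimage holomorphic_on_imp_continuous_on) auto
    then have U0: "open U0" "w0 \<in> U0" "\<And>w. w \<in> U0 \<Longrightarrow> b w \<noteq> 0"
      using False w0 by (auto simp: U0_def)
    have "(\<lambda>w. a w / b w) holomorphic_on (U0 \<inter> S)"
      using U0 a b by (intro holomorphic_on_divide) (auto elim: holomorphic_on_subset)
    then show ?thesis
      using U0 w0 S by (intro exI[of _ "U0 \<inter> S"] exI[of _ "\<lambda>w. a w / b w"]) auto
  next
    case True
    have "\<not> b constant_on S"
      using True b0 w0 unfolding constant_on_def by metis
    then obtain u r m where u: "0 < m" "0 < r" "ball w0 r \<subseteq> S" "u holomorphic_on ball w0 r"
      "\<And>w. w \<in> ball w0 r \<Longrightarrow> b w = (w - w0) ^ m * u w" "\<And>w. w \<in> ball w0 r \<Longrightarrow> u w \<noteq> 0"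
      using holomorphic_factor_zero_nonconstant[OF b S w0 True] by metis
    have bnz: "b w \<noteq> 0" if "w \<in> ball w0 r - {w0}" for w
      using that u(5,6)[of w] by auto
    \<comment> \<open>It is enough to take n = m, the order of b at \<open>w0\<close>: then the
      power m + 1 of (w - w0) a / b is (w - w0) times a function continuous at \<open>w0\<close>, so
      it tends to 0 and the singularity of a / b is removable.\<close>
    obtain c where c: "c holomorphic_on S" "\<And>w. w \<in> S \<Longrightarrow> a w ^ Suc m = b w ^ m * c w"
      using powers by blast
    define f where "f w = a w / b w" for w
    have f: "f holomorphic_on (ball w0 r - {w0})"
      unfolding f_def using a b u(3) bnz
      by (intro holomorphic_on_divide) (auto elim!: holomorphic_on_subset)
    have key: "((w - w0) * f w) ^ Suc m = (w - w0) * (c w / u w)" if w: "w \<in> ball w0 r - {w0}" for w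
    proof -
      have wS: "w \<in> S" "w \<in> ball w0 r" "w \<noteq> w0"
        using w u(3) by auto
      have "((w - w0) * f w) ^ Suc m = (w - w0) ^ Suc m * (a w ^ Suc m / b w ^ Suc m)"
        by (simp add: f_def power_mult_distrib power_divide)
      also have "a w ^ Suc m / b w ^ Suc m = c w / b w"
        using c(2)[OF wS(1)] bnz[OF w] by (simp add: field_simps)
      also have "(w - w0) ^ Suc m * (c w / b w) = (w - w0) * (c w / u w)"
        using u(5)[OF wS(2)] u(6)[OF wS(2)] wS(3) by (simp add: field_simps)
      finally show ?thesis .
    qed
    have "isCont (\<lambda>w. (w - w0) * (c w / u w)) w0"
    proof -
      have "isCont c w0" "isCont u w0"
        using c(1) u(4) S(1) w0 u(2) holomorphic_on_imp_continuous_on continuous_on_eq_continuous_at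
        by (metis centre_in_ball open_ball)+
      then show ?thesis
        using u(6)[of w0] u(2) by (intro continuous_intros) auto
    qed
    then have "((\<lambda>w. (w - w0) * (c w / u w)) \<longlongrightarrow> (w0 - w0) * (c w0 / u w0)) (at w0)"
      by (rule isContD)
    then have "((\<lambda>w. (w - w0) * (c w / u w)) \<longlongrightarrow> 0) (at w0)"
      by (simp only: diff_self mult_zero_left)
    moreover have ev: "\<forall>\<^sub>F w in at w0. w \<in> ball w0 r - {w0}"
      using u(2) by (intro eventually_at_in_open) auto
    ultimately have "((\<lambda>w. ((w - w0) * f w) ^ Suc m) \<longlongrightarrow> 0) (at w0)"
      by (subst tendsto_cong[OF eventually_mono[OF ev key]]) auto
    then have "((\<lambda>w. (cmod ((w - w0) * f w)) ^ Suc m) \<longlongrightarrow> 0) (at w0)"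
      unfolding norm_power [symmetric] by (rule tendsto_norm_zero)
    then have "((\<lambda>w. root (Suc m) ((cmod ((w - w0) * f w)) ^ Suc m)) \<longlongrightarrow> root (Suc m) 0) (at w0)"
      by (rule tendsto_real_root)
    then have "((\<lambda>w. cmod ((w - w0) * f w)) \<longlongrightarrow> 0) (at w0)"
      by (simp add: real_root_power_cancel del: power_Suc)
    then have "((\<lambda>w. (w - w0) * f w) \<longlongrightarrow> 0) (at w0)"
      by (rule tendsto_norm_zero_cancel)
    then obtain g where g: "g holomorphic_on ball w0 r" "\<And>z. z \<in> ball w0 r - {w0} \<Longrightarrow> g z = f z"
      using holomorphic_on_extend_lim[OF f] u(2) by auto
    show ?thesis
      by (rule exI[of _ "ball w0 r"], rule exI[of _ g]) (use u g bnz f_def in auto)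
  qed
  \<comment> \<open>Taking limits gives one global function that agrees with each of the local
    quotients.\<close>
  define g where "g w = Lim (at w) (\<lambda>w. a w / b w)" for w
  have local: "\<exists>U. open U \<and> w0 \<in> U \<and> g holomorphic_on U \<and> a w0 = b w0 * g w0" if w0: "w0 \<in> S" for w0
  proof -
    obtain U g' where U: "open U" "w0 \<in> U" "U \<subseteq> S" "g' holomorphic_on U"
      "\<And>w. w \<in> U \<Longrightarrow> w \<noteq> w0 \<Longrightarrow> b w \<noteq> 0 \<and> g' w = a w / b w"
      using loc[OF w0] by blast
    have contg: "isCont g' w" if "w \<in> U" for w
      using U that holomorphic_on_imp_continuous_on continuous_on_eq_continuous_at by blast
    have eq: "g w = g' w" if w: "w \<in> U" for w
    proof -
      have ev: "\<forall>\<^sub>F v in at w. v \<in> U - {w0}"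
      proof (cases "w = w0")
        case True
        then show ?thesis
          using U eventually_at_in_open[of U w0] by simp
      next
        case False
        then have "\<forall>\<^sub>F v in at w. v \<in> (U - {w0}) - {w}"
          using U w by (intro eventually_at_in_open open_delete) auto
        then show ?thesis
          by (rule eventually_mono) auto
      qed
      have "(g' \<longlongrightarrow> g' w) (at w)"
        using contg[OF w] by (simp add: isCont_def)
      then have "((\<lambda>w. a w / b w) \<longlongrightarrow> g' w) (at w)"
        by (rule Lim_transform_eventually) (use ev U(5) in \<open>auto elim!: eventually_mono\<close>)
      then show ?thesis
        unfolding g_def by (rule tendsto_Lim[OF at_neq_bot])
    qed
    have "g holomorphic_on U"
      using U(4) eq by (simp cong: holomorphic_cong)
    moreover have "a w0 = b w0 * g w0"
    proof -
      have cont: "isCont a w0" "isCont b w0"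
        using a b S(1) w0 holomorphic_on_imp_continuous_on continuous_on_eq_continuous_at by blast+
      have "(a \<longlongrightarrow> a w0) (at w0)" "((\<lambda>w. b w * g' w) \<longlongrightarrow> b w0 * g' w0) (at w0)"
        using cont contg[OF U(2)] by (auto simp: isCont_def intro!: tendsto_mult)
      moreover have "\<forall>\<^sub>F w in at w0. a w = b w * g' w"
        using eventually_at_in_open[OF U(1,2)] by (rule eventually_mono) (use U(5) in auto)
      ultimately have "a w0 = b w0 * g' w0"
        using tendsto_cong[of a "\<lambda>w. b w * g' w" "at w0" "a w0"] tendsto_unique[OF at_neq_bot] by metis
      then show ?thesis
        using eq U(2) by simp
    qed
    ultimately show ?thesis
      using U by blast
  qed
  have "g holomorphic_on S"
    using local S(1) by (metis holomorphic_on_open holomorphic_on_imp_differentiable_at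
        field_differentiable_def)
  then show ?thesis
    using that local by blast
qed

section \<open>Integer matrices and the slash action\<close>

no_notation fps_nth (infixl "$" 75)

definition mat2 :: "int \<Rightarrow> int \<Rightarrow> int \<Rightarrow> int \<Rightarrow> int^2^2" where
  "mat2 a b c d = vector [vector [a, b], vector [c, d]]"

lemma mat2_nth [simp]:
  "mat2 a b c d $ 1 $ 1 = a" "mat2 a b c d $ 1 $ 2 = b"
  "mat2 a b c d $ 2 $ 1 = c" "mat2 a b c d $ 2 $ 2 = d"
  by (simp_all add: mat2_def)

lemma mat2_eqI:
  fixes A B :: "int^2^2"
  assumes "A $ 1 $ 1 = B $ 1 $ 1" "A $ 1 $ 2 = B $ 1 $ 2" "A $ 2 $ 1 = B $ 2 $ 1" "A $ 2 $ 2 = B $ 2 $ 2"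
  shows "A = B"
  using assms by (simp add: vec_eq_iff forall_2)

lemma mat2_mult_nth:
  fixes A B :: "int^2^2"
  shows "(A ** B) $ i $ j = A $ i $ 1 * B $ 1 $ j + A $ i $ 2 * B $ 2 $ j"
  by (simp add: matrix_matrix_mult_def sum_2)

lemma mat_1_nth [simp]:
  "(mat 1 :: int^2^2) $ 1 $ 1 = 1" "(mat 1 :: int^2^2) $ 1 $ 2 = 0"
  "(mat 1 :: int^2^2) $ 2 $ 1 = 0" "(mat 1 :: int^2^2) $ 2 $ 2 = 1"
  by (simp_all add: mat_def)

lemma det_mat2: "det (mat2 a b c d) = a * d - b * c"
  by (simp add: det_2)

lemma det_SL2Z: "\<gamma> \<in> SL2Z \<Longrightarrow> \<gamma> $ 1 $ 1 * \<gamma> $ 2 $ 2 - \<gamma> $ 1 $ 2 * \<gamma> $ 2 $ 1 = 1"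
  by (simp add: SL2Z_def det_2)

lemma SL2Z_det: "\<gamma> \<in> SL2Z \<longleftrightarrow> det \<gamma> = 1"
  by (simp add: SL2Z_def)

lemma SL2Z_mult: "\<gamma> \<in> SL2Z \<Longrightarrow> \<delta> \<in> SL2Z \<Longrightarrow> \<gamma> ** \<delta> \<in> SL2Z"
  by (simp add: SL2Z_def det_mul)

lemma SL2Z_1 [simp]: "mat 1 \<in> SL2Z"
  by (simp add: SL2Z_def)

definition minv :: "int^2^2 \<Rightarrow> int^2^2" where
  "minv \<gamma> = mat2 (\<gamma> $ 2 $ 2) (- \<gamma> $ 1 $ 2) (- \<gamma> $ 2 $ 1) (\<gamma> $ 1 $ 1)"

lemma minv_SL2Z: "\<gamma> \<in> SL2Z \<Longrightarrow> minv \<gamma> \<in> SL2Z"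
  using det_SL2Z[of \<gamma>] by (simp add: SL2Z_det minv_def det_mat2 mult.commute)

lemma minv_mult: "\<gamma> \<in> SL2Z \<Longrightarrow> minv \<gamma> ** \<gamma> = mat 1" "\<gamma> \<in> SL2Z \<Longrightarrow> \<gamma> ** minv \<gamma> = mat 1"
  using det_SL2Z[of \<gamma>] by (auto intro!: mat2_eqI simp: mat2_mult_nth minv_def algebra_simps)

lemma aut_factor_nonzero:
  assumes "det \<gamma> > 0" "Im z > 0"
  shows "aut_factor \<gamma> z \<noteq> 0"
proof
  assume *: "aut_factor \<gamma> z = 0"
  have "\<gamma> $ 2 $ 1 = 0"
    using arg_cong[OF *, of Im] assms(2) by (simp add: aut_factor_def)
  moreover from this have "\<gamma> $ 2 $ 2 = 0"
    using arg_cong[OF *, of Re] by (simp add: aut_factor_def)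
  ultimately show False
    using assms(1) by (simp add: det_2)
qed

lemma Im_mat_act:
  assumes "det \<gamma> > 0" "Im z > 0"
  shows "Im (mat_act \<gamma> z) = of_int (det \<gamma>) * Im z / (cmod (aut_factor \<gamma> z))\<^sup>2"
proof -
  define a b c d where abcd: "a = \<gamma> $ 1 $ 1" "b = \<gamma> $ 1 $ 2" "c = \<gamma> $ 2 $ 1" "d = \<gamma> $ 2 $ 2"
  have "mat_act \<gamma> z = (of_int a * z + of_int b) / aut_factor \<gamma> z"
    by (simp add: mat_act_def moebius_def aut_factor_def abcd)
  also have "\<dots> = (of_int a * z + of_int b) * cnj (aut_factor \<gamma> z) / of_real ((cmod (aut_factor \<gamma> z))\<^sup>2)"
    by (metis complex_div_cnj)
  also have "Im \<dots> = Im ((of_int a * z + of_int b) * cnj (aut_factor \<gamma> z)) / (cmod (aut_factor \<gamma> z))\<^sup>2"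
    by (simp add: Im_divide_of_real)
  also have "Im ((of_int a * z + of_int b) * cnj (aut_factor \<gamma> z)) = of_int (det \<gamma>) * Im z"
    by (simp add: aut_factor_def det_2 abcd[symmetric] algebra_simps)
  finally show ?thesis .
qed

lemma mat_act_uhp: "det \<gamma> > 0 \<Longrightarrow> Im z > 0 \<Longrightarrow> Im (mat_act \<gamma> z) > 0"
  by (simp add: Im_mat_act aut_factor_nonzero)

lemma mat_act_mult_aux:
  assumes "det B > 0" "Im z > 0"
  shows "aut_factor (A ** B) z = aut_factor A (mat_act B z) * aut_factor B z"
    and "of_int ((A ** B) $ 1 $ 1) * z + of_int ((A ** B) $ 1 $ 2) =
      (of_int (A $ 1 $ 1) * mat_act B z + of_int (A $ 1 $ 2)) * aut_factor B z"
proof -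
  have *: "mat_act B z * aut_factor B z = of_int (B $ 1 $ 1) * z + of_int (B $ 1 $ 2)"
    using aut_factor_nonzero[OF assms] by (simp add: mat_act_def moebius_def aut_factor_def)
  have "(of_int x * mat_act B z + of_int y) * aut_factor B z =
    of_int x * (mat_act B z * aut_factor B z) + of_int y * aut_factor B z" for x y
    by (simp add: algebra_simps)
  then have **: "(of_int x * mat_act B z + of_int y) * aut_factor B z =
    of_int x * (of_int (B $ 1 $ 1) * z + of_int (B $ 1 $ 2)) +
    of_int y * (of_int (B $ 2 $ 1) * z + of_int (B $ 2 $ 2))" for x y
    unfolding * by (simp add: aut_factor_def)
  show "aut_factor (A ** B) z = aut_factor A (mat_act B z) * aut_factor B z"
    unfolding aut_factor_def[of A] ** by (simp add: aut_factor_def mat2_mult_nth algebra_simps)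
  show "of_int ((A ** B) $ 1 $ 1) * z + of_int ((A ** B) $ 1 $ 2) =
      (of_int (A $ 1 $ 1) * mat_act B z + of_int (A $ 1 $ 2)) * aut_factor B z"
    unfolding ** by (simp add: mat2_mult_nth algebra_simps)
qed

lemmas aut_factor_mult = mat_act_mult_aux(1)

lemma mat_act_mult:
  assumes "det B > 0" "Im z > 0"
  shows "mat_act (A ** B) z = mat_act A (mat_act B z)"
proof -
  have "mat_act (A ** B) z = (of_int ((A ** B) $ 1 $ 1) * z + of_int ((A ** B) $ 1 $ 2)) / aut_factor (A ** B) z"
    by (simp add: mat_act_def moebius_def aut_factor_def)
  also have "\<dots> = (of_int (A $ 1 $ 1) * mat_act B z + of_int (A $ 1 $ 2)) / aut_factor A (mat_act B z)"
    unfolding mat_act_mult_aux[OF assms] using aut_factor_nonzero[OF assms] by simp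
  finally show ?thesis
    by (simp add: mat_act_def moebius_def aut_factor_def)
qed

lemma slash_mult:
  assumes "det B > 0" "Im z > 0"
  shows "slash w F (A ** B) z = slash w (slash w F A) B z"
  using assms by (simp add: slash_def mat_act_mult aut_factor_mult power_int_mult_distrib)

lemma slash_cong: "(\<And>z. Im z > 0 \<Longrightarrow> F z = G z) \<Longrightarrow> det \<gamma> > 0 \<Longrightarrow> Im z > 0 \<Longrightarrow> slash w F \<gamma> z = slash w G \<gamma> z"
  by (simp add: slash_def mat_act_uhp)

lemma slash_1 [simp]: "slash w F (mat 1) z = F z"
  by (simp add: slash_def aut_factor_def mat_act_def moebius_def)

lemma slash_prod2:
  assumes "det \<gamma> > 0" "Im z > 0"
  shows "slash (k + l) (\<lambda>z. F z * G z) \<gamma> z = slash k F \<gamma> z * slash l G \<gamma> z"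
  using aut_factor_nonzero[OF assms] by (simp add: slash_def power_int_add power_int_minus power_int_diff field_simps)

lemma slash_add: "slash k (\<lambda>z. F z + G z) \<gamma> z = slash k F \<gamma> z + slash k G \<gamma> z"
  by (simp add: slash_def algebra_simps)

lemma slash_diff: "slash k (\<lambda>z. F z - G z) \<gamma> z = slash k F \<gamma> z - slash k G \<gamma> z"
  by (simp add: slash_def algebra_simps)

lemma slash_cmult: "slash k (\<lambda>z. x * F z) \<gamma> z = x * slash k F \<gamma> z"
  by (simp add: slash_def algebra_simps)

lemma slash_sum: "slash k (\<lambda>z. \<Sum>i\<in>I. F i z) \<gamma> z = (\<Sum>i\<in>I. slash k (F i) \<gamma> z)"
  by (simp add: slash_def sum_distrib_left)

lemma slash_const_0: "slash 0 (\<lambda>z. x) \<gamma> z = x"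
  by (simp add: slash_def)

lemma slash_holomorphic:
  assumes F: "F holomorphic_on uhp" and \<gamma>: "det \<gamma> > 0"
  shows "slash w F \<gamma> holomorphic_on uhp"
proof -
  have nz: "of_int (\<gamma> $ 2 $ 1) * z + of_int (\<gamma> $ 2 $ 2) \<noteq> 0" if "z \<in> uhp" for z
    using aut_factor_nonzero[OF \<gamma>, of z] that by (simp add: aut_factor_def)
  have "mat_act \<gamma> holomorphic_on uhp"
    unfolding mat_act_def moebius_def using nz by (intro holomorphic_intros)
  then have "F \<circ> mat_act \<gamma> holomorphic_on uhp"
    by (rule holomorphic_on_compose_gen[OF _ F]) (auto simp: mat_act_uhp \<gamma>)
  then have "(\<lambda>z. F (mat_act \<gamma> z)) holomorphic_on uhp"
    by (simp add: o_def)
  moreover have "(\<lambda>z. aut_factor \<gamma> z powi (- w)) holomorphic_on uhp"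
    unfolding aut_factor_def using nz by (intro holomorphic_intros) auto
  ultimately show ?thesis
    unfolding slash_def[abs_def] by (rule holomorphic_on_mult[rotated])
qed

definition transl :: "int \<Rightarrow> int^2^2" where "transl n = mat2 1 n 0 1"

lemma transl_SL2Z [simp]: "transl n \<in> SL2Z"
  by (simp add: transl_def SL2Z_det det_mat2)

lemma mat_act_transl [simp]: "mat_act (transl n) z = z + of_int n"
  by (simp add: mat_act_def moebius_def transl_def)

lemma aut_factor_transl [simp]: "aut_factor (transl n) z = 1"
  by (simp add: aut_factor_def transl_def)

lemma slash_transl [simp]: "slash w F (transl n) z = F (z + of_int n)"
  by (simp add: slash_def)

lemma SL2Z_det_pos [simp]: "\<gamma> \<in> SL2Z \<Longrightarrow> det \<gamma> > 0"
  by (simp add: SL2Z_det)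

subsection \<open>Congruence classes modulo \<open>N\<close>\<close>

definition congm :: "nat \<Rightarrow> int^2^2 \<Rightarrow> int^2^2 \<Rightarrow> bool" where
  "congm N A B \<longleftrightarrow> (\<forall>i j. int N dvd A $ i $ j - B $ i $ j)"

lemma congm_refl [simp]: "congm N A A"
  by (simp add: congm_def)

lemma congm_sym: "congm N A B \<Longrightarrow> congm N B A"
  by (simp add: congm_def dvd_diff_commute)

lemma congm_trans:
  assumes "congm N A B" "congm N B C"
  shows "congm N A C"
  unfolding congm_def
proof (intro allI)
  fix i j
  have "int N dvd (A $ i $ j - B $ i $ j) + (B $ i $ j - C $ i $ j)"
    by (rule dvd_add[OF assms(1)[unfolded congm_def, rule_format] assms(2)[unfolded congm_def, rule_format]])
  then show "int N dvd A $ i $ j - C $ i $ j"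
    by simp
qed

lemma congm_mult:
  assumes "congm N A B" "congm N C D"
  shows "congm N (A ** C) (B ** D)"
  unfolding congm_def
proof (intro allI)
  fix i j
  have "(A ** C) $ i $ j - (B ** D) $ i $ j =
    (A $ i $ 1 - B $ i $ 1) * C $ 1 $ j + B $ i $ 1 * (C $ 1 $ j - D $ 1 $ j) +
    (A $ i $ 2 - B $ i $ 2) * C $ 2 $ j + B $ i $ 2 * (C $ 2 $ j - D $ 2 $ j)"
    by (simp add: mat2_mult_nth algebra_simps)
  then show "int N dvd (A ** C) $ i $ j - (B ** D) $ i $ j"
    using assms by (simp add: congm_def)
qed

lemma congm_dvd: "congm N A B \<Longrightarrow> M dvd N \<Longrightarrow> congm M A B"
  by (metis (no_types) congm_def dvd_trans int_dvd_int_iff)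

definition Gam :: "nat \<Rightarrow> (int^2^2) set" where
  "Gam N = {\<gamma> \<in> SL2Z. congm N \<gamma> (mat 1)}"

lemma Gam_SL2Z: "\<gamma> \<in> Gam N \<Longrightarrow> \<gamma> \<in> SL2Z"
  by (simp add: Gam_def)

lemma Gam_1: "Gam 1 = SL2Z"
  by (auto simp: Gam_def congm_def)

text \<open>The class of the identity is represented by the identity itself, so that it can be split
  off sums and products over \<open>mreps\<close>.\<close>

definition mrep :: "nat \<Rightarrow> int^2^2 \<Rightarrow> int^2^2" where
  "mrep N \<gamma> = (if congm N \<gamma> (mat 1) then mat 1 else SOME \<delta>. \<delta> \<in> SL2Z \<and> congm N \<gamma> \<delta>)"

definition mreps :: "nat \<Rightarrow> (int^2^2) set" where
  "mreps N = mrep N ` SL2Z"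

lemma mrep:
  assumes "\<gamma> \<in> SL2Z"
  shows "mrep N \<gamma> \<in> SL2Z" "congm N \<gamma> (mrep N \<gamma>)"
proof -
  have "\<exists>\<delta>. \<delta> \<in> SL2Z \<and> congm N \<gamma> \<delta>"
    using assms by (intro exI[of _ \<gamma>]) simp
  from someI_ex[OF this] show "mrep N \<gamma> \<in> SL2Z" "congm N \<gamma> (mrep N \<gamma>)"
    by (auto simp: mrep_def)
qed

lemma mrep_eq:
  assumes "congm N \<gamma> \<delta>"
  shows "mrep N \<gamma> = mrep N \<delta>"
proof -
  have "congm N \<gamma> = congm N \<delta>"
    using assms congm_sym congm_trans by blast
  then show ?thesis
    by (simp add: mrep_def)
qed

lemma mreps_SL2Z: "\<rho> \<in> mreps N \<Longrightarrow> \<rho> \<in> SL2Z"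
  using mrep by (auto simp: mreps_def)

lemma mrep_in_mreps [simp]: "\<gamma> \<in> SL2Z \<Longrightarrow> mrep N \<gamma> \<in> mreps N"
  by (simp add: mreps_def)

lemma one_in_mreps [simp]: "mat 1 \<in> mreps N"
proof -
  have "mrep N (mat 1) = mat 1"
    by (simp add: mrep_def)
  then show ?thesis
    using mrep_in_mreps[OF SL2Z_1] by metis
qed

lemma mreps_unique: "\<rho> \<in> mreps N \<Longrightarrow> \<rho>' \<in> mreps N \<Longrightarrow> congm N \<rho> \<rho>' \<Longrightarrow> \<rho> = \<rho>'"
proof -
  assume "\<rho> \<in> mreps N" "\<rho>' \<in> mreps N" and *: "congm N \<rho> \<rho>'"
  then obtain \<gamma> \<gamma>' where \<gamma>: "\<gamma> \<in> SL2Z" "\<rho> = mrep N \<gamma>" "\<gamma>' \<in> SL2Z" "\<rho>' = mrep N \<gamma>'"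
    by (auto simp: mreps_def)
  then have "congm N \<gamma> \<gamma>'"
    using mrep(2) * congm_sym congm_trans by metis
  then show ?thesis
    using \<gamma> mrep_eq by simp
qed

definition mat_entries :: "nat \<Rightarrow> int^2^2 \<Rightarrow> int \<times> int \<times> int \<times> int" where
  "mat_entries N A =
    (A $ 1 $ 1 mod int N, A $ 1 $ 2 mod int N, A $ 2 $ 1 mod int N, A $ 2 $ 2 mod int N)"

lemma congm_entries: "mat_entries N A = mat_entries N B \<Longrightarrow> congm N A B"
  unfolding congm_def forall_2 mat_entries_def prod.inject mod_eq_dvd_iff by (elim conjE) (intro conjI)

lemma mat_entries_range: "N > 0 \<Longrightarrow> mat_entries N A \<in> {0..<int N} \<times> {0..<int N} \<times> {0..<int N} \<times> {0..<int N}"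
  by (simp add: mat_entries_def)

lemma finite_mreps:
  assumes "N > 0"
  shows "finite (mreps N)"
proof -
  have "inj_on (mat_entries N) (mreps N)"
    by (rule inj_onI) (rule mreps_unique, auto intro: congm_entries)
  moreover have "finite (mat_entries N ` mreps N)"
    by (rule finite_subset[of _ "{0..<int N} \<times> {0..<int N} \<times> {0..<int N} \<times> {0..<int N}"])
       (use mat_entries_range[OF assms] in blast, simp)
  ultimately show ?thesis
    using finite_imageD by blast
qed

text \<open>Right translation permutes the cosets of the normal subgroup \<Gamma>(N). Traces and
  norms over \<open>mreps\<close> are invariant under \<open>SL2Z\<close> for this reason.\<close>

lemma mreps_bij:
  assumes "N > 0" and \<gamma>: "\<gamma> \<in> SL2Z"
  shows "bij_betw (\<lambda>\<rho>. mrep N (\<rho> ** \<gamma>)) (mreps N) (mreps N)"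
proof -
  have "inj_on (\<lambda>\<rho>. mrep N (\<rho> ** \<gamma>)) (mreps N)"
  proof (rule inj_onI)
    fix \<rho> \<rho>' assume \<rho>: "\<rho> \<in> mreps N" "\<rho>' \<in> mreps N" and *: "mrep N (\<rho> ** \<gamma>) = mrep N (\<rho>' ** \<gamma>)"
    have "congm N (\<rho> ** \<gamma>) (\<rho>' ** \<gamma>)"
      using mrep(2)[OF SL2Z_mult[OF mreps_SL2Z[OF \<rho>(1)] \<gamma>], of N]
        congm_sym[OF mrep(2)[OF SL2Z_mult[OF mreps_SL2Z[OF \<rho>(2)] \<gamma>], of N]]
      unfolding * by (rule congm_trans)
    then have "congm N (\<rho> ** \<gamma> ** minv \<gamma>) (\<rho>' ** \<gamma> ** minv \<gamma>)"
      by (rule congm_mult) simp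
    then show "\<rho> = \<rho>'"
      using \<rho> mreps_unique by (simp add: matrix_mul_assoc [symmetric] minv_mult[OF \<gamma>])
  qed
  moreover have "(\<lambda>\<rho>. mrep N (\<rho> ** \<gamma>)) ` mreps N \<subseteq> mreps N"
    using \<gamma> by (auto simp: SL2Z_mult mreps_SL2Z)
  ultimately show ?thesis
    using endo_inj_surj[OF finite_mreps[OF assms(1)]] by (simp add: bij_betw_def)
qed

lemma sum_mreps:
  assumes "N > 0" "\<gamma> \<in> SL2Z" and "\<And>\<alpha> \<beta>. \<alpha> \<in> SL2Z \<Longrightarrow> \<beta> \<in> SL2Z \<Longrightarrow> congm N \<alpha> \<beta> \<Longrightarrow> h \<alpha> = h \<beta>"
  shows "(\<Sum>\<rho>\<in>mreps N. h (\<rho> ** \<gamma>)) = (\<Sum>\<rho>\<in>mreps N. h \<rho> :: complex)"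
proof -
  have "(\<Sum>\<rho>\<in>mreps N. h (\<rho> ** \<gamma>)) = (\<Sum>\<rho>\<in>mreps N. h (mrep N (\<rho> ** \<gamma>)))"
  proof (rule sum.cong[OF refl])
    fix \<rho> assume "\<rho> \<in> mreps N"
    then have "\<rho> ** \<gamma> \<in> SL2Z"
      using assms(2) mreps_SL2Z SL2Z_mult by blast
    then show "h (\<rho> ** \<gamma>) = h (mrep N (\<rho> ** \<gamma>))"
      by (intro assms(3) mrep)
  qed
  also have "\<dots> = (\<Sum>\<rho>\<in>mreps N. h \<rho>)"
    by (rule sum.reindex_bij_betw[OF mreps_bij[OF assms(1,2)]])
  finally show ?thesis .
qed

lemma prod_mreps:
  assumes "N > 0" "\<gamma> \<in> SL2Z" and "\<And>\<alpha> \<beta>. \<alpha> \<in> SL2Z \<Longrightarrow> \<beta> \<in> SL2Z \<Longrightarrow> congm N \<alpha> \<beta> \<Longrightarrow> h \<alpha> = h \<beta>"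
  shows "(\<Prod>\<rho>\<in>mreps N. h (\<rho> ** \<gamma>)) = (\<Prod>\<rho>\<in>mreps N. h \<rho> :: complex)"
proof -
  have "(\<Prod>\<rho>\<in>mreps N. h (\<rho> ** \<gamma>)) = (\<Prod>\<rho>\<in>mreps N. h (mrep N (\<rho> ** \<gamma>)))"
  proof (rule prod.cong[OF refl])
    fix \<rho> assume "\<rho> \<in> mreps N"
    then have "\<rho> ** \<gamma> \<in> SL2Z"
      using assms(2) mreps_SL2Z SL2Z_mult by blast
    then show "h (\<rho> ** \<gamma>) = h (mrep N (\<rho> ** \<gamma>))"
      by (intro assms(3) mrep)
  qed
  also have "\<dots> = (\<Prod>\<rho>\<in>mreps N. h \<rho>)"
    by (rule prod.reindex_bij_betw[OF mreps_bij[OF assms(1,2)]])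
  finally show ?thesis .
qed

lemma congm_Gam:
  assumes "\<gamma> \<in> SL2Z" "\<delta> \<in> SL2Z" "congm N \<gamma> \<delta>"
  obtains \<alpha> where "\<alpha> \<in> Gam N" "\<gamma> = \<alpha> ** \<delta>"
proof
  have "congm N (\<gamma> ** minv \<delta>) (\<delta> ** minv \<delta>)"
    by (intro congm_mult assms congm_refl)
  then show "\<gamma> ** minv \<delta> \<in> Gam N"
    using assms by (simp add: Gam_def SL2Z_mult minv_SL2Z minv_mult)
  show "\<gamma> = \<gamma> ** minv \<delta> ** \<delta>"
    by (simp add: matrix_mul_assoc [symmetric] minv_mult assms)
qed

subsection \<open>Modular forms for the principal congruence subgroup\<close>

text \<open>Modular forms of weight k for \<Gamma>(N). The expansions of all slashes in
  \<open>qq N\<close> express holomorphy at the cusps and, through the identity matrix, also on the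
  half plane.\<close>

definition MF :: "int \<Rightarrow> nat \<Rightarrow> (complex \<Rightarrow> complex) set" where
  "MF k N = {F. (\<forall>\<gamma>\<in>Gam N. \<forall>z. Im z > 0 \<longrightarrow> slash k F \<gamma> z = F z) \<and>
                (\<forall>\<gamma>\<in>SL2Z. \<exists>c. qexp N (slash k F \<gamma>) c)}"

lemma MF_inv: "F \<in> MF k N \<Longrightarrow> \<gamma> \<in> Gam N \<Longrightarrow> Im z > 0 \<Longrightarrow> slash k F \<gamma> z = F z"
  by (simp add: MF_def)

lemma MF_qexpE:
  assumes "F \<in> MF k N" "\<gamma> \<in> SL2Z"
  obtains c where "qexp N (slash k F \<gamma>) c"
  using assms by (auto simp: MF_def)

lemma MF_qexp1E:
  assumes "F \<in> MF k N"
  obtains c where "qexp N F c"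
proof -
  obtain c where "qexp N (slash k F (mat 1)) c"
    using MF_qexpE[OF assms SL2Z_1] .
  then show ?thesis
    using that qexp_cong[of "slash k F (mat 1)" F N c] by simp
qed

lemma slash_invariant_congm:
  assumes inv: "\<And>\<gamma> z. \<gamma> \<in> Gam N \<Longrightarrow> Im z > 0 \<Longrightarrow> slash k F \<gamma> z = F z"
    and "\<gamma> \<in> SL2Z" "\<delta> \<in> SL2Z" "congm N \<gamma> \<delta>" "Im z > 0"
  shows "slash k F \<gamma> z = slash k F \<delta> z"
proof -
  obtain \<alpha> where \<alpha>: "\<alpha> \<in> Gam N" "\<gamma> = \<alpha> ** \<delta>"
    using congm_Gam[OF assms(2-4)] .
  have "slash k F \<gamma> z = slash k (slash k F \<alpha>) \<delta> z"
    unfolding \<alpha>(2) by (rule slash_mult) (use assms in auto)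
  also have "\<dots> = slash k F \<delta> z"
    by (rule slash_cong) (use \<alpha> assms in auto)
  finally show ?thesis .
qed

lemma MF_congm:
  "F \<in> MF k N \<Longrightarrow> \<gamma> \<in> SL2Z \<Longrightarrow> \<delta> \<in> SL2Z \<Longrightarrow> congm N \<gamma> \<delta> \<Longrightarrow> Im z > 0 \<Longrightarrow>
    slash k F \<gamma> z = slash k F \<delta> z"
  by (rule slash_invariant_congm[of N]) (auto simp: MF_inv)

text \<open>Bounds near the cusps are enough: \<gamma> times translation by N is congruent to
  \<gamma> modulo N, so each slash has period N and \<open>qexp_exists\<close> applies.\<close>

lemma MF_I:
  assumes N: "N > 0" and hol: "F holomorphic_on uhp"
    and inv: "\<And>\<gamma> z. \<gamma> \<in> Gam N \<Longrightarrow> Im z > 0 \<Longrightarrow> slash k F \<gamma> z = F z"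
    and bd: "\<And>\<gamma>. \<gamma> \<in> SL2Z \<Longrightarrow> \<exists>B Y. \<forall>z. Im z \<ge> Y \<longrightarrow> cmod (slash k F \<gamma> z) \<le> B"
  shows "F \<in> MF k N"
  unfolding MF_def
proof (intro CollectI conjI ballI allI impI)
  fix \<gamma> assume \<gamma>: "\<gamma> \<in> SL2Z"
  obtain B Y where BY: "\<And>z. Im z \<ge> Y \<Longrightarrow> cmod (slash k F \<gamma> z) \<le> B"
    using bd[OF \<gamma>] by blast
  have per: "slash k F \<gamma> (z + of_nat N) = slash k F \<gamma> z" if z: "Im z > 0" for z
  proof -
    have "slash k F \<gamma> (z + of_nat N) = slash k (slash k F \<gamma>) (transl (int N)) z"
      by simp
    also have "\<dots> = slash k F (\<gamma> ** transl (int N)) z"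
      by (rule slash_mult [symmetric]) (use z in simp_all)
    also have "\<dots> = slash k F \<gamma> z"
    proof (rule slash_invariant_congm[OF inv])
      have "congm N (transl (int N)) (mat 1)"
        by (auto simp: congm_def forall_2 transl_def)
      then show "congm N (\<gamma> ** transl (int N)) \<gamma>"
        using congm_mult[of N \<gamma> \<gamma> "transl (int N)" "mat 1"] by simp
    qed (use z \<gamma> in \<open>auto simp: SL2Z_mult\<close>)
    finally show ?thesis .
  qed
  show "\<exists>c. qexp N (slash k F \<gamma>) c"
    using qexp_exists[OF N slash_holomorphic[OF hol SL2Z_det_pos[OF \<gamma>]] per BY] by metis
qed (use inv in auto)

lemma MF_holomorphic: "F \<in> MF k N \<Longrightarrow> N > 0 \<Longrightarrow> F holomorphic_on uhp"
  using MF_qexp1E qexp_holomorphic by metis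

lemma MF_slash_lim:
  assumes "F \<in> MF k N" "N > 0" "\<gamma> \<in> SL2Z"
  shows "\<exists>B Y. \<forall>z. Im z \<ge> Y \<longrightarrow> cmod (slash k F \<gamma> z) \<le> B"
proof -
  obtain c where "qexp N (slash k F \<gamma>) c"
    using MF_qexpE[OF assms(1,3)] .
  from qexp_tendsto[OF this assms(2)]
  have "\<forall>\<^sub>F z in filtercomap Im at_top. dist (slash k F \<gamma> z) (fps_nth c 0) < 1"
    by (rule tendstoD) simp
  then obtain Y where Y: "\<And>z. Im z \<ge> Y \<Longrightarrow> dist (slash k F \<gamma> z) (fps_nth c 0) < 1"
    unfolding eventually_Im_at_top by blast
  have "cmod (slash k F \<gamma> z) \<le> 1 + cmod (fps_nth c 0)" if "Im z \<ge> Y" for z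
    using Y[OF that] norm_triangle_sub[of "slash k F \<gamma> z" "fps_nth c 0"] by (simp add: dist_norm)
  then show ?thesis by blast
qed

lemma MF_0: "(\<lambda>z. 0) \<in> MF k N"
  by (auto simp: MF_def slash_def[abs_def] intro!: exI[of _ 0] qexp_0)

lemma MF_const: "(\<lambda>z. x) \<in> MF 0 N"
  by (auto simp: MF_def slash_def[abs_def] intro!: exI[of _ "fps_const x"] qexp_fps_const)

lemma MF_add:
  assumes "F \<in> MF k N" "G \<in> MF k N" "N > 0"
  shows "(\<lambda>z. F z + G z) \<in> MF k N"
proof -
  have "\<exists>c. qexp N (slash k (\<lambda>z. F z + G z) \<gamma>) c" if \<gamma>: "\<gamma> \<in> SL2Z" for \<gamma>
  proof -
    obtain a b where "qexp N (slash k F \<gamma>) a" "qexp N (slash k G \<gamma>) b"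
      using MF_qexpE[OF assms(1) \<gamma>] MF_qexpE[OF assms(2) \<gamma>] by metis
    from qexp_add[OF this assms(3)] show ?thesis
      by (auto simp: slash_add[abs_def])
  qed
  then show ?thesis
    using MF_inv[OF assms(1)] MF_inv[OF assms(2)] by (simp add: MF_def slash_add)
qed

lemma MF_mult:
  assumes F: "F \<in> MF k N" and G: "G \<in> MF l N" and N: "N > 0"
  shows "(\<lambda>z. F z * G z) \<in> MF (k + l) N"
  unfolding MF_def
proof (intro CollectI conjI ballI allI impI)
  fix \<gamma> z assume "\<gamma> \<in> Gam N" "Im z > 0"
  then show "slash (k + l) (\<lambda>z. F z * G z) \<gamma> z = F z * G z"
    by (simp add: slash_prod2 Gam_SL2Z MF_inv[OF F] MF_inv[OF G])
next
  fix \<gamma> assume \<gamma>: "\<gamma> \<in> SL2Z"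
  obtain a b where "qexp N (slash k F \<gamma>) a" "qexp N (slash l G \<gamma>) b"
    using MF_qexpE[OF F \<gamma>] MF_qexpE[OF G \<gamma>] by metis
  then have "qexp N (\<lambda>z. slash k F \<gamma> z * slash l G \<gamma> z) (a * b)"
    using qexp_mult N by blast
  then show "\<exists>c. qexp N (slash (k + l) (\<lambda>z. F z * G z) \<gamma>) c"
    by (subst (asm) qexp_cong[where G = "slash (k + l) (\<lambda>z. F z * G z) \<gamma>"])
       (auto simp: slash_prod2 \<gamma>)
qed

lemma MF_cmult: "F \<in> MF k N \<Longrightarrow> N > 0 \<Longrightarrow> (\<lambda>z. x * F z) \<in> MF k N"
  using MF_mult[OF MF_const[of x]] by fastforce

lemma MF_diff:
  assumes "F \<in> MF k N" "G \<in> MF k N" "N > 0"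
  shows "(\<lambda>z. F z - G z) \<in> MF k N"
  using MF_add[OF assms(1) MF_cmult[OF assms(2,3), of "- 1"] assms(3)] by simp

lemma MF_sum: "(\<And>i. i \<in> I \<Longrightarrow> F i \<in> MF k N) \<Longrightarrow> N > 0 \<Longrightarrow> (\<lambda>z. \<Sum>i\<in>I. F i z) \<in> MF k N"
  by (induction I rule: infinite_finite_induct) (auto intro: MF_0 MF_add)

lemma MF_power: "F \<in> MF k N \<Longrightarrow> N > 0 \<Longrightarrow> (\<lambda>z. F z ^ n) \<in> MF (int n * k) N"
proof (induction n)
  case (Suc n)
  have "int (Suc n) * k = k + int n * k"
    by (simp add: algebra_simps)
  then show ?case
    using MF_mult[OF Suc.prems(1) Suc.IH[OF Suc.prems] Suc.prems(2)] by simp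
qed (simp add: MF_const)

lemma MF_prod:
  "(\<And>i. i \<in> I \<Longrightarrow> F i \<in> MF k N) \<Longrightarrow> N > 0 \<Longrightarrow> (\<lambda>z. \<Prod>i\<in>I. F i z) \<in> MF (int (card I) * k) N"
proof (induction I rule: infinite_finite_induct)
  case (insert i I)
  have "int (card (insert i I)) * k = k + int (card I) * k"
    using insert.hyps by (simp add: algebra_simps)
  then show ?case
    using MF_mult[of "F i" k N "\<lambda>z. \<Prod>i\<in>I. F i z" "int (card I) * k"] insert by simp
qed (simp_all add: MF_const)

lemma MF_slash:
  assumes F: "F \<in> MF k N" and \<gamma>: "\<gamma> \<in> SL2Z"
  shows "slash k F \<gamma> \<in> MF k N"
  unfolding MF_def
proof (intro CollectI conjI ballI allI impI)
  fix \<delta> z assume \<delta>: "\<delta> \<in> Gam N" and z: "Im z > 0"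
  have "slash k (slash k F \<gamma>) \<delta> z = slash k F (\<gamma> ** \<delta>) z"
    by (rule slash_mult [symmetric]) (use \<delta> z in \<open>auto simp: Gam_SL2Z\<close>)
  also have "\<dots> = slash k F \<gamma> z"
  proof (rule MF_congm[OF F])
    show "congm N (\<gamma> ** \<delta>) \<gamma>"
      using congm_mult[of N \<gamma> \<gamma> \<delta> "mat 1"] \<delta> by (simp add: Gam_def)
  qed (use \<delta> z \<gamma> in \<open>auto simp: Gam_SL2Z SL2Z_mult\<close>)
  finally show "slash k (slash k F \<gamma>) \<delta> z = slash k F \<gamma> z" .
next
  fix \<delta> assume \<delta>: "\<delta> \<in> SL2Z"
  obtain c where "qexp N (slash k F (\<gamma> ** \<delta>)) c"
    using MF_qexpE[OF F SL2Z_mult[OF \<gamma> \<delta>]] .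
  then show "\<exists>c. qexp N (slash k (slash k F \<gamma>) \<delta>) c"
    using qexp_cong[of "slash k (slash k F \<gamma>) \<delta>" "slash k F (\<gamma> ** \<delta>)" N c] \<delta>
    by (auto simp: slash_mult)
qed

lemma MF_raise:
  assumes F: "F \<in> MF k N" and "N > 0" "m > 0"
  shows "F \<in> MF k (N * m)"
  unfolding MF_def
proof (intro CollectI conjI ballI allI impI)
  fix \<gamma> z assume "\<gamma> \<in> Gam (N * m)" "Im z > 0"
  moreover from this have "\<gamma> \<in> Gam N"
    using congm_dvd[of "N * m" \<gamma> "mat 1" N] by (auto simp: Gam_def)
  ultimately show "slash k F \<gamma> z = F z"
    using MF_inv[OF F] by blast
next
  fix \<gamma> assume "\<gamma> \<in> SL2Z"
  then obtain c where "qexp N (slash k F \<gamma>) c"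
    using MF_qexpE[OF F] by blast
  then show "\<exists>c. qexp (N * m) (slash k F \<gamma>) c"
    using qexp_spread assms(2,3) by blast
qed

subsection \<open>Reduction to the fundamental domain\<close>

text \<open>Take \<gamma> with |c z + d| minimal, that is, with mat_act \<gamma> z as high as
  possible. Translation adjusts the real part without changing the bottom row, and if the image had
  modulus below 1, inversion would make |c z + d| smaller.\<close>

lemma fund_domain_reduction:
  assumes z: "Im z > 0"
  obtains \<gamma> where "\<gamma> \<in> SL2Z" "\<bar>Re (mat_act \<gamma> z)\<bar> \<le> 1/2" "cmod (mat_act \<gamma> z) \<ge> 1"
proof -
  define P where "P = {(\<gamma> $ 2 $ 1, \<gamma> $ 2 $ 2) | \<gamma>. \<gamma> \<in> SL2Z \<and> cmod (aut_factor \<gamma> z) \<le> 1}"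
  \<comment> \<open>If |c z + d| <= 1, then |c| Im z <= 1, which bounds c and after that d. So only
    finitely many bottom rows compete for the minimum.\<close>
  define B where "B = \<lceil>1 / Im z\<rceil>"
  define C where "C = \<lceil>1 + of_int B * cmod z\<rceil>"
  have "P \<subseteq> {-B..B} \<times> {-C..C}"
  proof
    fix t assume "t \<in> P"
    then obtain \<gamma> where t: "t = (\<gamma> $ 2 $ 1, \<gamma> $ 2 $ 2)" and 1: "cmod (aut_factor \<gamma> z) \<le> 1"
      by (auto simp: P_def)
    define c d where cd: "c = \<gamma> $ 2 $ 1" "d = \<gamma> $ 2 $ 2"
    have "\<bar>Im (aut_factor \<gamma> z)\<bar> \<le> 1"
      using abs_Im_le_cmod 1 order_trans by blast
    then have "\<bar>of_int c\<bar> * Im z \<le> 1"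
      using z by (simp add: aut_factor_def cd[symmetric] abs_mult)
    then have "\<bar>of_int c\<bar> \<le> 1 / Im z"
      using z by (simp add: field_simps)
    then have c: "\<bar>c\<bar> \<le> B"
      unfolding B_def by linarith
    have "\<bar>of_int d\<bar> = cmod (of_int d :: complex)"
      by simp
    also have "\<dots> = cmod (aut_factor \<gamma> z - of_int c * z)"
      by (simp add: aut_factor_def cd[symmetric])
    also have "\<dots> \<le> 1 + \<bar>of_int c\<bar> * cmod z"
      using norm_triangle_ineq4[of "aut_factor \<gamma> z" "of_int c * z"] 1 by (simp add: norm_mult)
    also have "\<dots> \<le> 1 + of_int B * cmod z"
      using c by (intro add_left_mono mult_right_mono) simp_all
    finally have "\<bar>d\<bar> \<le> C"
      unfolding C_def by linarith
    then show "t \<in> {-B..B} \<times> {-C..C}"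
      using c by (auto simp: t cd[symmetric])
  qed
  then have fin: "finite P"
    by (rule finite_subset) auto
  have "(0, 1) \<in> P"
    unfolding P_def by (auto intro!: exI[of _ "mat 1"] simp: aut_factor_def)
  then have "P \<noteq> {}"
    by blast
  define m where "m t = cmod (of_int (fst t) * z + of_int (snd t))" for t :: "int \<times> int"
  obtain t where t: "t \<in> P" "\<And>s. s \<in> P \<Longrightarrow> m t \<le> m s"
    using arg_min_if_finite[OF fin \<open>P \<noteq> {}\<close>, of m] not_le by blast
  then obtain \<gamma> where \<gamma>: "\<gamma> \<in> SL2Z" "cmod (aut_factor \<gamma> z) \<le> 1" "t = (\<gamma> $ 2 $ 1, \<gamma> $ 2 $ 2)"
    by (auto simp: P_def)
  have min: "cmod (aut_factor \<gamma> z) \<le> cmod (aut_factor \<delta> z)" if "\<delta> \<in> SL2Z" for \<delta>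
  proof (cases "cmod (aut_factor \<delta> z) \<le> 1")
    case True
    then have "(\<delta> $ 2 $ 1, \<delta> $ 2 $ 2) \<in> P"
      using that by (auto simp: P_def)
    then show ?thesis
      using t(2) \<gamma>(3) by (force simp: m_def aut_factor_def)
  qed (use \<gamma>(2) in auto)
  define n where "n = - round (Re (mat_act \<gamma> z))"
  define \<gamma>' where "\<gamma>' = transl n ** \<gamma>"
  have \<gamma>': "\<gamma>' \<in> SL2Z"
    using \<gamma> by (simp add: \<gamma>'_def SL2Z_mult)
  have act': "mat_act \<gamma>' z = mat_act \<gamma> z + of_int n"
    using z \<gamma> by (simp add: \<gamma>'_def mat_act_mult)
  have aut': "aut_factor \<gamma>' z = aut_factor \<gamma> z"
    using z \<gamma> by (simp add: \<gamma>'_def aut_factor_mult)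
  have "\<bar>Re (mat_act \<gamma>' z)\<bar> \<le> 1/2"
    using of_int_round_abs_le[of "Re (mat_act \<gamma> z)"] unfolding act' n_def
    by (simp add: abs_minus_commute)
  moreover have "cmod (mat_act \<gamma>' z) \<ge> 1"
  proof -
    define S where "S = mat2 0 (- 1) 1 0"
    have S: "S ** \<gamma>' \<in> SL2Z"
      using \<gamma>' by (intro SL2Z_mult) (simp_all add: S_def SL2Z_det det_mat2)
    have "aut_factor (S ** \<gamma>') z = mat_act \<gamma>' z * aut_factor \<gamma>' z"
      using z \<gamma>' by (simp add: aut_factor_mult) (simp add: S_def aut_factor_def)
    then have "cmod (aut_factor \<gamma>' z) \<le> cmod (mat_act \<gamma>' z) * cmod (aut_factor \<gamma>' z)"
      using min[OF S] aut' by (simp add: norm_mult)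
    moreover have "cmod (aut_factor \<gamma>' z) > 0"
      using aut_factor_nonzero[of \<gamma>' z] \<gamma>' z by simp
    ultimately show ?thesis
      by simp
  qed
  ultimately show ?thesis
    using that \<gamma>' by blast
qed

lemma fund_domain_Im:
  assumes "\<bar>Re z\<bar> \<le> 1/2" "cmod z \<ge> 1" "Im z > 0"
  shows "(Im z)\<^sup>2 \<ge> 3/4"
proof -
  have "1 \<le> (Re z)\<^sup>2 + (Im z)\<^sup>2"
    using assms(2) by (metis cmod_power2 one_le_power power_one)
  moreover have "(Re z)\<^sup>2 \<le> (1/2)\<^sup>2"
    using assms(1) by (metis abs_le_square_iff abs_of_nonneg half_nonnegative_int_iff zero_le_divide_1_iff zero_le_numeral)
  ultimately show ?thesis
    by (simp add: power_divide)
qed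

text \<open>
  For a form \<open>F\<close> of level 1 and weight \<open>k\<close>, the function \<open>\<bar>F(z)\<bar> y\<^bsup>k/2\<^esup>\<close> is \<open>SL\<^sub>2(\<int>)\<close>-invariant.
  It attains its supremum if it tends to 0 at the cusp.
\<close>

definition pet_abs :: "int \<Rightarrow> (complex \<Rightarrow> complex) \<Rightarrow> complex \<Rightarrow> real" where
  "pet_abs k F z = cmod (F z) * Im z powr (of_int k / 2)"

lemma pet_abs_invariant:
  assumes inv: "slash k F \<gamma> z = F z" and \<gamma>: "\<gamma> \<in> SL2Z" and z: "Im z > 0"
  shows "pet_abs k F (mat_act \<gamma> z) = pet_abs k F z"
proof -
  define A where "A = cmod (aut_factor \<gamma> z)"
  have A: "A > 0"
    using aut_factor_nonzero[of \<gamma> z] \<gamma> z by (simp add: A_def)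
  have F: "cmod (F z) = A powi (- k) * cmod (F (mat_act \<gamma> z))"
    using inv [symmetric] by (simp add: slash_def norm_mult norm_power_int A_def)
  have "Im (mat_act \<gamma> z) = Im z / A\<^sup>2"
    using \<gamma> z by (simp add: Im_mat_act A_def SL2Z_det)
  moreover have "(Im z / A\<^sup>2) powr (of_int k / 2) = Im z powr (of_int k / 2) * A powi (- k)"
  proof -
    have "(A\<^sup>2) powr (of_int k / 2) = (A powr 2) powr (of_int k / 2)"
      using A by (simp add: powr_numeral)
    also have "\<dots> = A powr of_int k"
      by (simp only: powr_powr) simp
    also have "\<dots> = A powi k"
      by (rule powr_real_of_int') (use A in simp_all)
    finally have "(A\<^sup>2) powr (of_int k / 2) = A powi k" .
    moreover have "(Im z / A\<^sup>2) powr (of_int k / 2) = Im z powr (of_int k / 2) / (A\<^sup>2) powr (of_int k / 2)"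
      by (rule powr_divide)
    ultimately show ?thesis
      by (simp only: power_int_minus divide_inverse)
  qed
  ultimately show ?thesis
    by (simp add: pet_abs_def F mult_ac)
qed

lemma MF1_slash: "F \<in> MF k 1 \<Longrightarrow> \<gamma> \<in> SL2Z \<Longrightarrow> Im z > 0 \<Longrightarrow> slash k F \<gamma> z = F z"
  using MF_inv[of F k 1] by (simp add: Gam_1 del: One_nat_def)

lemma norm_qq_1:
  "cmod (qq 1 z) = exp (- 2 * pi * Im z)" "cmod (qq (Suc 0) z) = exp (- 2 * pi * Im z)"
  by (simp_all add: norm_qq)

text \<open>For k < 0 the power of Im z decays while F stays bounded; otherwise F has a factor q,
  which beats any power of Im z.\<close>

lemma pet_abs_decay:
  assumes F: "qexp 1 F c" and c: "k < 0 \<or> fps_nth c 0 = 0" and e: "e > 0"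
  obtains Y where "\<And>z. Im z \<ge> Y \<Longrightarrow> pet_abs k F z < e"
proof -
  have rad: "fps_conv_radius c > 0"
    using qexp_radius[OF F, of 0] by (simp add: zero_ereal_def)
  obtain u where u: "((\<lambda>z. u z * Im z powr (of_int k / 2)) \<longlongrightarrow> 0) (filtercomap Im at_top)"
    and Fu: "\<forall>\<^sub>F z in filtercomap Im at_top. cmod (F z) \<le> u z"
  proof (cases "k < 0")
    case True
    have "\<forall>\<^sub>F z in filtercomap Im at_top. dist (F z) (fps_nth c 0) < 1"
      by (rule tendstoD[OF qexp_tendsto[OF F]]) simp_all
    then have "\<forall>\<^sub>F z in filtercomap Im at_top. cmod (F z) \<le> cmod (fps_nth c 0) + 1"
    proof (rule eventually_mono)
      fix z assume "dist (F z) (fps_nth c 0) < 1"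
      then show "cmod (F z) \<le> cmod (fps_nth c 0) + 1"
        using norm_triangle_sub[of "F z" "fps_nth c 0"] by (simp add: dist_norm)
    qed
    moreover have "((\<lambda>y. (cmod (fps_nth c 0) + 1) * y powr (of_int k / 2)) \<longlongrightarrow> (cmod (fps_nth c 0) + 1) * 0) at_top"
      using True by (intro tendsto_mult tendsto_const tendsto_neg_powr filterlim_ident) simp
    then have "((\<lambda>z. (cmod (fps_nth c 0) + 1) * Im z powr (of_int k / 2)) \<longlongrightarrow> 0) (filtercomap Im at_top)"
      by (intro filterlim_compose[OF _ filterlim_filtercomap]) simp
    ultimately show ?thesis
      using that[of "\<lambda>z. cmod (fps_nth c 0) + 1"] by blast
  next
    case False
    then have c0: "fps_nth c 0 = 0"
      using c by blast
    have "c = fps_X * fps_shift 1 c"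
      using c0 by (intro fps_ext) (simp add: fps_X_mult_nth)
    then have ev: "eval_fps c w = w * eval_fps (fps_shift 1 c) w" if "ereal (cmod w) < fps_conv_radius c" for w
      using that by (metis eval_fps_mult eval_fps_X fps_conv_radius_fps_X fps_conv_radius_shift less_ereal.simps(4))
    define B where "B = cmod (eval_fps (fps_shift 1 c) 0) + 1"
    have "((\<lambda>z. eval_fps (fps_shift 1 c) (qq 1 z)) \<longlongrightarrow> eval_fps (fps_shift 1 c) 0) (filtercomap Im at_top)"
      using isCont_tendsto_compose[OF isCont_eval_fps_0 tendsto_qq] rad by simp
    from tendstoD[OF this, of 1]
    have 1: "\<forall>\<^sub>F z in filtercomap Im at_top. dist (eval_fps (fps_shift 1 c) (qq 1 z)) (eval_fps (fps_shift 1 c) 0) < 1"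
      by simp
    have "\<forall>\<^sub>F z in filtercomap Im at_top. cmod (F z) \<le> B * exp (- 2 * pi * Im z)"
      using 1 eventually_uhp
    proof eventually_elim
      case (elim z)
      then have z: "Im z > 0"
        by simp
      have "cmod (eval_fps (fps_shift 1 c) (qq 1 z)) \<le> B"
        using elim(1) norm_triangle_sub[of "eval_fps (fps_shift 1 c) (qq 1 z)" "eval_fps (fps_shift 1 c) 0"]
        by (simp add: dist_norm B_def)
      then show ?case
        using ev[OF qexp_radius_qq[OF F _ z]] qexp_eval[OF F z]
        by (simp add: norm_mult norm_qq_1 del: One_nat_def)
    qed
    moreover have "((\<lambda>y. B * exp (- 2 * pi * y) * y powr (of_int k / 2)) \<longlongrightarrow> 0) at_top"
      by real_asymp
    then have "((\<lambda>z. B * exp (- 2 * pi * Im z) * Im z powr (of_int k / 2)) \<longlongrightarrow> 0) (filtercomap Im at_top)"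
      by (rule filterlim_compose[OF _ filterlim_filtercomap])
    ultimately show ?thesis
      using that[of "\<lambda>z. B * exp (- 2 * pi * Im z)"] by simp
  qed
  have "\<forall>\<^sub>F z in filtercomap Im at_top. dist (u z * Im z powr (of_int k / 2)) 0 < e"
    by (rule tendstoD[OF u e])
  with Fu have "\<forall>\<^sub>F z in filtercomap Im at_top. pet_abs k F z < e"
  proof eventually_elim
    case (elim z)
    have "pet_abs k F z \<le> u z * Im z powr (of_int k / 2)"
      unfolding pet_abs_def by (intro mult_right_mono elim) simp
    also have "\<dots> < e"
      using elim(2) by (simp add: dist_norm)
    finally show ?case .
  qed
  then show ?thesis
    using that unfolding eventually_Im_at_top by blast
qed

lemma pet_abs_max:
  assumes F: "F \<in> MF k 1" and qF: "qexp 1 F c" and c: "k < 0 \<or> fps_nth c 0 = 0"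
    and nz: "Im z0 > 0" "F z0 \<noteq> 0"
  obtains z1 where "Im z1 > 0" "(Im z1)\<^sup>2 \<ge> 3/4" "F z1 \<noteq> 0"
    "\<And>z. Im z > 0 \<Longrightarrow> pet_abs k F z \<le> pet_abs k F z1"
proof -
  have red: "\<exists>w. \<bar>Re w\<bar> \<le> 1/2 \<and> cmod w \<ge> 1 \<and> Im w > 0 \<and> pet_abs k F w = pet_abs k F z"
    if z: "Im z > 0" for z
  proof -
    obtain \<gamma> where \<gamma>: "\<gamma> \<in> SL2Z" "\<bar>Re (mat_act \<gamma> z)\<bar> \<le> 1/2" "cmod (mat_act \<gamma> z) \<ge> 1"
      using fund_domain_reduction[OF z] .
    then show ?thesis
      using pet_abs_invariant[OF MF1_slash[OF F \<gamma>(1) z] \<gamma>(1) z] mat_act_uhp[of \<gamma> z] z by auto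
  qed
  define e where "e = pet_abs k F z0"
  have e: "e > 0"
    using nz by (simp add: e_def pet_abs_def)
  obtain Y where Y: "\<And>z. Im z \<ge> Y \<Longrightarrow> pet_abs k F z < e"
    using pet_abs_decay[OF qF c e] by blast
  \<comment> \<open>The fundamental domain cut off at the height Y, beyond which
    \<open>pet_abs\<close> is below e. The bound 1/2 is a rational number below sqrt 3 / 2; it keeps
    K inside the half plane.\<close>
  define K where "K = {z. - (1/2) \<le> Re z} \<inter> {z. Re z \<le> 1/2} \<inter> {z. cmod z \<ge> 1} \<inter> {z. Im z \<ge> 1/2} \<inter> {z. Im z \<le> Y}"
  have "closed K"
    unfolding K_def by (intro closed_Int closed_Collect_le continuous_intros)
  moreover have "bounded K"
  proof (rule boundedI)
    fix z assume "z \<in> K"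
    then show "cmod z \<le> 1/2 + \<bar>Y\<bar>"
      using cmod_le[of z] unfolding K_def by auto
  qed
  ultimately have K: "compact K"
    using compact_eq_bounded_closed by blast
  have inK: "w \<in> K" if "\<bar>Re w\<bar> \<le> 1/2" "cmod w \<ge> 1" "Im w > 0" "pet_abs k F w \<ge> e" for w
  proof -
    have "Im w < Y"
      using Y[of w] that(4) by force
    moreover have "Im w \<ge> 1/2"
    proof (rule ccontr)
      assume "\<not> ?thesis"
      then have "(Im w)\<^sup>2 < (1/2)\<^sup>2"
        using that(3) by (intro power_strict_mono) auto
      then show False
        using fund_domain_Im[OF that(1,2,3)] by (simp add: power_divide)
    qed
    ultimately show ?thesis
      using that by (auto simp: K_def)
  qed
  obtain w0 where w0: "w0 \<in> K" "pet_abs k F w0 = e"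
    using red[OF nz(1)] inK unfolding e_def by force
  have "continuous_on uhp F"
    by (intro holomorphic_on_imp_continuous_on qexp_holomorphic[OF qF]) simp
  then have "continuous_on K F"
    by (rule continuous_on_subset) (auto simp: K_def)
  then have "continuous_on K (pet_abs k F)"
    unfolding pet_abs_def[abs_def] by (intro continuous_intros) (auto simp: K_def)
  then obtain z1 where z1: "z1 \<in> K" "\<And>w. w \<in> K \<Longrightarrow> pet_abs k F w \<le> pet_abs k F z1"
    using continuous_attains_sup[OF K, of "pet_abs k F"] w0 by blast
  have ge: "pet_abs k F z1 \<ge> e"
    using z1(2)[OF w0(1)] w0(2) by simp
  have "pet_abs k F z \<le> pet_abs k F z1" if z: "Im z > 0" for z
  proof -
    obtain w where w: "\<bar>Re w\<bar> \<le> 1/2" "cmod w \<ge> 1" "Im w > 0" "pet_abs k F w = pet_abs k F z"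
      using red[OF z] by blast
    show ?thesis
    proof (cases "pet_abs k F w \<ge> e")
      case True
      then show ?thesis
        using z1(2)[OF inK[OF w(1-3)]] w(4) by simp
    next
      case False
      then show ?thesis
        using ge w(4) by simp
    qed
  qed
  moreover have "F z1 \<noteq> 0"
    using ge e by (auto simp: pet_abs_def)
  moreover have "Im z1 > 0" "\<bar>Re z1\<bar> \<le> 1/2" "cmod z1 \<ge> 1"
    using z1(1) by (auto simp: K_def)
  ultimately show ?thesis
    using that fund_domain_Im[of z1] by blast
qed

text \<open>For k <= 0 the power y^(k/2) does not increase with y. So if |F| y^(k/2) is maximal at
  z1, then |F| is at most |F z1| at all points not higher than z1, that is, for |q| >= |q1|; the
  maximum principle extends this to |q| < |q1|. Hence F is constant, which both alternatives of the
  hypothesis exclude.\<close>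

lemma MF1_weight_nonpos_eq_0:
  assumes F: "F \<in> MF k 1" and qF: "qexp 1 F c" and k: "k \<le> 0" and c: "k < 0 \<or> fps_nth c 0 = 0"
    and z: "Im z > 0"
  shows "F z = 0"
proof (rule ccontr)
  assume "F z \<noteq> 0"
  then obtain z1 where z1: "Im z1 > 0" "F z1 \<noteq> 0" "\<And>z. Im z > 0 \<Longrightarrow> pet_abs k F z \<le> pet_abs k F z1"
    using pet_abs_max[OF F qF c z] by metis
  define q1 where "q1 = qq 1 z1"
  have q1: "cmod q1 < 1" "q1 \<noteq> 0"
    using norm_qq_less_1[of 1 z1] z1 by (auto simp: q1_def)
  have hol: "eval_fps c holomorphic_on ball 0 1"
    by (rule qexp_holomorphic_disc[OF qF])
  have outer: "cmod (eval_fps c w) \<le> cmod (eval_fps c q1)" if w: "cmod w < 1" "cmod w \<ge> cmod q1" for w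
  proof -
    have "w \<noteq> 0"
      using w q1 by auto
    then obtain z where z: "Im z > 0" "qq 1 z = w"
      using qq_surjE[of 1 w] w by auto
    have y: "Im z \<le> Im z1"
      using w(2) z(2) norm_qq_1[of z] norm_qq_1[of z1] by (simp add: q1_def)
    have "Im z1 powr (of_int k / 2) \<le> Im z powr (of_int k / 2)"
      using y k z z1 by (intro powr_mono2') auto
    then have "cmod (F z) * Im z1 powr (of_int k / 2) \<le> pet_abs k F z"
      unfolding pet_abs_def by (intro mult_left_mono) auto
    also have "\<dots> \<le> cmod (F z1) * Im z1 powr (of_int k / 2)"
      using z1(3)[OF z(1)] by (simp add: pet_abs_def)
    finally have "cmod (F z) \<le> cmod (F z1)"
      using z1(1) by simp
    then show ?thesis
      using qexp_eval[OF qF z(1)] qexp_eval[OF qF z1(1)] z(2) by (simp add: q1_def)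
  qed
  have all: "cmod (eval_fps c w) \<le> cmod (eval_fps c q1)" if w: "w \<in> ball 0 1" for w
  proof (cases "cmod w \<ge> cmod q1")
    case False
    show ?thesis
    proof (rule maximum_modulus_frontier[of "eval_fps c" "ball 0 (cmod q1)"])
      show "eval_fps c holomorphic_on interior (ball 0 (cmod q1))"
        by (rule holomorphic_on_subset[OF hol]) (use q1 in auto)
      show "continuous_on (closure (ball 0 (cmod q1))) (eval_fps c)"
        by (rule continuous_on_subset[OF holomorphic_on_imp_continuous_on[OF hol]]) (use q1 in auto)
      show "cmod (eval_fps c w) \<le> cmod (eval_fps c q1)" if "w \<in> frontier (ball 0 (cmod q1))" for w
        using that q1 by (intro outer) (auto simp: frontier_ball)
    qed (use False in auto)
  qed (use outer w in auto)
  have "eval_fps c constant_on ball 0 1"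
    by (rule maximum_modulus_principle[OF hol, of "ball 0 1" q1]) (use q1 all in auto)
  then obtain a where a: "\<And>w. cmod w < 1 \<Longrightarrow> eval_fps c w = a"
    by (auto simp: constant_on_def)
  then have Fa: "F z = a" if "Im z > 0" for z
    using qexp_eval[OF qF that] norm_qq_less_1[of 1 z] that by simp
  show False
    using c
  proof
    assume "fps_nth c 0 = 0"
    then show False
      using a[of 0] Fa[OF z1(1)] z1(2) by (simp add: eval_fps_at_0)
  next
    assume k: "k < 0"
    \<comment> \<open>For a nonzero constant and k < 0, going down from z1 would increase
      \<open>pet_abs\<close>.\<close>
    define z2 where "z2 = Complex 0 (Im z1 / 2)"
    have "pet_abs k F z2 \<le> pet_abs k F z1"
      by (rule z1(3)) (simp add: z2_def z1)
    then have "(Im z1 / 2) powr (of_int k / 2) \<le> Im z1 powr (of_int k / 2)"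
      using Fa[of z2] Fa[OF z1(1)] z1(1,2) by (simp add: pet_abs_def z2_def)
    moreover have "Im z1 powr (of_int k / 2) < (Im z1 / 2) powr (of_int k / 2)"
      using k z1(1) by (intro powr_less_mono2_neg) auto
    ultimately show False
      by simp
  qed
qed

lemma MF_norm:
  assumes F: "F \<in> MF k N" and N: "N > 0"
  shows "(\<lambda>z. \<Prod>\<rho>\<in>mreps N. slash k F \<rho> z) \<in> MF (int (card (mreps N)) * k) 1"
    (is "?P \<in> MF ?k 1")
proof -
  have P: "?P \<in> MF ?k N"
    using MF_slash[OF F mreps_SL2Z] N by (intro MF_prod) auto
  have inv: "slash ?k ?P \<gamma> z = ?P z" if \<gamma>: "\<gamma> \<in> SL2Z" and z: "Im z > 0" for \<gamma> z
  proof -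
    have gen: "slash (int (card I) * k) (\<lambda>z. \<Prod>\<rho>\<in>I. slash k F \<rho> z) \<gamma> z = (\<Prod>\<rho>\<in>I. slash k (slash k F \<rho>) \<gamma> z)"
      if "finite I" for I
      using that
    proof (induction I rule: finite_induct)
      case (insert \<rho> I)
      have "int (card (insert \<rho> I)) * k = k + int (card I) * k"
        using insert.hyps by (simp add: algebra_simps)
      then show ?case
        using slash_prod2[of \<gamma> z k "int (card I) * k" "slash k F \<rho>" "\<lambda>z. \<Prod>\<rho>\<in>I. slash k F \<rho> z"] \<gamma> z insert
        by simp
    qed (simp add: slash_const_0)
    have "slash ?k ?P \<gamma> z = (\<Prod>\<rho>\<in>mreps N. slash k (slash k F \<rho>) \<gamma> z)"
      by (rule gen[OF finite_mreps[OF N]])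
    also have "\<dots> = (\<Prod>\<rho>\<in>mreps N. slash k F (\<rho> ** \<gamma>) z)"
      using \<gamma> z by (simp add: slash_mult)
    also have "\<dots> = ?P z"
      by (rule prod_mreps[OF N \<gamma>, of "\<lambda>\<rho>. slash k F \<rho> z"]) (intro MF_congm[OF F] z)
    finally show ?thesis .
  qed
  show ?thesis
  proof (rule MF_I)
    show "?P holomorphic_on uhp"
      using MF_holomorphic[OF P N] .
    show "\<exists>B Y. \<forall>z. Im z \<ge> Y \<longrightarrow> cmod (slash ?k ?P \<gamma> z) \<le> B" if "\<gamma> \<in> SL2Z" for \<gamma>
      by (rule MF_slash_lim[OF P N that])
  qed (use inv in \<open>auto simp: Gam_SL2Z\<close>)
qed

text \<open>The norm to level 1 has weight <= 0 and vanishes at oo because its factor for the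
  identity coset does; nothing is asked of the other cusps. So the norm is 0, and since power series
  form an integral domain, one of the slashes of F is 0.\<close>

lemma MF_weight_nonpos_eq_0:
  assumes F: "F \<in> MF k N" and N: "N > 0" and k: "k \<le> 0"
    and qF: "qexp N F c" and c0: "fps_nth c 0 = 0" and z: "Im z > 0"
  shows "F z = 0"
proof -
  define P where "P = (\<lambda>z. \<Prod>\<rho>\<in>mreps N. slash k F \<rho> z)"
  have "\<exists>a. qexp N (slash k F \<rho>) a" if "\<rho> \<in> mreps N" for \<rho>
    using MF_qexpE[OF F mreps_SL2Z[OF that]] by blast
  then obtain a where a: "\<And>\<rho>. \<rho> \<in> mreps N \<Longrightarrow> qexp N (slash k F \<rho>) (a \<rho>)"
    by metis
  have qP: "qexp N P (\<Prod>\<rho>\<in>mreps N. a \<rho>)"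
    unfolding P_def by (intro qexp_prod a N)
  have P: "P \<in> MF (int (card (mreps N)) * k) 1"
    unfolding P_def by (rule MF_norm[OF F N])
  obtain b where b: "qexp 1 P b"
    using MF_qexp1E[OF P] .
  have "a (mat 1) = c"
    using a[OF one_in_mreps] qF qexp_cong[of "slash k F (mat 1)" F N] qexp_unique N slash_1 by blast
  then have "fps_nth (\<Prod>\<rho>\<in>mreps N. a \<rho>) 0 = 0"
    using prod.remove[OF finite_mreps[OF N] one_in_mreps, of a] c0 by simp
  then have "fps_nth b 0 = 0"
    using tendsto_unique[OF filtercomap_Im_at_top_neq_bot qexp_tendsto[OF qP N] qexp_tendsto[OF b]] by simp
  then have "P z = 0" if "Im z > 0" for z
    using MF1_weight_nonpos_eq_0[OF P b _ _ that] k by (simp add: mult_nonneg_nonpos)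
  then have "(\<Prod>\<rho>\<in>mreps N. a \<rho>) = 0"
    using qexp_eq_0_iff[OF qP N] by simp
  then obtain \<rho> where \<rho>: "\<rho> \<in> mreps N" "a \<rho> = 0"
    using finite_mreps[OF N] by auto
  then have zero: "slash k F \<rho> z = 0" if "Im z > 0" for z
    using qexp_eq_0_iff[OF a[OF \<rho>(1)] N] that by simp
  have \<rho>S: "\<rho> \<in> SL2Z"
    using \<rho>(1) by (rule mreps_SL2Z)
  define w where "w = mat_act (minv \<rho>) z"
  have w: "Im w > 0"
    unfolding w_def by (intro mat_act_uhp z SL2Z_det_pos minv_SL2Z \<rho>S)
  have "mat_act \<rho> w = mat_act (\<rho> ** minv \<rho>) z"
    unfolding w_def by (rule mat_act_mult [symmetric]) (use z \<rho>S minv_SL2Z in auto)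
  then have "mat_act \<rho> w = z"
    by (simp add: minv_mult \<rho>S) (simp add: mat_act_def moebius_def)
  then show ?thesis
    using zero[OF w] aut_factor_nonzero[of \<rho> w] w \<rho>S by (simp add: slash_def)
qed

subsection \<open>Cusp forms of weight 12\<close>

text \<open>
  A cusp form \<open>F\<close> of weight 12 with a second zero \<open>q\<^sub>0\<close> (possibly \<open>q\<^sub>0 = 0\<close>) in the region
  \<open>\<bar>q\<bar> \<le> exp (- \<pi> \<surd>3)\<close> contradicts the maximum principle for \<open>F / (q (q - q\<^sub>0))\<close> on
  \<open>\<bar>q\<bar> \<le> exp (- \<pi>)\<close>, since the maximum of \<open>\<bar>F\<bar> y\<^sup>6\<close> is attained in the region as well.
\<close>

lemma exp_power8_ge:
  fixes x :: real
  assumes "x \<ge> 0"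
  shows "(1 + x / 8 + (x / 8)\<^sup>2 / 2) ^ 8 \<le> exp x"
proof -
  have "1 + x / 8 + (x / 8)\<^sup>2 / 2 \<le> exp (x / 8)"
    by (rule exp_lower_Taylor_quadratic) (use assms in simp)
  then have "(1 + x / 8 + (x / 8)\<^sup>2 / 2) ^ 8 \<le> exp (x / 8) ^ 8"
    using assms by (intro power_mono) auto
  also have "\<dots> = exp x"
    by (simp add: exp_of_nat_mult [symmetric])
  finally show ?thesis .
qed

text \<open>Here x is twice the height of the maximum, so that |q1| = exp (- pi x), and s is |q0|.
  The inequality makes the bound at q1 that the maximum principle derives from the circle |q| = exp
  (- pi) strictly smaller than the value at q1.\<close>

lemma weight_12_bound:
  fixes x :: real
  assumes x: "x > 0" "x\<^sup>2 \<ge> 3" and s: "s \<ge> 0" "s \<le> exp (- pi * sqrt 3)"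
  shows "exp (- pi * x) * (exp (- pi * x) + s) * x ^ 6 < exp (- pi) * (exp (- pi) - s)"
proof -
  define r where "r = exp (- pi)"
  define \<epsilon> where "\<epsilon> = exp (- pi * (sqrt 3 - 1))"
  define A where "A = exp (- pi * x)"
  have r: "r > 0" and \<epsilon>: "\<epsilon> > 0" and A: "A > 0"
    by (simp_all add: r_def \<epsilon>_def A_def)
  have sqrt3: "sqrt 3 \<ge> 1.732"
    by (rule real_le_rsqrt) (simp add: power2_eq_square)
  have r\<epsilon>: "exp (- pi * sqrt 3) = r * \<epsilon>"
    unfolding r_def \<epsilon>_def by (simp add: exp_add [symmetric] algebra_simps)
  have "x \<ge> sqrt 3"
    using x by (intro real_le_lsqrt) auto
  then have As: "A \<le> r * \<epsilon>"
    unfolding A_def r\<epsilon> [symmetric] by simp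
  \<comment> \<open>The function x^6 exp (- pi x) is largest at x = 6 / pi; this is t <= exp (t - 1)
    with t = pi x / 6. The maximum is then compared with exp (- pi) by writing pi = 3 + (pi -
    3).\<close>
  have A6: "A * x ^ 6 \<le> 64 / 19 * r"
  proof -
    have u: "exp 1 * (pi * x / 6) \<le> exp (pi * x / 6)"
    proof -
      have "pi * x / 6 \<le> exp (pi * x / 6 - 1)"
        using exp_ge_add_one_self[of "pi * x / 6 - 1"] by simp
      then have "exp 1 * (pi * x / 6) \<le> exp 1 * exp (pi * x / 6 - 1)"
        by simp
      also have "\<dots> = exp (pi * x / 6)"
        by (simp only: exp_add [symmetric]) simp
      finally show ?thesis .
    qed
    have "(exp 1 * (pi * x / 6)) ^ 6 \<le> exp (pi * x / 6) ^ 6"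
      using x by (intro power_mono u) auto
    also have "exp (pi * x / 6) ^ 6 = exp (pi * x)"
      by (simp add: exp_of_nat_mult [symmetric])
    finally have 1: "exp 6 * (pi / 6) ^ 6 * x ^ 6 \<le> exp (pi * x)"
      by (simp add: power_mult_distrib power_divide exp_of_nat_mult [symmetric] field_simps)
    have pi: "exp (pi - 3) \<le> (pi / 3) ^ 6"
    proof -
      have b: "0 \<le> pi - 3" "pi - 3 \<le> 1"
        using pi_gt3 pi_less_4 by auto
      have "exp (pi - 3) \<le> 1 + (pi - 3) + (pi - 3)\<^sup>2"
        by (rule exp_bound) (use b in auto)
      also have "(pi - 3)\<^sup>2 \<le> pi - 3"
        using b by (simp add: power2_eq_square mult_left_le)
      also have "1 + (pi - 3) + (pi - 3) = 1 + of_nat 6 * ((pi - 3) / 3)"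
        by (simp add: diff_divide_distrib algebra_simps)
      also have "\<dots> \<le> (1 + (pi - 3) / 3) ^ 6"
        by (rule Bernoulli_inequality) (use b in simp)
      also have "1 + (pi - 3) / 3 = pi / 3"
        by (simp add: diff_divide_distrib)
      finally show ?thesis by simp
    qed
    have e3: "exp (3::real) \<ge> 19"
      using exp_power8_ge[of 3] by (simp add: power2_eq_square) (simp add: eval_nat_numeral)?
    have "19 * exp pi \<le> exp 3 * exp pi"
      using e3 by simp
    also have "\<dots> = exp 6 * exp (pi - 3)"
      by (simp add: exp_add [symmetric])
    also have "\<dots> \<le> exp 6 * (pi / 3) ^ 6"
      using pi by simp
    also have "\<dots> = 64 * (exp 6 * (pi / 6) ^ 6)"
      by (simp add: power_divide)
    finally have 2: "19 * exp pi * x ^ 6 \<le> 64 * (exp 6 * (pi / 6) ^ 6) * x ^ 6"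
      using x by (intro mult_right_mono) auto
    have "19 * exp pi * x ^ 6 \<le> 64 * exp (pi * x)"
      using 1 2 by linarith
    then show ?thesis
      unfolding A_def r_def by (simp add: exp_minus field_simps)
  qed
  \<comment> \<open>At the end \<epsilon> must be below 1 / (1 + 128/19), about 1 / 7.74. The
    exponent 2.196 is 3 * 0.732, from pi > 3 and sqrt 3 >= 1.732.\<close>
  have \<epsilon>8: "\<epsilon> \<le> 1 / 8.5"
  proof -
    have "2.196 \<le> pi * (sqrt 3 - 1)"
    proof -
      have "3 * 0.732 \<le> pi * (sqrt 3 - 1)"
        using pi_gt3 sqrt3 by (intro mult_mono) auto
      then show ?thesis by simp
    qed
    then have "exp 2.196 \<le> exp (pi * (sqrt 3 - 1))"
      by simp
    moreover have "8.5 \<le> exp (2.196 :: real)"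
      using exp_power8_ge[of "2.196"] by (simp add: power2_eq_square) (simp add: eval_nat_numeral)?
    ultimately have "8.5 \<le> exp (pi * (sqrt 3 - 1))"
      by linarith
    then have "inverse (exp (pi * (sqrt 3 - 1))) \<le> inverse 8.5"
      by (intro le_imp_inverse_le) auto
    then show ?thesis
      unfolding \<epsilon>_def by (simp only: mult_minus_left exp_minus inverse_eq_divide)
  qed
  have "A * (A + s) * x ^ 6 = (A * x ^ 6) * (A + s)"
    by simp
  also have "\<dots> \<le> (64 / 19 * r) * (r * \<epsilon> + r * \<epsilon>)"
    by (rule mult_mono[OF A6 add_mono[OF As s(2)[unfolded r\<epsilon>]]]) (use r A s in auto)
  also have "\<dots> < r * (r - r * \<epsilon>)"
  proof -
    have "64 / 19 * (\<epsilon> + \<epsilon>) < 1 - \<epsilon>"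
      using \<epsilon>8 by simp
    then have "r * r * (64 / 19 * (\<epsilon> + \<epsilon>)) < r * r * (1 - \<epsilon>)"
      using r by (intro mult_strict_left_mono) auto
    then show ?thesis
      by (simp add: algebra_simps)
  qed
  also have "\<dots> \<le> r * (r - s)"
    using s r r\<epsilon> by (intro mult_left_mono) auto
  finally show ?thesis
    unfolding A_def r_def .
qed

lemma holomorphic_divide_linear:
  assumes f: "f holomorphic_on ball 0 1" and a: "a \<in> ball 0 1" "f a = 0"
  obtains g where "g holomorphic_on ball 0 (1::real)" "\<And>w. w \<in> ball 0 1 \<Longrightarrow> f w = (w - a) * g w"
proof
  define g where "g w = (if w = a then deriv f a else (f w - f a) / (w - a))" for w
  show "g holomorphic_on ball 0 1"
    unfolding g_def[abs_def] by (rule pole_lemma[OF f]) (use a in simp)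
  show "f w = (w - a) * g w" if "w \<in> ball 0 1" for w
    using a by (simp add: g_def)
qed

lemma weight_12_double_zero:
  assumes F: "F \<in> MF 12 1" and qF: "qexp 1 F c" and c0: "fps_nth c 0 = 0"
    and nz: "Im z0 > 0" "F z0 \<noteq> 0"
    and q0: "cmod q0 \<le> exp (- pi * sqrt 3)"
    and \<psi>: "\<psi> holomorphic_on ball 0 1" "\<And>w. w \<in> ball 0 1 \<Longrightarrow> eval_fps c w = w * (w - q0) * \<psi> w"
  shows False
proof -
  obtain z1 where z1: "Im z1 > 0" "(Im z1)\<^sup>2 \<ge> 3/4" "F z1 \<noteq> 0"
    "\<And>z. Im z > 0 \<Longrightarrow> pet_abs 12 F z \<le> pet_abs 12 F z1"
    using pet_abs_max[OF F qF _ nz] c0 by metis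
  have pet: "pet_abs 12 F z = cmod (F z) * Im z ^ 6" if "Im z > 0" for z
    using that by (simp add: pet_abs_def powr_numeral)
  \<comment> \<open>With this x, |q1| = exp (- pi x). On the circle |q| = exp (- pi) the height is
    1/2, so comparing \<open>pet_abs\<close> there with its maximum costs the factor (2 Im z1)^6 =
    x^6.\<close>
  define x where "x = 2 * Im z1"
  have x: "x > 0" "x\<^sup>2 \<ge> 3"
    using z1 by (simp_all add: x_def power_mult_distrib)
  define r where "r = exp (- pi)"
  define q1 where "q1 = qq 1 z1"
  have q1: "cmod q1 = exp (- pi * x)" "q1 \<noteq> 0"
    by (simp_all add: q1_def norm_qq_1 x_def)
  have "1 < sqrt 3"
    by simp
  then have s_r: "exp (- pi * sqrt 3) < r"
    unfolding r_def by simp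
  have "1 < x"
  proof (rule ccontr)
    assume "\<not> 1 < x"
    then have "x\<^sup>2 \<le> 1"
      using x(1) by (simp add: power_le_one)
    then show False
      using x by simp
  qed
  then have q1r: "cmod q1 < r"
    unfolding q1 r_def by simp
  have r0: "r > 0" and r1: "r < 1"
    by (simp_all add: r_def)
  have q0r: "cmod q0 < r"
    using q0 s_r by simp
  define B where "B = cmod (F z1) * x ^ 6 / (r * (r - cmod q0))"
  have "cmod (\<psi> q1) \<le> B"
  proof (rule maximum_modulus_frontier[of \<psi> "ball 0 r"])
    show "\<psi> holomorphic_on interior (ball 0 r)"
      by (rule holomorphic_on_subset[OF \<psi>(1)]) (use r1 in auto)
    show "continuous_on (closure (ball 0 r)) \<psi>"
      by (rule continuous_on_subset[OF holomorphic_on_imp_continuous_on[OF \<psi>(1)]])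
         (use r0 r1 in \<open>auto simp: closure_ball\<close>)
    show "cmod (\<psi> w) \<le> B" if "w \<in> frontier (ball 0 r)" for w
    proof -
      have w: "cmod w = r"
        using that by (simp add: frontier_ball r_def)
      then have "w \<noteq> 0"
        by (auto simp: r_def)
      then obtain z where z: "Im z > 0" "qq 1 z = w"
        using qq_surjE[of 1 w] w r1 by auto
      have Imz: "Im z = 1/2"
        using w z(2) norm_qq_1[of z] by (simp add: r_def)
      have "cmod (F z) * (1/2) ^ 6 \<le> cmod (F z1) * Im z1 ^ 6"
        using z1(4)[OF z(1)] pet[OF z(1)] pet[OF z1(1)] Imz by simp
      then have Fz: "cmod (F z) \<le> cmod (F z1) * x ^ 6"
        by (simp add: x_def power_mult_distrib power_divide)
      have "F z = w * (w - q0) * \<psi> w"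
        using qexp_eval[OF qF z(1)] \<psi>(2)[of w] z(2) w r1 by simp
      then have "r * cmod (w - q0) * cmod (\<psi> w) = cmod (F z)"
        using w by (simp add: norm_mult)
      moreover have "r - cmod q0 \<le> cmod (w - q0)"
        using norm_triangle_ineq2[of w q0] w by simp
      ultimately have "r * (r - cmod q0) * cmod (\<psi> w) \<le> cmod (F z1) * x ^ 6"
        using Fz by (smt (verit, best) exp_gt_zero mult_left_mono mult_right_mono norm_ge_zero r_def)
      then show ?thesis
        unfolding B_def using q0r by (simp add: r_def field_simps)
    qed
  qed (use q1r in auto)
  then have le: "cmod (\<psi> q1) * (r * (r - cmod q0)) \<le> cmod (F z1) * x ^ 6"
    unfolding B_def using q0r by (simp add: r_def field_simps)
  have "F z1 = q1 * (q1 - q0) * \<psi> q1"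
    using qexp_eval[OF qF z1(1)] \<psi>(2)[of q1] q1r r1 by (simp add: q1_def)
  then have F1: "cmod (F z1) = cmod q1 * cmod (q1 - q0) * cmod (\<psi> q1)"
    by (simp add: norm_mult)
  have \<psi>1: "cmod (\<psi> q1) > 0"
    using F1 z1(3) by auto
  have "cmod (\<psi> q1) * (r * (r - cmod q0)) \<le> cmod (\<psi> q1) * (cmod q1 * cmod (q1 - q0) * x ^ 6)"
    using le unfolding F1 by (simp add: mult_ac)
  then have "r * (r - cmod q0) \<le> cmod q1 * cmod (q1 - q0) * x ^ 6"
    using \<psi>1 by simp
  also have "\<dots> \<le> cmod q1 * (cmod q1 + cmod q0) * x ^ 6"
    using norm_triangle_ineq4[of q1 q0] x by (intro mult_right_mono mult_left_mono) auto
  also have "\<dots> < r * (r - cmod q0)"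
    unfolding q1(1) r_def using weight_12_bound[OF x, of "cmod q0"] q0 by simp
  finally show False
    by simp
qed

text \<open>The vanishing constant term is one zero at q = 0. A zero in the half plane can be moved
  to the fundamental domain, where |q| <= exp (- pi sqrt 3), and a vanishing coefficient of q is a
  second zero at q = 0; \<open>weight_12_double_zero\<close> excludes both.\<close>

lemma weight_12_no_zero:
  assumes F: "F \<in> MF 12 1" and qF: "qexp 1 F c" and c0: "fps_nth c 0 = 0"
    and nz: "Im z0 > 0" "F z0 \<noteq> 0"
  shows "fps_nth c 1 \<noteq> 0" and "Im z > 0 \<Longrightarrow> F z \<noteq> 0"
proof -
  have hol: "eval_fps c holomorphic_on ball 0 1"
    by (rule qexp_holomorphic_disc[OF qF])
  obtain g where g: "g holomorphic_on ball 0 1" "\<And>w. w \<in> ball 0 1 \<Longrightarrow> eval_fps c w = w * g w"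
    using holomorphic_divide_linear[OF hol, of 0] c0 by (auto simp: eval_fps_at_0)
  have no: "g q0 \<noteq> 0" if "cmod q0 \<le> exp (- pi * sqrt 3)" for q0
  proof
    assume "g q0 = 0"
    moreover have q0: "q0 \<in> ball 0 1"
      using that by (auto intro: le_less_trans)
    ultimately obtain \<psi> where "\<psi> holomorphic_on ball 0 1" "\<And>w. w \<in> ball 0 1 \<Longrightarrow> g w = (w - q0) * \<psi> w"
      using holomorphic_divide_linear[OF g(1)] by blast
    then show False
      using weight_12_double_zero[OF F qF c0 nz that, of \<psi>] g(2) by (simp add: mult.assoc)
  qed
  show "fps_nth c 1 \<noteq> 0"
  proof
    assume c1: "fps_nth c 1 = 0"
    have rad: "fps_conv_radius c > 0"
      using qexp_radius[OF qF, of 0] by (simp add: zero_ereal_def)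
    have "fps_nth c 1 = deriv (eval_fps c) 0"
      using fps_nth_conv_deriv[OF rad, of 1] by simp
    also have "deriv (eval_fps c) 0 = deriv (\<lambda>w. w * g w) 0"
      by (rule deriv_cong_ev)
         (use g(2) eventually_nhds_in_open[of "ball (0::complex) 1" 0] in \<open>auto elim: eventually_mono\<close>)
    also have "\<dots> = g 0"
    proof -
      have "(g has_field_derivative deriv g 0) (at 0)"
        by (rule holomorphic_derivI[OF g(1)]) auto
      then have "((\<lambda>w. w * g w) has_field_derivative g 0) (at 0)"
        by (auto intro!: derivative_eq_intros)
      then show ?thesis
        by (rule DERIV_imp_deriv)
    qed
    finally show False
      using no[of 0] c1 by simp
  qed
  show "F z \<noteq> 0" if z: "Im z > 0"
  proof
    assume Fz: "F z = 0"
    obtain \<gamma> where \<gamma>: "\<gamma> \<in> SL2Z" "\<bar>Re (mat_act \<gamma> z)\<bar> \<le> 1/2" "cmod (mat_act \<gamma> z) \<ge> 1"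
      using fund_domain_reduction[OF z] .
    define w where "w = mat_act \<gamma> z"
    have w: "Im w > 0" "(Im w)\<^sup>2 \<ge> 3/4"
      using \<gamma> z mat_act_uhp[of \<gamma> z] fund_domain_Im[of w] by (auto simp: w_def)
    have "F w = 0"
      using MF1_slash[OF F \<gamma>(1) z] Fz aut_factor_nonzero[of \<gamma> z] \<gamma>(1) z
      by (simp add: slash_def w_def)
    then have "g (qq 1 w) = 0"
      using qexp_eval[OF qF w(1)] g(2)[of "qq 1 w"] norm_qq_less_1[of 1 w] w(1) by simp
    moreover have "cmod (qq 1 w) \<le> exp (- pi * sqrt 3)"
    proof -
      have "sqrt 3 \<le> 2 * Im w"
        using w by (intro real_le_lsqrt) (auto simp: power_mult_distrib)
      then show ?thesis
        by (simp add: norm_qq_1)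
    qed
    ultimately show False
      using no by blast
  qed
qed

subsection \<open>Lipschitz' formula\<close>

text \<open>
  \<open>eul n / (1 - x)\<^bsup>n+1\<^esup>\<close> is obtained from \<open>x / (1 - x)\<close> by applying \<open>x d/dx\<close> \<open>n\<close> times.
\<close>

fun eul :: "nat \<Rightarrow> complex poly" where
  "eul 0 = [:0, 1:]"
| "eul (Suc n) = [:0, 1:] * (pderiv (eul n) * [:1, -1:] + of_nat (Suc n) * eul n)"

text \<open>The polylogarithm of order -n, equal on the unit disc to the sum of r^n x^r over r >= 1.
  The rational form also makes sense at roots of unity x other than 1, where it will give values of
  Dirichlet series.\<close>

definition fr :: "nat \<Rightarrow> complex \<Rightarrow> complex" where
  "fr n x = poly (eul n) x / (1 - x) ^ Suc n"

lemma poly_of_nat_mult: "poly (of_nat n * p) x = of_nat n * poly p (x :: complex)"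
  by (simp add: of_nat_poly)

lemma fr_deriv:
  assumes "x \<noteq> 1"
  obtains d where "(fr n has_field_derivative d) (at x)" "x * d = fr (Suc n) x"
proof
  define p where "p = eul n"
  define d where "d = (poly (pderiv p) x * (1 - x) + of_nat (Suc n) * poly p x) / (1 - x) ^ Suc (Suc n)"
  have nz: "(1 - x) \<noteq> 0"
    using assms by simp
  have "((\<lambda>x. poly p x / (1 - x) ^ Suc n) has_field_derivative
      (poly (pderiv p) x * (1 - x) ^ Suc n - poly p x * (of_nat (Suc n) * (1 - x) ^ n * (- 1))) /
      ((1 - x) ^ Suc n * (1 - x) ^ Suc n)) (at x)"
    using nz by (auto intro!: derivative_eq_intros simp del: power_Suc of_nat_Suc)
  also have "(poly (pderiv p) x * (1 - x) ^ Suc n - poly p x * (of_nat (Suc n) * (1 - x) ^ n * (- 1))) =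
     (1 - x) ^ n * (poly (pderiv p) x * (1 - x) + of_nat (Suc n) * poly p x)"
    by (simp add: algebra_simps del: of_nat_Suc)
  also have "\<dots> / ((1 - x) ^ Suc n * (1 - x) ^ Suc n) = d"
    using nz by (simp add: d_def divide_simps del: of_nat_Suc) 
  finally show "(fr n has_field_derivative d) (at x)"
    by (simp add: fr_def[abs_def] p_def)
  show "x * d = fr (Suc n) x"
  proof -
    have "poly (eul (Suc n)) x = x * (poly (pderiv p) x * (1 - x) + of_nat (Suc n) * poly p x)"
      unfolding eul.simps p_def by (simp add: poly_of_nat_mult algebra_simps del: of_nat_Suc)
    then show ?thesis
      by (simp add: d_def fr_def del: of_nat_Suc eul.simps)
  qed
qed

text \<open>The index 0 is treated apart because 0 ^ 0 = 1 would contribute a constant term for n =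
  0.\<close>

definition fr_coeff :: "nat \<Rightarrow> nat \<Rightarrow> complex" where
  "fr_coeff n r = (if r = 0 then 0 else of_nat r ^ n)"

lemma fr_power_series:
  "fps_conv_radius (Abs_fps (fr_coeff n)) \<ge> 1 \<and>
   (\<forall>x. cmod x < 1 \<longrightarrow> eval_fps (Abs_fps (fr_coeff n)) x = fr n x)"
proof (induction n)
  case 0
  have s: "(\<lambda>r. fr_coeff 0 r * x ^ r) sums fr 0 x" if x: "cmod x < 1" for x
  proof -
    have x1: "x \<noteq> 1"
      using x by auto
    have "(\<lambda>r. x ^ r) sums (1 / (1 - x))"
      by (rule geometric_sums) (use x in simp)
    then have "(\<lambda>r. x ^ r - (if r = 0 then 1 else 0)) sums (1 / (1 - x) - 1)"
      by (intro sums_diff) (auto intro: sums_single[of 0 "\<lambda>_. 1", simplified])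
    moreover have "(\<lambda>r. x ^ r - (if r = 0 then 1 else 0)) = (\<lambda>r. fr_coeff 0 r * x ^ r)"
      by (auto simp: fr_coeff_def)
    moreover have "1 / (1 - x) - 1 = fr 0 x"
      using x1 by (simp add: fr_def field_simps)
    ultimately show ?thesis
      by simp
  qed
  have "fps_conv_radius (Abs_fps (fr_coeff 0)) \<ge> 1"
    unfolding fps_conv_radius_def
  proof (rule conv_radius_geI_ex')
    fix r :: real assume "0 < r" "ereal r < 1"
    then show "summable (\<lambda>n. fps_nth (Abs_fps (fr_coeff 0)) n * complex_of_real r ^ n)"
      using s[of "of_real r"] by (auto simp: sums_iff)
  qed
  then show ?case
    using s by (auto simp: eval_fps_def sums_iff)
next
  case (Suc n)
  define A where "A = Abs_fps (fr_coeff n)"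
  have A: "fps_conv_radius A \<ge> 1" "\<And>x. cmod x < 1 \<Longrightarrow> eval_fps A x = fr n x"
    using Suc by (auto simp: A_def)
  have eq: "Abs_fps (fr_coeff (Suc n)) = fps_X * fps_deriv A"
    by (rule fps_ext) (auto simp: A_def fps_X_mult_nth fr_coeff_def)
  have rad: "fps_conv_radius (fps_deriv A) \<ge> 1"
    using A(1) fps_conv_radius_deriv order_trans by blast
  have "1 \<le> min (fps_conv_radius fps_X) (fps_conv_radius (fps_deriv A))"
    using rad by simp
  then have "fps_conv_radius (fps_X * fps_deriv A) \<ge> 1"
    using fps_conv_radius_mult order_trans by blast
  moreover have "eval_fps (fps_X * fps_deriv A) x = fr (Suc n) x" if x: "cmod x < 1" for x
  proof -
    have lt: "ereal (cmod x) < fps_conv_radius A" "ereal (cmod x) < fps_conv_radius (fps_deriv A)"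
      using x A(1) rad by (meson ereal_less(3) less_le_trans)+
    have x1: "x \<noteq> 1"
      using x by auto
    obtain d where d: "(fr n has_field_derivative d) (at x)" "x * d = fr (Suc n) x"
      using fr_deriv[OF x1] .
    have "eval_fps (fps_deriv A) x = deriv (eval_fps A) x"
      by (rule eval_fps_deriv[OF lt(1)])
    also have "\<dots> = deriv (fr n) x"
      by (rule deriv_cong_ev)
         (use eventually_nhds_in_open[of "ball (0::complex) 1" x] x A(2) in \<open>auto elim!: eventually_mono\<close>)
    also have "\<dots> = d"
      by (rule DERIV_imp_deriv[OF d(1)])
    finally show ?thesis
      using lt d(2) by (simp add: eval_fps_mult)
  qed
  ultimately show ?case
    unfolding eq by blast
qed

lemma fr_sums: "cmod x < 1 \<Longrightarrow> (\<lambda>r. fr_coeff n r * x ^ r) sums fr n x"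
  and fr_summable_norm: "cmod x < 1 \<Longrightarrow> summable (\<lambda>r. cmod (fr_coeff n r * x ^ r))"
proof -
  assume x: "cmod x < 1"
  then have "ereal (cmod x) < fps_conv_radius (Abs_fps (fr_coeff n))"
    using fr_power_series[of n] by (meson ereal_less(3) less_le_trans)
  from sums_eval_fps[OF this] norm_summable_fps[OF this] show
    "(\<lambda>r. fr_coeff n r * x ^ r) sums fr n x" "summable (\<lambda>r. cmod (fr_coeff n r * x ^ r))"
    using fr_power_series[of n] x by simp_all
qed

lemma fr_has_sum: "cmod x < 1 \<Longrightarrow> ((\<lambda>r. of_nat r ^ n * x ^ r) has_sum fr n x) {1..}"
proof -
  assume x: "cmod x < 1"
  have "((\<lambda>r. fr_coeff n r * x ^ r) has_sum fr n x) UNIV"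
    using norm_summable_imp_has_sum[OF fr_summable_norm fr_sums] x by blast
  also have "?this \<longleftrightarrow> ?thesis"
    by (rule has_sum_cong_neutral) (auto simp: fr_coeff_def)
  finally show ?thesis .
qed

definition Ex :: "complex \<Rightarrow> complex" where
  "Ex w = exp (2 * of_real pi * \<i> * w)"

lemma Ex_eq_1_iff: "Ex w = 1 \<longleftrightarrow> w \<in> \<int>"
proof -
  have "Ex w = qq 1 w"
    by (simp add: Ex_def qq_def)
  then show ?thesis
    using qq_eq_1_iff[of 1 w] by (auto simp: Ints_def)
qed

lemma Ex_add: "Ex (v + w) = Ex v * Ex w"
  by (simp add: Ex_def distrib_left exp_add)

lemma Ex_of_nat_mult: "Ex (of_nat n * w) = Ex w ^ n"
  by (simp add: Ex_def exp_of_nat_mult [symmetric] mult_ac)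

lemma Ex_nonzero [simp]: "Ex w \<noteq> 0"
  by (simp add: Ex_def)

lemma norm_Ex: "cmod (Ex w) = exp (- 2 * pi * Im w)"
  by (simp add: Ex_def)

lemma Ex_deriv: "(Ex has_field_derivative 2 * of_real pi * \<i> * Ex w) (at w)"
  unfolding Ex_def by (auto intro!: derivative_eq_intros)

text \<open>The n-th derivative of \<psi>(w) - \<psi>(1 - w) = - \<pi> cot (\<pi> w), where \<psi>
  is the digamma function.\<close>

definition polyg :: "nat \<Rightarrow> complex \<Rightarrow> complex" where
  "polyg n w = Polygamma n w - (-1) ^ n * Polygamma n (1 - w)"

lemma notin_Ints_nonpos: "w \<notin> \<int> \<Longrightarrow> w \<notin> \<int>\<^sub>\<le>\<^sub>0" "w \<notin> \<int> \<Longrightarrow> 1 - w \<notin> \<int>\<^sub>\<le>\<^sub>0" for w :: complex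
proof -
  assume w: "w \<notin> \<int>"
  then show "w \<notin> \<int>\<^sub>\<le>\<^sub>0"
    using nonpos_Ints_subset_Ints by blast
  show "1 - w \<notin> \<int>\<^sub>\<le>\<^sub>0"
  proof
    assume "1 - w \<in> \<int>\<^sub>\<le>\<^sub>0"
    then have "1 - w \<in> \<int>"
      using nonpos_Ints_subset_Ints by blast
    then have "1 - (1 - w) \<in> \<int>"
      by (intro Ints_diff) auto
    then show False
      using w by simp
  qed
qed

lemma polyg_deriv:
  assumes "w \<notin> \<int>"
  shows "(polyg n has_field_derivative polyg (Suc n) w) (at w)"
  unfolding polyg_def[abs_def] using notin_Ints_nonpos[OF assms]
  by (auto intro!: derivative_eq_intros)

text \<open>Differentiate the reflection formula 1 / (\<Gamma>(w) \<Gamma>(1 - w)) = sin (\<pi> w) /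
  \<pi> to get the cotangent, then rewrite the cotangent in terms of exp (2 \<pi> i w).\<close>

lemma polyg_0:
  assumes w: "w \<notin> \<int>"
  shows "polyg 0 w = of_real pi * \<i> + 2 * of_real pi * \<i> * fr 0 (Ex w)"
proof -
  have "((\<lambda>w. rGamma w * rGamma (1 - w)) has_field_derivative
      rGamma w * rGamma (1 - w) * (Digamma (1 - w) - Digamma w)) (at w)"
    using notin_Ints_nonpos[OF w]
    by (auto intro!: derivative_eq_intros simp: algebra_simps)
  moreover have "(\<lambda>w::complex. rGamma w * rGamma (1 - w)) = (\<lambda>w. sin (of_real pi * w) / of_real pi)"
    by (simp add: rGamma_reflection_complex)
  moreover have "((\<lambda>w. sin (of_real pi * w) / of_real pi) has_field_derivative cos (of_real pi * w)) (at w)"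
    by (auto intro!: derivative_eq_intros)
  ultimately have "rGamma w * rGamma (1 - w) * (Digamma (1 - w) - Digamma w) = cos (of_real pi * w)"
    using DERIV_unique by metis
  then have eq: "sin (of_real pi * w) * (Digamma w - Digamma (1 - w)) = - of_real pi * cos (of_real pi * w)"
    unfolding rGamma_reflection_complex by (simp add: field_simps)
  define E where "E = exp (\<i> * of_real pi * w)"
  have E0: "E \<noteq> 0"
    by (simp add: E_def)
  have E2: "Ex w = E\<^sup>2"
    unfolding E_def Ex_def exp_double [symmetric] by (simp add: mult_ac)
  have e1: "exp (\<i> * (of_real pi * w)) = E"
    by (simp add: E_def mult.assoc)
  have e2: "exp (- (\<i> * (of_real pi * w))) = 1 / E"
    by (simp add: E_def mult.assoc exp_minus inverse_eq_divide)
  have sin: "sin (of_real pi * w) = (E - 1 / E) / (2 * \<i>)"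
    unfolding sin_exp_eq e1 e2 by (rule refl)
  have cos: "cos (of_real pi * w) = (E + 1 / E) / 2"
    unfolding cos_exp_eq e1 e2 by (rule refl)
  have E1: "E\<^sup>2 \<noteq> 1"
    unfolding E2 [symmetric] Ex_eq_1_iff by (rule w)
  have nz: "E\<^sup>2 - 1 \<noteq> 0" "1 - E\<^sup>2 \<noteq> 0"
    using E1 by auto
  define s c D where "s = sin (of_real pi * w)" and "c = cos (of_real pi * w)"
    and "D = Digamma w - Digamma (1 - w)"
  have "(E - 1 / E) * E = E\<^sup>2 - 1" "(E + 1 / E) * E = E\<^sup>2 + 1"
    using E0 by (simp_all add: left_diff_distrib distrib_right power2_eq_square)
  moreover have "s * (2 * \<i>) = E - 1 / E"
    by (rule iffD1[OF nonzero_eq_divide_eq sin[folded s_def]]) simp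
  moreover have "c * 2 = E + 1 / E"
    by (simp add: c_def cos)
  ultimately have sc: "s * (2 * \<i> * E) = E\<^sup>2 - 1" "c * (2 * E) = E\<^sup>2 + 1"
    by (metis mult.assoc)+
  have "(E\<^sup>2 - 1) * D = (s * D) * (2 * \<i> * E)"
    by (simp add: sc(1) [symmetric])
  also have "s * D = - of_real pi * c"
    using eq by (simp add: s_def c_def D_def)
  also have "- of_real pi * c * (2 * \<i> * E) = - of_real pi * \<i> * (c * (2 * E))"
    by simp
  finally have "(E\<^sup>2 - 1) * (Digamma w - Digamma (1 - w)) = - of_real pi * \<i> * (E\<^sup>2 + 1)"
    by (simp only: sc(2) D_def)
  then have "Digamma w - Digamma (1 - w) = - of_real pi * \<i> * (E\<^sup>2 + 1) / (E\<^sup>2 - 1)"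
    by (metis mult.commute nonzero_eq_divide_eq nz(1))
  also have "\<dots> = of_real pi * \<i> + 2 * of_real pi * \<i> * (E\<^sup>2 / (1 - E\<^sup>2))"
  proof -
    have gen: "- P * (u + 2) / u = P + 2 * P * ((u + 1) / (- u))" if "u \<noteq> 0" for P u :: complex
      using that by (simp add: field_simps)
    have "E\<^sup>2 - 1 + 2 = E\<^sup>2 + 1" "E\<^sup>2 - 1 + 1 = E\<^sup>2" "- (E\<^sup>2 - 1) = 1 - E\<^sup>2"
      by simp_all
    then show ?thesis
      using gen[OF nz(1), of "of_real pi * \<i>"] by (simp only: mult.assoc mult_minus_left)
  qed
  finally show ?thesis
    by (simp add: polyg_def fr_def E2)
qed

lemma polyg_eq:
  assumes "w \<notin> \<int>"
  shows "polyg n w = (if n = 0 then of_real pi * \<i> else 0) + (2 * of_real pi * \<i>) ^ Suc n * fr n (Ex w)"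
  using assms
proof (induction n arbitrary: w)
  case (Suc n)
  have E1: "Ex w \<noteq> 1"
    using Suc.prems Ex_eq_1_iff by simp
  obtain d where d: "(fr n has_field_derivative d) (at (Ex w))" "Ex w * d = fr (Suc n) (Ex w)"
    using fr_deriv[OF E1] .
  define c where "c = (if n = 0 then of_real pi * \<i> else 0)"
  have der: "((\<lambda>w. c + (2 * of_real pi * \<i>) ^ Suc n * fr n (Ex w)) has_field_derivative
      (2 * of_real pi * \<i>) ^ Suc n * (d * (2 * of_real pi * \<i> * Ex w))) (at w)"
    by (auto intro!: derivative_eq_intros DERIV_chain2[where f = "fr n" and g = Ex, OF d(1)] Ex_deriv simp del: power_Suc)
  have "open (- \<int> :: complex set)"
    by (intro open_Compl closed_Ints)
  then have "\<forall>\<^sub>F u in nhds w. u \<in> - \<int>"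
    using Suc.prems by (intro eventually_nhds_in_open) auto
  then have ev: "\<forall>\<^sub>F u in nhds w. polyg n u = c + (2 * of_real pi * \<i>) ^ Suc n * fr n (Ex u)"
    by (rule eventually_mono) (use Suc.IH in \<open>auto simp: c_def\<close>)
  from DERIV_cong_ev[OF refl ev refl] der have "(polyg n has_field_derivative
      (2 * of_real pi * \<i>) ^ Suc n * (d * (2 * of_real pi * \<i> * Ex w))) (at w)"
    by blast
  then have "polyg (Suc n) w = (2 * of_real pi * \<i>) ^ Suc n * (d * (2 * of_real pi * \<i> * Ex w))"
    using polyg_deriv[OF Suc.prems] DERIV_unique by blast
  also have "\<dots> = (2 * of_real pi * \<i>) ^ Suc (Suc n) * (Ex w * d)"
    by simp
  finally show ?case
    by (simp add: d(2))
qed (use polyg_0 in simp)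

text \<open>The constant (-2 \<pi> i)^k / (k - 1)! in Lipschitz' formula.\<close>

definition lip :: "nat \<Rightarrow> complex" where
  "lip k = (- 1) ^ k * (2 * of_real pi * \<i>) ^ k / fact (k - 1)"

lemma summable_norm_inverse_power:
  fixes w :: complex
  assumes "k \<ge> 2"
  shows "summable (\<lambda>n. norm (inverse ((w + of_nat n) ^ k)))"
proof (rule summable_comparison_test_ev)
  show "summable (\<lambda>n. 4 * inverse (real n ^ 2))"
    by (intro summable_mult inverse_power_summable) simp
  have "norm (norm (inverse ((w + of_nat n) ^ k))) \<le> 4 * inverse (real n ^ 2)"
    if n: "real n \<ge> 2 * cmod w" "n \<ge> 2" for n
  proof -
    have "real n / 2 \<le> cmod (w + of_nat n)"
      using norm_triangle_ineq4[of "w + of_nat n" w] n(1) by simp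
    moreover have "real n / 2 \<ge> 1"
      using n by simp
    ultimately have "(real n / 2) ^ 2 \<le> cmod (w + of_nat n) ^ k"
      using assms by (meson order_trans power_increasing power_mono zero_le_one)
    then have "inverse (cmod (w + of_nat n) ^ k) \<le> inverse ((real n / 2) ^ 2)"
      using n by (intro le_imp_inverse_le) auto
    moreover have "inverse ((real n / 2) ^ 2) = 4 * inverse (real n ^ 2)"
      by (simp add: power_divide inverse_eq_divide)
    ultimately have "inverse (cmod (w + of_nat n) ^ k) \<le> 4 * inverse (real n ^ 2)"
      by (simp only:)
    then show ?thesis
      by (simp add: norm_inverse norm_power)
  qed
  then show "\<forall>\<^sub>F n in sequentially. norm (norm (inverse ((w + of_nat n) ^ k))) \<le> 4 * inverse (real n ^ 2)"
    unfolding eventually_sequentially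
    by (intro exI[of _ "max 2 (nat \<lceil>2 * cmod w\<rceil>)"]) (auto simp: nat_le_iff ceiling_le_iff)
qed

lemma has_sum_int:
  fixes f :: "int \<Rightarrow> 'a::{topological_comm_monoid_add}"
  assumes "((\<lambda>n::nat. f (int n)) has_sum a) UNIV" "((\<lambda>n::nat. f (- 1 - int n)) has_sum b) UNIV"
  shows "(f has_sum (a + b)) UNIV"
proof -
  have "(f has_sum a) {0..}"
    using assms(1) by (subst (asm) has_sum_reindex_bij_witness[of UNIV nat int "{0..}" f _ a a]) auto
  moreover have "(f has_sum b) {..<0}"
    using assms(2)
    by (subst (asm) has_sum_reindex_bij_witness[of UNIV "\<lambda>l. nat (- 1 - l)" "\<lambda>n. - 1 - int n" "{..<0}" f _ b b]) auto
  ultimately have "(f has_sum (a + b)) ({0..} \<union> {..<0})"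
    by (intro has_sum_Un_disjoint) auto
  moreover have "{0..} \<union> {..<0} = (UNIV :: int set)"
    by auto
  ultimately show ?thesis
    by simp
qed

text \<open>The terms with l >= 0 and those with l < 0 are polygamma values at w and at 1 - w, which
  \<open>polyg\<close> combines. No condition on Im w enters, so the formula is also available at
  rational points.\<close>

lemma lipschitz_aux:
  assumes w: "w \<notin> \<int>" and k: "k \<ge> 2"
  shows "((\<lambda>l::int. inverse ((w + of_int l) ^ k)) has_sum (lip k * fr (k - 1) (Ex w))) UNIV"
proof -
  have k1: "Suc (k - 1) = k" "k - 1 > 0"
    using k by auto
  have nz: "w \<noteq> 0" "1 - w \<noteq> 0"
    using w by auto
  have 1: "((\<lambda>n. inverse ((w + of_nat n) ^ k)) has_sum ((- 1) ^ k * Polygamma (k - 1) w / fact (k - 1))) UNIV"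
    using Polygamma_LIMSEQ[OF nz(1) k1(2)] unfolding k1(1)
    by (intro norm_summable_imp_has_sum summable_norm_inverse_power k)
  have "((\<lambda>n. inverse ((1 - w + of_nat n) ^ k)) has_sum ((- 1) ^ k * Polygamma (k - 1) (1 - w) / fact (k - 1))) UNIV"
    using Polygamma_LIMSEQ[OF nz(2) k1(2)] unfolding k1(1)
    by (intro norm_summable_imp_has_sum summable_norm_inverse_power k)
  then have "((\<lambda>n. (- 1) ^ k * inverse ((1 - w + of_nat n) ^ k)) has_sum
      ((- 1) ^ k * ((- 1) ^ k * Polygamma (k - 1) (1 - w) / fact (k - 1)))) UNIV"
    by (rule has_sum_cmult_right)
  moreover have "(- 1) ^ k * inverse ((1 - w + of_nat n) ^ k) = inverse ((w + of_int (- 1 - int n)) ^ k)" for n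
  proof -
    have eq: "w + of_int (- 1 - int n) = (- 1) * (1 - w + of_nat n)"
      by simp
    have "inverse ((- 1 :: complex) ^ k) = (- 1) ^ k"
      by (cases "even k") auto
    then show ?thesis
      unfolding eq power_mult_distrib inverse_mult_distrib by simp
  qed
  ultimately have 2: "((\<lambda>n. inverse ((w + of_int (- 1 - int n)) ^ k)) has_sum
      (Polygamma (k - 1) (1 - w) / fact (k - 1))) UNIV"
    by (simp flip: mult.assoc power_mult_distrib)
  have "(- 1) ^ k * Polygamma (k - 1) w / fact (k - 1) + Polygamma (k - 1) (1 - w) / fact (k - 1) =
    (- 1) ^ k * polyg (k - 1) w / fact (k - 1)"
    using k1 by (cases "even k") (auto simp: polyg_def diff_divide_distrib add_divide_distrib)
  also have "\<dots> = lip k * fr (k - 1) (Ex w)"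
    using polyg_eq[OF w, of "k - 1"] k1 by (simp add: lip_def)
  finally have "(- 1) ^ k * Polygamma (k - 1) w / fact (k - 1) + Polygamma (k - 1) (1 - w) / fact (k - 1) =
    lip k * fr (k - 1) (Ex w)" .
  moreover have "((\<lambda>n. inverse ((w + of_int (int n)) ^ k)) has_sum ((- 1) ^ k * Polygamma (k - 1) w / fact (k - 1))) UNIV"
    using 1 by simp
  ultimately show ?thesis
    using has_sum_int[of "\<lambda>l. inverse ((w + of_int l) ^ k)", OF _ 2] by metis
qed

lemma lipschitz_mod:
  fixes w :: complex and N :: nat
  assumes w: "w / of_nat N \<notin> \<int>" and k: "k \<ge> 2" and N: "N > 0"
    and wv: "w = u + of_int v"
  shows "((\<lambda>n::int. inverse ((u + of_int n) ^ k)) has_sum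
      (lip k / of_nat N ^ k * fr (k - 1) (Ex (w / of_nat N)))) {n. int N dvd n - v}"
proof -
  have "((\<lambda>l::int. inverse (of_nat N ^ k) * inverse ((w / of_nat N + of_int l) ^ k)) has_sum
      (inverse (of_nat N ^ k) * (lip k * fr (k - 1) (Ex (w / of_nat N))))) UNIV"
    by (intro has_sum_cmult_right lipschitz_aux w k)
  also have "?this \<longleftrightarrow> ((\<lambda>n::int. inverse ((u + of_int n) ^ k)) has_sum
      (lip k / of_nat N ^ k * fr (k - 1) (Ex (w / of_nat N)))) {n. int N dvd n - v}"
  proof (rule has_sum_reindex_bij_witness[of _ "\<lambda>n. (n - v) div int N" "\<lambda>l. v + int N * l"])
    fix l :: int
    have "u + of_int (v + int N * l) = of_nat N * (w / of_nat N + of_int l)"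
      using N by (simp add: wv field_simps)
    then show "inverse ((u + of_int (v + int N * l)) ^ k) =
      inverse (of_nat N ^ k) * inverse ((w / of_nat N + of_int l) ^ k)"
      by (simp add: power_mult_distrib)
  qed (use N in \<open>auto simp: divide_inverse mult_ac\<close>)
  finally show ?thesis .
qed

subsection \<open>Eisenstein series for the principal congruence subgroup\<close>

definition lat :: "nat \<Rightarrow> int \<times> int \<Rightarrow> (int \<times> int) set" where
  "lat N v = {(m, n). int N dvd m - fst v \<and> int N dvd n - snd v \<and> (m, n) \<noteq> (0, 0)}"

definition lterm :: "nat \<Rightarrow> complex \<Rightarrow> int \<times> int \<Rightarrow> complex" where
  "lterm k z t = inverse ((of_int (fst t) * z + of_int (snd t)) ^ k)"

text \<open>The sum runs over the full class of v, not over coprime pairs. By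
  \<open>slash_Eis\<close>, slashing replaces the row vector v by v \<gamma>, so the expansions at
  all cusps are expansions at oo for other v.\<close>

definition Eis :: "nat \<Rightarrow> nat \<Rightarrow> int \<times> int \<Rightarrow> complex \<Rightarrow> complex" where
  "Eis k N v z = infsum (lterm k z) (lat N v)"

definition rowact :: "int \<times> int \<Rightarrow> int^2^2 \<Rightarrow> int \<times> int" where
  "rowact v \<gamma> = (fst v * \<gamma> $ 1 $ 1 + snd v * \<gamma> $ 2 $ 1, fst v * \<gamma> $ 1 $ 2 + snd v * \<gamma> $ 2 $ 2)"

lemma rowact_mult: "rowact (rowact v A) B = rowact v (A ** B)"
  by (simp add: rowact_def mat2_mult_nth algebra_simps)

lemma rowact_1 [simp]: "rowact v (mat 1) = v"
  by (simp add: rowact_def)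

lemma lat_rowact:
  assumes "t \<in> lat N v" "\<gamma> \<in> SL2Z"
  shows "rowact t \<gamma> \<in> lat N (rowact v \<gamma>)"
proof -
  have "fst (rowact t \<gamma>) - fst (rowact v \<gamma>) = (fst t - fst v) * \<gamma> $ 1 $ 1 + (snd t - snd v) * \<gamma> $ 2 $ 1"
    "snd (rowact t \<gamma>) - snd (rowact v \<gamma>) = (fst t - fst v) * \<gamma> $ 1 $ 2 + (snd t - snd v) * \<gamma> $ 2 $ 2"
    by (simp_all add: rowact_def algebra_simps)
  moreover have "int N dvd fst t - fst v" "int N dvd snd t - snd v"
    using assms(1) by (auto simp: lat_def)
  moreover have "rowact t \<gamma> \<noteq> (0, 0)"
  proof
    assume *: "rowact t \<gamma> = (0, 0)"
    have "t = rowact (rowact t \<gamma>) (minv \<gamma>)"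
      by (simp add: rowact_mult minv_mult assms(2))
    also have "\<dots> = (0, 0)"
      by (simp add: *) (simp add: rowact_def)
    finally show False
      using assms(1) by (simp add: lat_def)
  qed
  ultimately show ?thesis
    by (cases "rowact t \<gamma>") (auto simp: lat_def)
qed

lemma slash_Eis:
  assumes \<gamma>: "\<gamma> \<in> SL2Z" and z: "Im z > 0"
  shows "slash (int k) (Eis k N v) \<gamma> z = Eis k N (rowact v \<gamma>) z"
proof -
  have "slash (int k) (Eis k N v) \<gamma> z =
      infsum (\<lambda>t. inverse (aut_factor \<gamma> z ^ k) * lterm k (mat_act \<gamma> z) t) (lat N v)"
    by (simp add: slash_def Eis_def infsum_cmult_right' power_int_minus)
  also have "\<dots> = infsum (lterm k z) (lat N (rowact v \<gamma>))"
  proof (rule infsum_reindex_bij_witness[of _ "\<lambda>t. rowact t (minv \<gamma>)" "\<lambda>t. rowact t \<gamma>"])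
    show "rowact t (minv \<gamma>) \<in> lat N v" if "t \<in> lat N (rowact v \<gamma>)" for t
      using lat_rowact[OF that minv_SL2Z[OF \<gamma>]] by (simp add: rowact_mult minv_mult \<gamma>)
    show "lterm k z (rowact t \<gamma>) = inverse (aut_factor \<gamma> z ^ k) * lterm k (mat_act \<gamma> z) t" for t
    proof -
      have nz: "aut_factor \<gamma> z \<noteq> 0"
        using aut_factor_nonzero[of \<gamma> z] \<gamma> z by simp
      have "mat_act \<gamma> z * aut_factor \<gamma> z = of_int (\<gamma> $ 1 $ 1) * z + of_int (\<gamma> $ 1 $ 2)"
        using nz by (simp add: mat_act_def moebius_def aut_factor_def)
      then have "(of_int (fst t) * mat_act \<gamma> z + of_int (snd t)) * aut_factor \<gamma> z =
          of_int (fst t) * (of_int (\<gamma> $ 1 $ 1) * z + of_int (\<gamma> $ 1 $ 2)) + of_int (snd t) * aut_factor \<gamma> z"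
        by (simp only: distrib_right mult.assoc)
      also have "\<dots> = of_int (fst (rowact t \<gamma>)) * z + of_int (snd (rowact t \<gamma>))"
        by (simp add: rowact_def aut_factor_def algebra_simps)
      finally have eq: "of_int (fst (rowact t \<gamma>)) * z + of_int (snd (rowact t \<gamma>)) =
          (of_int (fst t) * mat_act \<gamma> z + of_int (snd t)) * aut_factor \<gamma> z" ..
      show ?thesis
        unfolding lterm_def eq by (simp add: power_mult_distrib)
    qed
  qed (use \<gamma> in \<open>auto simp: rowact_mult minv_mult lat_rowact\<close>)
  finally show ?thesis
    by (simp add: Eis_def)
qed

lemma Eis_cong:
  assumes "int N dvd fst v - fst v'" "int N dvd snd v - snd v'"
  shows "Eis k N v = Eis k N v'"
proof -
  have "int N dvd x - fst v \<longleftrightarrow> int N dvd x - fst v'" "int N dvd x - snd v \<longleftrightarrow> int N dvd x - snd v'" for x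
    using assms dvd_add_right_iff[of "int N" "fst v - fst v'" "x - fst v"]
      dvd_add_right_iff[of "int N" "snd v - snd v'" "x - snd v"]
    by (simp_all add: algebra_simps)
  then have "lat N v = lat N v'"
    by (simp add: lat_def)
  then show ?thesis
    by (simp add: Eis_def[abs_def])
qed

lemma summable_int_powr: "(\<lambda>n::int. (\<bar>of_int n\<bar> + 1 :: real) powr (- 3/2)) summable_on UNIV"
proof -
  have "summable (\<lambda>n. real n powr (- 3/2))"
    by (subst summable_real_powr_iff) simp
  then have s1: "summable (\<lambda>n. real (Suc n) powr (- 3/2))"
    by (subst summable_Suc_iff)
  then have s2: "summable (\<lambda>n. real (Suc (Suc n)) powr (- 3/2))"
    by (subst (asm) summable_Suc_iff [symmetric])
  have "((\<lambda>n::int. (\<bar>of_int n\<bar> + 1 :: real) powr (- 3/2)) has_sum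
      ((\<Sum>n. real (Suc n) powr (- 3/2)) + (\<Sum>n. real (Suc (Suc n)) powr (- 3/2)))) UNIV"
  proof (rule has_sum_int)
    show "((\<lambda>n. (\<bar>real_of_int (int n)\<bar> + 1) powr (- 3/2)) has_sum (\<Sum>n. real (Suc n) powr (- 3/2))) UNIV"
      using sums_nonneg_imp_has_sum[OF summable_sums[OF s1]] by (simp add: add.commute)
    show "((\<lambda>n. (\<bar>real_of_int (- 1 - int n)\<bar> + 1) powr (- 3/2)) has_sum (\<Sum>n. real (Suc (Suc n)) powr (- 3/2))) UNIV"
      using sums_nonneg_imp_has_sum[OF summable_sums[OF s2]] by (simp add: algebra_simps)
  qed
  then show ?thesis
    by (rule has_sum_imp_summable)
qed

lemma summable_on_product_nonneg:
  fixes f :: "'a \<Rightarrow> real" and g :: "'b \<Rightarrow> real"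
  assumes "f summable_on A" "g summable_on B" "\<And>x. x \<in> A \<Longrightarrow> f x \<ge> 0" "\<And>y. y \<in> B \<Longrightarrow> g y \<ge> 0"
  shows "(\<lambda>(x, y). f x * g y) summable_on A \<times> B"
proof (rule summable_on_SigmaI)
  fix x assume "x \<in> A"
  show "((\<lambda>y. (\<lambda>(x, y). f x * g y) (x, y)) has_sum (f x * infsum g B)) B"
    using assms(2) by (auto intro!: has_sum_cmult_right)
next
  show "(\<lambda>x. f x * infsum g B) summable_on A"
    using assms(1) by (rule summable_on_cmult_left)
qed (use assms in auto)

text \<open>Since |m| and |n| are at most D |m z + n|, the product (|m| + 1) (|n| + 1) is at most (2
  D |m z + n|)^2. Hence a term is bounded by a constant times ((|m| + 1) (|n| + 1))^(-3/2), which is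
  summable as a product of two convergent series.\<close>

lemma lterm_summable:
  assumes z: "Im z > 0" and k: "k \<ge> 3"
  shows "lterm k z summable_on (UNIV - {(0, 0)})"
proof -
  define D where "D = 1 / Im z + 1 + cmod z / Im z"
  have D: "D > 0"
    using z by (simp add: D_def add_pos_nonneg)
  have bound: "norm (lterm k z (m, n)) \<le> 8 * D ^ k * ((\<bar>of_int m\<bar> + 1) powr (- 3/2) * (\<bar>of_int n\<bar> + 1) powr (- 3/2))"
    if mn: "(m, n) \<noteq> (0, 0)" for m n :: int
  proof -
    define W where "W = cmod (of_int m * z + of_int n)"
    have "\<bar>Im (of_int m * z + of_int n)\<bar> \<le> W"
      unfolding W_def by (rule abs_Im_le_cmod)
    then have "\<bar>of_int m\<bar> * Im z \<le> W"
      using z by (simp add: abs_mult)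
    then have m: "\<bar>of_int m\<bar> \<le> W / Im z"
      using z by (simp add: field_simps)
    have W0: "W \<ge> 0"
      by (simp add: W_def)
    have "\<bar>of_int n\<bar> = cmod ((of_int m * z + of_int n) - of_int m * z)"
      by simp
    also have "\<dots> \<le> W + \<bar>of_int m\<bar> * cmod z"
      unfolding W_def by (rule order_trans[OF norm_triangle_ineq4]) (simp add: norm_mult)
    also have "\<dots> \<le> W + W / Im z * cmod z"
      using m by (intro add_left_mono mult_right_mono) auto
    finally have n: "\<bar>of_int n\<bar> \<le> W + W / Im z * cmod z" .
    have "D * W = W / Im z + (W + W / Im z * cmod z)"
      by (simp add: D_def distrib_right)
    moreover have "W / Im z \<ge> 0" "W / Im z * cmod z \<ge> 0"
      using z W0 by simp_all
    ultimately have "W / Im z \<le> D * W" "W + W / Im z * cmod z \<le> D * W"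
      using W0 by linarith+
    with m n have mD: "\<bar>of_int m\<bar> \<le> D * W" and nD: "\<bar>of_int n\<bar> \<le> D * W"
      by linarith+
    have "D * W \<ge> 1"
    proof (cases "m = 0")
      case True
      then have "n \<noteq> 0"
        using mn by simp
      then have "\<bar>real_of_int n\<bar> \<ge> 1"
        by linarith
      then show ?thesis
        using nD by linarith
    next
      case False
      then have "\<bar>real_of_int m\<bar> \<ge> 1"
        by linarith
      then show ?thesis
        using mD by linarith
    qed
    define M where "M = (\<bar>real_of_int m\<bar> + 1) * (\<bar>real_of_int n\<bar> + 1)"
    have M: "M \<ge> 1"
      unfolding M_def using mult_mono[of 1 "\<bar>real_of_int m\<bar> + 1" 1 "\<bar>real_of_int n\<bar> + 1"] by simp
    have "M \<le> (2 * (D * W)) * (2 * (D * W))"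
      unfolding M_def using mD nD \<open>D * W \<ge> 1\<close> by (intro mult_mono) auto
    then have M2: "M \<le> (2 * (D * W))\<^sup>2"
      by (simp add: power2_eq_square)
    then have "M powr (3/2) \<le> ((2 * (D * W))\<^sup>2) powr (3/2)"
      using M by (intro powr_mono2) auto
    also have "((2 * (D * W))\<^sup>2) powr (3/2) = ((2 * (D * W)) powr 2) powr (3/2)"
      using \<open>D * W \<ge> 1\<close> by (simp add: powr_numeral)
    also have "\<dots> = (2 * (D * W)) powr 3"
      by (simp only: powr_powr) simp
    also have "\<dots> = 8 * (D * W) ^ 3"
      using \<open>D * W \<ge> 1\<close> by (simp add: powr_numeral power_mult_distrib)
    also have "\<dots> \<le> 8 * (D * W) ^ k"
      using \<open>D * W \<ge> 1\<close> k by (simp add: power_increasing)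
    finally have "M powr (3/2) \<le> 8 * D ^ k * W ^ k"
      by (simp add: power_mult_distrib)
    moreover have "W > 0"
      using \<open>D * W \<ge> 1\<close> D W0 by (cases "W = 0") auto
    ultimately have "inverse (W ^ k) \<le> 8 * D ^ k * inverse (M powr (3/2))"
      using M by (simp add: field_simps)
    also have "inverse (M powr (3/2)) = (\<bar>of_int m\<bar> + 1) powr (- 3/2) * (\<bar>of_int n\<bar> + 1) powr (- 3/2)"
      by (simp add: M_def powr_mult powr_minus [symmetric])
    finally show ?thesis
      by (simp add: lterm_def norm_inverse norm_power W_def)
  qed
  have "(\<lambda>(m, n). (\<bar>of_int m\<bar> + 1) powr (- 3/2) * (\<bar>of_int n\<bar> + 1 :: real) powr (- 3/2)) summable_on
      (UNIV :: int set) \<times> (UNIV :: int set)"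
    by (intro summable_on_product_nonneg summable_int_powr) auto
  then have "(\<lambda>(m, n). (\<bar>of_int m\<bar> + 1) powr (- 3/2) * (\<bar>of_int n\<bar> + 1 :: real) powr (- 3/2)) summable_on
      (UNIV - {(0 :: int, 0 :: int)})"
    by (rule summable_on_subset_banach) auto
  then have "(\<lambda>t. 8 * D ^ k * (case t of (m, n) \<Rightarrow> (\<bar>of_int m\<bar> + 1) powr (- 3/2) * (\<bar>of_int n\<bar> + 1 :: real) powr (- 3/2)))
      summable_on (UNIV - {(0 :: int, 0 :: int)})"
    by (rule summable_on_cmult_right)
  then have "(\<lambda>t. norm (lterm k z t)) summable_on (UNIV - {(0, 0)})"
    by (rule Infinite_Sum.abs_summable_on_comparison_test') (use bound in auto)
  then show ?thesis
    by (rule abs_summable_summable)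
qed

lemma qq_Ex: "qq N z = Ex (z / of_nat N)"
  by (simp add: qq_def Ex_def)

lemma cmod_Ex_of_int [simp]: "cmod (Ex (of_int a / of_nat N)) = 1"
  by (simp add: norm_Ex)

text \<open>A twisted divisor sum: it collects the pairs m, r with m r = l, where m > 0 lies in the
  class of the first coordinate and r is the exponent in Lipschitz' formula for the row m.\<close>

definition eis_div_sum :: "nat \<Rightarrow> nat \<Rightarrow> int \<times> int \<Rightarrow> nat \<Rightarrow> complex" where
  "eis_div_sum k N v l = (\<Sum>m | m > 0 \<and> int N dvd int m - fst v \<and> m dvd l.
     of_nat (l div m) ^ (k - 1) * Ex (of_int (snd v) / of_nat N) ^ (l div m))"

text \<open>Lipschitz' formula sums each row m > 0 over n; the resulting double series in m and r is
  then rearranged by the product l = m r.\<close>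

lemma eis_half:
  assumes N: "N > 0" and k: "k \<ge> 3" and z: "Im z > 0"
  obtains S where
    "(lterm k z has_sum (lip k / of_nat N ^ k * S))
      {t. fst t > 0 \<and> int N dvd fst t - fst v \<and> int N dvd snd t - snd v}"
    "((\<lambda>l. eis_div_sum k N v l * qq N z ^ l) has_sum S) {1..}"
proof -
  define E where "E = Ex (of_int (snd v) / of_nat N)"
  define q where "q = qq N z"
  define M where "M = {m::nat. m > 0 \<and> int N dvd int m - fst v}"
  define R where "R = {n::int. int N dvd n - snd v}"
  define t where "t = (\<lambda>(m::nat, r::nat). of_nat r ^ (k - 1) * (E ^ r * q ^ (m * r)))"
  have E: "cmod E = 1"
    by (simp add: E_def)
  have q: "0 < cmod q" "cmod q < 1"
    using norm_qq_less_1[OF N z] by (simp_all add: q_def)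
  \<comment> \<open>As m + r <= 2 m r, |q|^(m r) <= s^m s^r, a majorant that is a product and
    justifies the rearrangement.\<close>
  define s where "s = sqrt (cmod q)"
  have s: "0 < s" "s < 1" "s\<^sup>2 = cmod q"
    using q by (simp_all add: s_def)
  have tsum: "t summable_on M \<times> {1..}"
  proof -
    have "summable (\<lambda>m. norm (s ^ m))"
      using s by (simp add: norm_power summable_geometric)
    then have 1: "(\<lambda>m. s ^ m) summable_on M"
      by (intro summable_on_subset_banach[OF norm_summable_imp_summable_on]) auto
    have "(\<lambda>r. cmod (fr_coeff (k - 1) r * of_real s ^ r)) summable_on UNIV"
      using fr_summable_norm[of "of_real s" "k - 1"] s by (intro norm_summable_imp_summable_on) simp
    then have "(\<lambda>r. cmod (fr_coeff (k - 1) r * of_real s ^ r)) summable_on {1..}"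
      by (rule summable_on_subset_banach) simp
    also have "?this \<longleftrightarrow> (\<lambda>r. real r ^ (k - 1) * s ^ r) summable_on {1..}"
      using s by (intro summable_on_cong) (auto simp: fr_coeff_def norm_mult norm_power)
    finally have 2: "(\<lambda>r. real r ^ (k - 1) * s ^ r) summable_on {1..}" .
    have "(\<lambda>(m, r). s ^ m * (real r ^ (k - 1) * s ^ r)) summable_on M \<times> {1..}"
      using s by (intro summable_on_product_nonneg 1 2) auto
    then have "(\<lambda>x. norm (t x)) summable_on M \<times> {1..}"
    proof (rule Infinite_Sum.abs_summable_on_comparison_test')
      fix x assume "x \<in> M \<times> {1::nat..}"
      then obtain m r where x: "x = (m, r)" "m > 0" "r > 0"
        by (auto simp: M_def)
      have "m + r \<le> 2 * (m * r)"
        using x by (cases m; cases r) auto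
      then have "s ^ (2 * (m * r)) \<le> s ^ (m + r)"
        using s by (intro power_decreasing) auto
      moreover have "s ^ (2 * (m * r)) = cmod q ^ (m * r)"
        by (simp only: power_mult s(3))
      ultimately have "cmod q ^ (m * r) \<le> s ^ m * s ^ r"
        by (simp add: power_add)
      then have "real r ^ (k - 1) * cmod q ^ (m * r) \<le> real r ^ (k - 1) * (s ^ m * s ^ r)"
        by (intro mult_left_mono) auto
      moreover have "norm (t x) = real r ^ (k - 1) * cmod q ^ (m * r)"
        by (simp add: x t_def norm_mult norm_power E)
      ultimately show "norm (t x) \<le> (case x of (m, r) \<Rightarrow> s ^ m * (real r ^ (k - 1) * s ^ r))"
        by (simp add: x mult_ac)
    qed
    then show ?thesis
      by (rule abs_summable_summable)
  qed
  define S where "S = infsum t (M \<times> {1..})"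
  have tS: "(t has_sum S) (M \<times> {1..})"
    unfolding S_def by (rule has_sum_infsum[OF tsum])
  have inner: "((\<lambda>r. t (m, r)) has_sum fr (k - 1) (E * q ^ m)) {1..}" if "m \<in> M" for m
  proof -
    have "cmod q ^ m < 1"
      using that q by (intro power_less_one_iff[THEN iffD2]) (auto simp: M_def)
    then have "((\<lambda>r. of_nat r ^ (k - 1) * (E * q ^ m) ^ r) has_sum fr (k - 1) (E * q ^ m)) {1..}"
      by (intro fr_has_sum) (simp add: norm_mult norm_power E)
    then show ?thesis
      by (simp add: t_def power_mult_distrib power_mult)
  qed
  have frM: "((\<lambda>m. fr (k - 1) (E * q ^ m)) has_sum S) M"
    by (rule has_sum_SigmaD[OF tS inner])
  have lip_m: "((\<lambda>n. lterm k z (int m, n)) has_sum (lip k / of_nat N ^ k * fr (k - 1) (E * q ^ m))) R"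
    if "m \<in> M" for m
  proof -
    define w where "w = of_nat m * z + of_int (snd v)"
    have "Im (w / of_nat N) > 0"
      using that z N by (simp add: w_def M_def Im_divide_of_nat)
    moreover have "Im (w / of_nat N) = 0" if "w / of_nat N \<in> \<int>"
      using that by (metis Ints_cases complex_Im_of_int)
    ultimately have "w / of_nat N \<notin> \<int>"
      by linarith
    moreover have "Ex (w / of_nat N) = E * q ^ m"
    proof -
      have eq: "w / of_nat N = of_int (snd v) / of_nat N + of_nat m * (z / of_nat N)"
        by (simp add: w_def add_divide_distrib)
      show ?thesis
        unfolding eq Ex_add Ex_of_nat_mult E_def q_def qq_Ex ..
    qed
    ultimately have "((\<lambda>n::int. inverse ((of_nat m * z + of_int n) ^ k)) has_sum
      (lip k / of_nat N ^ k * fr (k - 1) (E * q ^ m))) R"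
      using lipschitz_mod[of w N k "of_nat m * z" "snd v"] k N by (simp add: w_def R_def)
    then show ?thesis
      by (simp add: lterm_def)
  qed
  define U where "U = {t. fst t > 0 \<and> int N dvd fst t - fst v \<and> int N dvd snd t - snd v}"
  have Usum: "lterm k z summable_on U"
    by (rule summable_on_subset_banach[OF lterm_summable[OF z k]]) (auto simp: U_def)
  define S1 where "S1 = infsum (lterm k z) U"
  have U1: "(lterm k z has_sum S1) U"
    unfolding S1_def by (rule has_sum_infsum[OF Usum])
  have "((\<lambda>x. lterm k z (int (fst x), snd x)) has_sum S1) (Sigma M (\<lambda>_. R)) \<longleftrightarrow> (lterm k z has_sum S1) U"
    by (rule has_sum_reindex_bij_witness[of _ "\<lambda>t. (nat (fst t), snd t)" "\<lambda>x. (int (fst x), snd x)"])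
       (auto simp: M_def R_def U_def)
  then have "((\<lambda>x. lterm k z (int (fst x), snd x)) has_sum S1) (Sigma M (\<lambda>_. R))"
    using U1 by simp
  from has_sum_SigmaD[OF this, of "\<lambda>m. lip k / of_nat N ^ k * fr (k - 1) (E * q ^ m)"]
  have "((\<lambda>m. lip k / of_nat N ^ k * fr (k - 1) (E * q ^ m)) has_sum S1) M"
    using lip_m by simp
  moreover have "((\<lambda>m. lip k / of_nat N ^ k * fr (k - 1) (E * q ^ m)) has_sum (lip k / of_nat N ^ k * S)) M"
    by (rule has_sum_cmult_right[OF frM])
  ultimately have S1: "S1 = lip k / of_nat N ^ k * S"
    by (rule has_sum_unique)
  define D where "D l = {m. m > 0 \<and> int N dvd int m - fst v \<and> m dvd l}" for l
  define t' where "t' = (\<lambda>(l, m). of_nat (l div m) ^ (k - 1) * (E ^ (l div m) * q ^ l))"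
  have "(t' has_sum S) (Sigma {1..} D) \<longleftrightarrow> (t has_sum S) (M \<times> {1..})"
  proof (rule has_sum_reindex_bij_witness[of _ "\<lambda>(m, r). (m * r, m)" "\<lambda>(l, m). (m, l div m)"])
    fix x assume "x \<in> Sigma {1..} D"
    then obtain l m where x: "x = (l, m)" "l \<ge> 1" "m > 0" "int N dvd int m - fst v" "m dvd l"
      by (auto simp: D_def)
    then have "l div m > 0"
      by (simp add: div_greater_zero_iff dvd_imp_le)
    then show "(case x of (l, m) \<Rightarrow> (m, l div m)) \<in> M \<times> {1..}"
      using x by (simp add: M_def)
    show "(\<lambda>(m, r). (m * r, m)) (case x of (l, m) \<Rightarrow> (m, l div m)) = x"
      using x by simp
    show "t (case x of (l, m) \<Rightarrow> (m, l div m)) = t' x"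
      using x by (simp add: t_def t'_def)
  qed (auto simp: M_def D_def)
  then have t'S: "(t' has_sum S) (Sigma {1..} D)"
    using tS by simp
  have "((\<lambda>l. eis_div_sum k N v l * q ^ l) has_sum S) {1..}"
  proof (rule has_sum_SigmaD[OF t'S])
    fix l :: nat assume l: "l \<in> {1..}"
    have "finite (D l)"
      by (rule finite_subset[of _ "{m. m dvd l}"]) (use l in \<open>auto simp: D_def\<close>)
    moreover have "eis_div_sum k N v l * q ^ l = (\<Sum>m\<in>D l. t' (l, m))"
      by (simp add: eis_div_sum_def D_def t'_def E_def sum_distrib_right mult.assoc)
    ultimately show "((\<lambda>m. t' (l, m)) has_sum (eis_div_sum k N v l * q ^ l)) (D l)"
      by (rule has_sum_finiteI)
  qed
  then show ?thesis
    using that[of S] U1 S1 by (simp add: U_def q_def)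
qed

text \<open>The row m = 0. Both signs of n occur, which makes the sum an algebraic multiple of
  \<pi>^k for odd k too.\<close>

definition eis_zeta :: "nat \<Rightarrow> nat \<Rightarrow> int \<Rightarrow> complex" where
  "eis_zeta k N a = infsum (\<lambda>n. inverse (of_int n ^ k)) {n. int N dvd n - a \<and> n \<noteq> 0}"

definition eis_fps :: "nat \<Rightarrow> nat \<Rightarrow> int \<times> int \<Rightarrow> complex fps" where
  "eis_fps k N v = Abs_fps (\<lambda>l. if l = 0 then (if int N dvd fst v then eis_zeta k N (snd v) else 0)
     else lip k / of_nat N ^ k * (eis_div_sum k N v l + (- 1) ^ k * eis_div_sum k N (- fst v, - snd v) l))"

lemma eis_zeta_has_sum:
  assumes "k \<ge> 3"
  shows "((\<lambda>n. inverse (of_int n ^ k)) has_sum eis_zeta k N a) {n. int N dvd n - a \<and> n \<noteq> 0}"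
proof -
  have "lterm k \<i> summable_on ((\<lambda>n. (0, n)) ` {n. int N dvd n - a \<and> n \<noteq> 0})"
    by (rule summable_on_subset_banach[OF lterm_summable[of \<i> k]]) (use assms in auto)
  then have "(\<lambda>n. inverse (of_int n ^ k) :: complex) summable_on {n. int N dvd n - a \<and> n \<noteq> 0}"
    by (subst (asm) summable_on_reindex) (auto simp: inj_on_def lterm_def o_def)
  then show ?thesis
    unfolding eis_zeta_def by (rule has_sum_infsum)
qed

text \<open>The row m = 0 gives the constant term, and the rows m < 0 are the rows m > 0 for -v up
  to the sign (-1)^k.\<close>

theorem qexp_Eis:
  assumes N: "N > 0" and k: "k \<ge> 3"
  shows "qexp N (Eis k N v) (eis_fps k N v)"
  unfolding qexp_iff[OF N] has_q_expansion_def
proof (intro ballI)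
  fix z assume "z \<in> uhp"
  then have z: "Im z > 0"
    by simp
  define v' where "v' = (- fst v, - snd v)"
  define Z where "Z = (if int N dvd fst v then eis_zeta k N (snd v) else 0)"
  define C where "C = lip k / of_nat N ^ k"
  obtain S where S: "(lterm k z has_sum (C * S)) {t. fst t > 0 \<and> int N dvd fst t - fst v \<and> int N dvd snd t - snd v}"
    "((\<lambda>l. eis_div_sum k N v l * qq N z ^ l) has_sum S) {1..}"
    unfolding C_def using eis_half[OF N k z] by blast
  obtain S' where S': "(lterm k z has_sum (C * S')) {t. fst t > 0 \<and> int N dvd fst t - fst v' \<and> int N dvd snd t - snd v'}"
    "((\<lambda>l. eis_div_sum k N v' l * qq N z ^ l) has_sum S') {1..}"
    unfolding C_def using eis_half[OF N k z] by blast
  have "((\<lambda>t. (- 1) ^ k * lterm k z t) has_sum ((- 1) ^ k * (C * S')))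
      {t. fst t > 0 \<and> int N dvd fst t - fst v' \<and> int N dvd snd t - snd v'}"
    by (rule has_sum_cmult_right[OF S'(1)])
  also have "?this \<longleftrightarrow> (lterm k z has_sum ((- 1) ^ k * (C * S')))
      {t. fst t < 0 \<and> int N dvd fst t - fst v \<and> int N dvd snd t - snd v}"
  proof (rule has_sum_reindex_bij_witness[of _ "\<lambda>t. (- fst t, - snd t)" "\<lambda>t. (- fst t, - snd t)"])
    have neg: "int N dvd - x - y \<longleftrightarrow> int N dvd x - - y" for x y
      using dvd_minus_iff[of "int N" "x + y"] by (simp add: algebra_simps)
    fix t :: "int \<times> int"
    assume "t \<in> {t. fst t > 0 \<and> int N dvd fst t - fst v' \<and> int N dvd snd t - snd v'}"
    then show "(- fst t, - snd t) \<in> {t. fst t < 0 \<and> int N dvd fst t - fst v \<and> int N dvd snd t - snd v}"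
      by (simp add: v'_def neg)
    have eq: "of_int (fst (- fst t, - snd t)) * z + of_int (snd (- fst t, - snd t)) =
        (- 1) * (of_int (fst t) * z + of_int (snd t))"
      by simp
    have m1: "inverse ((- 1 :: complex) ^ k) = (- 1) ^ k"
      by (cases "even k") auto
    show "lterm k z (- fst t, - snd t) = (- 1) ^ k * lterm k z t"
      unfolding lterm_def eq power_mult_distrib inverse_mult_distrib m1 ..
  next
    have neg: "int N dvd - x - - y \<longleftrightarrow> int N dvd x - y" for x y
      using dvd_minus_iff[of "int N" "x - y"] by (simp add: algebra_simps)
    fix t :: "int \<times> int"
    assume "t \<in> {t. fst t < 0 \<and> int N dvd fst t - fst v \<and> int N dvd snd t - snd v}"
    then show "(- fst t, - snd t) \<in> {t. fst t > 0 \<and> int N dvd fst t - fst v' \<and> int N dvd snd t - snd v'}"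
      by (simp only: v'_def neg mem_Collect_eq fst_conv snd_conv) simp
  qed auto
  finally have neg: "(lterm k z has_sum ((- 1) ^ k * (C * S')))
      {t. fst t < 0 \<and> int N dvd fst t - fst v \<and> int N dvd snd t - snd v}" .
  have zero: "(lterm k z has_sum Z)
      {t. fst t = 0 \<and> int N dvd fst v \<and> int N dvd snd t - snd v \<and> snd t \<noteq> 0}"
  proof (cases "int N dvd fst v")
    case True
    have "(lterm k z has_sum eis_zeta k N (snd v)) ((\<lambda>n. (0, n)) ` {n. int N dvd n - snd v \<and> n \<noteq> 0})"
      using eis_zeta_has_sum[OF k, of N "snd v"]
      by (subst has_sum_reindex) (auto simp: inj_on_def lterm_def o_def)
    moreover have "(\<lambda>n. (0 :: int, n)) ` {n. int N dvd n - snd v \<and> n \<noteq> 0} =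
        {t. fst t = 0 \<and> int N dvd fst v \<and> int N dvd snd t - snd v \<and> snd t \<noteq> 0}"
      using True by (auto simp: image_iff) (metis prod.collapse)?
    ultimately show ?thesis
      by (simp only: Z_def if_P[OF True])
  qed (auto simp: Z_def)
  have "(lterm k z has_sum (Z + C * S + (- 1) ^ k * (C * S')))
    ({t. fst t = 0 \<and> int N dvd fst v \<and> int N dvd snd t - snd v \<and> snd t \<noteq> 0} \<union>
     {t. fst t > 0 \<and> int N dvd fst t - fst v \<and> int N dvd snd t - snd v} \<union>
     {t. fst t < 0 \<and> int N dvd fst t - fst v \<and> int N dvd snd t - snd v})"
    by (intro has_sum_Un_disjoint zero S(1) neg) auto
  also have "({t. fst t = 0 \<and> int N dvd fst v \<and> int N dvd snd t - snd v \<and> snd t \<noteq> 0} \<union>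
     {t. fst t > 0 \<and> int N dvd fst t - fst v \<and> int N dvd snd t - snd v} \<union>
     {t. fst t < 0 \<and> int N dvd fst t - fst v \<and> int N dvd snd t - snd v}) = lat N v"
  proof (rule Set.set_eqI)
    fix t :: "int \<times> int"
    obtain m n where t: "t = (m, n)"
      by (cases t)
    show "t \<in> {t. fst t = 0 \<and> int N dvd fst v \<and> int N dvd snd t - snd v \<and> snd t \<noteq> 0} \<union>
     {t. fst t > 0 \<and> int N dvd fst t - fst v \<and> int N dvd snd t - snd v} \<union>
     {t. fst t < 0 \<and> int N dvd fst t - fst v \<and> int N dvd snd t - snd v} \<longleftrightarrow> t \<in> lat N v"
      unfolding t lat_def by (cases m "0::int" rule: linorder_cases) auto
  qed
  finally have Eis: "Eis k N v z = Z + (C * S + (- 1) ^ k * (C * S'))"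
    unfolding Eis_def by (simp add: infsumI add.assoc)
  have "((\<lambda>l. C * (eis_div_sum k N v l * qq N z ^ l) + (- 1) ^ k * (C * (eis_div_sum k N v' l * qq N z ^ l)))
      has_sum (C * S + (- 1) ^ k * (C * S'))) {1..}"
    by (intro has_sum_add has_sum_cmult_right S(2) S'(2))
  also have "?this \<longleftrightarrow> ((\<lambda>l. fps_nth (eis_fps k N v) l * qq N z ^ l) has_sum (C * S + (- 1) ^ k * (C * S'))) {1..}"
    by (rule has_sum_cong) (simp add: eis_fps_def C_def v'_def algebra_simps)
  finally have "((\<lambda>l. fps_nth (eis_fps k N v) l * qq N z ^ l) has_sum
      (fps_nth (eis_fps k N v) 0 * qq N z ^ 0 + (C * S + (- 1) ^ k * (C * S')))) (insert 0 {1..})"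
    by (intro has_sum_insert) auto
  moreover have "insert 0 {1..} = (UNIV :: nat set)"
    by auto
  ultimately have "(\<lambda>l. fps_nth (eis_fps k N v) l * qq N z ^ l) sums Eis k N v z"
    by (intro has_sum_imp_sums) (simp add: Eis eis_fps_def Z_def)
  then show "(\<lambda>n. fps_nth (eis_fps k N v) n * exp (2 * complex_of_real pi * \<i> * z / of_nat N) ^ n) sums Eis k N v z"
    by (simp add: qq_def)
qed

lemma Eis_MF:
  assumes N: "N > 0" and k: "k \<ge> 3"
  shows "Eis k N v \<in> MF (int k) N"
  unfolding MF_def
proof (intro CollectI conjI ballI allI impI)
  fix \<gamma> z assume \<gamma>: "\<gamma> \<in> Gam N" and z: "Im z > 0"
  have d: "int N dvd \<gamma> $ 1 $ 1 - 1" "int N dvd \<gamma> $ 1 $ 2" "int N dvd \<gamma> $ 2 $ 1" "int N dvd \<gamma> $ 2 $ 2 - 1"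
    using \<gamma> by (auto simp: Gam_def congm_def forall_2)
  have "fst (rowact v \<gamma>) - fst v = fst v * (\<gamma> $ 1 $ 1 - 1) + snd v * \<gamma> $ 2 $ 1"
    "snd (rowact v \<gamma>) - snd v = fst v * \<gamma> $ 1 $ 2 + snd v * (\<gamma> $ 2 $ 2 - 1)"
    by (simp_all add: rowact_def algebra_simps)
  then have "int N dvd fst (rowact v \<gamma>) - fst v" "int N dvd snd (rowact v \<gamma>) - snd v"
    using d by simp_all
  then have "Eis k N (rowact v \<gamma>) = Eis k N v"
    by (rule Eis_cong)
  then show "slash (int k) (Eis k N v) \<gamma> z = Eis k N v z"
    using slash_Eis[OF Gam_SL2Z[OF \<gamma>] z] by simp
next
  fix \<gamma> assume \<gamma>: "\<gamma> \<in> SL2Z"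
  show "\<exists>c. qexp N (slash (int k) (Eis k N v) \<gamma>) c"
    using qexp_Eis[OF N k, of "rowact v \<gamma>"] slash_Eis[OF \<gamma>]
      qexp_cong[of "slash (int k) (Eis k N v) \<gamma>" "Eis k N (rowact v \<gamma>)" N] by blast
qed

text \<open>Lipschitz' formula at the rational point a / N. The argument of \<open>fr\<close> is
  then a root of unity on the boundary of the disc, where only the rational form of
  \<open>fr\<close> gives a value.\<close>

lemma eis_zeta_not_dvd:
  assumes "\<not> int N dvd a" "k \<ge> 3" "N > 0"
  shows "eis_zeta k N a = lip k / of_nat N ^ k * fr (k - 1) (Ex (of_int a / of_nat N))"
proof -
  have ni: "of_int a / (of_nat N :: complex) \<notin> \<int>"
  proof
    assume "of_int a / (of_nat N :: complex) \<in> \<int>"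
    then obtain b where "of_int a / (of_nat N :: complex) = of_int b"
      by (auto elim!: Ints_cases)
    then have "(of_int a :: complex) = of_int (b * int N)"
      using assms by (simp add: field_simps)
    then have "a = b * int N"
      by (simp only: of_int_eq_iff)
    then show False
      using assms by simp
  qed
  have "((\<lambda>n::int. inverse ((0 + of_int n) ^ k)) has_sum
      (lip k / of_nat N ^ k * fr (k - 1) (Ex (of_int a / of_nat N)))) {n. int N dvd n - a}"
    using lipschitz_mod[OF ni, of k 0 a] assms by simp
  moreover have "{n. int N dvd n - a \<and> n \<noteq> 0} = {n. int N dvd n - a}"
    using assms by auto
  ultimately show ?thesis
    unfolding eis_zeta_def by (simp add: infsumI)
qed

lemma eis_zeta_dvd:
  assumes "int N dvd a" "k \<ge> 3" "N > 0"
  shows "eis_zeta k N a = eis_zeta k 1 0 / of_nat N ^ k"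
proof -
  have "((\<lambda>n::int. inverse (of_nat N ^ k) * inverse (of_int n ^ k)) has_sum (inverse (of_nat N ^ k) * eis_zeta k 1 0))
      {n. int 1 dvd n - 0 \<and> n \<noteq> 0}"
    by (intro has_sum_cmult_right eis_zeta_has_sum assms)
  also have "?this \<longleftrightarrow> ((\<lambda>n. inverse (of_int n ^ k)) has_sum (inverse (of_nat N ^ k) * eis_zeta k 1 0))
      {n. int N dvd n - a \<and> n \<noteq> 0}"
    by (rule has_sum_reindex_bij_witness[of _ "\<lambda>n. n div int N" "\<lambda>n. int N * n"])
       (use assms in \<open>auto simp: power_mult_distrib dvd_diff_left_iff\<close>)
  finally show ?thesis
    unfolding eis_zeta_def[of k N] by (simp add: infsumI divide_inverse mult.commute)
qed

text \<open>At integers Lipschitz' formula meets the pole x = 1 of \<open>fr\<close>. So split by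
  parity: the even n give 2^(-k) times the whole sum, and the odd n are the case a / N = 1/2, that
  is, x = -1.\<close>

lemma eis_zeta_1_0:
  assumes k: "k \<ge> 3"
  shows "eis_zeta k 1 0 * (2 ^ k - 1) = lip k * fr (k - 1) (- 1)"
proof -
  have "((\<lambda>n. inverse (of_int n ^ k)) has_sum (eis_zeta k 2 1 + eis_zeta k 2 0))
      ({n. int 2 dvd n - 1 \<and> n \<noteq> 0} \<union> {n. int 2 dvd n - 0 \<and> n \<noteq> 0})"
    by (intro has_sum_Un_disjoint eis_zeta_has_sum k) auto
  moreover have "{n. int 2 dvd n - 1 \<and> n \<noteq> 0} \<union> {n. int 2 dvd n - 0 \<and> n \<noteq> 0} = {n. int 1 dvd n - 0 \<and> n \<noteq> 0}"
    by auto
  ultimately have "((\<lambda>n. inverse (of_int n ^ k)) has_sum (eis_zeta k 2 1 + eis_zeta k 2 0))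
      {n. int 1 dvd n - 0 \<and> n \<noteq> 0}"
    by (simp only:)
  from has_sum_unique[OF eis_zeta_has_sum[OF k, of 1 0] this]
  have 1: "eis_zeta k 1 0 = eis_zeta k 2 1 + eis_zeta k 2 0" .
  have "Ex (1 / 2) = - 1"
    by (simp add: Ex_def)
  then have "eis_zeta k 2 1 = lip k / 2 ^ k * fr (k - 1) (- 1)"
    using eis_zeta_not_dvd[of 2 1 k] k by simp
  moreover have "eis_zeta k 2 0 = eis_zeta k 1 0 / 2 ^ k"
    using eis_zeta_dvd[of 2 0 k] k by simp
  ultimately have "eis_zeta k 1 0 = lip k / 2 ^ k * fr (k - 1) (- 1) + eis_zeta k 1 0 / 2 ^ k"
    using 1 by simp
  then have "eis_zeta k 1 0 * 2 ^ k = (lip k / 2 ^ k * fr (k - 1) (- 1) + eis_zeta k 1 0 / 2 ^ k) * 2 ^ k"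
    by (rule arg_cong)
  also have "\<dots> = lip k * fr (k - 1) (- 1) + eis_zeta k 1 0"
    by (simp add: distrib_right)
  finally show ?thesis
    by (simp add: right_diff_distrib)
qed

subsection \<open>Constants for a derivation\<close>

context derivation
begin

lemma const_ii [simp]: "\<delta> \<i> = 0"
  by (rule const_root[of _ 2]) simp_all

lemma \<delta>_fact [simp]: "\<delta> (fact n) = 0"
  using \<delta>_of_nat[of "fact n"] by simp

lemma eul_const: "\<delta> (coeff (eul n) i) = 0"
proof (induction n arbitrary: i)
  case 0
  show ?case
    by (cases i) (auto simp: coeff_pCons split: nat.split)
next
  case (Suc n)
  have mul: "\<delta> (coeff (p * q) i) = 0" if "\<And>i. \<delta> (coeff p i) = 0" "\<And>i. \<delta> (coeff q i) = 0" for p q :: "complex poly" and i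
    using that by (auto simp: coeff_mult intro!: const_sum const_mult)
  have a: "\<delta> (coeff (pderiv (eul n)) i) = 0" for i
    by (simp add: coeff_pderiv const_mult Suc del: of_nat_Suc)
  have b: "\<delta> (coeff [:1, - 1:] i) = 0" "\<delta> (coeff [:0, 1:] i) = 0" for i
    by (auto simp: coeff_pCons split: nat.split)
  have c: "\<delta> (coeff (of_nat (Suc n) * eul n) i) = 0" for i
    by (simp add: of_nat_poly const_mult Suc del: of_nat_Suc)
  have "\<delta> (coeff (pderiv (eul n) * [:1, - 1:] + of_nat (Suc n) * eul n) i) = 0" for i
    unfolding coeff_add add mul[OF a b(1)] c by simp
  then show ?case
    unfolding eul.simps by (rule mul[OF b(2)])
qed

lemma fr_const: "\<delta> x = 0 \<Longrightarrow> \<delta> (fr n x) = 0"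
  unfolding fr_def poly_altdef
  by (intro const_divide const_sum const_mult const_power eul_const) (simp_all add: \<delta>_diff)

text \<open>A derivation need not kill \<pi>, and no other factor of \<open>lip\<close> can be
  transcendental; this is the origin of all divisions by \<pi>^k below.\<close>

lemma lip_const: "\<delta> (lip k / of_real pi ^ k) = 0"
proof -
  have "lip k / of_real pi ^ k = (- 1) ^ k * (2 * \<i>) ^ k / of_nat (fact (k - 1))"
    by (simp add: lip_def power_mult_distrib)
  also have "\<delta> \<dots> = 0"
    by (intro const_divide const_mult const_power) (simp_all add: const_mult)
  finally show ?thesis .
qed

lemma Ex_rational_const:
  assumes "N > 0"
  shows "\<delta> (Ex (of_int a / of_nat N)) = 0"
proof (rule const_root[OF _ assms])
  have "Ex (of_int a / of_nat N) ^ N = Ex (of_int a)"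
    using assms by (simp add: Ex_of_nat_mult [symmetric])
  also have "\<dots> = 1"
    by (simp add: Ex_eq_1_iff)
  finally show "\<delta> (Ex (of_int a / of_nat N) ^ N) = 0"
    by simp
qed

lemma eis_zeta_const:
  assumes N: "N > 0" and k: "k \<ge> 3"
  shows "\<delta> (eis_zeta k N a / of_real pi ^ k) = 0"
proof (cases "int N dvd a")
  case False
  have "eis_zeta k N a / of_real pi ^ k = (lip k / of_real pi ^ k) * fr (k - 1) (Ex (of_int a / of_nat N)) / of_nat N ^ k"
    using eis_zeta_not_dvd[OF False k N] by simp
  then show ?thesis
    by (simp only:) (intro const_divide const_mult lip_const fr_const Ex_rational_const N const_power, simp)
next
  case True
  have "(2 :: complex) ^ k \<noteq> 1"
    using k by (metis norm_numeral norm_one norm_power not_numeral_le_zero power_eq_1_iff numeral_eq_one_iff semiring_norm(85) zero_neq_numeral)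
  then have nz: "(2 :: complex) ^ k - 1 \<noteq> 0"
    by simp
  have z1: "eis_zeta k 1 0 = lip k * fr (k - 1) (- 1) / (2 ^ k - 1)"
    using eis_zeta_1_0[OF k] nz by (metis nonzero_eq_divide_eq)
  have "eis_zeta k N a / of_real pi ^ k =
      (lip k / of_real pi ^ k) * fr (k - 1) (- 1) / (2 ^ k - 1) / of_nat N ^ k"
    unfolding eis_zeta_dvd[OF True k N] z1 by (simp add: mult_ac)
  then show ?thesis
    by (simp only:) (intro const_divide const_mult lip_const fr_const const_power; simp add: \<delta>_diff const_power)
qed

lemma eis_fps_const:
  assumes N: "N > 0" and k: "k \<ge> 3"
  shows "\<delta> (fps_nth (eis_fps k N v) l / of_real pi ^ k) = 0"
proof (cases "l = 0")
  case True
  then show ?thesis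
    using eis_zeta_const[OF N k] by (simp add: eis_fps_def)
next
  case False
  have div_sum: "\<delta> (eis_div_sum k N v l) = 0" for v l
    unfolding eis_div_sum_def by (intro const_sum const_mult const_power Ex_rational_const N) simp
  have "fps_nth (eis_fps k N v) l / of_real pi ^ k = (lip k / of_real pi ^ k) *
      (eis_div_sum k N v l + (- 1) ^ k * eis_div_sum k N (- fst v, - snd v) l) / of_nat N ^ k"
    using False by (simp add: eis_fps_def)
  also have "\<delta> \<dots> = 0"
    by (intro const_divide const_mult lip_const const_power)
       (simp_all add: add div_sum const_mult const_power)
  finally show ?thesis .
qed


text \<open>The counterpart of forms with algebraic coefficients for a single \<delta>. All cusps
  are included so that the notion is stable under slashing.\<close>

definition cform :: "int \<Rightarrow> nat \<Rightarrow> (complex \<Rightarrow> complex) \<Rightarrow> bool" where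
  "cform k N u \<longleftrightarrow> u \<in> MF k N \<and>
     (\<forall>\<gamma>\<in>SL2Z. \<forall>c. qexp N (slash k u \<gamma>) c \<longrightarrow> (\<forall>n. \<delta> (fps_nth c n) = 0))"

text \<open>The span over \<complex>: whatever \<delta> does not kill is carried by the scalars t,
  so \<delta> acts on F through them.\<close>

definition cspan :: "int \<Rightarrow> nat \<Rightarrow> (complex \<Rightarrow> complex) \<Rightarrow> bool" where
  "cspan k N F \<longleftrightarrow> (\<exists>(n::nat) u t. (\<forall>i<n. cform k N (u i)) \<and>
     (\<forall>z. Im z > 0 \<longrightarrow> F z = (\<Sum>i<n. t i * u i z)))"

lemma cspanE:
  assumes "cspan k N F"
  obtains n :: nat and u t where "\<And>i. i < n \<Longrightarrow> cform k N (u i)"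
    "\<And>z. Im z > 0 \<Longrightarrow> F z = (\<Sum>i<n. t i * u i z)"
  using assms unfolding cspan_def by blast

lemma cspanI:
  fixes n :: nat
  assumes "\<And>i. i < n \<Longrightarrow> cform k N (u i)" "\<And>z. Im z > 0 \<Longrightarrow> F z = (\<Sum>i<n. t i * u i z)"
  shows "cspan k N F"
  using assms unfolding cspan_def by blast

lemma cform_MF: "cform k N u \<Longrightarrow> u \<in> MF k N"
  by (simp add: cform_def)

lemma cform_const: "cform k N u \<Longrightarrow> \<gamma> \<in> SL2Z \<Longrightarrow> qexp N (slash k u \<gamma>) c \<Longrightarrow> \<delta> (fps_nth c n) = 0"
  by (simp add: cform_def)

lemma cform_const1: "cform k N u \<Longrightarrow> qexp N u c \<Longrightarrow> \<delta> (fps_nth c n) = 0"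
  using cform_const[OF _ SL2Z_1, of k N u c n] qexp_cong[of "slash k u (mat 1)" u N c] by simp

lemma cformI:
  assumes "u \<in> MF k N" "N > 0"
    and "\<And>\<gamma>. \<gamma> \<in> SL2Z \<Longrightarrow> \<exists>c. qexp N (slash k u \<gamma>) c \<and> (\<forall>n. \<delta> (fps_nth c n) = 0)"
  shows "cform k N u"
  unfolding cform_def using assms qexp_unique by metis

lemma cform_qexpE:
  assumes "cform k N u" "\<gamma> \<in> SL2Z"
  obtains c where "qexp N (slash k u \<gamma>) c" "\<And>n. \<delta> (fps_nth c n) = 0"
proof -
  obtain c where "qexp N (slash k u \<gamma>) c"
    using MF_qexpE[OF cform_MF[OF assms(1)] assms(2)] .
  then show ?thesis
    using that cform_const[OF assms] by blast
qed

lemma cform_mult: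
  assumes u: "cform k N u" and v: "cform l N v" and N: "N > 0"
  shows "cform (k + l) N (\<lambda>z. u z * v z)"
proof (rule cformI[OF MF_mult[OF cform_MF[OF u] cform_MF[OF v] N] N])
  fix \<gamma> assume \<gamma>: "\<gamma> \<in> SL2Z"
  obtain a where a: "qexp N (slash k u \<gamma>) a" "\<And>n. \<delta> (fps_nth a n) = 0"
    using cform_qexpE[OF u \<gamma>] by blast
  obtain b where b: "qexp N (slash l v \<gamma>) b" "\<And>n. \<delta> (fps_nth b n) = 0"
    using cform_qexpE[OF v \<gamma>] by blast
  have "qexp N (slash (k + l) (\<lambda>z. u z * v z) \<gamma>) (a * b)"
    using qexp_mult[OF a(1) b(1) N]
    by (subst qexp_cong[where G = "\<lambda>z. slash k u \<gamma> z * slash l v \<gamma> z"]) (simp_all add: slash_prod2 \<gamma>)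
  moreover have "\<delta> (fps_nth (a * b) n) = 0" for n
    using a(2) b(2) by (simp add: fps_mult_nth const_sum const_mult)
  ultimately show "\<exists>c. qexp N (slash (k + l) (\<lambda>z. u z * v z) \<gamma>) c \<and> (\<forall>n. \<delta> (fps_nth c n) = 0)"
    by blast
qed

lemma cform_constant:
  assumes "\<delta> x = 0" "N > 0"
  shows "cform 0 N (\<lambda>z. x)"
proof (rule cformI[OF MF_const assms(2)])
  fix \<gamma>
  have "qexp N (slash 0 (\<lambda>z. x) \<gamma>) (fps_const x)"
    by (simp add: slash_const_0[abs_def] qexp_fps_const)
  then show "\<exists>c. qexp N (slash 0 (\<lambda>z. x) \<gamma>) c \<and> (\<forall>n. \<delta> (fps_nth c n) = 0)"
    using assms by (intro exI[of _ "fps_const x"]) auto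
qed

lemma cform_cmult: "cform k N u \<Longrightarrow> \<delta> x = 0 \<Longrightarrow> N > 0 \<Longrightarrow> cform k N (\<lambda>z. x * u z)"
  using cform_mult[OF cform_constant, of x N k u] by simp

lemma cform_add:
  assumes u: "cform k N u" and v: "cform k N v" and N: "N > 0"
  shows "cform k N (\<lambda>z. u z + v z)"
proof (rule cformI[OF MF_add[OF cform_MF[OF u] cform_MF[OF v] N] N])
  fix \<gamma> assume \<gamma>: "\<gamma> \<in> SL2Z"
  obtain a where a: "qexp N (slash k u \<gamma>) a" "\<And>n. \<delta> (fps_nth a n) = 0"
    using cform_qexpE[OF u \<gamma>] by blast
  obtain b where b: "qexp N (slash k v \<gamma>) b" "\<And>n. \<delta> (fps_nth b n) = 0"
    using cform_qexpE[OF v \<gamma>] by blast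
  have "qexp N (slash k (\<lambda>z. u z + v z) \<gamma>) (a + b)"
    using qexp_add[OF a(1) b(1) N] by (simp add: slash_add[abs_def])
  moreover have "\<delta> (fps_nth (a + b) n) = 0" for n
    using a(2) b(2) by (simp add: add)
  ultimately show "\<exists>c. qexp N (slash k (\<lambda>z. u z + v z) \<gamma>) c \<and> (\<forall>n. \<delta> (fps_nth c n) = 0)"
    by blast
qed

lemma cform_diff:
  assumes "cform k N u" "cform k N v" "N > 0"
  shows "cform k N (\<lambda>z. u z - v z)"
  using cform_add[OF assms(1) cform_cmult[OF assms(2), of "- 1"] assms(3)] assms(3) by simp

lemma cform_power: "cform k N u \<Longrightarrow> N > 0 \<Longrightarrow> cform (int n * k) N (\<lambda>z. u z ^ n)"
proof (induction n)
  case (Suc n)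
  have "int (Suc n) * k = k + int n * k"
    by (simp add: algebra_simps)
  then show ?case
    using cform_mult[OF Suc.prems(1) Suc.IH[OF Suc.prems] Suc.prems(2)] by simp
qed (simp add: cform_constant)

lemma cform_prod:
  "(\<And>i. i \<in> I \<Longrightarrow> cform k N (u i)) \<Longrightarrow> N > 0 \<Longrightarrow> finite I \<Longrightarrow>
     cform (int (card I) * k) N (\<lambda>z. \<Prod>i\<in>I. u i z)"
proof (induction I rule: infinite_finite_induct)
  case (insert i I)
  have "int (card (insert i I)) * k = k + int (card I) * k"
    using insert.hyps by (simp add: algebra_simps)
  then show ?case
    using cform_mult[of k N "u i" "int (card I) * k" "\<lambda>z. \<Prod>i\<in>I. u i z"] insert by simp
qed (simp_all add: cform_constant)

lemma cform_slash:
  assumes u: "cform k N u" and N: "N > 0" and \<gamma>: "\<gamma> \<in> SL2Z"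
  shows "cform k N (slash k u \<gamma>)"
proof (rule cformI[OF MF_slash[OF cform_MF[OF u] \<gamma>] N])
  fix \<beta> assume \<beta>: "\<beta> \<in> SL2Z"
  obtain a where a: "qexp N (slash k u (\<gamma> ** \<beta>)) a" "\<And>n. \<delta> (fps_nth a n) = 0"
    using cform_qexpE[OF u SL2Z_mult[OF \<gamma> \<beta>]] by blast
  have "qexp N (slash k (slash k u \<gamma>) \<beta>) a"
    using a(1) by (subst qexp_cong[where G = "slash k u (\<gamma> ** \<beta>)"]) (simp_all add: slash_mult \<beta>)
  then show "\<exists>c. qexp N (slash k (slash k u \<gamma>) \<beta>) c \<and> (\<forall>n. \<delta> (fps_nth c n) = 0)"
    using a(2) by blast
qed

lemma cform_raise:
  assumes u: "cform k N u" and N: "N > 0" "m > 0"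
  shows "cform k (N * m) u"
proof (rule cformI[OF MF_raise[OF cform_MF[OF u] N]])
  fix \<gamma> assume \<gamma>: "\<gamma> \<in> SL2Z"
  obtain a where a: "qexp N (slash k u \<gamma>) a" "\<And>n. \<delta> (fps_nth a n) = 0"
    using cform_qexpE[OF u \<gamma>] by blast
  then show "\<exists>c. qexp (N * m) (slash k u \<gamma>) c \<and> (\<forall>n. \<delta> (fps_nth c n) = 0)"
    using qexp_spread[OF a(1) N] by (intro exI[of _ "fps_spread m a"]) (simp add: fps_spread_nth)
qed (use N in simp)

lemma cform_Eis:
  assumes "N > 0" "k \<ge> 3"
  shows "cform (int k) N (\<lambda>z. inverse (of_real pi ^ k) * Eis k N v z)"
proof (rule cformI[OF MF_cmult[OF Eis_MF[OF assms] assms(1)] assms(1)])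
  fix \<gamma> assume \<gamma>: "\<gamma> \<in> SL2Z"
  have "qexp N (\<lambda>z. inverse (of_real pi ^ k) * Eis k N (rowact v \<gamma>) z)
      (fps_const (inverse (of_real pi ^ k)) * eis_fps k N (rowact v \<gamma>))"
    by (intro qexp_cmult qexp_Eis assms)
  then have "qexp N (slash (int k) (\<lambda>z. inverse (of_real pi ^ k) * Eis k N v z) \<gamma>)
      (fps_const (inverse (of_real pi ^ k)) * eis_fps k N (rowact v \<gamma>))"
    by (subst qexp_cong[where G = "\<lambda>z. inverse (of_real pi ^ k) * Eis k N (rowact v \<gamma>) z"])
       (simp_all add: slash_cmult slash_Eis \<gamma>)
  moreover have "\<delta> (fps_nth (fps_const (inverse (of_real pi ^ k)) * eis_fps k N (rowact v \<gamma>)) n) = 0" for n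
    using eis_fps_const[OF assms] by (simp add: divide_inverse mult.commute)
  ultimately show "\<exists>c. qexp N (slash (int k) (\<lambda>z. inverse (of_real pi ^ k) * Eis k N v z) \<gamma>) c \<and>
      (\<forall>n. \<delta> (fps_nth c n) = 0)"
    by blast
qed

lemma cspan_cform: "cform k N u \<Longrightarrow> cspan k N u"
  unfolding cspan_def by (intro exI[of _ 1] exI[of _ "\<lambda>_. u"] exI[of _ "\<lambda>_. 1"]) simp

lemma cspan_cong: "(\<And>z. Im z > 0 \<Longrightarrow> F z = G z) \<Longrightarrow> cspan k N G \<Longrightarrow> cspan k N F"
  unfolding cspan_def by metis

lemma cspan_0: "cspan k N (\<lambda>z. 0)"
  unfolding cspan_def by (intro exI[of _ 0]) simp

lemma cspan_add:
  assumes "cspan k N F" "cspan k N G"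
  shows "cspan k N (\<lambda>z. F z + G z)"
proof -
  obtain n :: nat and u t where 1: "\<And>i. i < n \<Longrightarrow> cform k N (u i)"
    "\<And>z. Im z > 0 \<Longrightarrow> F z = (\<Sum>i<n. t i * u i z)"
    using cspanE[OF assms(1)] by blast
  obtain m :: nat and v s where 2: "\<And>i. i < m \<Longrightarrow> cform k N (v i)"
    "\<And>z. Im z > 0 \<Longrightarrow> G z = (\<Sum>i<m. s i * v i z)"
    using cspanE[OF assms(2)] by blast
  define w where "w i = (if i < n then u i else v (i - n))" for i
  define r where "r i = (if i < n then t i else s (i - n))" for i
  have split: "(\<Sum>i<n + m. r i * w i z) = (\<Sum>i<n. t i * u i z) + (\<Sum>i<m. s i * v i z)" for z
  proof -
    have "(\<Sum>i<n + m. r i * w i z) = (\<Sum>i<n. r i * w i z) + (\<Sum>i<m. r (n + i) * w (n + i) z)"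
      by (induction m) (simp_all add: add.assoc)
    also have "\<dots> = (\<Sum>i<n. t i * u i z) + (\<Sum>i<m. s i * v i z)"
      by (simp add: r_def w_def)
    finally show ?thesis .
  qed
  show ?thesis
    by (rule cspanI[of "n + m" k N w _ r]) (use 1 2 split in \<open>auto simp: w_def\<close>)
qed

lemma cspan_cmult: "cspan k N F \<Longrightarrow> cspan k N (\<lambda>z. x * F z)"
proof -
  assume "cspan k N F"
  then obtain n :: nat and u t where 1: "\<And>i. i < n \<Longrightarrow> cform k N (u i)"
    "\<And>z. Im z > 0 \<Longrightarrow> F z = (\<Sum>i<n. t i * u i z)"
    using cspanE by blast
  show ?thesis
    by (rule cspanI[of n k N u _ "\<lambda>i. x * t i"]) (use 1 in \<open>simp_all add: sum_distrib_left mult.assoc\<close>)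
qed

lemma cspan_sum: "finite I \<Longrightarrow> (\<And>i. i \<in> I \<Longrightarrow> cspan k N (F i)) \<Longrightarrow> cspan k N (\<lambda>z. \<Sum>i\<in>I. F i z)"
  by (induction I rule: finite_induct) (auto intro: cspan_0 cspan_add)

lemma cspan_mult:
  assumes F: "cspan k N F" and v: "cform l N v" and N: "N > 0"
  shows "cspan (l + k) N (\<lambda>z. v z * F z)"
proof -
  obtain n :: nat and u t where 1: "\<And>i. i < n \<Longrightarrow> cform k N (u i)"
    "\<And>z. Im z > 0 \<Longrightarrow> F z = (\<Sum>i<n. t i * u i z)"
    using cspanE[OF F] by blast
  show ?thesis
    by (rule cspanI[of n _ N "\<lambda>i z. v z * u i z" _ t])
       (use 1 cform_mult[OF v 1(1) N] in \<open>simp_all add: sum_distrib_left mult_ac\<close>)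
qed

lemma cspan_raise: "cspan k N F \<Longrightarrow> N > 0 \<Longrightarrow> m > 0 \<Longrightarrow> cspan k (N * m) F"
  unfolding cspan_def using cform_raise by metis

end

subsection \<open>Level 1\<close>

lemma lip_nonzero: "lip k \<noteq> 0"
  by (simp add: lip_def)

lemma fr_3_minus_1: "fr 3 (- 1) = 1 / 8" and fr_5_minus_1: "fr 5 (- 1) = - 1 / 4"
  by (simp_all add: fr_def eval_nat_numeral of_nat_poly pderiv_pCons)

lemma eis_zeta_4: "eis_zeta 4 1 0 = lip 4 / 120" and eis_zeta_6: "eis_zeta 6 1 0 = - lip 6 / 252"
proof -
  have "eis_zeta 4 1 0 * 15 = lip 4 * (1 / 8)"
    using eis_zeta_1_0[of 4] fr_3_minus_1 by simp
  then show "eis_zeta 4 1 0 = lip 4 / 120"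
    by (simp add: field_simps)
  have "eis_zeta 6 1 0 * 63 = lip 6 * (- 1 / 4)"
    using eis_zeta_1_0[of 6] fr_5_minus_1 by simp
  then show "eis_zeta 6 1 0 = - lip 6 / 252"
    by (simp add: field_simps)
qed

lemma eis_div_sum_1: "eis_div_sum k 1 (0, 0) 1 = 1"
proof -
  have "{m. m > 0 \<and> int 1 dvd int m - fst (0, 0) \<and> m dvd (1::nat)} = {1}"
    by auto
  then show ?thesis
    by (simp add: eis_div_sum_def Ex_def)
qed

definition E4 :: "complex \<Rightarrow> complex" where "E4 z = inverse (eis_zeta 4 1 0) * Eis 4 1 (0, 0) z"

definition E6 :: "complex \<Rightarrow> complex" where "E6 z = inverse (eis_zeta 6 1 0) * Eis 6 1 (0, 0) z"

text \<open>This is 1728 times the discriminant function.\<close>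

definition Delta :: "complex \<Rightarrow> complex" where "Delta z = E4 z ^ 3 - E6 z ^ 2"

definition E4_fps :: "complex fps" where "E4_fps = fps_const (inverse (eis_zeta 4 1 0)) * eis_fps 4 1 (0, 0)"

definition E6_fps :: "complex fps" where "E6_fps = fps_const (inverse (eis_zeta 6 1 0)) * eis_fps 6 1 (0, 0)"

definition Delta_fps :: "complex fps" where "Delta_fps = E4_fps ^ 3 - E6_fps ^ 2"

lemma E4_MF: "E4 \<in> MF 4 1" and E6_MF: "E6 \<in> MF 6 1"
  using MF_cmult[OF Eis_MF[of 1 4 "(0, 0)"]] MF_cmult[OF Eis_MF[of 1 6 "(0, 0)"]]
  by (simp_all add: E4_def[abs_def] E6_def[abs_def])

lemma qexp_E4: "qexp 1 E4 E4_fps" and qexp_E6: "qexp 1 E6 E6_fps"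
  unfolding E4_def[abs_def] E4_fps_def E6_def[abs_def] E6_fps_def
  by (intro qexp_cmult qexp_Eis; simp)+

lemma qexp_Delta: "qexp 1 Delta Delta_fps"
  unfolding Delta_def[abs_def] Delta_fps_def
  by (intro qexp_diff qexp_power qexp_E4 qexp_E6) simp_all

lemma Delta_MF: "Delta \<in> MF 12 1"
  using MF_diff[of "\<lambda>z. E4 z ^ 3" 12 1 "\<lambda>z. E6 z ^ 2"] MF_power[OF E4_MF, of 3] MF_power[OF E6_MF, of 2]
  by (simp add: Delta_def[abs_def])

lemma E4_fps_nth: "fps_nth E4_fps 0 = 1" "fps_nth E4_fps 1 = 240"
  and E6_fps_nth: "fps_nth E6_fps 0 = 1" "fps_nth E6_fps 1 = - 504"
proof -
  have "eis_zeta 4 1 0 \<noteq> 0" "lip 4 * inverse (eis_zeta 4 1 0) = 120"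
    "eis_zeta 6 1 0 \<noteq> 0" "lip 6 * inverse (eis_zeta 6 1 0) = - 252"
    unfolding eis_zeta_4 eis_zeta_6 using lip_nonzero[of 4] lip_nonzero[of 6] by simp_all
  then show "fps_nth E4_fps 0 = 1" "fps_nth E4_fps 1 = 240" "fps_nth E6_fps 0 = 1" "fps_nth E6_fps 1 = - 504"
    using eis_div_sum_1[of 4] eis_div_sum_1[of 6] by (simp_all add: E4_fps_def E6_fps_def eis_fps_def)
qed

lemma fps_mult_nth_Suc_0: "fps_nth (f * g) (Suc 0) = fps_nth f 0 * fps_nth g 1 + fps_nth f 1 * fps_nth g 0"
  by (simp add: fps_mult_nth)

lemma Delta_fps_nth: "fps_nth Delta_fps 0 = 0" "fps_nth Delta_fps 1 = 1728"
  using E4_fps_nth E6_fps_nth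
  by (simp_all add: Delta_fps_def power3_eq_cube power2_eq_square fps_mult_nth_Suc_0)

lemma Delta_fps_nonzero: "Delta_fps \<noteq> 0"
  using Delta_fps_nth(2) by force

lemma subdegree_Delta_fps: "subdegree Delta_fps = 1"
  by (rule subdegreeI) (use Delta_fps_nth in auto)

lemma Delta_nonzero: "Im z > 0 \<Longrightarrow> Delta z \<noteq> 0"
proof -
  assume z: "Im z > 0"
  obtain z0 where "Im z0 > 0" "Delta z0 \<noteq> 0"
    using qexp_eq_0_iff[OF qexp_Delta] Delta_fps_nonzero by auto
  then show ?thesis
    using weight_12_no_zero(2)[OF Delta_MF qexp_Delta Delta_fps_nth(1) _ _ z] by blast
qed

lemma MF1_divide_Delta:
  assumes F: "F \<in> MF k 1" and a: "qexp 1 F a" "fps_nth a 0 = 0"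
  shows "(\<lambda>z. F z / Delta z) \<in> MF (k - 12) 1"
proof -
  obtain c where c: "qexp 1 (\<lambda>z. F z / Delta z) c"
    using qexp_divide[OF a(1) qexp_Delta _ Delta_nonzero] a(2) subdegree_Delta_fps by auto
  have inv: "slash (k - 12) (\<lambda>z. F z / Delta z) \<gamma> z = F z / Delta z" if \<gamma>: "\<gamma> \<in> SL2Z" and z: "Im z > 0" for \<gamma> z
  proof -
    have "slash (k - 12 + 12) (\<lambda>z. F z / Delta z * Delta z) \<gamma> z =
        slash (k - 12) (\<lambda>z. F z / Delta z) \<gamma> z * slash 12 Delta \<gamma> z"
      using \<gamma> z by (intro slash_prod2) auto
    also have "slash 12 Delta \<gamma> z = Delta z"
      using MF1_slash[OF Delta_MF \<gamma> z] .
    also have "slash (k - 12 + 12) (\<lambda>z. F z / Delta z * Delta z) \<gamma> z = slash k F \<gamma> z"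
      unfolding diff_add_cancel by (rule slash_cong) (use \<gamma> z Delta_nonzero in auto)
    also have "slash k F \<gamma> z = F z"
      using MF1_slash[OF F \<gamma> z] .
    finally show ?thesis
      using Delta_nonzero[OF z] by (simp add: field_simps)
  qed
  show ?thesis
    unfolding MF_def
  proof (intro CollectI conjI ballI allI impI)
    fix \<gamma> assume \<gamma>: "\<gamma> \<in> SL2Z"
    have "qexp 1 (slash (k - 12) (\<lambda>z. F z / Delta z) \<gamma>) c"
      using c by (subst qexp_cong[where G = "\<lambda>z. F z / Delta z"]) (simp_all add: inv \<gamma>)
    then show "\<exists>c. qexp 1 (slash (k - 12) (\<lambda>z. F z / Delta z) \<gamma>) c"
      by blast
  qed (simp add: inv Gam_SL2Z)
qed

lemma MF1_odd_eq_0: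
  assumes F: "F \<in> MF k 1" and k: "odd k" and z: "Im z > 0"
  shows "F z = 0"
proof -
  define J where "J = mat2 (- 1) 0 0 (- 1)"
  have J: "J \<in> SL2Z"
    by (simp add: J_def SL2Z_det det_mat2)
  have "slash k F J z = (- 1) powi (- k) * F z"
    by (simp add: slash_def J_def aut_factor_def mat_act_def moebius_def)
  also have "(- 1 :: complex) powi (- k) = - 1"
    using k by (simp add: power_int_minus_left)
  finally show ?thesis
    using MF1_slash[OF F J z] by simp
qed

text \<open>Otherwise F / Delta would be a nonzero form of negative weight.\<close>

lemma MF1_small_eq_0:
  assumes F: "F \<in> MF k 1" and a: "qexp 1 F a" "fps_nth a 0 = 0" and k: "k < 12" and z: "Im z > 0"
  shows "F z = 0"
proof -
  have "(\<lambda>z. F z / Delta z) \<in> MF (k - 12) 1"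
    by (rule MF1_divide_Delta[OF F a])
  moreover obtain c where "qexp 1 (\<lambda>z. F z / Delta z) c"
    using MF_qexp1E[OF calculation] .
  ultimately have "F z / Delta z = 0"
    using MF1_weight_nonpos_eq_0[of "\<lambda>z. F z / Delta z" "k - 12" c z] k z by simp
  then show ?thesis
    using Delta_nonzero[OF z] by simp
qed

text \<open>By the previous lemma, F^2 = x^2 E4 and F^3 = x^3 E6, where x is the constant term.
  Comparing sixth powers gives x^6 Delta = 0, so x = 0 and the previous lemma applies to F
  itself.\<close>

lemma MF1_weight_2:
  assumes F: "F \<in> MF 2 1" and z: "Im z > 0"
  shows "F z = 0"
proof -
  obtain a where a: "qexp 1 F a"
    using MF_qexp1E[OF F] .
  define x where "x = fps_nth a 0"
  have "F z ^ 2 - x ^ 2 * E4 z = 0" if z: "Im z > 0" for z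
  proof (rule MF1_small_eq_0[of "\<lambda>z. F z ^ 2 - x ^ 2 * E4 z" 4 "a ^ 2 - fps_const (x ^ 2) * E4_fps"])
    show "(\<lambda>z. F z ^ 2 - x ^ 2 * E4 z) \<in> MF 4 1"
      using MF_power[OF F, of 2] by (intro MF_diff MF_cmult E4_MF) simp_all
    show "qexp 1 (\<lambda>z. F z ^ 2 - x ^ 2 * E4 z) (a ^ 2 - fps_const (x ^ 2) * E4_fps)"
      by (intro qexp_diff qexp_cmult qexp_power a qexp_E4) simp_all
  qed (use z in \<open>simp_all add: E4_fps_nth x_def power2_eq_square\<close>)
  then have 2: "F z ^ 2 = x ^ 2 * E4 z" if "Im z > 0" for z
    using that by simp
  have "F z ^ 3 - x ^ 3 * E6 z = 0" if z: "Im z > 0" for z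
  proof (rule MF1_small_eq_0[of "\<lambda>z. F z ^ 3 - x ^ 3 * E6 z" 6 "a ^ 3 - fps_const (x ^ 3) * E6_fps"])
    show "(\<lambda>z. F z ^ 3 - x ^ 3 * E6 z) \<in> MF 6 1"
      using MF_power[OF F, of 3] by (intro MF_diff MF_cmult E6_MF) simp_all
    show "qexp 1 (\<lambda>z. F z ^ 3 - x ^ 3 * E6 z) (a ^ 3 - fps_const (x ^ 3) * E6_fps)"
      by (intro qexp_diff qexp_cmult qexp_power a qexp_E6) simp_all
  qed (use z in \<open>simp_all add: E6_fps_nth x_def power3_eq_cube\<close>)
  then have 3: "F z ^ 3 = x ^ 3 * E6 z" if "Im z > 0" for z
    using that by simp
  have "(F z ^ 2) ^ 3 = (F z ^ 3) ^ 2"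
    by (simp add: power_mult [symmetric])
  then have "(x ^ 2 * E4 z) ^ 3 = (x ^ 3 * E6 z) ^ 2"
    by (simp only: 2[OF z] 3[OF z])
  then have "x ^ 6 * Delta z = 0"
    by (simp add: power_mult_distrib power_mult [symmetric] Delta_def right_diff_distrib)
  then have "x = 0"
    using Delta_nonzero[OF z] by simp
  then show ?thesis
    using MF1_small_eq_0[OF F a _ _ z] by (simp add: x_def)
qed

context derivation
begin

lemma cform_E4: "cform 4 1 E4"
proof -
  have "\<delta> (inverse (eis_zeta 4 1 0 / of_real pi ^ 4)) = 0"
    by (intro const_inverse eis_zeta_const) simp_all
  from cform_cmult[OF cform_Eis[of 1 4 "(0, 0)"] this] show ?thesis
    by (simp add: E4_def[abs_def] field_simps)
qed

lemma cform_E6: "cform 6 1 E6"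
proof -
  have "\<delta> (inverse (eis_zeta 6 1 0 / of_real pi ^ 6)) = 0"
    by (intro const_inverse eis_zeta_const) simp_all
  from cform_cmult[OF cform_Eis[of 1 6 "(0, 0)"] this] show ?thesis
    by (simp add: E6_def[abs_def] field_simps)
qed

lemma cform_Delta: "cform 12 1 Delta"
  using cform_diff[of 12 1 "\<lambda>z. E4 z ^ 3" "\<lambda>z. E6 z ^ 2"] cform_power[OF cform_E4, of 3]
    cform_power[OF cform_E6, of 2] by (simp add: Delta_def[abs_def])

text \<open>Induction on the weight in steps of 12: a monomial in E4 and E6 of weight k removes the
  constant term, and the remainder is divisible by Delta. Such monomials exist in all even weights
  from 4 on; odd weights and weight 2 contain only 0, and weight 0 only constants.\<close>

theorem level_1_cspan:
  assumes "F \<in> MF k 1"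
  shows "cspan k 1 F"
proof (cases "k < 0")
  case True
  obtain a where "qexp 1 F a"
    using MF_qexp1E[OF assms] .
  then have "F z = 0" if "Im z > 0" for z
    using MF1_weight_nonpos_eq_0[OF assms _ _ _ that] True by auto
  then show ?thesis
    by (rule cspan_cong[OF _ cspan_0])
next
  case False
  then obtain n where "k = int n"
    by (metis int_nat_eq not_le_imp_less nat_0_le)
  then show ?thesis
    using assms
  proof (induction n arbitrary: k F rule: less_induct)
    case (less n)
    obtain a where a: "qexp 1 F a"
      using MF_qexp1E[OF less.prems(2)] .
    consider "odd n" | "n = 0" | "n = 2" | i j where "n = 4 * i + 6 * j" "n \<ge> 4"
    proof (cases "odd n \<or> n = 0 \<or> n = 2")
      case False
      then obtain m where m: "n = 2 * m" "m \<ge> 2"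
        by (auto elim!: evenE)
      show ?thesis
      proof (cases "even m")
        case True
        then obtain i where "m = 2 * i" ..
        then show ?thesis
          using that(4)[of i 0] m by simp
      next
        case False
        then obtain i where "m = 2 * i + 1" ..
        then show ?thesis
          using that(4)[of "i - 1" 1] m by simp
      qed
    qed blast
    then show ?case
    proof cases
      case 1
      then have "F z = 0" if "Im z > 0" for z
        using MF1_odd_eq_0[OF less.prems(2) _ that] less.prems(1) by simp
      then show ?thesis
        by (rule cspan_cong[OF _ cspan_0])
    next
      case 2
      have "F z - fps_nth a 0 = 0" if z: "Im z > 0" for z
      proof (rule MF1_small_eq_0[of "\<lambda>z. F z - fps_nth a 0" 0 "a - fps_const (fps_nth a 0)"])
        show "(\<lambda>z. F z - fps_nth a 0) \<in> MF 0 1"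
          using less.prems 2 by (intro MF_diff MF_const) auto
        show "qexp 1 (\<lambda>z. F z - fps_nth a 0) (a - fps_const (fps_nth a 0))"
          by (intro qexp_diff a qexp_fps_const) simp
      qed (use z in simp_all)
      then have "F z = fps_nth a 0 * 1" if "Im z > 0" for z
        using that by simp
      moreover have "cspan k 1 (\<lambda>z. fps_nth a 0 * 1)"
        using less.prems 2 by (intro cspan_cmult cspan_cform) (simp add: cform_constant)
      ultimately show ?thesis
        by (rule cspan_cong)
    next
      case 3
      then have "F z = 0" if "Im z > 0" for z
        using MF1_weight_2[OF _ that] less.prems by simp
      then show ?thesis
        by (rule cspan_cong[OF _ cspan_0])
    next
      case (4 i j)
      define P where "P z = E4 z ^ i * E6 z ^ j" for z
      define b where "b = E4_fps ^ i * E6_fps ^ j"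
      have kij: "k = int i * 4 + int j * 6"
        using less.prems 4 by simp
      have P: "cform k 1 P"
        unfolding P_def[abs_def] kij
        by (intro cform_mult cform_power cform_E4 cform_E6) simp_all
      have b: "qexp 1 P b" "fps_nth b 0 = 1"
        unfolding P_def[abs_def] b_def
        by (intro qexp_mult qexp_power qexp_E4 qexp_E6; simp)
           (simp add: E4_fps_nth E6_fps_nth fps_power_zeroth)
      define G where "G z = F z - fps_nth a 0 * P z" for z
      have G: "G \<in> MF k 1"
        unfolding G_def[abs_def] by (intro MF_diff MF_cmult less.prems(2) cform_MF[OF P]) simp_all
      have qG: "qexp 1 G (a - fps_const (fps_nth a 0) * b)"
        unfolding G_def[abs_def] by (intro qexp_diff qexp_cmult a b(1)) simp_all
      have H: "(\<lambda>z. G z / Delta z) \<in> MF (k - 12) 1"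
        by (rule MF1_divide_Delta[OF G qG]) (simp add: b(2))
      have "cspan (k - 12) 1 (\<lambda>z. G z / Delta z)"
      proof (cases "n < 12")
        case True
        obtain c where "qexp 1 (\<lambda>z. G z / Delta z) c"
          using MF_qexp1E[OF H] .
        then have "G z / Delta z = 0" if "Im z > 0" for z
          using MF1_weight_nonpos_eq_0[OF H _ _ _ that] True less.prems(1) by auto
        then show ?thesis
          by (rule cspan_cong[OF _ cspan_0])
      next
        case False
        then show ?thesis
          using less.IH[of "n - 12" "k - 12"] H less.prems(1) by (simp add: of_nat_diff)
      qed
      then have "cspan (12 + (k - 12)) 1 (\<lambda>z. Delta z * (G z / Delta z))"
        by (rule cspan_mult[OF _ cform_Delta]) simp
      moreover have "12 + (k - 12) = k"
        by simp
      ultimately have "cspan k 1 (\<lambda>z. Delta z * (G z / Delta z))"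
        by (simp only:)
      then have "cspan k 1 (\<lambda>z. fps_nth a 0 * P z + Delta z * (G z / Delta z))"
        by (rule cspan_add[OF cspan_cmult[OF cspan_cform[OF P]]])
      then show ?thesis
        by (rule cspan_cong[rotated]) (simp add: Delta_nonzero G_def)
    qed
  qed
qed

end

subsection \<open>Separation of cosets by Eisenstein series of weight 3\<close>

lemma fr_2: "fr 2 x = x * (1 + x) / (1 - x) ^ 3"
  by (simp add: fr_def eval_nat_numeral of_nat_poly pderiv_pCons algebra_simps)

lemma cubic_inj:
  fixes t s :: real
  assumes "t * (1 + t\<^sup>2) = s * (1 + s\<^sup>2)"
  shows "t = s"
proof -
  have "(t - s) * (1 + t\<^sup>2 + t * s + s\<^sup>2) = t * (1 + t\<^sup>2) - s * (1 + s\<^sup>2)"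
    by (simp add: algebra_simps power2_eq_square)
  then have "(t - s) * (1 + t\<^sup>2 + t * s + s\<^sup>2) = 0"
    using assms by simp
  moreover have "1 + t\<^sup>2 + t * s + s\<^sup>2 > 0"
  proof -
    have "1 + t\<^sup>2 + t * s + s\<^sup>2 = 1 + (t + s / 2)\<^sup>2 + 3 / 4 * s\<^sup>2"
      by (simp add: algebra_simps power2_eq_square)
    moreover have "(t + s / 2)\<^sup>2 \<ge> 0" "3 / 4 * s\<^sup>2 \<ge> 0"
      by simp_all
    ultimately show ?thesis
      by linarith
  qed
  ultimately show ?thesis
    by simp
qed

text \<open>With \<open>x = exp (2 i \<alpha>)\<close>, the quantity \<open>t\<close> below is \<open>cot \<alpha>\<close>.\<close>

lemma circle_cot:
  assumes x: "cmod x = 1" "x \<noteq> 1"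
  obtains t :: real where "of_real t * (x - 1) = \<i> * (x + 1)" "of_real (t * (1 + t\<^sup>2)) = 4 * \<i> * fr 2 x"
proof -
  define u where "u = \<i> * (x + 1) / (x - 1)"
  have nz: "x - 1 \<noteq> 0" "x \<noteq> 0"
    using x by auto
  have xc: "x * cnj x = 1"
    using x(1) complex_norm_square[of x] by simp
  then have c: "cnj x = 1 / x"
    using nz by (simp add: field_simps)
  have "cnj u = u"
  proof -
    have "cnj u = - \<i> * (1 / x + 1) / (1 / x - 1)"
      by (simp add: u_def c)
    also have "\<dots> = - \<i> * ((1 + x) / x) / ((1 - x) / x)"
      using nz by (simp add: field_simps)
    also have "\<dots> = - \<i> * (1 + x) / (1 - x)"
      using nz by simp
    also have "\<dots> = u"
    proof -
      have "1 - x = - (x - 1)" "- \<i> * (1 + x) = - (\<i> * (x + 1))"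
        by (simp_all add: algebra_simps)
      then show ?thesis
        by (simp only: u_def minus_divide_divide)
    qed
    finally show ?thesis .
  qed
  then obtain t where t: "u = of_real t"
    using Reals_cnj_iff[of u] by (auto elim: Reals_cases)
  have ut: "of_real t * (x - 1) = \<i> * (x + 1)"
    using nz by (simp add: t [symmetric] u_def)
  define e where "e = x - 1"
  have e: "e \<noteq> 0" "x = e + 1"
    using nz by (auto simp: e_def)
  have ue: "u = \<i> * (e + 2) / e"
    by (simp add: u_def e)
  have div: "v / e * (1 + (v / e)\<^sup>2) * e ^ 3 = v * (e\<^sup>2 + v\<^sup>2)" for v
  proof -
    have "v / e * (1 + (v / e)\<^sup>2) * e ^ 3 = (v / e * e) * (e * e + (v / e * e) * (v / e * e))"
      by (simp only: power2_eq_square power3_eq_cube ring_distribs mult_ac mult_1_left mult_1_right)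
    then show ?thesis
      using e(1) by (simp add: power2_eq_square)
  qed
  have "u * (1 + u\<^sup>2) * e ^ 3 = \<i> * (e + 2) * (e\<^sup>2 - (e + 2)\<^sup>2)"
    unfolding ue div by (simp add: power_mult_distrib)
  also have "\<dots> = - 4 * \<i> * x * (1 + x)"
    by (simp add: e(2) algebra_simps power2_eq_square)
  finally have "u * (1 + u\<^sup>2) = - 4 * \<i> * x * (1 + x) / e ^ 3"
    using e(1) by (simp add: field_simps)
  also have "\<dots> = 4 * \<i> * fr 2 x"
  proof -
    have "(1 - x) ^ 3 = - (e ^ 3)"
      by (simp add: e(2) power3_eq_cube)
    then show ?thesis
      by (simp add: fr_2)
  qed
  finally have "of_real (t * (1 + t\<^sup>2)) = 4 * \<i> * fr 2 x"
    by (simp add: t)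
  then show ?thesis
    using that ut by blast
qed

text \<open>For x = exp (2 i \<alpha>) and t = cot \<alpha>, 4 i \<open>fr 2 x\<close> is t (1 +
  t^2), which is strictly increasing in t, and t determines x.\<close>

lemma fr_2_inj:
  assumes x: "cmod x = 1" "x \<noteq> 1" and y: "cmod y = 1" "y \<noteq> 1" and eq: "fr 2 x = fr 2 y"
  shows "x = y"
proof -
  obtain t where t: "of_real t * (x - 1) = \<i> * (x + 1)" "of_real (t * (1 + t\<^sup>2)) = 4 * \<i> * fr 2 x"
    using circle_cot[OF x] .
  obtain s where s: "of_real s * (y - 1) = \<i> * (y + 1)" "of_real (s * (1 + s\<^sup>2)) = 4 * \<i> * fr 2 y"
    using circle_cot[OF y] .
  have "complex_of_real (t * (1 + t\<^sup>2)) = complex_of_real (s * (1 + s\<^sup>2))"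
    using t(2) s(2) eq by simp
  then have "t = s"
    using cubic_inj of_real_eq_iff by blast
  have "(of_real t - \<i>) * (x - y) = (of_real t * (x - 1) - \<i> * (x + 1)) - (of_real t * (y - 1) - \<i> * (y + 1))"
    by (simp add: algebra_simps)
  also have "\<dots> = 0"
    using t(1) s(1) \<open>t = s\<close> by simp
  finally have "(of_real t - \<i>) * (x - y) = 0" .
  moreover have "of_real t - \<i> \<noteq> 0"
    by (simp add: complex_eq_iff)
  ultimately show ?thesis
    by simp
qed

lemma Ex_rational_eq_1_iff:
  assumes "N > 0"
  shows "Ex (of_int a / of_nat N) = 1 \<longleftrightarrow> int N dvd a"
proof -
  have "of_int a / (of_nat N :: complex) \<in> \<int> \<longleftrightarrow> int N dvd a"
  proof
    assume "of_int a / (of_nat N :: complex) \<in> \<int>"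
    then obtain b where "of_int a / (of_nat N :: complex) = of_int b"
      by (auto elim!: Ints_cases)
    then have "(of_int a :: complex) = of_int (b * int N)"
      using assms by (simp add: field_simps)
    then have "a = b * int N"
      by (simp only: of_int_eq_iff)
    then show "int N dvd a"
      by simp
  next
    assume "int N dvd a"
    then obtain b where "a = int N * b" ..
    then show "of_int a / (of_nat N :: complex) \<in> \<int>"
      using assms by simp
  qed
  then show ?thesis
    by (simp add: Ex_eq_1_iff)
qed

text \<open>The constant term for (c, d) is 0 unless N divides c, and then it is a fixed multiple of
  \<open>fr 2\<close> at exp (2 \<pi> i d / N), which determines d modulo N. For (0, 1) it is
  nonzero: away from x = 1, \<open>fr 2\<close> vanishes on the unit circle only at -1, which N >= 3
  excludes.\<close>

lemma Eis_3_constant_term: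
  assumes N: "N \<ge> 3" and ne: "\<not> (int N dvd c \<and> int N dvd d - 1)" and cd: "int N dvd c \<Longrightarrow> \<not> int N dvd d"
  shows "fps_nth (eis_fps 3 N (0, 1)) 0 \<noteq> fps_nth (eis_fps 3 N (c, d)) 0"
proof
  assume eq: "fps_nth (eis_fps 3 N (0, 1)) 0 = fps_nth (eis_fps 3 N (c, d)) 0"
  have N0: "N > 0"
    using N by simp
  have nd: "\<not> int N dvd 1"
    using N by (auto dest: zdvd_imp_le)
  define X0 where "X0 = Ex (of_int 1 / of_nat N)"
  have X0: "cmod X0 = 1" "X0 \<noteq> 1"
    using Ex_rational_eq_1_iff[OF N0, of 1] nd cmod_Ex_of_int[of 1 N] by (auto simp: X0_def simp del: of_int_1)
  have lhs: "fps_nth (eis_fps 3 N (0, 1)) 0 = lip 3 / of_nat N ^ 3 * fr 2 X0"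
    using eis_zeta_not_dvd[OF nd, of 3] N0 by (simp add: eis_fps_def X0_def)
  have coef: "lip 3 / of_nat N ^ 3 \<noteq> 0"
    using lip_nonzero N0 by simp
  show False
  proof (cases "int N dvd c")
    case False
    then have "fr 2 X0 = 0"
      using eq lhs coef by (simp add: eis_fps_def)
    then have "X0 = - 1"
      using X0 by (auto simp: fr_2 add_eq_0_iff)
    then have "Ex (of_int 2 / of_nat N) = 1"
      using Ex_of_nat_mult[of 2 "of_int 1 / of_nat N"] by (simp add: X0_def)
    then have "int N dvd 2"
      using Ex_rational_eq_1_iff[OF N0] by blast
    then show False
      using N by (auto dest: zdvd_imp_le)
  next
    case True
    define Y0 where "Y0 = Ex (of_int d / of_nat N)"
    have Y0: "cmod Y0 = 1" "Y0 \<noteq> 1"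
      using Ex_rational_eq_1_iff[OF N0] cd[OF True] by (auto simp: Y0_def)
    have "fps_nth (eis_fps 3 N (c, d)) 0 = lip 3 / of_nat N ^ 3 * fr 2 Y0"
      using eis_zeta_not_dvd[OF cd[OF True], of 3] N0 True by (simp add: eis_fps_def Y0_def)
    then have "fr 2 Y0 = fr 2 X0"
      using eq lhs coef by simp
    then have "Y0 = X0"
      using fr_2_inj X0 Y0 by blast
    have "Ex (of_int (d - 1) / of_nat N) * X0 = Y0"
      unfolding X0_def Y0_def Ex_add [symmetric] by (simp add: diff_divide_distrib)
    then have "Ex (of_int (d - 1) / of_nat N) = 1"
      using \<open>Y0 = X0\<close> X0 by (metis mult_cancel_right1 norm_zero zero_neq_one)
    then have "int N dvd d - 1"
      using Ex_rational_eq_1_iff[OF N0] by blast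
    then show False
      using ne True by blast
  qed
qed

lemma Eis_3_neq:
  assumes N: "N \<ge> 3" and "\<not> (int N dvd c \<and> int N dvd d - 1)" "int N dvd c \<Longrightarrow> \<not> int N dvd d"
  shows "\<exists>z. Im z > 0 \<and> Eis 3 N (c, d) z \<noteq> Eis 3 N (0, 1) z"
proof (rule ccontr)
  assume "\<not> ?thesis"
  then have "qexp N (Eis 3 N (c, d)) (eis_fps 3 N (0, 1))"
    using qexp_Eis[of N 3 "(0, 1)"] N qexp_cong[of "Eis 3 N (c, d)" "Eis 3 N (0, 1)"] by auto
  then have "eis_fps 3 N (0, 1) = eis_fps 3 N (c, d)"
    using qexp_Eis[of N 3 "(c, d)"] N by (intro qexp_unique[of N "Eis 3 N (c, d)"]) auto
  then show False
    using Eis_3_constant_term[OF assms] by simp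
qed

lemma slash_nonzero:
  assumes "Im z > 0" "F z \<noteq> 0" and \<gamma>: "\<gamma> \<in> SL2Z"
  shows "\<exists>w. Im w > 0 \<and> slash k F \<gamma> w \<noteq> 0"
proof -
  define w where "w = mat_act (minv \<gamma>) z"
  have w: "Im w > 0"
    unfolding w_def by (intro mat_act_uhp assms SL2Z_det_pos minv_SL2Z)
  have "mat_act \<gamma> w = mat_act (\<gamma> ** minv \<gamma>) z"
    unfolding w_def by (rule mat_act_mult [symmetric]) (use assms minv_SL2Z in auto)
  then have "mat_act \<gamma> w = z"
    by (simp add: minv_mult \<gamma>) (simp add: mat_act_def moebius_def)
  then show ?thesis
    using w aut_factor_nonzero[of \<gamma> w] \<gamma> assms by (intro exI[of _ w]) (simp add: slash_def)
qed

text \<open>If the bottom row of \<rho> is not (0, 1) modulo N, then v = (0, 1) works, by the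
  constant terms at oo. Otherwise the top row (a, b) differs from (1, 0); slashing by \<sigma>
  carries these two to (- b, a) and (0, 1), where the same comparison of constant terms
  applies.\<close>

lemma Eis_3_separates:
  assumes N: "N \<ge> 3" and \<rho>: "\<rho> \<in> SL2Z" "\<not> congm N \<rho> (mat 1)"
  shows "\<exists>v z. Im z > 0 \<and> Eis 3 N (rowact v \<rho>) z \<noteq> Eis 3 N v z"
proof -
  define a b c d where abcd: "a = \<rho> $ 1 $ 1" "b = \<rho> $ 1 $ 2" "c = \<rho> $ 2 $ 1" "d = \<rho> $ 2 $ 2"
  have det: "a * d - b * c = 1"
    using det_SL2Z[OF \<rho>(1)] by (simp add: abcd)
  have nd: "\<not> int N dvd 1"
    using N by (auto dest: zdvd_imp_le)
  show ?thesis
  proof (cases "int N dvd c \<and> int N dvd d - 1")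
    case False
    have "\<not> int N dvd d" if "int N dvd c"
    proof
      assume "int N dvd d"
      then have "int N dvd a * d - b * c"
        using that by simp
      then show False
        using nd det by simp
    qed
    then obtain z where "Im z > 0" "Eis 3 N (c, d) z \<noteq> Eis 3 N (0, 1) z"
      using Eis_3_neq[OF N False] by blast
    then show ?thesis
      by (intro exI[of _ "(0, 1)"] exI[of _ z]) (simp add: rowact_def abcd)
  next
    case True
    have ab: "\<not> (int N dvd - b \<and> int N dvd a - 1)"
      using \<rho>(2) True by (auto simp: congm_def forall_2 abcd)
    have "\<not> int N dvd a" if "int N dvd - b"
    proof
      assume "int N dvd a"
      then have "int N dvd a * d - b * c"
        using that by simp
      then show False
        using nd det by simp
    qed
    then obtain z where z: "Im z > 0" "Eis 3 N (- b, a) z \<noteq> Eis 3 N (0, 1) z"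
      using Eis_3_neq[OF N ab] by blast
    define \<sigma> where "\<sigma> = mat2 0 1 (- 1) 0"
    have \<sigma>: "\<sigma> \<in> SL2Z"
      by (simp add: \<sigma>_def SL2Z_det det_mat2)
    have "slash (int 3) (Eis 3 N (a, b)) \<sigma> z \<noteq> slash (int 3) (Eis 3 N (1, 0)) \<sigma> z"
      unfolding slash_Eis[OF \<sigma> z(1)] using z(2) by (simp add: rowact_def \<sigma>_def)
    then have "Eis 3 N (a, b) (mat_act \<sigma> z) \<noteq> Eis 3 N (1, 0) (mat_act \<sigma> z)"
      by (auto simp: slash_def)
    then show ?thesis
      using mat_act_uhp[of \<sigma> z] z(1) \<sigma>
      by (intro exI[of _ "(1, 0)"] exI[of _ "mat_act \<sigma> z"]) (simp add: rowact_def abcd)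
  qed
qed

subsection \<open>Lagrange interpolation\<close>

lemma slash_prod:
  assumes "finite I" "det \<gamma> > 0" "Im z > 0"
  shows "slash (int (card I) * k) (\<lambda>z. \<Prod>i\<in>I. u i z) \<gamma> z = (\<Prod>i\<in>I. slash k (u i) \<gamma> z)"
  using assms(1)
proof (induction I rule: finite_induct)
  case (insert i I)
  have "int (card (insert i I)) * k = k + int (card I) * k"
    using insert.hyps by (simp add: algebra_simps)
  then show ?case
    using slash_prod2[OF assms(2,3), of k "int (card I) * k" "u i" "\<lambda>z. \<Prod>i\<in>I. u i z"] insert
    by simp
qed (simp add: slash_const_0)

lemma MF_trace:
  assumes F: "F \<in> MF k N" and N: "N > 0"
  shows "(\<lambda>z. \<Sum>\<rho>\<in>mreps N. slash k F \<rho> z) \<in> MF k 1" (is "?T \<in> _")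
proof -
  have T: "?T \<in> MF k N"
    using MF_slash[OF F mreps_SL2Z] N by (intro MF_sum) auto
  have inv: "slash k ?T \<gamma> z = ?T z" if \<gamma>: "\<gamma> \<in> SL2Z" and z: "Im z > 0" for \<gamma> z
  proof -
    have "slash k ?T \<gamma> z = (\<Sum>\<rho>\<in>mreps N. slash k (slash k F \<rho>) \<gamma> z)"
      by (rule slash_sum)
    also have "\<dots> = (\<Sum>\<rho>\<in>mreps N. slash k F (\<rho> ** \<gamma>) z)"
      using \<gamma> z by (simp add: slash_mult)
    also have "\<dots> = ?T z"
      by (rule sum_mreps[OF N \<gamma>, of "\<lambda>\<rho>. slash k F \<rho> z"]) (intro MF_congm[OF F] z)
    finally show ?thesis .
  qed
  show ?thesis
  proof (rule MF_I)
    show "?T holomorphic_on uhp"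
      using MF_holomorphic[OF T N] .
    show "\<exists>B Y. \<forall>z. Im z \<ge> Y \<longrightarrow> cmod (slash k ?T \<gamma> z) \<le> B" if "\<gamma> \<in> SL2Z" for \<gamma>
      by (rule MF_slash_lim[OF T N that])
  qed (use inv in \<open>auto simp: Gam_SL2Z\<close>)
qed

context derivation
begin

text \<open>For every nontrivial coset \<rho> choose a_\<rho> with a_\<rho>|\<rho> different from
  a_\<rho>. The product Y_\<gamma> of all a_\<rho>|\<rho> - a_\<rho>|\<gamma> is d for the trivial
  coset and 0 for the others, so d F is the sum of Y_\<gamma> (F|\<gamma>) over all cosets \<gamma>.
  Expanding Y_\<gamma> over subsets turns this into a combination of traces to level 1, which
  \<open>level_1_cspan\<close> controls, multiplied by products of the a_\<rho>|\<rho>.\<close>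

theorem common_denominator:
  assumes N: "N \<ge> 3"
  obtains w d z0 where "cform w N d" "Im z0 > 0" "d z0 \<noteq> 0"
    "\<And>k F. F \<in> MF k N \<Longrightarrow> cspan (w + k) N (\<lambda>z. d z * F z)"
proof -
  have N0: "N > 0"
    using N by simp
  define R where "R = mreps N - {mat 1}"
  have finR: "finite R"
    unfolding R_def using finite_mreps[OF N0] by simp
  have "\<exists>a. cform 3 N a \<and> (\<exists>z. Im z > 0 \<and> slash 3 a \<rho> z \<noteq> a z)" if "\<rho> \<in> R" for \<rho>
  proof -
    have \<rho>: "\<rho> \<in> SL2Z" "\<not> congm N \<rho> (mat 1)"
      using that mreps_SL2Z mreps_unique[OF _ one_in_mreps] unfolding R_def by blast+
    obtain v z where v: "Im z > 0" "Eis 3 N (rowact v \<rho>) z \<noteq> Eis 3 N v z"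
      using Eis_3_separates[OF N \<rho>] by blast
    define a where "a z = inverse (of_real pi ^ 3) * Eis 3 N v z" for z
    have "cform (int 3) N a"
      unfolding a_def[abs_def] by (rule cform_Eis) (use N in simp_all)
    moreover have "slash (int 3) a \<rho> z \<noteq> a z"
      unfolding a_def[abs_def] slash_cmult slash_Eis[OF \<rho>(1) v(1)] using v(2) by simp
    ultimately show ?thesis
      using v(1) by auto
  qed
  then obtain a where a: "\<And>\<rho>. \<rho> \<in> R \<Longrightarrow> cform 3 N (a \<rho>)"
    "\<And>\<rho>. \<rho> \<in> R \<Longrightarrow> \<exists>z. Im z > 0 \<and> slash 3 (a \<rho>) \<rho> z \<noteq> a \<rho> z"
    by metis
  have RS: "\<rho> \<in> SL2Z" if "\<rho> \<in> R" for \<rho>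
    using that mreps_SL2Z unfolding R_def by blast
  define Y where "Y \<gamma> z = (\<Prod>\<rho>\<in>R. slash 3 (a \<rho>) \<rho> z - slash 3 (a \<rho>) \<gamma> z)" for \<gamma> z
  define d where "d = (\<lambda>z. \<Prod>\<rho>\<in>R. slash 3 (a \<rho>) \<rho> z - a \<rho> z)"
  define w where "w = int (card R) * 3"
  have c: "cform 3 N (\<lambda>z. slash 3 (a \<rho>) \<rho> z - a \<rho> z)" if "\<rho> \<in> R" for \<rho>
    by (intro cform_diff cform_slash a(1) that RS N0)
  have d: "cform w N d"
    unfolding d_def w_def by (intro cform_prod c N0 finR)
  obtain z0 where z0: "Im z0 > 0" "d z0 \<noteq> 0"
  proof -
    \<comment> \<open>No factor of d is identically 0, and power series form an integral
      domain.\<close>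
    have "\<exists>b. qexp N (\<lambda>z. slash 3 (a \<rho>) \<rho> z - a \<rho> z) b" if "\<rho> \<in> R" for \<rho>
      using MF_qexp1E[OF cform_MF[OF c[OF that]]] by blast
    then obtain b where b: "\<And>\<rho>. \<rho> \<in> R \<Longrightarrow> qexp N (\<lambda>z. slash 3 (a \<rho>) \<rho> z - a \<rho> z) (b \<rho>)"
      by metis
    have "b \<rho> \<noteq> 0" if "\<rho> \<in> R" for \<rho>
      using a(2)[OF that] qexp_eq_0_iff[OF b[OF that] N0] by auto
    then have "(\<Prod>\<rho>\<in>R. b \<rho>) \<noteq> 0"
      using finR by simp
    moreover have "qexp N d (\<Prod>\<rho>\<in>R. b \<rho>)"
      unfolding d_def by (intro qexp_prod b N0)
    ultimately have "\<exists>z. Im z > 0 \<and> d z \<noteq> 0"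
      using qexp_eq_0_iff[of N d "\<Prod>\<rho>\<in>R. b \<rho>"] N0 by auto
    then show ?thesis
      using that by blast
  qed
  have main: "cspan (w + k) N (\<lambda>z. d z * F z)" if F: "F \<in> MF k N" for k F
  proof -
    \<comment> \<open>For a subset S of the factors of Y_\<gamma>, b holds the part independent of
      \<gamma>, and c the part that is slashed by \<gamma> together with F.\<close>
    define b where "b S z = (\<Prod>\<rho>\<in>S. slash 3 (a \<rho>) \<rho> z)" for S z
    define c where "c S z = (\<Prod>\<rho>\<in>R - S. - 1 * a \<rho> z)" for S z
    define l where "l S = int (card (R - S)) * 3" for S
    define Tr where "Tr S z = (\<Sum>\<gamma>\<in>mreps N. slash (l S + k) (\<lambda>z. c S z * F z) \<gamma> z)" for S z
    have cS: "cform (l S) N (c S)" if "S \<in> Pow R" for S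
      unfolding c_def[abs_def] l_def using that finR
      by (intro cform_prod cform_cmult a(1) N0) auto
    have bS: "cform (int (card S) * 3) N (b S)" if "S \<in> Pow R" for S
      unfolding b_def[abs_def] using that finR finite_subset
      by (intro cform_prod cform_slash a(1) N0 RS) auto
    have "cspan (w + k) N (\<lambda>z. b S z * Tr S z)" if S: "S \<in> Pow R" for S
    proof -
      have "Tr S \<in> MF (l S + k) 1"
        unfolding Tr_def[abs_def] by (intro MF_trace MF_mult cform_MF[OF cS[OF S]] F N0)
      then have "cspan (l S + k) (1 * N) (Tr S)"
        using N0 by (intro cspan_raise level_1_cspan) simp_all
      then have "cspan (int (card S) * 3 + (l S + k)) N (\<lambda>z. b S z * Tr S z)"
        using cspan_mult[OF _ bS[OF S] N0] by simp
      moreover have "card R = card S + card (R - S)"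
        using S finR by (metis PowD card_Diff_subset card_mono finite_subset le_add_diff_inverse)
      then have "int (card S) * 3 + (l S + k) = w + k"
        by (simp add: l_def w_def)
      ultimately show ?thesis
        by simp
    qed
    then have "cspan (w + k) N (\<lambda>z. \<Sum>S\<in>Pow R. b S z * Tr S z)"
      using finR by (intro cspan_sum) auto
    moreover have "d z * F z = (\<Sum>S\<in>Pow R. b S z * Tr S z)" if z: "Im z > 0" for z
    proof -
      have Y0: "Y \<gamma> z = 0" if "\<gamma> \<in> mreps N - {mat 1}" for \<gamma>
        unfolding Y_def using that finR by (auto simp: R_def)
      have "(\<Sum>\<gamma>\<in>mreps N. Y \<gamma> z * slash k F \<gamma> z) = Y (mat 1) z * slash k F (mat 1) z"
        using Y0 by (subst sum.remove[OF finite_mreps[OF N0] one_in_mreps]) simp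
      then have 1: "d z * F z = (\<Sum>\<gamma>\<in>mreps N. Y \<gamma> z * slash k F \<gamma> z)"
        by (simp add: Y_def d_def)
      have Y: "Y \<gamma> z = (\<Sum>S\<in>Pow R. b S z * slash (l S) (c S) \<gamma> z)" if \<gamma>: "\<gamma> \<in> mreps N" for \<gamma>
      proof -
        have "Y \<gamma> z = (\<Prod>\<rho>\<in>R. slash 3 (a \<rho>) \<rho> z + - 1 * slash 3 (a \<rho>) \<gamma> z)"
          by (simp add: Y_def)
        also have "\<dots> = (\<Sum>S\<in>Pow R. (\<Prod>\<rho>\<in>S. slash 3 (a \<rho>) \<rho> z) * (\<Prod>\<rho>\<in>R - S. - 1 * slash 3 (a \<rho>) \<gamma> z))"
          by (rule prod_add[OF finR])
        also have "\<dots> = (\<Sum>S\<in>Pow R. b S z * slash (l S) (c S) \<gamma> z)"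
        proof (rule sum.cong[OF refl])
          fix S assume "S \<in> Pow R"
          have "slash (l S) (c S) \<gamma> z = (\<Prod>\<rho>\<in>R - S. slash 3 (\<lambda>z. - 1 * a \<rho> z) \<gamma> z)"
            unfolding l_def c_def[abs_def] using finR mreps_SL2Z[OF \<gamma>] z by (intro slash_prod) auto
          then show "(\<Prod>\<rho>\<in>S. slash 3 (a \<rho>) \<rho> z) * (\<Prod>\<rho>\<in>R - S. - 1 * slash 3 (a \<rho>) \<gamma> z) =
              b S z * slash (l S) (c S) \<gamma> z"
            by (simp only: b_def slash_cmult)
        qed
        finally show ?thesis .
      qed
      have "d z * F z = (\<Sum>\<gamma>\<in>mreps N. \<Sum>S\<in>Pow R. b S z * (slash (l S) (c S) \<gamma> z * slash k F \<gamma> z))"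
        unfolding 1 by (intro sum.cong refl) (simp add: Y sum_distrib_right mult.assoc)
      also have "\<dots> = (\<Sum>S\<in>Pow R. b S z * (\<Sum>\<gamma>\<in>mreps N. slash (l S) (c S) \<gamma> z * slash k F \<gamma> z))"
        by (subst sum.swap) (simp add: sum_distrib_left)
      also have "\<dots> = (\<Sum>S\<in>Pow R. b S z * Tr S z)"
        unfolding Tr_def using z
        by (intro sum.cong refl arg_cong2[of _ _ _ _ "times"] slash_prod2 [symmetric]) (auto dest: mreps_SL2Z)
      finally show ?thesis .
    qed
    ultimately show ?thesis
      by (rule cspan_cong[rotated])
  qed
  show ?thesis
    by (rule that[OF d z0 main])
qed

end

subsection \<open>Derivations act on modular forms\<close>

lemma qexp_congI: "qexp h G c \<Longrightarrow> (\<And>z. Im z > 0 \<Longrightarrow> F z = G z) \<Longrightarrow> qexp h F c"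
  using qexp_cong[of F G h c] by simp

text \<open>The expansions of one form at all matrices \<gamma> simultaneously, so that a formal
  operation performed on all of them can be shown to come from a form again.\<close>

definition mf_family :: "int \<Rightarrow> nat \<Rightarrow> (int^2^2 \<Rightarrow> complex fps) \<Rightarrow> bool" where
  "mf_family k N a \<longleftrightarrow> (\<exists>F\<in>MF k N. \<forall>\<gamma>\<in>SL2Z. qexp N (slash k F \<gamma>) (a \<gamma>))"

lemma mf_familyE:
  assumes "mf_family k N a"
  obtains F where "F \<in> MF k N" "\<And>\<gamma>. \<gamma> \<in> SL2Z \<Longrightarrow> qexp N (slash k F \<gamma>) (a \<gamma>)"
  using assms by (auto simp: mf_family_def)

lemma mf_familyI:
  "F \<in> MF k N \<Longrightarrow> (\<And>\<gamma>. \<gamma> \<in> SL2Z \<Longrightarrow> qexp N (slash k F \<gamma>) (a \<gamma>)) \<Longrightarrow> mf_family k N a"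
  by (auto simp: mf_family_def)

lemma mf_family_diff:
  assumes a: "mf_family k N a" and b: "mf_family k N b" and N: "N > 0"
  shows "mf_family k N (\<lambda>\<gamma>. a \<gamma> - b \<gamma>)"
proof -
  obtain F where F: "F \<in> MF k N" "\<And>\<gamma>. \<gamma> \<in> SL2Z \<Longrightarrow> qexp N (slash k F \<gamma>) (a \<gamma>)"
    using mf_familyE[OF a] by blast
  obtain G where G: "G \<in> MF k N" "\<And>\<gamma>. \<gamma> \<in> SL2Z \<Longrightarrow> qexp N (slash k G \<gamma>) (b \<gamma>)"
    using mf_familyE[OF b] by blast
  show ?thesis
  proof (rule mf_familyI[OF MF_diff[OF F(1) G(1) N]])
    fix \<gamma> assume \<gamma>: "\<gamma> \<in> SL2Z"
    have "slash k (\<lambda>z. F z - G z) \<gamma> = (\<lambda>z. slash k F \<gamma> z - slash k G \<gamma> z)"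
      by (simp add: fun_eq_iff slash_diff)
    then show "qexp N (slash k (\<lambda>z. F z - G z) \<gamma>) (a \<gamma> - b \<gamma>)"
      using qexp_diff[OF F(2) G(2) N, OF \<gamma> \<gamma>] by simp
  qed
qed

lemma mf_family_mult:
  assumes a: "mf_family k N a" and b: "mf_family l N b" and N: "N > 0"
  shows "mf_family (k + l) N (\<lambda>\<gamma>. a \<gamma> * b \<gamma>)"
proof -
  obtain F where F: "F \<in> MF k N" "\<And>\<gamma>. \<gamma> \<in> SL2Z \<Longrightarrow> qexp N (slash k F \<gamma>) (a \<gamma>)"
    using mf_familyE[OF a] by blast
  obtain G where G: "G \<in> MF l N" "\<And>\<gamma>. \<gamma> \<in> SL2Z \<Longrightarrow> qexp N (slash l G \<gamma>) (b \<gamma>)"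
    using mf_familyE[OF b] by blast
  show ?thesis
  proof (rule mf_familyI[OF MF_mult[OF F(1) G(1) N]])
    fix \<gamma> assume \<gamma>: "\<gamma> \<in> SL2Z"
    have "qexp N (slash (k + l) (\<lambda>z. F z * G z) \<gamma>) (a \<gamma> * b \<gamma>) \<longleftrightarrow>
        qexp N (\<lambda>z. slash k F \<gamma> z * slash l G \<gamma> z) (a \<gamma> * b \<gamma>)"
      by (rule qexp_cong) (simp add: slash_prod2 \<gamma>)
    then show "qexp N (slash (k + l) (\<lambda>z. F z * G z) \<gamma>) (a \<gamma> * b \<gamma>)"
      using qexp_mult[OF F(2) G(2) N, OF \<gamma> \<gamma>] by simp
  qed
qed

lemma mf_family_cmult:
  assumes a: "mf_family k N a" and N: "N > 0"
  shows "mf_family k N (\<lambda>\<gamma>. fps_const x * a \<gamma>)"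
proof -
  obtain F where F: "F \<in> MF k N" "\<And>\<gamma>. \<gamma> \<in> SL2Z \<Longrightarrow> qexp N (slash k F \<gamma>) (a \<gamma>)"
    using mf_familyE[OF a] by blast
  show ?thesis
  proof (rule mf_familyI[OF MF_cmult[OF F(1) N]])
    fix \<gamma> assume \<gamma>: "\<gamma> \<in> SL2Z"
    have "slash k (\<lambda>z. x * F z) \<gamma> = (\<lambda>z. x * slash k F \<gamma> z)"
      by (simp add: fun_eq_iff slash_cmult)
    then show "qexp N (slash k (\<lambda>z. x * F z) \<gamma>) (fps_const x * a \<gamma>)"
      using qexp_cmult[OF F(2) N, OF \<gamma>] by simp
  qed
qed

lemma mf_family_power:
  assumes a: "mf_family k N a" and N: "N > 0"
  shows "mf_family (int n * k) N (\<lambda>\<gamma>. a \<gamma> ^ n)"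
proof (induction n)
  case 0
  have "mf_family 0 N (\<lambda>\<gamma>. 1)"
  proof (rule mf_familyI)
    show "(\<lambda>z. 1) \<in> MF 0 N"
      by (rule MF_const)
    show "qexp N (slash 0 (\<lambda>z. 1) \<gamma>) 1" if "\<gamma> \<in> SL2Z" for \<gamma>
      using qexp_1 by (simp add: slash_const_0[abs_def])
  qed
  then show ?case
    by simp
next
  case (Suc n)
  have "k + int n * k = int (Suc n) * k"
    by (simp add: algebra_simps)
  then show ?case
    using mf_family_mult[OF a Suc N] by simp
qed

context derivation
begin

definition fps_delta :: "complex fps \<Rightarrow> complex fps" where
  "fps_delta c = Abs_fps (\<lambda>n. \<delta> (fps_nth c n))"

lemma fps_delta_nth [simp]: "fps_nth (fps_delta c) n = \<delta> (fps_nth c n)"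
  by (simp add: fps_delta_def)

lemma fps_delta_add: "fps_delta (a + b) = fps_delta a + fps_delta b"
  by (simp add: fps_eq_iff add)

lemma fps_delta_diff: "fps_delta (a - b) = fps_delta a - fps_delta b"
  by (simp add: fps_eq_iff \<delta>_diff)

lemma fps_delta_0 [simp]: "fps_delta 0 = 0"
  by (simp add: fps_eq_iff)

lemma fps_delta_mult: "fps_delta (a * b) = fps_delta a * b + a * fps_delta b"
  by (simp add: fps_eq_iff fps_mult_nth \<delta>_sum mult sum.distrib)

lemma fps_delta_eq_0_iff: "fps_delta c = 0 \<longleftrightarrow> (\<forall>n. \<delta> (fps_nth c n) = 0)"
  by (simp add: fps_eq_iff)

lemma fps_delta_funpow_const_left:
  assumes "fps_delta b = 0"
  shows "(fps_delta ^^ m) (b * a) = b * (fps_delta ^^ m) a"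
  by (induction m) (simp_all add: fps_delta_mult assms)

lemma fps_delta_funpow_sum_const:
  assumes "\<And>i. i \<in> I \<Longrightarrow> fps_delta (b i) = 0"
  shows "(fps_delta ^^ m) (\<Sum>i\<in>I. fps_const (t i) * b i) = (\<Sum>i\<in>I. fps_const ((\<delta> ^^ m) (t i)) * b i)"
proof (induction m)
  case (Suc m)
  have "fps_nth (fps_delta (\<Sum>i\<in>I. fps_const ((\<delta> ^^ m) (t i)) * b i)) n =
      fps_nth (\<Sum>i\<in>I. fps_const ((\<delta> ^^ Suc m) (t i)) * b i) n" for n
  proof -
    have "\<delta> (fps_nth (b i) n) = 0" if "i \<in> I" for i
      using assms[OF that] by (simp add: fps_delta_eq_0_iff)
    then show ?thesis
      by (simp add: fps_sum_nth \<delta>_sum mult)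
  qed
  then show ?case
    by (simp add: Suc fps_eq_iff)
qed simp

text \<open>
  \<open>leib f n m y\<close> is the sum of \<open>(-1)\<^sup>n\<^sup>-\<^sup>i (n choose i) f\<^sup>n\<^sup>-\<^sup>i D\<^sup>m (f\<^sup>i y)\<close> over \<open>i\<close>, that is, the
  \<open>n\<close>-fold commutator of \<open>D\<^sup>m\<close> with multiplication by \<open>f\<close>. As \<open>D\<^sup>m\<close> is a differential operator of
  order \<open>m\<close>, it vanishes for \<open>n > m\<close> and is the symbol of \<open>D\<^sup>n\<close> for \<open>m = n\<close>.
\<close>

primrec leib :: "complex fps \<Rightarrow> nat \<Rightarrow> nat \<Rightarrow> complex fps \<Rightarrow> complex fps" where
  "leib f 0 m y = (fps_delta ^^ m) y"
| "leib f (Suc n) m y = leib f n m (f * y) - f * leib f n m y"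

text \<open>The Leibniz rule for the n-fold commutator of the product D D^m with f: the commutator
  [D, f] is multiplication by D f, and further commutators of it with f vanish, so only two terms
  remain. For n = 0 the index n - 1 is harmless because of the factor n.\<close>

lemma leib_Suc_right:
  "leib f n (Suc m) y = fps_delta (leib f n m y) + of_nat n * fps_delta f * leib f (n - 1) m y"
proof (induction n arbitrary: y)
  case (Suc n)
  show ?case
  proof (cases n)
    case 0
    then show ?thesis
      by (simp add: fps_delta_diff fps_delta_mult algebra_simps)
  next
    case (Suc n')
    have "leib f (Suc n) (Suc m) y = leib f n (Suc m) (f * y) - f * leib f n (Suc m) y"
      by simp
    also have "\<dots> = fps_delta (leib f n m (f * y)) + of_nat n * fps_delta f * leib f n' m (f * y)
        - f * (fps_delta (leib f n m y) + of_nat n * fps_delta f * leib f n' m y)"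
      by (simp only: Suc.IH) (simp add: Suc)
    also have "\<dots> = fps_delta (leib f (Suc n) m y) + fps_delta f * leib f n m y +
        of_nat n * fps_delta f * (leib f n' m (f * y) - f * leib f n' m y)"
      by (simp add: fps_delta_diff fps_delta_mult algebra_simps)
    also have "leib f n' m (f * y) - f * leib f n' m y = leib f n m y"
      by (simp add: Suc)
    finally show ?thesis
      by (simp add: algebra_simps)
  qed
qed simp

lemma leib_zero_order: "n > 0 \<Longrightarrow> leib f n 0 y = 0"
proof (induction n arbitrary: y)
  case (Suc n)
  then show ?case
    by (cases "n = 0") simp_all
qed simp

lemma leib_symbol: "(m < n \<longrightarrow> leib f n m y = 0) \<and> leib f m m y = fact m * fps_delta f ^ m * y"
proof (induction m arbitrary: n)
  case 0
  then show ?case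
    by (simp add: leib_zero_order)
next
  case (Suc m)
  have IH: "leib f n m y = 0" if "m < n" for n
    using Suc that by blast
  have "leib f n (Suc m) y = 0" if "Suc m < n"
    using that by (simp only: leib_Suc_right) (simp add: IH)
  moreover have "leib f (Suc m) (Suc m) y = fact (Suc m) * fps_delta f ^ Suc m * y"
    using Suc by (simp only: leib_Suc_right) (simp add: IH algebra_simps del: leib.simps)
  ultimately show ?case
    by blast
qed

text \<open>In d F = sum of t_i u_i the series of d and of the u_i are killed by \<delta>. So d
  passes through D^m, and D^m acts only on the scalars t_i, which leaves a combination of the forms
  u_i.\<close>

lemma mf_family_delta_funpow:
  assumes N: "N > 0" and d: "cform w N d" and cd: "\<And>\<gamma>. \<gamma> \<in> SL2Z \<Longrightarrow> qexp N (slash w d \<gamma>) (b \<gamma>)"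
    and den: "\<And>F. F \<in> MF k N \<Longrightarrow> cspan (w + k) N (\<lambda>z. d z * F z)"
    and a: "mf_family k N a"
  shows "mf_family (w + k) N (\<lambda>\<gamma>. b \<gamma> * (fps_delta ^^ m) (a \<gamma>))"
proof -
  obtain F where F: "F \<in> MF k N" and aF: "\<And>\<gamma>. \<gamma> \<in> SL2Z \<Longrightarrow> qexp N (slash k F \<gamma>) (a \<gamma>)"
    using mf_familyE[OF a] by blast
  obtain n :: nat and u t where u: "\<And>i. i < n \<Longrightarrow> cform (w + k) N (u i)"
    and eq: "\<And>z. Im z > 0 \<Longrightarrow> d z * F z = (\<Sum>i<n. t i * u i z)"
    using cspanE[OF den[OF F]] by metis
  have "\<exists>c. qexp N (slash (w + k) (u i) \<gamma>) c \<and> fps_delta c = 0" if "i < n" "\<gamma> \<in> SL2Z" for i \<gamma>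
    using cform_qexpE[OF u[OF that(1)] that(2)] by (metis fps_delta_eq_0_iff)
  then obtain c where c: "\<And>i \<gamma>. i < n \<Longrightarrow> \<gamma> \<in> SL2Z \<Longrightarrow> qexp N (slash (w + k) (u i) \<gamma>) (c i \<gamma>)"
    and dc: "\<And>i \<gamma>. i < n \<Longrightarrow> \<gamma> \<in> SL2Z \<Longrightarrow> fps_delta (c i \<gamma>) = 0"
    by metis
  have qsum: "qexp N (slash (w + k) (\<lambda>z. \<Sum>i<n. s i * u i z) \<gamma>) (\<Sum>i<n. fps_const (s i) * c i \<gamma>)"
    if \<gamma>: "\<gamma> \<in> SL2Z" for \<gamma> s
  proof -
    have "slash (w + k) (\<lambda>z. \<Sum>i<n. s i * u i z) \<gamma> = (\<lambda>z. \<Sum>i<n. s i * slash (w + k) (u i) \<gamma> z)"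
      by (simp add: fun_eq_iff slash_sum slash_cmult)
    moreover have "qexp N (\<lambda>z. \<Sum>i<n. s i * slash (w + k) (u i) \<gamma> z) (\<Sum>i<n. fps_const (s i) * c i \<gamma>)"
      using c \<gamma> N by (intro qexp_sum qexp_cmult) auto
    ultimately show ?thesis
      by simp
  qed
  show ?thesis
  proof (rule mf_familyI)
    show "(\<lambda>z. \<Sum>i<n. (\<delta> ^^ m) (t i) * u i z) \<in> MF (w + k) N"
      using u N by (intro MF_sum MF_cmult cform_MF) auto
    fix \<gamma> assume \<gamma>: "\<gamma> \<in> SL2Z"
    have "b \<gamma> * a \<gamma> = (\<Sum>i<n. fps_const (t i) * c i \<gamma>)"
    proof (rule qexp_unique[OF _ qsum[OF \<gamma>] N])
      have "qexp N (\<lambda>z. slash w d \<gamma> z * slash k F \<gamma> z) (b \<gamma> * a \<gamma>)"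
        by (rule qexp_mult[OF cd[OF \<gamma>] aF[OF \<gamma>] N])
      moreover have "slash (w + k) (\<lambda>z. \<Sum>i<n. t i * u i z) \<gamma> z = slash w d \<gamma> z * slash k F \<gamma> z"
        if "Im z > 0" for z
        using slash_cong[OF eq, where \<gamma> = \<gamma> and w = "w + k" and z = z] that
        by (simp add: slash_prod2 \<gamma>)
      ultimately show "qexp N (slash (w + k) (\<lambda>z. \<Sum>i<n. t i * u i z) \<gamma>) (b \<gamma> * a \<gamma>)"
        by (rule qexp_congI)
    qed
    then have "(fps_delta ^^ m) (b \<gamma> * a \<gamma>) = (\<Sum>i<n. fps_const ((\<delta> ^^ m) (t i)) * c i \<gamma>)"
      using fps_delta_funpow_sum_const[of "{..<n}" "\<lambda>i. c i \<gamma>" m t] dc \<gamma> by simp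
    moreover have "fps_delta (b \<gamma>) = 0"
      using cform_const[OF d \<gamma> cd[OF \<gamma>]] by (simp add: fps_delta_eq_0_iff)
    ultimately have "b \<gamma> * (fps_delta ^^ m) (a \<gamma>) = (\<Sum>i<n. fps_const ((\<delta> ^^ m) (t i)) * c i \<gamma>)"
      by (simp add: fps_delta_funpow_const_left)
    then show "qexp N (slash (w + k) (\<lambda>z. \<Sum>i<n. (\<delta> ^^ m) (t i) * u i z) \<gamma>) (b \<gamma> * (fps_delta ^^ m) (a \<gamma>))"
      using qsum[OF \<gamma>] by simp
  qed
qed

text \<open>The commutators \<open>leib\<close> involve D^m only on powers of F, and the previous
  lemma turns these into forms after multiplication by d. For m = n, applied to 1, the commutator is
  n! (D a)^n.\<close>

lemma mf_family_delta_power: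
  assumes N: "N > 0" and d: "cform w N d" and cd: "\<And>\<gamma>. \<gamma> \<in> SL2Z \<Longrightarrow> qexp N (slash w d \<gamma>) (b \<gamma>)"
    and den: "\<And>k F. F \<in> MF k N \<Longrightarrow> cspan (w + k) N (\<lambda>z. d z * F z)"
    and a: "mf_family k N a"
  shows "mf_family (w + int n * k) N (\<lambda>\<gamma>. b \<gamma> * fps_delta (a \<gamma>) ^ n)"
proof -
  \<comment> \<open>The exponent s stays free because \<open>leib f (Suc n)\<close> evaluates
    \<open>leib f n\<close> at f y.\<close>
  have *: "mf_family (w + int (n + s) * k) N (\<lambda>\<gamma>. b \<gamma> * leib (a \<gamma>) n m (a \<gamma> ^ s))" for n m s
  proof (induction n arbitrary: s)
    case 0
    show ?case
      using mf_family_delta_funpow[OF N d cd den mf_family_power[OF a N]] by simp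
  next
    case (Suc n)
    have "mf_family (w + int (n + Suc s) * k) N (\<lambda>\<gamma>. b \<gamma> * leib (a \<gamma>) n m (a \<gamma> ^ Suc s))"
      by (rule Suc)
    moreover have kw: "k + (w + int (n + s) * k) = w + int (n + Suc s) * k"
      by (simp add: algebra_simps)
    have "mf_family (w + int (n + Suc s) * k) N (\<lambda>\<gamma>. a \<gamma> * (b \<gamma> * leib (a \<gamma>) n m (a \<gamma> ^ s)))"
      using mf_family_mult[OF a Suc[of s] N] by (simp only: kw)
    ultimately have "mf_family (w + int (n + Suc s) * k) N
        (\<lambda>\<gamma>. b \<gamma> * leib (a \<gamma>) n m (a \<gamma> ^ Suc s) - a \<gamma> * (b \<gamma> * leib (a \<gamma>) n m (a \<gamma> ^ s)))"
      by (rule mf_family_diff[OF _ _ N])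
    moreover have "b * leib f n m (f ^ Suc s) - f * (b * leib f n m (f ^ s)) = b * leib f (Suc n) m (f ^ s)"
      for b f :: "complex fps"
      by (simp add: algebra_simps)
    ultimately show ?case
      by simp
  qed
  have "mf_family (w + int n * k) N (\<lambda>\<gamma>. fps_const (inverse (fact n)) * (b \<gamma> * leib (a \<gamma>) n n 1))"
    using mf_family_cmult[OF *[of n 0 n] N] by simp
  moreover have "fps_const (inverse (fact n)) * (b * leib f n n 1) = b * fps_delta f ^ n"
    for b f :: "complex fps"
  proof -
    have f: "(fact n :: complex fps) = fps_const (fact n)"
      by (metis fps_of_nat of_nat_fact)
    have "fps_const (inverse (fact n)) * (b * leib f n n 1)
        = (fps_const (inverse (fact n)) * fps_const (fact n)) * (b * fps_delta f ^ n)"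
      using leib_symbol[of n n f 1] by (simp only: f) (simp add: mult_ac)
    also have "fps_const (inverse (fact n)) * fps_const (fact n :: complex) = 1"
      by simp
    finally show ?thesis
      by simp
  qed
  ultimately show ?thesis
    by simp
qed

text \<open>
  Since \<open>b \<cdot> (D a)\<^sup>n\<close> converges on the unit disc for every \<open>n\<close>, where \<open>b \<noteq> 0\<close> is fixed,
  \<open>D a\<close> has no poles there.
\<close>

theorem MF_fps_delta:
  assumes N: "N \<ge> 3" and F: "F \<in> MF k N"
  obtains G where "G \<in> MF k N"
    "\<And>\<gamma> c. \<gamma> \<in> SL2Z \<Longrightarrow> qexp N (slash k F \<gamma>) c \<Longrightarrow> qexp N (slash k G \<gamma>) (fps_delta c)"
proof -
  have N0: "N > 0"
    using N by simp
  obtain w d z0 where d: "cform w N d" and z0: "Im z0 > 0" "d z0 \<noteq> 0"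
    and den: "\<And>k F. F \<in> MF k N \<Longrightarrow> cspan (w + k) N (\<lambda>z. d z * F z)"
    using common_denominator[OF N] by metis
  have "\<forall>\<gamma>\<in>SL2Z. \<exists>c. qexp N (slash w d \<gamma>) c" "\<forall>\<gamma>\<in>SL2Z. \<exists>c. qexp N (slash k F \<gamma>) c"
    using cform_MF[OF d] F by (auto simp: MF_def)
  then obtain b a where b: "\<And>\<gamma>. \<gamma> \<in> SL2Z \<Longrightarrow> qexp N (slash w d \<gamma>) (b \<gamma>)"
    and a: "\<And>\<gamma>. \<gamma> \<in> SL2Z \<Longrightarrow> qexp N (slash k F \<gamma>) (a \<gamma>)"
    by metis
  have fam: "mf_family k N a"
    using F a by (rule mf_familyI)
  have famn: "mf_family (w + int n * k) N (\<lambda>\<gamma>. b \<gamma> * fps_delta (a \<gamma>) ^ n)" for n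
    by (rule mf_family_delta_power[OF N0 d b den fam])
  obtain G1 where G1: "G1 \<in> MF (w + k) N"
    and qG1: "\<And>\<gamma>. \<gamma> \<in> SL2Z \<Longrightarrow> qexp N (slash (w + k) G1 \<gamma>) (b \<gamma> * fps_delta (a \<gamma>))"
    using mf_familyE[OF famn[of 1]] by auto
  have conv: "qexp N (\<lambda>z. eval_fps (fps_delta (a \<gamma>)) (qq N z)) (fps_delta (a \<gamma>))" if \<gamma>: "\<gamma> \<in> SL2Z" for \<gamma>
  proof -
    obtain z1 where z1: "Im z1 > 0" "slash w d \<gamma> z1 \<noteq> 0"
      using slash_nonzero[of z0 d \<gamma>, OF z0 \<gamma>] by blast
    have b0: "eval_fps (b \<gamma>) (qq N z1) \<noteq> 0"
      using qexp_eval[OF b[OF \<gamma>] z1(1)] z1(2) by simp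
    have hol: "eval_fps (b \<gamma> * fps_delta (a \<gamma>) ^ n) holomorphic_on ball 0 1" for n
    proof -
      obtain H where "qexp N (slash (w + int n * k) H \<gamma>) (b \<gamma> * fps_delta (a \<gamma>) ^ n)"
        using mf_familyE[OF famn[of n]] \<gamma> by blast
      then show ?thesis
        by (rule qexp_holomorphic_disc)
    qed
    have rad: "fps_conv_radius (b \<gamma> * fps_delta (a \<gamma>) ^ n) \<ge> 1" for n
    proof -
      obtain H where "qexp N (slash (w + int n * k) H \<gamma>) (b \<gamma> * fps_delta (a \<gamma>) ^ n)"
        using mf_familyE[OF famn[of n]] \<gamma> by blast
      then show ?thesis
        by (simp add: qexp_def)
    qed
    have radb: "fps_conv_radius (b \<gamma>) \<ge> 1"
      using b[OF \<gamma>] by (simp add: qexp_def)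
    have less: "ereal (cmod w) < r" if "w \<in> ball 0 1" "r \<ge> 1" for w r
      using that by (metis dist_0_norm ereal_less(3) less_le_trans mem_ball)
    define A where "A = b \<gamma> * fps_delta (a \<gamma>)"
    have radA: "fps_conv_radius A \<ge> 1"
      using rad[of 1] by (simp add: A_def)
    \<comment> \<open>For A = b D a, the power A^(n+1) is b^n times b (D a)^(n+1), and the latter
      converges on the disc as the expansion of a form. This is the hypothesis of
      \<open>holomorphic_divide_of_powers\<close>.\<close>
    have pow: "\<exists>c. c holomorphic_on ball 0 1 \<and>
        (\<forall>w\<in>ball 0 1. eval_fps A w ^ Suc n = eval_fps (b \<gamma>) w ^ n * c w)" for n
    proof (intro exI conjI ballI)
      show "eval_fps (b \<gamma> * fps_delta (a \<gamma>) ^ Suc n) holomorphic_on ball 0 1"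
        by (rule hol)
      fix w :: complex assume w: "w \<in> ball 0 1"
      have "eval_fps A w ^ Suc n = eval_fps (A ^ Suc n) w"
        using less[OF w radA] by (simp only: eval_fps_power)
      also have "A ^ Suc n = b \<gamma> ^ n * (b \<gamma> * fps_delta (a \<gamma>) ^ Suc n)"
        by (simp add: A_def power_mult_distrib mult_ac)
      also have "eval_fps \<dots> w = eval_fps (b \<gamma> ^ n) w * eval_fps (b \<gamma> * fps_delta (a \<gamma>) ^ Suc n) w"
      proof (rule eval_fps_mult)
        have "fps_conv_radius (b \<gamma> ^ n) \<ge> 1"
          using fps_conv_radius_power[of "b \<gamma>" n] radb by (rule order_trans[rotated])
        then show "ereal (cmod w) < fps_conv_radius (b \<gamma> ^ n)"
          by (rule less[OF w])
        show "ereal (cmod w) < fps_conv_radius (b \<gamma> * fps_delta (a \<gamma>) ^ Suc n)"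
          by (rule less[OF w rad])
      qed
      also have "eval_fps (b \<gamma> ^ n) w = eval_fps (b \<gamma>) w ^ n"
        using less[OF w radb] by (simp only: eval_fps_power)
      finally show "eval_fps A w ^ Suc n = eval_fps (b \<gamma>) w ^ n * eval_fps (b \<gamma> * fps_delta (a \<gamma>) ^ Suc n) w" .
    qed
    have holA: "eval_fps A holomorphic_on ball 0 1"
      using hol[of 1] by (simp add: A_def)
    have qin: "qq N z \<in> ball 0 1" if "Im z > 0" for z
      using norm_qq_less_1[OF N0 that] by simp
    obtain g where g: "g holomorphic_on ball 0 1"
      and gA: "\<And>w. w \<in> ball 0 1 \<Longrightarrow> eval_fps A w = eval_fps (b \<gamma>) w * g w"
      using holomorphic_divide_of_powers[OF open_ball connected_ball holA
          qexp_holomorphic_disc[OF b[OF \<gamma>]] qin[OF z1(1)] b0 pow] by blast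
    have qg: "qexp N (\<lambda>z. g (qq N z)) (fps_expansion g 0)"
      by (rule qexp_of_disc[OF g N0]) simp
    have "b \<gamma> * fps_expansion g 0 = b \<gamma> * fps_delta (a \<gamma>)"
    proof (rule qexp_unique[OF _ qG1[OF \<gamma>] N0])
      have "qexp N (\<lambda>z. slash w d \<gamma> z * g (qq N z)) (b \<gamma> * fps_expansion g 0)"
        by (rule qexp_mult[OF b[OF \<gamma>] qg N0])
      moreover have "slash (w + k) G1 \<gamma> z = slash w d \<gamma> z * g (qq N z)" if "Im z > 0" for z
        using qexp_eval[OF qG1[OF \<gamma>] that] qexp_eval[OF b[OF \<gamma>] that] gA[OF qin[OF that]]
        by (simp add: A_def)
      ultimately show "qexp N (slash (w + k) G1 \<gamma>) (b \<gamma> * fps_expansion g 0)"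
        by (rule qexp_congI)
    qed
    moreover have "b \<gamma> \<noteq> 0"
      using qexp_eq_0_iff[OF b[OF \<gamma>] N0] z1 by auto
    ultimately have "fps_expansion g 0 = fps_delta (a \<gamma>)"
      by simp
    then show ?thesis
      using qg by (simp add: qexp_def)
  qed
  define G where "G z = eval_fps (fps_delta (a (mat 1))) (qq N z)" for z
  have holG: "G holomorphic_on uhp"
    using qexp_holomorphic[OF conv[OF SL2Z_1] N0] by (simp add: G_def[abs_def])
  have G1eq: "slash (w + k) G1 \<gamma> z = slash w d \<gamma> z * eval_fps (fps_delta (a \<gamma>)) (qq N z)"
    if \<gamma>: "\<gamma> \<in> SL2Z" and z: "Im z > 0" for \<gamma> z
  proof -
    have "qexp N (\<lambda>z. slash w d \<gamma> z * eval_fps (fps_delta (a \<gamma>)) (qq N z)) (b \<gamma> * fps_delta (a \<gamma>))"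
      by (rule qexp_mult[OF b[OF \<gamma>] conv[OF \<gamma>] N0])
    from qexp_eval[OF this z] qexp_eval[OF qG1[OF \<gamma>] z] show ?thesis
      by simp
  qed
  \<comment> \<open>G is defined from the expansion at the identity alone. Its slashes are found by
    cancelling d in \<open>G1\<close> = d G, whose slashes are known.\<close>
  have slG: "slash k G \<gamma> z = eval_fps (fps_delta (a \<gamma>)) (qq N z)" if \<gamma>: "\<gamma> \<in> SL2Z" and z: "Im z > 0" for \<gamma> z
  proof (rule holomorphic_mult_cancel[OF _ _ _ _ _ z])
    show "slash k G \<gamma> holomorphic_on uhp"
      using holG \<gamma> by (simp add: slash_holomorphic)
    show "(\<lambda>z. eval_fps (fps_delta (a \<gamma>)) (qq N z)) holomorphic_on uhp"
      by (rule qexp_holomorphic[OF conv[OF \<gamma>] N0])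
    show "slash w d \<gamma> holomorphic_on uhp"
      by (rule qexp_holomorphic[OF b[OF \<gamma>] N0])
    show "\<exists>z\<in>uhp. slash w d \<gamma> z \<noteq> 0"
      using slash_nonzero[of z0 d \<gamma>, OF z0 \<gamma>] by (metis uhp_iff)
    fix z assume z: "Im z > 0"
    have "slash w d \<gamma> z * slash k G \<gamma> z = slash (w + k) (\<lambda>z. d z * G z) \<gamma> z"
      using z \<gamma> by (simp add: slash_prod2)
    also have "\<dots> = slash (w + k) G1 \<gamma> z"
      using G1eq[OF SL2Z_1] z \<gamma> by (intro slash_cong) (auto simp: G_def)
    also have "\<dots> = slash w d \<gamma> z * eval_fps (fps_delta (a \<gamma>)) (qq N z)"
      by (rule G1eq[OF \<gamma> z])
    finally show "slash w d \<gamma> z * slash k G \<gamma> z = slash w d \<gamma> z * eval_fps (fps_delta (a \<gamma>)) (qq N z)" .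
  qed
  have qG: "qexp N (slash k G \<gamma>) (fps_delta (a \<gamma>))" if \<gamma>: "\<gamma> \<in> SL2Z" for \<gamma>
    using conv[OF \<gamma>] qexp_cong[of "slash k G \<gamma>" "\<lambda>z. eval_fps (fps_delta (a \<gamma>)) (qq N z)", OF slG[OF \<gamma>]] by simp
  have inv: "slash k G \<gamma> z = G z" if \<gamma>: "\<gamma> \<in> Gam N" and z: "Im z > 0" for \<gamma> z
  proof -
    have "qexp N (slash k F \<gamma>) (a (mat 1))"
      using a[OF SL2Z_1] qexp_cong[of "slash k F \<gamma>" "slash k F (mat 1)"] MF_inv[OF F \<gamma>] by simp
    then have "a \<gamma> = a (mat 1)"
      using a[OF Gam_SL2Z[OF \<gamma>]] qexp_unique N0 by blast
    then show ?thesis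
      using slG[OF Gam_SL2Z[OF \<gamma>] z] by (simp add: G_def)
  qed
  have "G \<in> MF k N"
    unfolding MF_def using inv qG by blast
  moreover have "qexp N (slash k G \<gamma>) (fps_delta c)" if "\<gamma> \<in> SL2Z" "qexp N (slash k F \<gamma>) c" for \<gamma> c
    using qG[OF that(1)] qexp_unique[OF that(2) a[OF that(1)] N0] by simp
  ultimately show ?thesis
    by (rule that)
qed

end

subsection \<open>Newform coefficients are killed by derivations\<close>

lemma sum_qq_power:
  assumes d: "d > 0"
  shows "(\<Sum>b<d. qq d (of_nat b) ^ j) = (if d dvd j then of_nat d else 0)"
proof -
  define x where "x = qq d (of_nat j)"
  have pw: "qq d (of_nat b) ^ j = x ^ b" for b
    by (simp add: x_def qq_def exp_of_nat_mult [symmetric] mult_ac)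
  have x1: "x = 1 \<longleftrightarrow> d dvd j"
  proof -
    have "x = 1 \<longleftrightarrow> (\<exists>n::int. (of_nat j :: complex) = of_int n * of_nat d)"
      by (simp add: x_def qq_eq_1_iff[OF d])
    also have "\<dots> \<longleftrightarrow> (\<exists>n::int. int j = n * int d)"
    proof -
      have "(of_nat j :: complex) = of_int n * of_nat d \<longleftrightarrow> int j = n * int d" for n
        by (metis of_int_eq_iff of_int_mult of_int_of_nat_eq)
      then show ?thesis
        by simp
    qed
    also have "\<dots> \<longleftrightarrow> int d dvd int j"
      by (auto simp: dvd_def mult.commute)
    finally show ?thesis
      by simp
  qed
  have xd: "x ^ d = 1"
  proof -
    have "x ^ d = qq d (of_nat j * of_nat d)"
      by (simp add: x_def qq_def exp_of_nat_mult [symmetric] mult_ac)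
    also have "\<dots> = 1"
      using qq_eq_1_iff[OF d, of "of_nat j * of_nat d"] by (metis of_int_of_nat_eq)
    finally show ?thesis .
  qed
  show ?thesis
  proof (cases "x = 1")
    case True
    then show ?thesis
      using x1 by (simp add: pw)
  next
    case False
    then have "(\<Sum>b<d. x ^ b) = 0"
      using xd by (simp add: geometric_sum)
    then show ?thesis
      using x1 False by (simp add: pw)
  qed
qed

text \<open>Orthogonality of the d-th roots of unity keeps exactly the exponents divisible by
  d.\<close>

lemma qexp_sum_shifts:
  assumes G: "qexp 1 G c" and d: "d > 0" and e: "e > 0"
  shows "qexp 1 (\<lambda>z. \<Sum>b<d. G ((of_nat e * z + of_nat b) / of_nat d))
    (fps_const (of_nat d) * fps_spread e (Abs_fps (\<lambda>l. fps_nth c (d * l))))"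
proof -
  have "has_q_expansion 1 (fps_nth (fps_const (of_nat d) * fps_spread e (Abs_fps (\<lambda>l. fps_nth c (d * l)))))
     (\<lambda>z. \<Sum>b<d. G ((of_nat e * z + of_nat b) / of_nat d))"
    unfolding has_q_expansion_def
  proof
    fix z assume z: "z \<in> uhp"
    define q where "q b = qq 1 ((of_nat e * z + of_nat b) / of_nat d)" for b :: nat
    have "(\<lambda>j. \<Sum>b<d. fps_nth c j * q b ^ j) sums (\<Sum>b<d. G ((of_nat e * z + of_nat b) / of_nat d))"
    proof (rule sums_sum)
      fix b assume "b \<in> {..<d}"
      have hq: "has_q_expansion 1 (fps_nth c) G"
        using G by (simp only: qexp_iff[OF zero_less_one])
      have "(of_nat e * z + of_nat b) / of_nat d \<in> uhp"
        using z d e by (simp add: Im_divide_of_nat)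
      from bspec[OF hq[unfolded has_q_expansion_def] this]
      show "(\<lambda>j. fps_nth c j * q b ^ j) sums G ((of_nat e * z + of_nat b) / of_nat d)"
        by (simp only: q_def qq_def)
    qed
    moreover have "(\<Sum>b<d. fps_nth c j * q b ^ j) =
        (if d dvd j then of_nat d * fps_nth c j * qq d (of_nat e * z) ^ j else 0)" for j
    proof -
      have "q b = qq d (of_nat e * z) * qq d (of_nat b)" for b
        by (simp add: q_def qq_def exp_add [symmetric] algebra_simps add_divide_distrib)
      then have "(\<Sum>b<d. fps_nth c j * q b ^ j) =
          fps_nth c j * qq d (of_nat e * z) ^ j * (\<Sum>b<d. qq d (of_nat b) ^ j)"
        by (simp add: power_mult_distrib sum_distrib_left mult_ac)
      then show ?thesis
        by (simp add: sum_qq_power[OF d])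
    qed
    ultimately have "(\<lambda>j. if d dvd j then of_nat d * fps_nth c j * qq d (of_nat e * z) ^ j else 0) sums
        (\<Sum>b<d. G ((of_nat e * z + of_nat b) / of_nat d))" (is "?f sums ?S")
      by simp
    moreover have "(\<lambda>l. ?f (d * l)) sums ?S \<longleftrightarrow> ?f sums ?S"
      by (rule sums_mono_reindex) (use d in \<open>auto simp: strict_mono_def dvd_def\<close>)
    ultimately have 1: "(\<lambda>l. ?f (d * l)) sums ?S"
      by simp
    let ?g = "\<lambda>n. fps_nth (fps_const (of_nat d) * fps_spread e (Abs_fps (\<lambda>l. fps_nth c (d * l)))) n * qq 1 z ^ n"
    have A: "(\<lambda>l. ?g (e * l)) sums ?S \<longleftrightarrow> ?g sums ?S"
      by (rule sums_mono_reindex) (use e in \<open>auto simp: strict_mono_def dvd_def fps_spread_nth\<close>)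
    have "?g (e * l) = ?f (d * l)" for l
    proof -
      have "qq d (of_nat e * z) ^ (d * l) = qq 1 z ^ (e * l)"
        using d by (simp add: qq_def exp_of_nat_mult [symmetric] mult_ac)
      then show ?thesis
        using e by (simp add: fps_spread_nth)
    qed
    then have B: "(\<lambda>l. ?g (e * l)) = (\<lambda>l. ?f (d * l))"
      by (rule ext)
    have "?g sums ?S"
      using A 1 unfolding B by blast
    then show "(\<lambda>n. fps_nth (fps_const (of_nat d) * fps_spread e (Abs_fps (\<lambda>l. fps_nth c (d * l)))) n *
        exp (2 * of_real pi * \<i> * z / of_nat 1) ^ n) sums ?S"
      by (simp only: qq_def)
  qed
  then show ?thesis
    by (simp only: qexp_iff[OF zero_less_one])
qed

text \<open>The Hecke operator on expansions at oo, kept formal so that it can be commuted with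
  \<open>fps_delta\<close> without any question of convergence.\<close>

definition hecke_fps :: "int \<Rightarrow> (int \<Rightarrow> complex) \<Rightarrow> nat \<Rightarrow> complex fps \<Rightarrow> complex fps" where
  "hecke_fps k \<psi> n c = (\<Sum>d | d dvd n.
     fps_const (of_nat n powi (k - 1) * \<psi> (int (n div d)) * of_nat d powi (- k) * of_nat d) *
     fps_spread (n div d) (Abs_fps (\<lambda>l. fps_nth c (d * l))))"

lemma qexp_hecke:
  assumes G: "qexp 1 G c" and n: "n > 0"
  shows "qexp 1 (hecke k \<psi> n G) (hecke_fps k \<psi> n c)"
proof -
  have "hecke k \<psi> n G = (\<lambda>z. \<Sum>d | d dvd n. (of_nat n powi (k - 1) * \<psi> (int (n div d)) * of_nat d powi (- k)) *
      (\<Sum>b<d. G ((of_nat (n div d) * z + of_nat b) / of_nat d)))"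
    by (simp only: fun_eq_iff hecke_def sum_distrib_left mult.assoc) simp
  moreover have "qexp 1 (\<lambda>z. \<Sum>d | d dvd n. (of_nat n powi (k - 1) * \<psi> (int (n div d)) * of_nat d powi (- k)) *
      (\<Sum>b<d. G ((of_nat (n div d) * z + of_nat b) / of_nat d)))
     (\<Sum>d | d dvd n. fps_const (of_nat n powi (k - 1) * \<psi> (int (n div d)) * of_nat d powi (- k)) *
       (fps_const (of_nat d) * fps_spread (n div d) (Abs_fps (\<lambda>l. fps_nth c (d * l)))))"
  proof (intro qexp_sum qexp_cmult qexp_sum_shifts[OF G])
    fix d assume d: "d \<in> {d. d dvd n}"
    then show "d > 0" "n div d > 0"
      using n by (auto intro: dvd_pos_nat simp: div_greater_zero_iff dvd_imp_le)
  qed simp_all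
  moreover have "fps_const x * (fps_const y * a) = fps_const (x * y) * a" for x y :: complex and a
    by (simp add: mult.assoc [symmetric])
  ultimately show ?thesis
    by (simp add: hecke_fps_def)
qed

lemma fps_spread_eq_0D: "fps_spread m a = 0 \<Longrightarrow> m > 0 \<Longrightarrow> a = 0"
proof -
  assume *: "fps_spread m a = 0" "m > 0"
  have "fps_nth a n = fps_nth (fps_spread m a) (m * n)" for n
    using *(2) by (simp add: fps_spread_nth)
  then show "a = 0"
    using *(1) by (simp add: fps_eq_iff)
qed

lemma hecke_fps_nth:
  "fps_nth (hecke_fps k \<psi> n c) i = (\<Sum>d | d dvd n. (of_nat n powi (k - 1) * \<psi> (int (n div d)) * of_nat d powi (- k) * of_nat d) *
     (if n div d dvd i then fps_nth c (d * (i div (n div d))) else 0))"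
  by (simp add: hecke_fps_def fps_sum_nth fps_spread_nth cong: if_cong)

lemma hecke_fps_add: "hecke_fps k \<psi> n (a + b) = hecke_fps k \<psi> n a + hecke_fps k \<psi> n b"
  unfolding fps_eq_iff fps_add_nth hecke_fps_nth sum.distrib [symmetric]
  by (intro allI sum.cong) (auto simp: algebra_simps)

lemma hecke_fps_cmult: "hecke_fps k \<psi> n (fps_const x * a) = fps_const x * hecke_fps k \<psi> n a"
  unfolding fps_eq_iff fps_mult_left_const_nth hecke_fps_nth sum_distrib_left
  by (intro allI sum.cong) (auto simp: algebra_simps)

lemma hecke_fps_0: "hecke_fps k \<psi> n 0 = 0"
  using hecke_fps_cmult[of k \<psi> n 0 0] by simp

lemma hecke_fps_sum: "hecke_fps k \<psi> n (\<Sum>i\<in>I. a i) = (\<Sum>i\<in>I. hecke_fps k \<psi> n (a i))"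
  by (induction I rule: infinite_finite_induct) (simp_all add: hecke_fps_0 hecke_fps_add)

lemma hecke_fps_nth_1:
  assumes n: "n > 0" and "\<psi> 1 = 1"
  shows "fps_nth (hecke_fps k \<psi> n c) 1 = fps_nth c n"
proof -
  have "fps_nth (hecke_fps k \<psi> n c) 1 = (\<Sum>d\<in>{n}. (of_nat n powi (k - 1) * \<psi> (int (n div d)) * of_nat d powi (- k) * of_nat d) *
     (if n div d dvd 1 then fps_nth c (d * (1 div (n div d))) else 0))"
    unfolding hecke_fps_nth
  proof (rule sum.mono_neutral_right)
    show "\<forall>d\<in>{d. d dvd n} - {n}. of_nat n powi (k - 1) * \<psi> (int (n div d)) * of_nat d powi (- k) * of_nat d *
        (if n div d dvd 1 then fps_nth c (d * (1 div (n div d))) else 0) = 0"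
    proof
      fix d assume d: "d \<in> {d. d dvd n} - {n}"
      have "\<not> n div d dvd 1"
      proof
        assume "n div d dvd 1"
        then have "n div d = 1"
          by simp
        then have "n = d"
          using d by (metis DiffD1 dvd_mult_div_cancel mem_Collect_eq mult.right_neutral)
        then show False
          using d by simp
      qed
      then show "of_nat n powi (k - 1) * \<psi> (int (n div d)) * of_nat d powi (- k) * of_nat d *
        (if n div d dvd 1 then fps_nth c (d * (1 div (n div d))) else 0) = 0"
        by simp
    qed
  qed (use n in auto)
  also have "\<dots> = (of_nat n powi (k - 1) * of_nat n powi (- k) * of_nat n) * fps_nth c n"
    using assms by simp
  also have "of_nat n powi (k - 1) * of_nat n powi (- k) * of_nat n = (1 :: complex)"
  proof -
    have "of_nat n powi (k - 1) * of_nat n powi (- k) * of_nat n powi 1 = (of_nat n powi (k - 1 + (- k) + 1) :: complex)"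
      using n by (subst power_int_add, simp)+ simp
    then show ?thesis
      by simp
  qed
  finally show ?thesis
    by simp
qed

lemma dirichlet_1: "dirichlet_character N \<psi> \<Longrightarrow> \<psi> 1 = 1"
proof -
  assume "dirichlet_character N \<psi>"
  then have "\<psi> (1 * 1) = \<psi> 1 * \<psi> 1" "\<psi> 1 \<noteq> 0"
    unfolding dirichlet_character_def by (blast, simp)
  then show ?thesis
    by simp
qed

lemma dirichlet_mult: "dirichlet_character N \<psi> \<Longrightarrow> \<psi> (a * b) = \<psi> a * \<psi> b"
  by (simp add: dirichlet_character_def)

lemma dirichlet_period: "dirichlet_character N \<psi> \<Longrightarrow> \<psi> (a + m * int N) = \<psi> a"
proof (induction m arbitrary: a rule: int_induct[where k = 0])
  case base
  then show ?case
    by simp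
next
  case (step1 m)
  have "\<psi> (a + (m + 1) * int N) = \<psi> ((a + m * int N) + int N)"
    by (simp add: algebra_simps)
  then show ?case
    using step1 by (simp add: dirichlet_character_def)
next
  case (step2 m)
  have "\<psi> (a + (m - 1) * int N) = \<psi> ((a + (m - 1) * int N) + int N)"
    using step2(3) unfolding dirichlet_character_def by metis
  also have "(a + (m - 1) * int N) + int N = a + m * int N"
    by (simp add: algebra_simps)
  finally show ?case
    using step2 by simp
qed

lemma dirichlet_cong:
  assumes "dirichlet_character N \<psi>" "int N dvd a - b"
  shows "\<psi> a = \<psi> b"
proof -
  obtain m where "a - b = int N * m"
    using assms(2) ..
  then have "a = b + m * int N"
    by (simp add: algebra_simps)
  then show ?thesis
    using dirichlet_period[OF assms(1)] by simp
qed

lemma dirichlet_cnj: "dirichlet_character N chi \<Longrightarrow> dirichlet_character N (\<lambda>d. cnj (chi d))"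
  by (simp add: dirichlet_character_def)

lemma transl_Gamma0 [simp]: "transl n \<in> Gamma0 N"
  by (simp add: Gamma0_def) (simp add: transl_def)

lemma modular_transform_period:
  assumes "modular_transform k N \<psi> F" "dirichlet_character N \<psi>" "Im z > 0"
  shows "F (z + of_int n) = F z"
proof -
  have "F (mat_act (transl n) z) = \<psi> (transl n $ 2 $ 2) * aut_factor (transl n) z powi k * F z"
    using assms transl_Gamma0 by (simp only: modular_transform_def uhp_iff)
  moreover have "transl n $ 2 $ 2 = 1"
    by (simp add: transl_def)
  ultimately show ?thesis
    using dirichlet_1[OF assms(2)] by simp
qed

lemma modular_transform_slash:
  assumes F: "modular_transform k N \<psi> F" and \<gamma>: "\<gamma> \<in> Gamma0 N" and z: "Im z > 0"
  shows "slash k F \<gamma> z = \<psi> (\<gamma> $ 2 $ 2) * F z"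
proof -
  have S: "\<gamma> \<in> SL2Z"
    using \<gamma> by (simp add: Gamma0_def)
  have nz: "aut_factor \<gamma> z \<noteq> 0"
    using S z by (simp add: aut_factor_nonzero)
  have "F (mat_act \<gamma> z) = \<psi> (\<gamma> $ 2 $ 2) * aut_factor \<gamma> z powi k * F z"
    using F \<gamma> z by (simp add: modular_transform_def)
  then show ?thesis
    using nz by (simp add: slash_def power_int_minus field_simps)
qed

lemma Gam_Gamma0:
  assumes "\<gamma> \<in> Gam N"
  shows "\<gamma> \<in> Gamma0 N" "int N dvd \<gamma> $ 2 $ 2 - 1"
proof -
  have c: "congm N \<gamma> (mat 1)" and S: "\<gamma> \<in> SL2Z"
    using assms by (auto simp: Gam_def)
  have "int N dvd \<gamma> $ 2 $ 1 - (mat 1 :: int^2^2) $ 2 $ 1" "int N dvd \<gamma> $ 2 $ 2 - (mat 1 :: int^2^2) $ 2 $ 2"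
    using c by (auto simp only: congm_def)
  then show "\<gamma> \<in> Gamma0 N" "int N dvd \<gamma> $ 2 $ 2 - 1"
    using S by (auto simp: Gamma0_def)
qed

lemma modular_transform_Gam:
  assumes F: "modular_transform k N \<psi> F" and \<psi>: "dirichlet_character N \<psi>" and \<gamma>: "\<gamma> \<in> Gam N" and z: "Im z > 0"
  shows "slash k F \<gamma> z = F z"
proof -
  have "\<psi> (\<gamma> $ 2 $ 2) = \<psi> 1"
    using Gam_Gamma0[OF \<gamma>] by (intro dirichlet_cong[OF \<psi>])
  then show ?thesis
    using modular_transform_slash[OF F Gam_Gamma0(1)[OF \<gamma>] z] dirichlet_1[OF \<psi>] by simp
qed

lemma cusp_forms_MF:
  assumes g: "g \<in> cusp_forms k N \<psi>" and N: "N > 0" and \<psi>: "dirichlet_character N \<psi>"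
  shows "g \<in> MF k N"
proof -
  have "modular_transform k N \<psi> g"
    using g by (simp add: cusp_forms_def)
  moreover have "\<exists>c. qexp N (slash k g \<gamma>) c" if "\<gamma> \<in> SL2Z" for \<gamma>
    using g that has_q_expansion_qexp[OF N] unfolding cusp_forms_def by blast
  ultimately show ?thesis
    unfolding MF_def using modular_transform_Gam[OF _ \<psi>] by blast
qed

lemma cusp_forms_qexp:
  assumes g: "g \<in> cusp_forms k N \<psi>" and N: "N > 0" and \<psi>: "dirichlet_character N \<psi>"
  shows "qexp 1 g (Abs_fps (q_coeff g))" and "q_coeff g 0 = 0"
proof -
  have M: "g \<in> MF k N"
    by (rule cusp_forms_MF[OF assms])
  have tr: "modular_transform k N \<psi> g"
    using g by (simp add: cusp_forms_def)
  obtain B Y where B: "\<And>z. Im z \<ge> Y \<Longrightarrow> cmod (slash k g (mat 1) z) \<le> B"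
    using MF_slash_lim[OF M N SL2Z_1] by blast
  obtain c where c: "qexp 1 g c"
  proof (rule qexp_exists[where F = g and h = 1])
    show "g holomorphic_on uhp"
      by (rule MF_holomorphic[OF M N])
    show "g (z + of_nat 1) = g z" if "Im z > 0" for z
      using modular_transform_period[OF tr \<psi> that, of 1] by simp
    show "cmod (g z) \<le> B" if "Im z \<ge> Y" for z
      using B[OF that] by simp
  qed simp_all
  have uniq: "fps_nth c = a" if "has_q_expansion 1 a g" for a
    using qexp_unique[OF c has_q_expansion_qexp[OF _ that]] by (simp add: fun_eq_iff)
  have "q_coeff g = fps_nth c"
    unfolding q_coeff_def
  proof (rule the_equality)
    show "has_q_expansion 1 (fps_nth c) g"
      using c by (simp only: qexp_iff[OF zero_less_one])
  qed (rule uniq [symmetric])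
  then show "qexp 1 g (Abs_fps (q_coeff g))"
    using c by (simp add: fps_nth_inverse)
  obtain a where a: "a 0 = 0" "has_q_expansion N a (slash k g (mat 1))"
    using g SL2Z_1 unfolding cusp_forms_def by blast
  have "slash k g (mat 1) = g"
    by (simp add: fun_eq_iff)
  then have "Abs_fps a = fps_spread N c"
    using qexp_unique[OF has_q_expansion_qexp[OF N a(2)] _ N] qexp_spread[OF c zero_less_one N] by simp
  then have "fps_nth (Abs_fps a) 0 = fps_nth (fps_spread N c) 0"
    by simp
  then show "q_coeff g 0 = 0"
    using a(1) \<open>q_coeff g = fps_nth c\<close> by (simp add: fps_spread_nth)
qed

lemma homogeneous_system:
  fixes a :: "'a \<Rightarrow> nat \<Rightarrow> complex"
  assumes "finite J" "card J > n"
  shows "\<exists>x. (\<exists>j\<in>J. x j \<noteq> 0) \<and> (\<forall>i<n. (\<Sum>j\<in>J. x j * a j i) = 0)"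
  using assms
proof (induction n arbitrary: J a)
  case 0
  then obtain j where "j \<in> J"
    by (metis card_gt_0_iff ex_in_conv)
  then show ?case
    by (intro exI[of _ "\<lambda>_. 1"]) auto
next
  case (Suc n)
  show ?case
  proof (cases "\<forall>j\<in>J. a j n = 0")
    case True
    obtain x where "\<exists>j\<in>J. x j \<noteq> 0" "\<forall>i<n. (\<Sum>j\<in>J. x j * a j i) = 0"
      using Suc.IH[of J a] Suc.prems by auto
    then show ?thesis
      using True by (intro exI[of _ x]) (auto simp: less_Suc_eq)
  next
    case False
    then obtain p where p: "p \<in> J" "a p n \<noteq> 0"
      by blast
    have "finite (J - {p})" "card (J - {p}) > n"
      using Suc.prems p by auto
    then obtain x where x: "\<exists>j\<in>J - {p}. x j \<noteq> 0"
      and eq: "\<forall>i<n. (\<Sum>j\<in>J - {p}. x j * (a j i - a j n / a p n * a p i)) = 0"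
      using Suc.IH[of "J - {p}" "\<lambda>j i. a j i - a j n / a p n * a p i"] by blast
    define x' where "x' = x(p := - (\<Sum>j\<in>J - {p}. x j * a j n) / a p n)"
    have s: "(\<Sum>j\<in>J. x' j * a j i) =
        (\<Sum>j\<in>J - {p}. x j * a j i) - (\<Sum>j\<in>J - {p}. x j * a j n) / a p n * a p i" for i
    proof -
      have "(\<Sum>j\<in>J. x' j * a j i) = x' p * a p i + (\<Sum>j\<in>J - {p}. x' j * a j i)"
        by (rule sum.remove[OF Suc.prems(1) p(1)])
      also have "(\<Sum>j\<in>J - {p}. x' j * a j i) = (\<Sum>j\<in>J - {p}. x j * a j i)"
        by (rule sum.cong) (auto simp: x'_def)
      finally show ?thesis
        by (simp add: x'_def)
    qed
    have "(\<Sum>j\<in>J. x' j * a j i) = 0" if "i < Suc n" for i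
    proof (cases "i = n")
      case True
      then show ?thesis
        using p(2) by (simp add: s)
    next
      case False
      then have "i < n"
        using that by simp
      have "(\<Sum>j\<in>J - {p}. x j * a j i) - (\<Sum>j\<in>J - {p}. x j * a j n) / a p n * a p i =
          (\<Sum>j\<in>J - {p}. x j * (a j i - a j n / a p n * a p i))"
        unfolding sum_divide_distrib sum_distrib_right sum_subtractf [symmetric]
        by (intro sum.cong) (simp_all add: algebra_simps)
      then show ?thesis
        using eq \<open>i < n\<close> by (simp add: s)
    qed
    moreover have "\<exists>j\<in>J. x' j \<noteq> 0"
      using x by (auto simp: x'_def)
    ultimately show ?thesis
      by blast
  qed
qed

context derivation
begin

text \<open>The powers of a nonzero value are again values of the character, hence finite in number,
  so the value is a root of unity.\<close>

lemma dirichlet_const: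
  assumes \<psi>: "dirichlet_character N \<psi>" and N: "N > 0"
  shows "\<delta> (\<psi> a) = 0"
proof (cases "\<psi> a = 0")
  case False
  have pw: "\<psi> a ^ n = \<psi> (a ^ n)" for n
    by (induction n) (simp_all add: dirichlet_1[OF \<psi>] dirichlet_mult[OF \<psi>])
  have "range (\<lambda>n. \<psi> a ^ n) \<subseteq> \<psi> ` {0..<int N}"
  proof safe
    fix n
    have "\<psi> (a ^ n) = \<psi> (a ^ n mod int N)"
      by (rule dirichlet_cong[OF \<psi>]) (simp add: minus_mod_eq_div_mult)
    moreover have "a ^ n mod int N \<in> {0..<int N}"
      using N by simp
    ultimately show "\<psi> a ^ n \<in> \<psi> ` {0..<int N}"
      by (simp add: pw)
  qed
  then have "finite (range (\<lambda>n. \<psi> a ^ n))"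
    by (rule finite_subset) simp
  then have "\<not> inj (\<lambda>n::nat. \<psi> a ^ n)"
    using finite_imageD by blast
  then obtain i j :: nat where ij: "i < j" "\<psi> a ^ i = \<psi> a ^ j"
    by (metis injI linorder_neqE_nat)
  have "\<psi> a ^ j = \<psi> a ^ i * \<psi> a ^ (j - i)"
    using ij(1) by (simp add: power_add [symmetric])
  then have "\<psi> a ^ (j - i) = 1"
    using ij(2) False by simp
  then have "\<delta> (\<psi> a ^ (j - i)) = 0"
    by (simp only: \<delta>_1)
  then show ?thesis
    by (rule const_root) (use ij(1) in simp)
qed simp

lemma fps_delta_hecke:
  assumes "\<And>a. \<delta> (\<psi> a) = 0"
  shows "fps_delta (hecke_fps k \<psi> n c) = hecke_fps k \<psi> n (fps_delta c)"
proof -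
  have "\<delta> (of_nat n powi (k - 1) * \<psi> (int (n div d)) * of_nat d powi (- k) * of_nat d) = 0" for d
    using assms by (intro const_mult const_powi) simp_all
  then show ?thesis
    by (auto simp: fps_eq_iff hecke_fps_nth \<delta>_sum mult intro!: sum.cong)
qed

lemma fps_delta_spread: "fps_delta (fps_spread m c) = fps_spread m (fps_delta c)"
  by (simp add: fps_eq_iff fps_spread_nth)

lemma fps_delta_funpow_spread: "(fps_delta ^^ j) (fps_spread m c) = fps_spread m ((fps_delta ^^ j) c)"
  by (induction j) (simp_all add: fps_delta_spread)

text \<open>After multiplication by the series b of a common denominator, all iterates D^j c lie in
  the span of the same n series \<open>a i\<close>, so n + 1 of them are dependent.\<close>

lemma fps_delta_funpow_dependent:
  assumes N: "N > 0" and F: "F \<in> MF k N" and c: "qexp 1 F c"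
  obtains n :: nat and x where "\<exists>j\<le>n. x j \<noteq> 0" "(\<Sum>j\<le>n. fps_const (x j) * (fps_delta ^^ j) c) = 0"
proof -
  \<comment> \<open>\<open>common_denominator\<close> asks for a level of at least 3.\<close>
  define M where "M = N * 3"
  have M: "M \<ge> 3" "M > 0"
    using N by (simp_all add: M_def)
  have FM: "F \<in> MF k M"
    unfolding M_def by (rule MF_raise[OF F N]) simp
  define c' where "c' = fps_spread M c"
  have c': "qexp M F c'"
    using qexp_spread[OF c zero_less_one M(2)] by (simp add: c'_def)
  obtain w d z0 where d: "cform w M d" and z0: "Im z0 > 0" "d z0 \<noteq> 0"
    and den: "\<And>k F. F \<in> MF k M \<Longrightarrow> cspan (w + k) M (\<lambda>z. d z * F z)"
    using common_denominator[OF M(1)] by metis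
  obtain n :: nat and u t where u: "\<And>i. i < n \<Longrightarrow> cform (w + k) M (u i)"
    and eq: "\<And>z. Im z > 0 \<Longrightarrow> d z * F z = (\<Sum>i<n. t i * u i z)"
    using cspanE[OF den[OF FM]] by metis
  have "\<exists>a. qexp M (u i) a \<and> fps_delta a = 0" if i: "i < n" for i
  proof -
    obtain a where "qexp M (u i) a"
      using MF_qexp1E[OF cform_MF[OF u[OF i]]] by blast
    then show ?thesis
      using cform_const1[OF u[OF i]] by (auto simp: fps_delta_eq_0_iff)
  qed
  then obtain a where a: "\<And>i. i < n \<Longrightarrow> qexp M (u i) (a i)" "\<And>i. i < n \<Longrightarrow> fps_delta (a i) = 0"
    by metis
  obtain b where b: "qexp M d b"
    using MF_qexp1E[OF cform_MF[OF d]] by blast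
  have db: "fps_delta b = 0"
    using cform_const1[OF d b] by (simp add: fps_delta_eq_0_iff)
  have "b * c' = (\<Sum>i<n. fps_const (t i) * a i)"
  proof (rule qexp_unique[OF _ _ M(2)])
    show "qexp M (\<lambda>z. d z * F z) (b * c')"
      by (rule qexp_mult[OF b c' M(2)])
    have "qexp M (\<lambda>z. \<Sum>i<n. t i * u i z) (\<Sum>i<n. fps_const (t i) * a i)"
      using a(1) M(2) by (intro qexp_sum qexp_cmult) auto
    then show "qexp M (\<lambda>z. d z * F z) (\<Sum>i<n. fps_const (t i) * a i)"
      by (rule qexp_congI) (rule eq)
  qed
  then have bj: "b * (fps_delta ^^ j) c' = (\<Sum>i<n. fps_const ((\<delta> ^^ j) (t i)) * a i)" for j
    using fps_delta_funpow_const_left[OF db, of j c'] fps_delta_funpow_sum_const[of "{..<n}" a j t] a(2) by simp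
  obtain x where x: "\<exists>j\<in>{..n}. x j \<noteq> 0" "\<forall>i<n. (\<Sum>j\<in>{..n}. x j * (\<delta> ^^ j) (t i)) = 0"
    using homogeneous_system[of "{..n}" n "\<lambda>j i. (\<delta> ^^ j) (t i)"] by auto
  have "b * (\<Sum>j\<le>n. fps_const (x j) * (fps_delta ^^ j) c') = (\<Sum>j\<le>n. fps_const (x j) * (b * (fps_delta ^^ j) c'))"
    by (simp add: sum_distrib_left mult_ac)
  also have "\<dots> = (\<Sum>j\<le>n. \<Sum>i<n. fps_const (x j * (\<delta> ^^ j) (t i)) * a i)"
    by (simp add: bj sum_distrib_left fps_const_mult [symmetric] mult.assoc del: fps_const_mult)
  also have "\<dots> = (\<Sum>i<n. \<Sum>j\<le>n. fps_const (x j * (\<delta> ^^ j) (t i)) * a i)"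
    by (rule sum.swap)
  also have "\<dots> = 0"
  proof (rule sum.neutral, rule ballI)
    fix i assume "i \<in> {..<n}"
    then have "(\<Sum>j\<le>n. x j * (\<delta> ^^ j) (t i)) = 0"
      using x(2) by simp
    moreover have "(\<Sum>j\<le>n. fps_const (x j * (\<delta> ^^ j) (t i)) * a i) = fps_const (\<Sum>j\<le>n. x j * (\<delta> ^^ j) (t i)) * a i"
      by (simp add: fps_eq_iff fps_sum_nth sum_distrib_right)
    ultimately show "(\<Sum>j\<le>n. fps_const (x j * (\<delta> ^^ j) (t i)) * a i) = 0"
      by simp
  qed
  finally have "b * (\<Sum>j\<le>n. fps_const (x j) * (fps_delta ^^ j) c') = 0" .
  moreover have "b \<noteq> 0"
    using qexp_eq_0_iff[OF b M(2)] z0 by auto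
  ultimately have "(\<Sum>j\<le>n. fps_const (x j) * (fps_delta ^^ j) c') = 0"
    by simp
  moreover have "(\<Sum>j\<in>J. fps_const (x j) * (fps_delta ^^ j) c') = fps_spread M (\<Sum>j\<in>J. fps_const (x j) * (fps_delta ^^ j) c)"
    for J :: "nat set"
    by (simp add: c'_def fps_delta_funpow_spread fps_eq_iff fps_sum_nth fps_spread_nth)
  ultimately have "fps_spread M (\<Sum>j\<le>n. fps_const (x j) * (fps_delta ^^ j) c) = 0"
    by (simp only:)
  then have "(\<Sum>j\<le>n. fps_const (x j) * (fps_delta ^^ j) c) = 0"
    using M(2) by (rule fps_spread_eq_0D)
  then show ?thesis
    using that x(1) by auto
qed

text \<open>
  If \<open>\<delta> \<lambda> = 1\<close>, then applying \<open>\<delta>\<close> repeatedly to the coefficients of an eigenvector with eigenvalue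
  \<open>\<lambda>\<close> gives an infinite Jordan chain.
\<close>

lemma eigenvalue_Jordan_chain:
  assumes F: "F \<in> MF k N" and N: "N > 0" and c: "qexp 1 F c" "c \<noteq> 0"
    and \<psi>: "\<And>a. \<delta> (\<psi> a) = 0" and eig: "hecke_fps l \<psi> n c = fps_const ev * c" and ev: "\<delta> ev = 1"
  shows False
proof -
  define D where "D j = (fps_delta ^^ j) c" for j
  have DSuc: "fps_delta (D j) = D (Suc j)" for j
    by (simp add: D_def)
  have fc: "fps_delta (fps_const x * a) = fps_const (\<delta> x) * a + fps_const x * fps_delta a" for x a
    by (simp add: fps_eq_iff mult)
  have chain: "hecke_fps l \<psi> n (D j) = fps_const ev * D j + fps_const (of_nat j) * D (j - 1)" for j
  proof (induction j)
    case 0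
    then show ?case
      using eig by (simp add: D_def)
  next
    case (Suc j)
    have "hecke_fps l \<psi> n (D (Suc j)) = fps_delta (hecke_fps l \<psi> n (D j))"
      by (simp add: DSuc [symmetric] fps_delta_hecke[OF \<psi>])
    also have "\<dots> = fps_delta (fps_const ev * D j + fps_const (of_nat j) * D (j - 1))"
      by (simp only: Suc)
    also have "\<dots> = D j + fps_const ev * D (Suc j) + fps_const (of_nat j) * fps_delta (D (j - 1))"
      by (simp add: fps_delta_add fc ev DSuc)
    also have "fps_const (of_nat j) * fps_delta (D (j - 1)) = fps_const (of_nat j) * D j"
      by (cases j) (simp_all add: DSuc)
    finally show ?case
      by (simp add: algebra_simps fps_const_add [symmetric] del: fps_const_add)
  qed
  define R where "R J \<longleftrightarrow> (\<exists>x. x J \<noteq> 0 \<and> (\<Sum>j\<le>J. fps_const (x j) * D j) = 0)" for J :: nat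
  obtain m :: nat and x where x: "\<exists>j\<le>m. x j \<noteq> 0" "(\<Sum>j\<le>m. fps_const (x j) * (fps_delta ^^ j) c) = 0"
    using fps_delta_funpow_dependent[OF N F c(1)] by metis
  have "\<exists>J. R J"
  proof -
    define J where "J = Max {j. j \<le> m \<and> x j \<noteq> 0}"
    have fin: "finite {j. j \<le> m \<and> x j \<noteq> 0}"
      by simp
    then have J: "J \<le> m" "x J \<noteq> 0"
      using Max_in[OF fin] x(1) by (auto simp: J_def)
    have "(\<Sum>j\<le>m. fps_const (x j) * D j) = (\<Sum>j\<le>J. fps_const (x j) * D j)"
    proof (rule sum.mono_neutral_right)
      have "x j = 0" if "j \<le> m" "\<not> j \<le> J" for j
        using Max_ge[OF fin, of j] that unfolding J_def by blast
      then show "\<forall>j\<in>{..m} - {..J}. fps_const (x j) * D j = 0"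
        by simp
    qed (use J in auto)
    then show ?thesis
      using J x(2) unfolding R_def D_def by auto
  qed
  then obtain J where J: "R J" "\<And>j. j < J \<Longrightarrow> \<not> R j"
    by (metis exists_least_iff)
  then obtain x where x: "x J \<noteq> 0" "(\<Sum>j\<le>J. fps_const (x j) * D j) = 0"
    by (auto simp: R_def)
  have "J \<noteq> 0"
  proof
    assume "J = 0"
    then have "fps_const (x 0) * c = 0"
      using x(2) by (simp add: D_def)
    then show False
      using x(1) c(2) \<open>J = 0\<close> by simp
  qed
  then obtain J' where J': "J = Suc J'"
    using not0_implies_Suc by blast
  \<comment> \<open>The operator T - ev maps D^j c to j D^(j-1) c. It turns the shortest relation,
    with top coefficient x_J, into a shorter one with top coefficient J x_J, which is nonzero in
    characteristic 0.\<close>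
  have "0 = hecke_fps l \<psi> n (\<Sum>j\<le>J. fps_const (x j) * D j) - fps_const ev * (\<Sum>j\<le>J. fps_const (x j) * D j)"
    by (simp add: x(2) hecke_fps_0)
  also have "\<dots> = (\<Sum>j\<le>J. fps_const (x j) * hecke_fps l \<psi> n (D j)) - (\<Sum>j\<le>J. fps_const (x j) * (fps_const ev * D j))"
    unfolding hecke_fps_sum hecke_fps_cmult sum_distrib_left
    by (intro arg_cong2[where f = "(-)"] refl sum.cong mult.left_commute)
  also have "\<dots> = (\<Sum>j\<le>J. fps_const (x j) * (fps_const (of_nat j) * D (j - 1)))"
    by (simp only: chain sum_subtractf [symmetric]) (simp add: algebra_simps)
  also have "\<dots> = (\<Sum>j\<le>J'. fps_const (x (Suc j) * of_nat (Suc j)) * D j)"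
    unfolding J' sum.atMost_Suc_shift
    by (simp add: fps_const_mult [symmetric] mult.assoc del: fps_const_mult of_nat_Suc)
  finally have rel: "(\<Sum>j\<le>J'. fps_const (x (Suc j) * of_nat (Suc j)) * D j) = 0" ..
  have "x (Suc J') * of_nat (Suc J') \<noteq> 0"
    using x(1) J' by (simp del: of_nat_Suc)
  then have "R J'"
    unfolding R_def using rel by (intro exI[of _ "\<lambda>j. x (Suc j) * of_nat (Suc j)"] conjI)
  then show False
    using J(2)[of J'] J' by simp
qed

text \<open>If \<delta> ev were nonzero, \<delta> divided by \<delta> ev would be a derivation with
  value 1 at ev, and the Jordan chain would apply to it.\<close>

lemma eigenvalue_const:
  assumes F: "F \<in> MF k N" and N: "N > 0" and c: "qexp 1 F c" "c \<noteq> 0"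
    and \<psi>: "dirichlet_character N' \<psi>" "N' > 0" and eig: "hecke_fps l \<psi> n c = fps_const ev * c"
  shows "\<delta> ev = 0"
proof (rule ccontr)
  assume ne: "\<delta> ev \<noteq> 0"
  interpret D: derivation "\<lambda>x. \<delta> x / \<delta> ev"
    by standard (simp_all add: add mult add_divide_distrib)
  show False
    by (rule D.eigenvalue_Jordan_chain[OF F N c D.dirichlet_const[OF \<psi>] eig]) (simp add: ne)
qed

theorem newform_coeff_const:
  assumes g: "normalized_newform k N \<psi> g" and \<psi>: "dirichlet_character N \<psi>" and N: "N > 0"
  shows "\<delta> (q_coeff g n) = 0"
proof -
  have cusp: "g \<in> cusp_forms k N \<psi>" and g1: "q_coeff g 1 = 1"
    using g by (auto simp: normalized_newform_def new_cusp_forms_def)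
  define c where "c = Abs_fps (q_coeff g)"
  have c: "qexp 1 g c" and c0: "q_coeff g 0 = 0"
    using cusp_forms_qexp[OF cusp N \<psi>] by (auto simp: c_def)
  have "fps_nth c 1 = 1"
    using g1 by (simp add: c_def)
  then have cnz: "c \<noteq> 0"
    by auto
  show ?thesis
  proof (cases "n = 0")
    case False
    then have n: "n > 0"
      by simp
    then obtain ev where ev: "\<And>z. Im z > 0 \<Longrightarrow> hecke k \<psi> n g z = ev * g z"
      using g unfolding normalized_newform_def by (metis One_nat_def Suc_leI uhp_iff)
    have eig: "hecke_fps k \<psi> n c = fps_const ev * c"
    proof (rule qexp_unique[OF qexp_hecke[OF c n] _ zero_less_one])
      show "qexp 1 (hecke k \<psi> n g) (fps_const ev * c)"
        by (rule qexp_congI[OF qexp_cmult[OF c zero_less_one] ev])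
    qed
    have "\<delta> ev = 0"
      by (rule eigenvalue_const[OF cusp_forms_MF[OF cusp N \<psi>] N c cnz \<psi> N eig])
    moreover have "fps_nth (hecke_fps k \<psi> n c) 1 = ev * fps_nth c 1"
      unfolding eig by simp
    then have "q_coeff g n = ev"
      using hecke_fps_nth_1[OF n, of \<psi> k c] dirichlet_1[OF \<psi>] g1 by (simp add: c_def)
    ultimately show ?thesis
      by simp
  qed (simp add: c0)
qed

lemma coeff_field_const:
  assumes "\<And>n. \<delta> (q_coeff g n) = 0" "x \<in> coeff_field g"
  shows "\<delta> x = 0"
  using assms(2) unfolding coeff_field_def
proof -
  let ?R = "ring_of_type_algebra :: complex ring"
  have c: "carrier ?R = UNIV" and o: "one ?R = 1" "ring.zero ?R = 0"
    and m: "monoid.mult ?R = times" "ring.add ?R = (+)"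
    by (auto simp: ring_of_type_algebra_def)
  interpret R: Ring.field ?R
    by (rule field_from_type_algebra)
  assume "x \<in> generate_field ?R (range (q_coeff g))"
  then show ?thesis
  proof (induction rule: generate_field.induct)
    case (a_inv h)
    have "h + (\<ominus>\<^bsub>?R\<^esub> h) = 0"
      using R.r_neg[of h] by (simp add: c o m)
    then have "\<ominus>\<^bsub>?R\<^esub> h = - h"
      by (simp add: add_eq_0_iff)
    then show ?case
      using a_inv by simp
  next
    case (m_inv h)
    have h: "h \<noteq> 0"
      using m_inv by (simp add: o)
    then have "h \<in> Units ?R"
      using R.field_Units by (simp add: c o)
    then have "h * (inv\<^bsub>?R\<^esub> h) = 1"
      using R.Units_r_inv[of h] by (simp add: o m)
    then have "inv\<^bsub>?R\<^esub> h = inverse h"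
      using h by (simp add: field_simps)
    then show ?case
      using m_inv by (simp add: const_inverse)
  qed (use assms(1) in \<open>auto simp: o m add const_mult\<close>)
qed

end

subsection \<open>Fourier expansions of harmonic Maass forms\<close>

lemma qexp_has_sum:
  assumes F: "qexp h F c" and h: "h > 0" and z: "Im z > 0"
  shows "((\<lambda>n. fps_nth c n * qq h z ^ n) has_sum F z) UNIV"
proof (rule norm_summable_imp_has_sum)
  have r: "ereal (cmod (qq h z)) < conv_radius (fps_nth c)"
    using qexp_radius_qq[OF F h z] by (simp add: fps_conv_radius_def)
  show "summable (\<lambda>n. norm (fps_nth c n * qq h z ^ n))"
    by (rule abs_summable_in_conv_radius[OF r])
  show "(\<lambda>n. fps_nth c n * qq h z ^ n) sums F z"
    using sums_eval_fps[OF qexp_radius_qq[OF F h z]] qexp_eval[OF F z] by simp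
qed

lemma tendsto_uhp_cong:
  assumes "(F \<longlongrightarrow> L) (filtercomap Im at_top)" "\<And>z. Im z > 0 \<Longrightarrow> F z = G z"
  shows "(G \<longlongrightarrow> L) (filtercomap Im at_top)"
proof (rule Lim_transform_eventually[OF assms(1)])
  have "eventually (\<lambda>z. Im z > 0) (filtercomap Im at_top)"
    using eventually_uhp by simp
  then show "eventually (\<lambda>z. F z = G z) (filtercomap Im at_top)"
    by eventually_elim (rule assms(2))
qed

lemma has_sum_finite_sum:
  fixes f :: "'i \<Rightarrow> 'a \<Rightarrow> complex"
  assumes "\<And>i. i \<in> I \<Longrightarrow> (f i has_sum S i) A"
  shows "((\<lambda>x. \<Sum>i\<in>I. f i x) has_sum (\<Sum>i\<in>I. S i)) A"
  using assms by (induction I rule: infinite_finite_induct) (auto intro: has_sum_add)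

lemma has_sum_diff:
  fixes f g :: "'a \<Rightarrow> complex"
  assumes "(f has_sum a) A" "(g has_sum b) A"
  shows "((\<lambda>x. f x - g x) has_sum (a - b)) A"
  using has_sum_add[OF assms(1) has_sum_cmult_right[OF assms(2), of "- 1"]] by simp

text \<open>Averaging over the points b / M against the character of m keeps only the n congruent to
  m modulo M. For M large these n, except m itself, avoid a finite set outside which the absolute
  sum is at most |u m| / 2, so they cannot cancel u m.\<close>

lemma fourier_coeff_unique:
  fixes u :: "int \<Rightarrow> complex"
  assumes u: "u summable_on UNIV"
    and zero: "\<And>x. ((\<lambda>n. u n * exp (2 * of_real pi * \<i> * of_int n * of_real x)) has_sum 0) UNIV"
  shows "u m = 0"
proof (rule ccontr)
  assume "u m \<noteq> 0"
  define e where "e = cmod (u m) / 2"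
  have e: "e > 0"
    using \<open>u m \<noteq> 0\<close> by (simp add: e_def)
  have abs: "(\<lambda>n. norm (u n)) summable_on UNIV"
    using u summable_on_iff_abs_summable_on_complex by blast
  obtain S where S: "finite S" "dist (sum (\<lambda>n. norm (u n)) S) (infsum (\<lambda>n. norm (u n)) UNIV) \<le> e"
    using infsum_finite_approximation[OF abs e] by blast
  \<comment> \<open>With M > |n - m| for all n in S, no such n other than m is congruent to m modulo
    M.\<close>
  define K where "K = Max (insert 0 ((\<lambda>n. nat \<bar>n - m\<bar>) ` S))"
  define M where "M = Suc K"
  have M: "M > 0"
    by (simp add: M_def)
  have far: "n \<notin> S" if "int M dvd n - m" "n \<noteq> m" for n
  proof
    assume "n \<in> S"
    then have "nat \<bar>n - m\<bar> \<le> K"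
      using S(1) unfolding K_def by (intro Max_ge) auto
    then have "\<bar>n - m\<bar> < int M"
      by (simp add: M_def)
    then show False
      using that dvd_imp_le_int[of "n - m" "int M"] by simp
  qed
  have qsum: "(\<Sum>b<M. exp (2 * of_real pi * \<i> * of_int n * of_real (real b / real M)))
      = (if int M dvd n then of_nat M else 0)" for n
  proof -
    define n' where "n' = nat (n mod int M)"
    have n': "int n' = n mod int M"
      using M by (simp add: n'_def)
    have "exp (2 * of_real pi * \<i> * of_int n * of_real (real b / real M)) = qq M (of_nat b) ^ n'" for b
    proof -
      have "of_int n = (of_nat n' + of_int (n div int M) * of_nat M :: complex)"
        by (metis mod_div_mult_eq n' of_int_add of_int_mult of_int_of_nat_eq)
      then have "exp (2 * of_real pi * \<i> * of_int n * of_real (real b / real M)) =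
          exp (2 * of_real pi * \<i> * of_nat n' * of_nat b / of_nat M
             + 2 * of_real (pi * of_int (n div int M * int b)) * \<i>)"
        using M by (simp add: field_simps)
      also have "\<dots> = exp (2 * of_real pi * \<i> * of_nat n' * of_nat b / of_nat M)"
        using exp_plus_2pin[of "2 * of_real pi * \<i> * of_nat n' * of_nat b / of_nat M" "n div int M * int b"]
        by (simp add: mult_ac)
      also have "\<dots> = qq M (of_nat b) ^ n'"
        by (simp add: qq_def exp_of_nat_mult [symmetric] mult_ac)
      finally show ?thesis .
    qed
    moreover have "M dvd n' \<longleftrightarrow> int M dvd n"
      by (metis int_dvd_int_iff n' dvd_mod_iff dvd_refl)
    ultimately show ?thesis
      by (simp add: sum_qq_power[OF M])
  qed
  have "((\<lambda>n. \<Sum>b<M. exp (- 2 * of_real pi * \<i> * of_int m * of_real (real b / real M)) *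
      (u n * exp (2 * of_real pi * \<i> * of_int n * of_real (real b / real M)))) has_sum
      (\<Sum>b<M. exp (- 2 * of_real pi * \<i> * of_int m * of_real (real b / real M)) * 0)) UNIV"
    by (intro has_sum_finite_sum has_sum_cmult_right zero)
  moreover have "(\<Sum>b<M. exp (- 2 * of_real pi * \<i> * of_int m * of_real (real b / real M)) *
      (u n * exp (2 * of_real pi * \<i> * of_int n * of_real (real b / real M)))) =
      u n * (if int M dvd n - m then of_nat M else 0)" for n
  proof -
    have "exp (- 2 * of_real pi * \<i> * of_int m * of_real x) * (u n * exp (2 * of_real pi * \<i> * of_int n * of_real x))
        = u n * exp (2 * of_real pi * \<i> * of_int (n - m) * of_real x)" for x
      by (simp add: exp_add [symmetric] algebra_simps)
    then show ?thesis
      by (simp only: sum_distrib_left [symmetric] qsum)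
  qed
  ultimately have "((\<lambda>n. u n * (if int M dvd n - m then of_nat M else 0)) has_sum 0) UNIV"
    by simp
  then have *: "((\<lambda>n. of_nat M * (if int M dvd n - m then u n else 0)) has_sum 0) UNIV"
    by (rule has_sum_cong[THEN iffD1, rotated]) simp
  have "((\<lambda>n. if int M dvd n - m then u n else 0) has_sum 0) UNIV"
  proof -
    have "inverse (of_nat M) * (of_nat M * x) = x" for x :: complex
      using M by simp
    with has_sum_cmult_right[OF *, of "inverse (of_nat M)"] show ?thesis
      by (simp only: mult_zero_right)
  qed
  moreover have "((\<lambda>n. if int M dvd n - m then u n else 0) has_sum s) UNIV \<longleftrightarrow> (u has_sum s) {n. int M dvd n - m}" for s
    by (rule has_sum_cong_neutral) auto
  ultimately have T: "(u has_sum 0) {n. int M dvd n - m}"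
    by simp
  have "(u has_sum (0 - u m)) ({n. int M dvd n - m} - {m})"
  proof -
    have "((\<lambda>n. if n = m then u m else 0) has_sum u m) {n. int M dvd n - m} \<longleftrightarrow> (u has_sum u m) {m}"
      by (rule has_sum_cong_neutral) auto
    then have "((\<lambda>n. if n = m then u m else 0) has_sum u m) {n. int M dvd n - m}"
      using has_sum_finite[of "{m}" u] by simp
    from has_sum_diff[OF T this]
    show ?thesis
      by (rule has_sum_cong_neutral[THEN iffD1, rotated 3]) auto
  qed
  then have "infsum u ({n. int M dvd n - m} - {m}) = - u m"
    by (simp add: infsumI)
  then have "cmod (u m) = norm (infsum u ({n. int M dvd n - m} - {m}))"
    by simp
  also have "\<dots> \<le> infsum (\<lambda>n. norm (u n)) ({n. int M dvd n - m} - {m})"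
    by (rule norm_infsum_bound) (rule summable_on_subset_banach[OF abs], simp)
  also have "\<dots> \<le> infsum (\<lambda>n. norm (u n)) (UNIV - S)"
    by (rule infsum_mono2[OF summable_on_subset_banach[OF abs] summable_on_subset_banach[OF abs]]) (use far in auto)
  also have "\<dots> = infsum (\<lambda>n. norm (u n)) UNIV - sum (\<lambda>n. norm (u n)) S"
    using S(1) by (subst infsum_Diff[OF abs]) auto
  also have "\<dots> \<le> e"
    using S(2) by (simp add: dist_real_def)
  finally show False
    using e by (simp add: e_def)
qed

subsubsection \<open>The incomplete Gamma function at integers\<close>

definition trunc_exp :: "nat \<Rightarrow> real \<Rightarrow> real" where
  "trunc_exp s x = (\<Sum>j\<le>s. x ^ j / fact j)"

lemma trunc_exp_deriv: "\<exists>D. (trunc_exp s has_real_derivative D) (at x) \<and> trunc_exp s x - D = x ^ s / fact s"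
proof (induction s)
  case 0
  have "(trunc_exp 0 has_real_derivative 0) (at x)"
    by (simp add: trunc_exp_def[abs_def])
  then show ?case
    by (intro exI[of _ 0]) (simp add: trunc_exp_def)
next
  case (Suc s)
  then obtain D where D: "(trunc_exp s has_real_derivative D) (at x)" "trunc_exp s x - D = x ^ s / fact s"
    by blast
  have eq: "trunc_exp (Suc s) = (\<lambda>x. trunc_exp s x + x ^ Suc s / fact (Suc s))"
    by (simp add: trunc_exp_def fun_eq_iff)
  have "((\<lambda>x. x ^ Suc s / fact (Suc s)) has_real_derivative (x ^ s / fact s)) (at x)"
    by (rule derivative_eq_intros refl | simp)+
  then have "(trunc_exp (Suc s) has_real_derivative (D + x ^ s / fact s)) (at x)"
    unfolding eq by (rule DERIV_add[OF D(1)])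
  then show ?case
    using D(2) by (intro exI[of _ "D + x ^ s / fact s"]) (simp add: eq)
qed

lemma tendsto_exp_minus_trunc_exp: "((\<lambda>x. exp (- x) * trunc_exp s x) \<longlongrightarrow> 0) at_top"
proof -
  have "((\<lambda>x::real. \<Sum>j\<le>s. x ^ j / exp x / fact j) \<longlongrightarrow> (\<Sum>j\<le>s. 0 / fact j)) at_top"
    by (intro tendsto_sum tendsto_divide tendsto_power_div_exp_0 tendsto_const) auto
  moreover have "(\<Sum>j\<le>s. x ^ j / exp x / fact j) = exp (- x) * trunc_exp s x" for x :: real
    by (simp add: trunc_exp_def sum_distrib_left exp_minus field_simps)
  ultimately show ?thesis
    by simp
qed

lemma upper_inc_Gamma_Suc:
  assumes x: "x > 0"
  shows "upper_inc_Gamma (real (Suc s)) x = fact s * exp (- x) * trunc_exp s x"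
proof -
  define F where "F t = - (fact s * (exp (- t) * trunc_exp s t))" for t
  have deriv: "DERIV F t :> t ^ s * exp (- t)" for t
  proof -
    obtain D where D: "(trunc_exp s has_real_derivative D) (at t)" "trunc_exp s t - D = t ^ s / fact s"
      using trunc_exp_deriv by blast
    have "DERIV F t :> - (fact s * (exp (- t) * (- 1) * trunc_exp s t + D * exp (- t)))"
      unfolding F_def[abs_def] by (rule derivative_eq_intros D(1) refl | simp)+
    moreover have "- (fact s * (exp (- t) * (- 1) * trunc_exp s t + D * exp (- t))) = fact s * (trunc_exp s t - D) * exp (- t)"
      by (simp add: algebra_simps)
    ultimately show ?thesis
      by (simp add: D(2))
  qed
  have lim: "(F \<longlongrightarrow> 0) at_top"
    using tendsto_minus[OF tendsto_mult_left[OF tendsto_exp_minus_trunc_exp[of s], of "fact s"]]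
    by (simp add: F_def[abs_def])
  have "(\<integral>\<^sup>+t. ennreal (t ^ s * exp (- t)) * indicator {x..} t \<partial>lborel) = ennreal (0 - F x)"
    by (rule nn_integral_FTC_atLeast[OF _ deriv _ lim]) (use x in auto)
  moreover have "0 - F x \<ge> 0"
    using x by (simp add: F_def trunc_exp_def sum_nonneg)
  moreover have "ennreal (t ^ s * exp (- t)) * indicator {x..} t = ennreal (t ^ s * exp (- t) * indicator {x..} t)" for t
    by (simp split: split_indicator)
  ultimately have "((\<lambda>t. t ^ s * exp (- t) * indicator {x..} t) has_integral (0 - F x)) UNIV"
    by (intro nn_integral_has_integral) (use x in \<open>auto split: split_indicator\<close>)
  moreover have "(\<lambda>t. t ^ s * exp (- t) * indicator {x..} t) = (\<lambda>t. if t \<in> {x..} then t ^ s * exp (- t) else 0)"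
    by (auto simp: fun_eq_iff split: split_indicator)
  ultimately have "((\<lambda>t. t ^ s * exp (- t)) has_integral (0 - F x)) {x..}"
    by (simp only: has_integral_restrict_UNIV)
  then have "((\<lambda>t. t powr (real (Suc s) - 1) * exp (- t)) has_integral (0 - F x)) {x..}"
    by (rule has_integral_eq[rotated]) (use x in \<open>simp add: powr_realpow\<close>)
  then show ?thesis
    by (simp add: upper_inc_Gamma_def integral_unique F_def mult.assoc)
qed

subsubsection \<open>The non-holomorphic part\<close>

text \<open>
  With \<open>s = k - 2\<close>, expanding the incomplete Gamma functions writes the non-holomorphic part
  belonging to \<open>\<xi> f = r g\<close> as \<open>s! (\<Sum>j\<le>s. y\<^sup>j cnj (G\<^sub>j(z)))\<close> with holomorphic functions \<open>G\<^sub>j\<close>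
  whose coefficients are given by \<open>nh_fps\<close>.
\<close>

definition nh_fps :: "nat \<Rightarrow> real \<Rightarrow> complex fps \<Rightarrow> nat \<Rightarrow> complex fps" where
  "nh_fps s r c j = Abs_fps (\<lambda>n. - of_real r * fps_nth c n * of_real ((4 * pi * n) ^ j / ((4 * pi * n) ^ Suc s * fact j)))"

definition nh_part :: "nat \<Rightarrow> real \<Rightarrow> complex fps \<Rightarrow> complex \<Rightarrow> complex" where
  "nh_part s r c z = fact s * (\<Sum>j\<le>s. of_real (Im z) ^ j * cnj (eval_fps (nh_fps s r c j) (qq 1 z)))"

lemma fps_conv_radius_mono:
  fixes a b :: "complex fps"
  assumes "fps_conv_radius a \<ge> 1" "B \<ge> 0" "\<And>n. cmod (fps_nth b n) \<le> B * cmod (fps_nth a n)"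
  shows "fps_conv_radius b \<ge> 1"
  unfolding fps_conv_radius_def
proof (rule conv_radius_geI_ex')
  fix r :: real assume r: "0 < r" "ereal r < 1"
  have "ereal (norm (complex_of_real r)) < conv_radius (fps_nth a)"
    using less_le_trans[OF r(2) assms(1)] r(1) by (simp add: fps_conv_radius_def)
  then have "summable (\<lambda>n. norm (fps_nth a n * of_real r ^ n))"
    by (rule abs_summable_in_conv_radius)
  then have "summable (\<lambda>n. B * norm (fps_nth a n * of_real r ^ n))"
    by (rule summable_mult)
  then show "summable (\<lambda>n. fps_nth b n * complex_of_real r ^ n)"
  proof (rule summable_comparison_test_ev[rotated], intro always_eventually allI)
    fix n
    show "norm (fps_nth b n * complex_of_real r ^ n) \<le> B * norm (fps_nth a n * of_real r ^ n)"
      using assms(3)[of n] by (simp add: norm_mult mult.assoc [symmetric] mult_right_mono)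
  qed
qed

lemma nh_fps_radius:
  assumes "fps_conv_radius c \<ge> 1" "j \<le> Suc s"
  shows "fps_conv_radius (nh_fps s r c j) \<ge> 1"
proof (rule fps_conv_radius_mono[OF assms(1)])
  show "\<bar>r\<bar> \<ge> 0"
    by simp
  fix n :: nat
  have "0 \<le> (4 * pi * n) ^ j / ((4 * pi * n) ^ Suc s * fact j) \<and> (4 * pi * n) ^ j / ((4 * pi * n) ^ Suc s * fact j) \<le> 1"
  \<comment> \<open>At n = 0 the denominator is 0, so the quotient is 0 by the convention for
    division.\<close>
  proof (cases "n = 0")
    case False
    have "pi * real n \<ge> 1 * 1"
      using False pi_gt3 by (intro mult_mono) auto
    then have b: "4 * pi * real n \<ge> 1"
      by simp
    have f: "fact j \<ge> (1::real)"
      by (rule fact_ge_1)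
    have "(4 * pi * n) ^ j \<le> (4 * pi * n) ^ Suc s"
      using b assms(2) by (rule power_increasing[rotated])
    also have "\<dots> \<le> (4 * pi * n) ^ Suc s * fact j"
      using b f by (metis mult_le_cancel_left1 order_trans zero_le_one zero_le_power not_le)
    finally have "(4 * pi * n) ^ j \<le> (4 * pi * n) ^ Suc s * fact j" .
    moreover have "4 * pi * real n > 0"
      using b by linarith
    then have "(4 * pi * n) ^ Suc s * fact j > 0"
      by (rule mult_pos_pos[OF zero_less_power fact_gt_zero])
    ultimately show ?thesis
      using b by (simp add: divide_le_eq)
  qed simp
  then have "\<bar>(4 * pi * n) ^ j / ((4 * pi * n) ^ Suc s * fact j)\<bar> \<le> 1"
    by simp
  then have "\<bar>r\<bar> * cmod (fps_nth c n) * \<bar>(4 * pi * n) ^ j / ((4 * pi * n) ^ Suc s * fact j)\<bar> \<le> \<bar>r\<bar> * cmod (fps_nth c n) * 1"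
    by (intro mult_left_mono) auto
  then show "cmod (fps_nth (nh_fps s r c j) n) \<le> \<bar>r\<bar> * cmod (fps_nth c n)"
    by (simp only: nh_fps_def fps_nth_Abs_fps norm_mult norm_minus_cancel norm_of_real mult_1_right)
qed

lemma nh_fps_Suc: "of_nat (Suc j) * fps_nth (nh_fps s r c (Suc j)) n = of_real (4 * pi) * of_nat n * fps_nth (nh_fps s r c j) n"
proof -
  have "real (Suc j) * (x ^ Suc j / (y * fact (Suc j))) = x * (x ^ j / (y * fact j))" for x y :: real
    by (simp del: of_nat_Suc)
  then have "real (Suc j) * ((4 * pi * n) ^ Suc j / ((4 * pi * n) ^ Suc s * fact (Suc j))) =
      4 * pi * real n * ((4 * pi * n) ^ j / ((4 * pi * n) ^ Suc s * fact j))" .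
  then have "complex_of_real (real (Suc j) * ((4 * pi * n) ^ Suc j / ((4 * pi * n) ^ Suc s * fact (Suc j)))) =
      of_real (4 * pi * real n * ((4 * pi * n) ^ j / ((4 * pi * n) ^ Suc s * fact j)))"
    by (simp only:)
  then have *: "of_nat (Suc j) * complex_of_real ((4 * pi * n) ^ Suc j / ((4 * pi * n) ^ Suc s * fact (Suc j))) =
      of_real (4 * pi) * of_nat n * of_real ((4 * pi * n) ^ j / ((4 * pi * n) ^ Suc s * fact j))"
    by (simp only: of_real_mult of_real_of_nat_eq)
  have "a * x = b * w \<Longrightarrow> a * (y * x) = b * (y * w)" for a b w x y :: complex
    by (metis mult.left_commute)
  from this[OF *] show ?thesis
    unfolding nh_fps_def fps_nth_Abs_fps .
qed

text \<open>At the extra index s + 1 the powers of 4 \<pi> n cancel and a multiple of c itself comes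
  back. The constant term of c has to vanish because the quotient at n = 0 is 0.\<close>

lemma nh_fps_top: "fps_nth c 0 = 0 \<Longrightarrow> nh_fps s r c (Suc s) = fps_const (- of_real r / fact (Suc s)) * c"
proof (rule fps_ext)
  fix n assume c0: "fps_nth c 0 = 0"
  show "fps_nth (nh_fps s r c (Suc s)) n = fps_nth (fps_const (- of_real r / fact (Suc s)) * c) n"
  proof (cases "n = 0")
    case True
    then show ?thesis
      using c0 by (simp add: nh_fps_def)
  next
    case False
    then have "(4 * pi * n) ^ Suc s / ((4 * pi * n) ^ Suc s * fact (Suc s)) = 1 / fact (Suc s)"
      by simp
    then show ?thesis
      by (simp only: nh_fps_def fps_nth_Abs_fps fps_mult_left_const_nth)
         (simp add: of_real_divide del: fact_Suc)
  qed
qed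

lemma nh_fps_deriv:
  assumes c: "fps_conv_radius c \<ge> 1" and j: "j \<le> s" and z: "Im z > 0"
  shows "((\<lambda>z. eval_fps (nh_fps s r c j) (qq 1 z)) has_field_derivative
    (\<i> / 2 * of_nat (Suc j) * eval_fps (nh_fps s r c (Suc j)) (qq 1 z))) (at z)"
proof -
  let ?a = "nh_fps s r c j" and ?b = "nh_fps s r c (Suc j)"
  have ra: "ereal (cmod (qq 1 z)) < fps_conv_radius ?a"
    using nh_fps_radius[OF c, of j s r] j norm_qq_less_1[of 1 z] z
    by (metis ereal_less(3) le_Suc_eq less_le_trans zero_less_one)
  have rb: "ereal (cmod (qq 1 z)) < fps_conv_radius ?b"
    using nh_fps_radius[OF c, of "Suc j" s r] j norm_qq_less_1[of 1 z] z
    by (metis ereal_less(3) Suc_le_mono less_le_trans zero_less_one)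
  have q: "(qq 1 has_field_derivative (2 * of_real pi * \<i> * qq 1 z)) (at z)"
    unfolding qq_def[abs_def] by (auto intro!: derivative_eq_intros)
  have "((\<lambda>z. eval_fps ?a (qq 1 z)) has_field_derivative (eval_fps (fps_deriv ?a) (qq 1 z) * (2 * of_real pi * \<i> * qq 1 z))) (at z)"
    by (rule DERIV_chain'[OF q has_field_derivative_eval_fps[OF ra]])
  moreover have "eval_fps (fps_deriv ?a) (qq 1 z) * (2 * of_real pi * \<i> * qq 1 z) = \<i> / 2 * of_nat (Suc j) * eval_fps ?b (qq 1 z)"
  proof -
    have "fps_const (of_real (4 * pi)) * (fps_X * fps_deriv ?a) = fps_const (of_nat (Suc j)) * ?b"
      (is "?l = ?r")
    proof (rule fps_ext)
      fix n
      show "fps_nth ?l n = fps_nth ?r n"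
        using nh_fps_Suc[of j s r c n] by (cases n) (simp_all add: mult_ac del: of_nat_Suc)
    qed
    moreover
    have rd: "ereal (cmod (qq 1 z)) < fps_conv_radius (fps_deriv ?a)"
      using ra fps_conv_radius_deriv[of ?a] by (rule less_le_trans)
    moreover have rx: "ereal (cmod (qq 1 z)) < fps_conv_radius (fps_X * fps_deriv ?a)"
      using fps_conv_radius_mult[of fps_X "fps_deriv ?a"] rd by (auto intro: less_le_trans)
    moreover have "eval_fps (fps_const x * F) q = x * eval_fps F q" if "ereal (cmod q) < fps_conv_radius F" for x q and F :: "complex fps"
      using that by (simp add: eval_fps_mult)
    ultimately have "of_real (4 * pi) * eval_fps (fps_X * fps_deriv ?a) (qq 1 z) = of_nat (Suc j) * eval_fps ?b (qq 1 z)"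
      using rb by (metis (no_types))
    moreover have "eval_fps (fps_X * fps_deriv ?a) (qq 1 z) = qq 1 z * eval_fps (fps_deriv ?a) (qq 1 z)"
      using rd by (simp add: eval_fps_mult)
    ultimately have "of_real (4 * pi) * (qq 1 z * eval_fps (fps_deriv ?a) (qq 1 z)) = of_nat (Suc j) * eval_fps ?b (qq 1 z)"
      by (simp only:)
    then show ?thesis
      by (simp add: algebra_simps)
  qed
  ultimately show ?thesis
    by (simp only:)
qed

text \<open>D 1 + \<i> (D \<i>) is twice the d-bar derivative. By \<open>nh_fps_deriv\<close> the
  derivative of G_j is (i / 2) (j + 1) G_(j+1), so the sum over j telescopes and only G_(s+1)
  remains, which is a multiple of the original form.\<close>

lemma nh_part_deriv:
  assumes c: "fps_conv_radius c \<ge> 1" "fps_nth c 0 = 0" and z: "Im z > 0"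
  obtains D where "(nh_part s r c has_derivative D) (at z)"
    "D 1 + \<i> * D \<i> = \<i> * of_real r * of_real (Im z) ^ s * cnj (eval_fps c (qq 1 z))"
proof -
  define G where "G j = (\<lambda>z. eval_fps (nh_fps s r c j) (qq 1 z))" for j
  define g' where "g' j = \<i> / 2 * of_nat (Suc j) * G (Suc j) z" for j
  define D where "D h = fact s * (\<Sum>j\<le>s. of_nat j * of_real (Im z) ^ (j - 1) * of_real (Im h) * cnj (G j z) +
     of_real (Im z) ^ j * cnj (h * g' j))" for h
  have Gd: "(G j has_derivative (\<lambda>h. h * g' j)) (at z)" if "j \<le> s" for j
  proof -
    have "(\<lambda>h. h * g' j) = times (g' j)"
      by (simp add: fun_eq_iff mult.commute)
    then show ?thesis
      using nh_fps_deriv[OF c(1) that z, of r] unfolding G_def g'_def has_field_derivative_def by (simp only:)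
  qed
  have "(nh_part s r c has_derivative D) (at z)"
  proof -
    have I: "((\<lambda>z. complex_of_real (Im z) ^ j) has_derivative (\<lambda>h. of_nat j * of_real (Im z) ^ (j - 1) * of_real (Im h))) (at z)" for j
      by (auto intro!: derivative_eq_intros simp: mult_ac)
    have C: "((\<lambda>z. cnj (G j z)) has_derivative (\<lambda>h. cnj (h * g' j))) (at z)" if "j \<le> s" for j
      by (rule bounded_linear.has_derivative[OF bounded_linear_cnj Gd[OF that]])
    have "((\<lambda>z. fact s * (\<Sum>j\<le>s. of_real (Im z) ^ j * cnj (G j z))) has_derivative
       (\<lambda>h. fact s * (\<Sum>j\<le>s. of_real (Im z) ^ j * cnj (h * g' j) + of_nat j * of_real (Im z) ^ (j - 1) * of_real (Im h) * cnj (G j z)))) (at z)"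
      by (intro has_derivative_mult_right has_derivative_sum has_derivative_mult I C) auto
    then show ?thesis
      by (simp add: nh_part_def[abs_def] D_def[abs_def] G_def add.commute)
  qed
  moreover have "D 1 + \<i> * D \<i> = \<i> * of_real r * of_real (Im z) ^ s * cnj (eval_fps c (qq 1 z))"
  proof -
    define T where "T j = \<i> * of_nat j * of_real (Im z) ^ (j - 1) * cnj (G j z)" for j
    have "D 1 + \<i> * D \<i> = fact s * (\<Sum>j\<le>s. \<i> * of_nat j * of_real (Im z) ^ (j - 1) * cnj (G j z) + 2 * of_real (Im z) ^ j * cnj (g' j))"
      by (simp add: D_def sum_distrib_left sum.distrib algebra_simps)
    also have "\<dots> = fact s * (\<Sum>j\<le>s. T j - T (Suc j))"
      by (intro arg_cong2[where f = "times"] refl sum.cong) (simp add: T_def g'_def algebra_simps)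
    also have "(\<Sum>j\<le>s. T j - T (Suc j)) = T 0 - T (Suc s)"
      by (rule sum_telescope)
    also have "\<dots> = - (\<i> * of_nat (Suc s) * of_real (Im z) ^ s * cnj (G (Suc s) z))"
      by (simp add: T_def)
    also have "G (Suc s) z = (- of_real r / fact (Suc s)) * eval_fps c (qq 1 z)"
    proof -
      have "ereal (cmod (qq 1 z)) < fps_conv_radius c"
        using c(1) norm_qq_less_1[of 1 z] z by (metis ereal_less(3) less_le_trans zero_less_one)
      then show ?thesis
        unfolding G_def nh_fps_top[OF c(2)] by (simp add: eval_fps_mult del: fact_Suc)
    qed
    also have "fact s * (- (\<i> * of_nat (Suc s) * of_real (Im z) ^ s * cnj ((- of_real r / fact (Suc s)) * eval_fps c (qq 1 z))))
        = (fact s * of_nat (Suc s) / fact (Suc s)) * (\<i> * of_real r * of_real (Im z) ^ s * cnj (eval_fps c (qq 1 z)))"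
      by (simp add: mult_ac del: fact_Suc of_nat_Suc)
    also have "(fact s * of_nat (Suc s) / fact (Suc s) :: complex) = 1"
      unfolding fact_Suc by (simp add: mult.commute del: of_nat_Suc)
    finally show ?thesis
      by simp
  qed
  ultimately show ?thesis
    by (rule that)
qed

lemma nh_part_bounded:
  assumes c: "fps_conv_radius c \<ge> 1" "fps_nth c 0 = 0"
  obtains Y B where "\<And>z. Im z \<ge> Y \<Longrightarrow> cmod (nh_part s r c z) \<le> B"
proof -
  have "((\<lambda>z. complex_of_real (Im z) ^ j * cnj (eval_fps (nh_fps s r c j) (qq 1 z))) \<longlongrightarrow> 0) (filtercomap Im at_top)"
    if j: "j \<le> s" for j
  proof -
    let ?a = "nh_fps s r c j"
    define a' where "a' = fps_shift 1 ?a"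
    have ra: "fps_conv_radius ?a \<ge> 1"
      using nh_fps_radius[OF c(1)] j by simp
    have ra': "fps_conv_radius a' \<ge> 1"
      using ra by (simp add: a'_def)
    have a: "?a = fps_X * a'"
      by (rule fps_ext) (auto simp: fps_X_mult_nth a'_def nh_fps_def c(2))
    have K: "((\<lambda>z. eval_fps a' (qq 1 z)) \<longlongrightarrow> fps_nth a' 0) (filtercomap Im at_top)"
      by (rule qexp_tendsto[of 1]) (use ra' in \<open>simp_all add: qexp_def\<close>)
    have P: "((\<lambda>z. complex_of_real (Im z) ^ j * cnj (qq 1 z)) \<longlongrightarrow> 0) (filtercomap Im at_top)"
    proof (rule tendsto_norm_zero_cancel)
      have t: "((\<lambda>y::real. (2 * pi * y) ^ j / exp (2 * pi * y)) \<longlongrightarrow> 0) at_top"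
        by (rule filterlim_compose[OF tendsto_power_div_exp_0])
           (intro filterlim_tendsto_pos_mult_at_top[OF tendsto_const _ filterlim_ident], simp)
      have "((\<lambda>y::real. inverse ((2 * pi) ^ j) * ((2 * pi * y) ^ j / exp (2 * pi * y))) \<longlongrightarrow> inverse ((2 * pi) ^ j) * 0) at_top"
        by (rule tendsto_mult_left[OF t])
      then have "((\<lambda>y::real. y ^ j * exp (- 2 * pi * y)) \<longlongrightarrow> 0) at_top"
        by (simp add: power_mult_distrib exp_minus field_simps)
      then have "((\<lambda>z. Im z ^ j * exp (- 2 * pi * Im z)) \<longlongrightarrow> 0) (filtercomap Im at_top)"
        by (rule filterlim_compose) (rule filterlim_filtercomap)
      then show "((\<lambda>z. norm (complex_of_real (Im z) ^ j * cnj (qq 1 z))) \<longlongrightarrow> 0) (filtercomap Im at_top)"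
      proof (rule Lim_transform_eventually)
        have "eventually (\<lambda>z. Im z > 0) (filtercomap Im at_top)"
          using eventually_uhp by simp
        then show "eventually (\<lambda>z. Im z ^ j * exp (- 2 * pi * Im z) = norm (complex_of_real (Im z) ^ j * cnj (qq 1 z))) (filtercomap Im at_top)"
          by eventually_elim (simp add: norm_mult norm_power norm_qq)
      qed
    qed
    have "((\<lambda>z. (complex_of_real (Im z) ^ j * cnj (qq 1 z)) * cnj (eval_fps a' (qq 1 z))) \<longlongrightarrow> 0 * cnj (fps_nth a' 0)) (filtercomap Im at_top)"
      by (intro tendsto_mult P tendsto_cnj K)
    then have "((\<lambda>z. complex_of_real (Im z) ^ j * cnj (eval_fps ?a (qq 1 z))) \<longlongrightarrow> 0 * cnj (fps_nth a' 0)) (filtercomap Im at_top)"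
    proof (rule tendsto_uhp_cong)
      fix z :: complex assume "Im z > 0"
      then have "ereal (cmod (qq 1 z)) < fps_conv_radius a'"
        using norm_qq_less_1[of 1 z] ra' by (metis ereal_less(3) less_le_trans zero_less_one)
      then show "complex_of_real (Im z) ^ j * cnj (qq 1 z) * cnj (eval_fps a' (qq 1 z)) =
          complex_of_real (Im z) ^ j * cnj (eval_fps ?a (qq 1 z))"
        by (simp add: a eval_fps_mult mult_ac)
    qed
    then show ?thesis
      by simp
  qed
  then have "((\<lambda>z. fact s * (\<Sum>j\<le>s. complex_of_real (Im z) ^ j * cnj (eval_fps (nh_fps s r c j) (qq 1 z)))) \<longlongrightarrow> fact s * (\<Sum>j\<le>s. 0)) (filtercomap Im at_top)"
    by (intro tendsto_mult_left tendsto_sum) simp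
  then have "(nh_part s r c \<longlongrightarrow> 0) (filtercomap Im at_top)"
    by (simp add: nh_part_def[abs_def])
  then have "eventually (\<lambda>z. dist (nh_part s r c z) 0 < 1) (filtercomap Im at_top)"
    by (rule tendstoD) simp
  then obtain Y where Y: "\<And>z. Im z \<ge> Y \<Longrightarrow> dist (nh_part s r c z) 0 < 1"
    by (auto simp: eventually_Im_at_top)
  show ?thesis
    by (rule that[of Y 1]) (use Y in \<open>force simp: less_imp_le\<close>)
qed

text \<open>For n = -l < 0, exp (2 \<pi> i n z) is the conjugate of q^l times exp (4 \<pi> l y), and
  this real exponential cancels the one in \<open>upper_inc_Gamma_Suc\<close>.\<close>

lemma nh_part_has_sum:
  assumes c: "fps_conv_radius c \<ge> 1" "fps_nth c 0 = 0" and z: "Im z > 0"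
  shows "((\<lambda>n. cnj (fps_nth (nh_fps s r c 0) (nat (- n))) * of_real (upper_inc_Gamma (real (Suc s)) (4 * pi * \<bar>of_int n\<bar> * Im z))
                * exp (2 * of_real pi * \<i> * of_int n * z)) has_sum nh_part s r c z) {..<0}"
proof -
  have "((\<lambda>n. fps_nth (nh_fps s r c j) n * qq 1 z ^ n) has_sum eval_fps (nh_fps s r c j) (qq 1 z)) UNIV" if "j \<le> s" for j
    by (rule qexp_has_sum[OF _ zero_less_one z]) (use nh_fps_radius[OF c(1), of j s r] that in \<open>simp add: qexp_def\<close>)
  then have "((\<lambda>n. cnj (fps_nth (nh_fps s r c j) n * qq 1 z ^ n)) has_sum cnj (eval_fps (nh_fps s r c j) (qq 1 z))) UNIV" if "j \<le> s" for j
    using that by (simp only: has_sum_cnj_iff)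
  then have "((\<lambda>n. fact s * (\<Sum>j\<le>s. of_real (Im z) ^ j * cnj (fps_nth (nh_fps s r c j) n * qq 1 z ^ n))) has_sum nh_part s r c z) UNIV"
    unfolding nh_part_def by (intro has_sum_cmult_right has_sum_finite_sum) simp_all
  also have "?this \<longleftrightarrow> ((\<lambda>n. fact s * (\<Sum>j\<le>s. of_real (Im z) ^ j * cnj (fps_nth (nh_fps s r c j) n * qq 1 z ^ n))) has_sum nh_part s r c z) {0<..}"
    by (rule has_sum_cong_neutral) (auto simp: nh_fps_def c(2))
  also have "\<dots> \<longleftrightarrow> ((\<lambda>n. cnj (fps_nth (nh_fps s r c 0) (nat (- n))) * of_real (upper_inc_Gamma (real (Suc s)) (4 * pi * \<bar>of_int n\<bar> * Im z))
                * exp (2 * of_real pi * \<i> * of_int n * z)) has_sum nh_part s r c z) {..<0}"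
  proof (rule has_sum_reindex_bij_witness[of _ "\<lambda>n. nat (- n)" "\<lambda>n. - int n"])
    fix n :: nat assume n: "n \<in> {0<..}"
    let ?x = "4 * pi * real n * Im z"
    have x: "?x > 0"
      using n z by simp
    have "exp (- 2 * of_real pi * \<i> * of_nat n * z) = cnj (qq 1 z ^ n) * of_real (exp ?x)"
    proof -
      have "cnj (qq 1 z ^ n) = exp (- 2 * of_real pi * \<i> * of_nat n * cnj z)"
        by (simp add: qq_def exp_of_nat_mult [symmetric] exp_cnj mult_ac)
      moreover have "- 2 * of_real pi * \<i> * of_nat n * z = - 2 * of_real pi * \<i> * of_nat n * cnj z + of_real ?x"
        by (simp add: complex_eq_iff)
      ultimately show ?thesis
        by (simp only: exp_add exp_of_real)
    qed
    then have e: "exp (2 * of_real pi * \<i> * of_int (- int n) * z) = cnj (qq 1 z ^ n) * of_real (exp ?x)"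
      by (simp add: mult_ac)
    have "upper_inc_Gamma (real (Suc s)) (4 * pi * \<bar>of_int (- int n)\<bar> * Im z) = fact s * exp (- ?x) * trunc_exp s ?x"
      using upper_inc_Gamma_Suc[OF x] by simp
    then have "cnj (fps_nth (nh_fps s r c 0) (nat (- (- int n)))) * of_real (upper_inc_Gamma (real (Suc s)) (4 * pi * \<bar>of_int (- int n)\<bar> * Im z))
        * exp (2 * of_real pi * \<i> * of_int (- int n) * z)
        = cnj (fps_nth (nh_fps s r c 0) n) * of_real (fact s * exp (- ?x) * trunc_exp s ?x) * (cnj (qq 1 z ^ n) * of_real (exp ?x))"
      by (simp only: e minus_minus nat_int)
    also have "\<dots> = cnj (fps_nth (nh_fps s r c 0) n) * (of_real (fact s) * of_real (trunc_exp s ?x)) * cnj (qq 1 z ^ n) * of_real (exp (- ?x) * exp ?x)"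
      by (simp only: of_real_mult mult_ac)
    also have "exp (- ?x) * exp ?x = 1"
      by (simp add: exp_minus)
    also have "cnj (fps_nth (nh_fps s r c 0) n) * (of_real (fact s) * of_real (trunc_exp s ?x)) * cnj (qq 1 z ^ n) * of_real 1
        = fact s * (\<Sum>j\<le>s. of_real (?x ^ j / fact j) * cnj (fps_nth (nh_fps s r c 0) n) * cnj (qq 1 z ^ n))"
      by (simp add: trunc_exp_def sum_distrib_left sum_distrib_right mult_ac)
    also have "\<dots> = fact s * (\<Sum>j\<le>s. of_real (Im z) ^ j * cnj (fps_nth (nh_fps s r c j) n * qq 1 z ^ n))"
    proof -
      have nj: "fps_nth (nh_fps s r c j) n = fps_nth (nh_fps s r c 0) n * of_real ((4 * pi * n) ^ j / fact j)" for j
        by (simp add: nh_fps_def)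
      have "of_real (?x ^ j / fact j) * cnj (fps_nth (nh_fps s r c 0) n) * cnj (qq 1 z ^ n) =
          of_real (Im z) ^ j * cnj (fps_nth (nh_fps s r c j) n * qq 1 z ^ n)" for j
        unfolding nj[of j] by (simp add: power_mult_distrib)
      then show ?thesis
        by (simp only:)
    qed
    finally show "cnj (fps_nth (nh_fps s r c 0) (nat (- (- int n)))) * of_real (upper_inc_Gamma (real (Suc s)) (4 * pi * \<bar>of_int (- int n)\<bar> * Im z))
        * exp (2 * of_real pi * \<i> * of_int (- int n) * z)
        = fact s * (\<Sum>j\<le>s. of_real (Im z) ^ j * cnj (fps_nth (nh_fps s r c j) n * qq 1 z ^ n))" .
  qed auto
  finally show ?thesis .
qed

text \<open>Uniqueness of Fourier coefficients at each height y settles n >= 0. For n < 0 it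
  expresses \<open>cp n - cp' n\<close> as a multiple of the incomplete Gamma function for every y >
  0, and this tends to 0 as y grows. This makes the definite description in \<open>c_plus\<close>
  meaningful.\<close>

lemma maass_expansion_unique:
  assumes k: "k \<ge> 2" and 1: "maass_expansion k f cp cm" and 2: "maass_expansion k f cp' cm'"
  shows "cp = cp'"
proof
  fix n
  define Gm where "Gm n y = complex_of_real (upper_inc_Gamma (of_int (k - 1)) (4 * pi * \<bar>of_int n\<bar> * y))" for n :: int and y
  define u where "u y n = (cp n - cp' n) * of_real (exp (- 2 * pi * of_int n * y)) +
      (if n < 0 then (cm n - cm' n) * Gm n y * of_real (exp (- 2 * pi * of_int n * y)) else 0)" for y and n :: int
  have hs: "((\<lambda>n. u y n * exp (2 * of_real pi * \<i> * of_int n * of_real x)) has_sum 0) UNIV" if y: "y > 0" for x y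
  proof -
    define z where "z = Complex x y"
    have z: "z \<in> uhp" "Im z = y"
      using y by (simp_all add: z_def)
    obtain A B where AB: "((\<lambda>n. cp n * exp (2 * of_real pi * \<i> * of_int n * z)) has_sum A) UNIV"
      "((\<lambda>n. cm n * Gm n y * exp (2 * of_real pi * \<i> * of_int n * z)) has_sum B) {..<0}" "f z = A + B"
      using 1 z(1) unfolding maass_expansion_def Gm_def z(2) [symmetric] by blast
    obtain A' B' where AB': "((\<lambda>n. cp' n * exp (2 * of_real pi * \<i> * of_int n * z)) has_sum A') UNIV"
      "((\<lambda>n. cm' n * Gm n y * exp (2 * of_real pi * \<i> * of_int n * z)) has_sum B') {..<0}" "f z = A' + B'"
      using 2 z(1) unfolding maass_expansion_def Gm_def z(2) [symmetric] by blast
    have ext: "((\<lambda>n. if n < 0 then v n else 0) has_sum S) UNIV" if "(v has_sum S) {..<0}" for v :: "int \<Rightarrow> complex" and S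
      using that by (subst has_sum_cong_neutral[where S = UNIV and T = "{..<0}" and g = v]) auto
    have "((\<lambda>n. cp n * exp (2 * of_real pi * \<i> * of_int n * z) - cp' n * exp (2 * of_real pi * \<i> * of_int n * z) +
        ((if n < 0 then cm n * Gm n y * exp (2 * of_real pi * \<i> * of_int n * z) else 0) -
         (if n < 0 then cm' n * Gm n y * exp (2 * of_real pi * \<i> * of_int n * z) else 0))) has_sum (A - A' + (B - B'))) UNIV"
      by (intro has_sum_add has_sum_diff AB(1) AB'(1) ext AB(2) AB'(2))
    moreover have "A - A' + (B - B') = 0"
      using AB(3) AB'(3) by (simp add: algebra_simps)
    moreover have "cp n * exp (2 * of_real pi * \<i> * of_int n * z) - cp' n * exp (2 * of_real pi * \<i> * of_int n * z) +
        ((if n < 0 then cm n * Gm n y * exp (2 * of_real pi * \<i> * of_int n * z) else 0) -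
         (if n < 0 then cm' n * Gm n y * exp (2 * of_real pi * \<i> * of_int n * z) else 0)) =
        u y n * exp (2 * of_real pi * \<i> * of_int n * of_real x)" for n
    proof -
      have "2 * of_real pi * \<i> * of_int n * z = of_real (- 2 * pi * of_int n * y) + 2 * of_real pi * \<i> * of_int n * of_real x"
        by (simp add: z_def complex_eq_iff)
      then have "exp (2 * of_real pi * \<i> * of_int n * z) = of_real (exp (- 2 * pi * of_int n * y)) * exp (2 * of_real pi * \<i> * of_int n * of_real x)"
        by (simp only: exp_add exp_of_real)
      then show ?thesis
        by (simp add: u_def algebra_simps)
    qed
    ultimately show ?thesis
      by simp
  qed
  have "(\<lambda>n. u y n) summable_on UNIV" if "y > 0" for y
    using hs[OF that, of 0] by (simp add: has_sum_imp_summable)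
  then have u0: "u y n = 0" if "y > 0" for y
    by (rule fourier_coeff_unique[OF _ hs]) (use that in auto)
  show "cp n = cp' n"
  proof (cases "n < 0")
    case False
    then show ?thesis
      using u0[of 1] by (simp add: u_def)
  next
    case True
    have eq: "cp n - cp' n = - ((cm n - cm' n) * Gm n y)" if "y > 0" for y
    proof -
      have "(cp n - cp' n + (cm n - cm' n) * Gm n y) * of_real (exp (- 2 * pi * of_int n * y)) = 0"
        using u0[OF that] True by (simp add: u_def algebra_simps)
      then show ?thesis
        by (simp add: eq_neg_iff_add_eq_0)
    qed
    define s where "s = nat (k - 2)"
    have s: "of_int (k - 1) = real (Suc s)"
      using k by (simp add: s_def)
    have pos: "4 * pi * \<bar>real_of_int n\<bar> > 0"
      using True by (intro mult_pos_pos) simp_all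
    have "((\<lambda>y. of_real (fact s * (exp (- (4 * pi * \<bar>of_int n\<bar> * y)) * trunc_exp s (4 * pi * \<bar>of_int n\<bar> * y)))) \<longlongrightarrow> complex_of_real (fact s * 0)) at_top"
      by (intro tendsto_of_real tendsto_mult_left filterlim_compose[OF tendsto_exp_minus_trunc_exp]
          filterlim_tendsto_pos_mult_at_top[OF tendsto_const _ filterlim_ident]) (rule pos)
    then have "((\<lambda>y. Gm n y) \<longlongrightarrow> complex_of_real (fact s * 0)) at_top"
    proof (rule Lim_transform_eventually)
      show "eventually (\<lambda>y. of_real (fact s * (exp (- (4 * pi * \<bar>of_int n\<bar> * y)) * trunc_exp s (4 * pi * \<bar>of_int n\<bar> * y))) = Gm n y) at_top"
        using eventually_gt_at_top[of 0]
      proof eventually_elim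
        case (elim y)
        have "4 * pi * \<bar>of_int n\<bar> * y > 0"
          using mult_pos_pos[OF pos elim] .
        then show ?case
          unfolding Gm_def s by (simp only: upper_inc_Gamma_Suc mult.assoc)
      qed
    qed
    then have "((\<lambda>y. Gm n y) \<longlongrightarrow> 0) at_top"
      by simp
    then have "((\<lambda>y. - ((cm n - cm' n) * Gm n y)) \<longlongrightarrow> - ((cm n - cm' n) * 0)) at_top"
      by (intro tendsto_minus tendsto_mult_left)
    moreover have "eventually (\<lambda>y. - ((cm n - cm' n) * Gm n y) = cp n - cp' n) at_top"
      using eventually_gt_at_top[of 0] by eventually_elim (simp add: eq)
    ultimately have "((\<lambda>y::real. cp n - cp' n) \<longlongrightarrow> - ((cm n - cm' n) * 0)) at_top"
      by (rule Lim_transform_eventually)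
    then show ?thesis
      by (simp add: tendsto_const_iff)
  qed
qed

section \<open>Laurent expansions in q and the Hecke operator at a prime\<close>

definition lexp :: "nat \<Rightarrow> (complex \<Rightarrow> complex) \<Rightarrow> (int \<Rightarrow> complex) \<Rightarrow> bool" where
  "lexp D F C \<longleftrightarrow> (\<forall>n. n < - int D \<longrightarrow> C n = 0) \<and>
     qexp 1 (\<lambda>z. qq 1 z ^ D * F z) (Abs_fps (\<lambda>m. C (int m - int D)))"

lemma lexp_qexp: "lexp D F C \<Longrightarrow> qexp 1 (\<lambda>z. qq 1 z ^ D * F z) (Abs_fps (\<lambda>m. C (int m - int D)))"
  by (simp add: lexp_def)

lemma qexp_exponent_raise:
  assumes q: "qexp 1 (\<lambda>z. qq 1 z ^ D * F z) a"
  shows "qexp 1 (\<lambda>z. qq 1 z ^ (D + m) * F z) (fps_X ^ m * a)"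
proof -
  have "qexp 1 (\<lambda>z. qq 1 z ^ m * (qq 1 z ^ D * F z)) (fps_X ^ m * a)"
    by (intro qexp_mult qexp_power qexp_qq q) simp_all
  moreover have "(\<lambda>z. qq 1 z ^ m * (qq 1 z ^ D * F z)) = (\<lambda>z. qq 1 z ^ (D + m) * F z)"
    by (simp add: fun_eq_iff power_add mult_ac)
  ultimately show ?thesis
    by simp
qed

lemma lexp_raise:
  assumes F: "lexp D F C"
  shows "lexp (D + m) F C"
proof -
  have C: "C n = 0" if "n < - int D" for n
    using F that by (simp add: lexp_def)
  have "fps_X ^ m * Abs_fps (\<lambda>i. C (int i - int D)) = Abs_fps (\<lambda>i. C (int i - int (D + m)))"
  proof (rule fps_ext)
    fix n
    show "fps_nth (fps_X ^ m * Abs_fps (\<lambda>i. C (int i - int D))) n = fps_nth (Abs_fps (\<lambda>i. C (int i - int (D + m)))) n"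
      using C[of "int n - int (D + m)"] by (cases "n < m") (simp_all add: fps_X_power_mult_nth of_nat_diff algebra_simps)
  qed
  then show ?thesis
    using qexp_exponent_raise[OF lexp_qexp[OF F], of m] C by (simp add: lexp_def)
qed

lemma lexp_add:
  assumes "lexp D F C" "lexp D G B"
  shows "lexp D (\<lambda>z. F z + G z) (\<lambda>n. C n + B n)"
proof -
  have "qexp 1 (\<lambda>z. qq 1 z ^ D * F z + qq 1 z ^ D * G z)
      (Abs_fps (\<lambda>m. C (int m - int D)) + Abs_fps (\<lambda>m. B (int m - int D)))"
    using assms by (intro qexp_add) (auto simp: lexp_def)
  moreover have "Abs_fps (\<lambda>m. C (int m - int D)) + Abs_fps (\<lambda>m. B (int m - int D)) = Abs_fps (\<lambda>m. C (int m - int D) + B (int m - int D))"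
    by (simp add: fps_eq_iff)
  ultimately show ?thesis
    using assms by (simp add: lexp_def distrib_left)
qed

lemma lexp_cmult:
  assumes "lexp D F C"
  shows "lexp D (\<lambda>z. x * F z) (\<lambda>n. x * C n)"
proof -
  have "qexp 1 (\<lambda>z. x * (qq 1 z ^ D * F z)) (fps_const x * Abs_fps (\<lambda>m. C (int m - int D)))"
    using assms by (intro qexp_cmult) (auto simp: lexp_def)
  moreover have "fps_const x * Abs_fps (\<lambda>m. C (int m - int D)) = Abs_fps (\<lambda>m. x * C (int m - int D))"
    by (simp add: fps_eq_iff)
  ultimately show ?thesis
    using assms by (simp add: lexp_def mult.left_commute)
qed

lemma qexp_dilate:
  assumes G: "qexp 1 G c" and e: "e > 0"
  shows "qexp 1 (\<lambda>z. G (of_nat e * z)) (fps_spread e c)"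
proof -
  have "Abs_fps (\<lambda>l. fps_nth c (1 * l)) = c"
    by (simp add: fps_eq_iff)
  then show ?thesis
    using qexp_sum_shifts[OF G, of 1 e] e by simp
qed

lemma lexp_dilate:
  assumes F: "lexp D F C" and p: "p > 0"
  shows "lexp (p * D) (\<lambda>z. F (of_nat p * z)) (\<lambda>n. if int p dvd n then C (n div int p) else 0)"
proof -
  have "qexp 1 (\<lambda>z. qq 1 (of_nat p * z) ^ D * F (of_nat p * z)) (fps_spread p (Abs_fps (\<lambda>m. C (int m - int D))))"
    using qexp_dilate[OF lexp_qexp[OF F] p] .
  moreover have "qq 1 (of_nat p * z) ^ D = qq 1 z ^ (p * D)" for z
    by (simp add: qq_def exp_of_nat_mult [symmetric] mult_ac)
  moreover have "fps_spread p (Abs_fps (\<lambda>m. C (int m - int D))) =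
      Abs_fps (\<lambda>m. if int p dvd int m - int (p * D) then C ((int m - int (p * D)) div int p) else 0)"
  proof (rule fps_ext)
    fix m
    have dv: "int p dvd int m - int (p * D) \<longleftrightarrow> p dvd m"
      by (metis dvd_diff_right_iff dvd_triv_left int_dvd_int_iff of_nat_mult dvd_diff_left_iff)
    have "(int m - int (p * D)) div int p = int (m div p) - int D" if "p dvd m"
      using that p by (elim dvdE) (simp add: right_diff_distrib [symmetric])
    then show "fps_nth (fps_spread p (Abs_fps (\<lambda>m. C (int m - int D)))) m =
      fps_nth (Abs_fps (\<lambda>m. if int p dvd int m - int (p * D) then C ((int m - int (p * D)) div int p) else 0)) m"
      using dv by (simp add: fps_spread_nth)
  qed
  moreover have "C (n div int p) = 0" if n: "n < - int (p * D)" "int p dvd n" for n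
  proof -
    obtain i where i: "n = int p * i"
      using n(2) ..
    then have "int p * i < int p * (- int D)"
      using n(1) by simp
    then have "i < - int D"
      using p by (metis mult_less_cancel_left_pos of_nat_0_less_iff)
    then show ?thesis
      using F p i by (simp add: lexp_def)
  qed
  ultimately show ?thesis
    unfolding lexp_def by auto
qed

lemma lexp_sum_shifts:
  assumes F: "lexp D F C" and p: "p > 0"
  shows "lexp D (\<lambda>z. \<Sum>b<p. F ((z + of_nat b) / of_nat p)) (\<lambda>n. of_nat p * C (int p * n))"
proof -
  have "p * D = D + (p - 1) * D"
    using p by (simp add: algebra_simps)
  then have F': "lexp (p * D) F C"
    using lexp_raise[OF F, of "(p - 1) * D"] by simp
  have "qexp 1 (\<lambda>z. \<Sum>b<p. qq 1 ((of_nat 1 * z + of_nat b) / of_nat p) ^ (p * D) * F ((of_nat 1 * z + of_nat b) / of_nat p))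
      (fps_const (of_nat p) * fps_spread 1 (Abs_fps (\<lambda>l. fps_nth (Abs_fps (\<lambda>m. C (int m - int (p * D)))) (p * l))))"
    by (rule qexp_sum_shifts[OF lexp_qexp[OF F'] p zero_less_one])
  moreover have "(\<lambda>z. \<Sum>b<p. qq 1 ((of_nat 1 * z + of_nat b) / of_nat p) ^ (p * D) * F ((of_nat 1 * z + of_nat b) / of_nat p)) =
      (\<lambda>z. qq 1 z ^ D * (\<Sum>b<p. F ((z + of_nat b) / of_nat p)))"
  proof
    fix z
    have "qq 1 ((of_nat 1 * z + of_nat b) / of_nat p) ^ (p * D) = qq 1 z ^ D" for b
    proof -
      have "qq 1 ((of_nat 1 * z + of_nat b) / of_nat p) ^ p = qq 1 (z + of_nat b)"
        using p by (simp add: qq_def exp_of_nat_mult [symmetric] mult_ac)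
      also have "qq 1 (z + of_nat b) = qq 1 z"
        using qq_eq_1_iff[of 1 "of_nat b"] by (simp add: qq_add) (metis of_int_of_nat_eq)
      finally show ?thesis
        by (simp add: power_mult)
    qed
    then show "(\<Sum>b<p. qq 1 ((of_nat 1 * z + of_nat b) / of_nat p) ^ (p * D) * F ((of_nat 1 * z + of_nat b) / of_nat p)) =
        qq 1 z ^ D * (\<Sum>b<p. F ((z + of_nat b) / of_nat p))"
      by (simp add: sum_distrib_left)
  qed
  moreover have "fps_const (of_nat p) * fps_spread 1 (Abs_fps (\<lambda>l. fps_nth (Abs_fps (\<lambda>m. C (int m - int (p * D)))) (p * l))) =
      Abs_fps (\<lambda>m. of_nat p * C (int p * (int m - int D)))"
    by (rule fps_ext) (simp add: fps_spread_nth algebra_simps)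
  moreover have "C (int p * n) = 0" if "n < - int D" for n
  proof -
    have "int p * n \<le> 1 * n"
      using p that by (intro mult_right_mono_neg) auto
    then have "int p * n < - int D"
      using that by linarith
    then show ?thesis
      using F unfolding lexp_def by blast
  qed
  ultimately show ?thesis
    by (simp add: lexp_def)
qed

lemma hecke_prime:
  assumes p: "prime p"
  shows "hecke w \<psi> p f z = of_nat p powi (w - 1) * \<psi> (int p) * f (of_nat p * z) +
    \<psi> 1 / of_nat p * (\<Sum>b<p. f ((z + of_nat b) / of_nat p))"
proof -
  have p0: "p > 0" "p \<noteq> 1"
    using p prime_gt_0_nat prime_gt_1_nat[of p] by auto
  have "{d. d dvd p} = {1, p}"
    using p by (auto simp: prime_nat_iff)
  then have "hecke w \<psi> p f z = of_nat p powi (w - 1) * (\<psi> (int p) * f (of_nat p * z) +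
      (\<Sum>b<p. \<psi> 1 * of_nat p powi (- w) * f ((z + of_nat b) / of_nat p)))"
    using p0 by (simp add: hecke_def)
  also have "\<dots> = of_nat p powi (w - 1) * \<psi> (int p) * f (of_nat p * z) +
      (of_nat p powi (w - 1) * of_nat p powi (- w)) * \<psi> 1 * (\<Sum>b<p. f ((z + of_nat b) / of_nat p))"
    by (simp add: sum_distrib_left algebra_simps)
  also have "of_nat p powi (w - 1) * of_nat p powi (- w) = (of_nat p powi (- 1) :: complex)"
    using p0 by (subst power_int_add [symmetric]) auto
  finally show ?thesis
    by (simp add: power_int_minus divide_inverse mult_ac)
qed

lemma hecke_fps_prime_nth:
  assumes p: "prime p" and \<psi>: "\<psi> 1 = 1"
  shows "fps_nth (hecke_fps k \<psi> p c) i =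
    fps_nth c (p * i) + of_nat p powi (k - 1) * \<psi> (int p) * (if p dvd i then fps_nth c (i div p) else 0)"
proof -
  have p0: "p > 0" "p \<noteq> 1"
    using p prime_gt_0_nat prime_gt_1_nat[of p] by auto
  have "{d. d dvd p} = {1, p}"
    using p by (auto simp: prime_nat_iff)
  then have "fps_nth (hecke_fps k \<psi> p c) i =
    of_nat p powi (k - 1) * \<psi> (int p) * (if p dvd i then fps_nth c (i div p) else 0) +
    (of_nat p powi (k - 1) * of_nat p powi (- k) * of_nat p powi 1) * fps_nth c (p * i)"
    using p0 \<psi> by (simp add: hecke_fps_nth)
  also have "of_nat p powi (k - 1) * of_nat p powi (- k) * of_nat p powi 1 = (of_nat p powi (k - 1 + (- k) + 1) :: complex)"
    using p0 by (subst power_int_add, simp)+ simp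
  finally show ?thesis
    by simp
qed

lemma lexp_hecke:
  assumes F: "lexp D F C" and p: "prime p" and \<psi>: "\<psi> 1 = 1"
  shows "lexp (p * D) (hecke w \<psi> p F)
    (\<lambda>n. C (int p * n) + of_nat p powi (w - 1) * \<psi> (int p) * (if int p dvd n then C (n div int p) else 0))"
proof -
  have p0: "p > 0"
    using p prime_gt_0_nat by auto
  have D: "p * D = D + (p - 1) * D"
    using p0 by (simp add: algebra_simps)
  have "lexp (p * D) (\<lambda>z. inverse (of_nat p) * (\<Sum>b<p. F ((z + of_nat b) / of_nat p)) +
      of_nat p powi (w - 1) * \<psi> (int p) * F (of_nat p * z))
    (\<lambda>n. inverse (of_nat p) * (of_nat p * C (int p * n)) +
      of_nat p powi (w - 1) * \<psi> (int p) * (if int p dvd n then C (n div int p) else 0))"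
  proof (intro lexp_add lexp_cmult lexp_dilate[OF F p0])
    show "lexp (p * D) (\<lambda>z. \<Sum>b<p. F ((z + of_nat b) / of_nat p)) (\<lambda>n. of_nat p * C (int p * n))"
      using lexp_raise[OF lexp_sum_shifts[OF F p0], of "(p - 1) * D"] D by simp
  qed
  moreover have "hecke w \<psi> p F = (\<lambda>z. inverse (of_nat p) * (\<Sum>b<p. F ((z + of_nat b) / of_nat p)) +
      of_nat p powi (w - 1) * \<psi> (int p) * F (of_nat p * z))"
    by (simp add: fun_eq_iff hecke_prime[OF p] \<psi> divide_inverse add.commute)
  moreover have "inverse (of_nat p) * (of_nat p * x) = x" for x :: complex
    using p0 by simp
  ultimately show ?thesis
    by simp
qed

text \<open>The vanishing eigenvalue reads c(p n) = - p^(k-1) cnj (chi(p)) c(n / p). Conjugation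
  turns the operator of weight 2 - k with character chi into this relation for each coefficient
  series separately, so every power y^j contributes 0.\<close>

lemma hecke_nh_part:
  assumes p: "prime p" and c: "fps_conv_radius c \<ge> 1" and \<psi>: "chi 1 = 1" and k: "k = int s + 2"
    and eig: "hecke_fps k (\<lambda>d. cnj (chi d)) p c = 0" and z: "Im z > 0"
  shows "hecke (2 - k) chi p (nh_part s r c) z = 0"
proof -
  have p0: "p > 0"
    using p prime_gt_0_nat by auto
  define G where "G j z = eval_fps (nh_fps s r c j) (qq 1 z)" for j z
  have qG: "qexp 1 (G j) (nh_fps s r c j)" if "j \<le> s" for j
    using nh_fps_radius[OF c, of j s r] that by (simp add: qexp_def G_def)
  have eig': "fps_nth c (p * i) = - (of_nat p ^ Suc s * cnj (chi (int p)) * (if p dvd i then fps_nth c (i div p) else 0))" for i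
  proof -
    have "fps_nth (hecke_fps k (\<lambda>d. cnj (chi d)) p c) i = 0"
      by (simp add: eig)
    moreover have "of_nat p powi (k - 1) = (of_nat p ^ Suc s :: complex)"
    proof -
      have "k - 1 = int (Suc s)"
        using k by simp
      then show ?thesis
        by (simp only: power_int_of_nat)
    qed
    ultimately show ?thesis
      using hecke_fps_prime_nth[OF p, of "\<lambda>d. cnj (chi d)" k c i] \<psi> by (simp add: eq_neg_iff_add_eq_0)
  qed
  have key: "(\<Sum>b<p. G j ((z + of_nat b) / of_nat p)) / of_nat p ^ Suc j
      + cnj (chi (int p)) * of_nat p ^ j / of_nat p ^ Suc s * G j (of_nat p * z) = 0" if j: "j \<le> s" for j
  proof -
    let ?a = "fps_const (inverse (of_nat p ^ Suc j)) * (fps_const (of_nat p) * fps_spread 1 (Abs_fps (\<lambda>l. fps_nth (nh_fps s r c j) (p * l))))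
        + fps_const (cnj (chi (int p)) * of_nat p ^ j / of_nat p ^ Suc s) * fps_spread p (nh_fps s r c j)"
    have "qexp 1 (\<lambda>z. inverse (of_nat p ^ Suc j) * (\<Sum>b<p. G j ((of_nat 1 * z + of_nat b) / of_nat p))
        + cnj (chi (int p)) * of_nat p ^ j / of_nat p ^ Suc s * G j (of_nat p * z)) ?a"
      by (intro qexp_add qexp_cmult qexp_sum_shifts[OF qG[OF j] p0] qexp_dilate[OF qG[OF j] p0]) simp_all
    moreover have "?a = 0"
    proof (rule fps_ext)
      fix l
      define R where "R n = complex_of_real ((4 * pi * n) ^ j / ((4 * pi * n) ^ Suc s * fact j))" for n :: nat
      have nth: "fps_nth (nh_fps s r c j) n = - of_real r * fps_nth c n * R n" for n
        by (simp add: nh_fps_def R_def)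
      \<comment> \<open>The weights are homogeneous of degree j - s - 1 in n. Used twice below, this
        turns the factor p^(s+1) of weight k into p^(-s-1), the factor of weight 2 - k.\<close>
      have Rp: "R (p * n) = of_nat p ^ j / of_nat p ^ Suc s * R n" for n
      proof -
        have "4 * pi * real (p * n) = real p * (4 * pi * real n)"
          by simp
        then show ?thesis
          unfolding R_def by (simp only: power_mult_distrib) simp
      qed
      have "fps_nth ?a l = inverse (of_nat p ^ Suc j) * of_nat p * (- of_real r * fps_nth c (p * l) * R (p * l)) +
          cnj (chi (int p)) * of_nat p ^ j / of_nat p ^ Suc s * (if p dvd l then - of_real r * fps_nth c (l div p) * R (l div p) else 0)"
        by (simp add: fps_spread_nth nth)
      also have "\<dots> = 0"
      proof (cases "p dvd l")
        case False
        then show ?thesis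
          by (simp add: eig')
      next
        case True
        then obtain i where i: "l = p * i" ..
        have "fps_nth c (p * l) = - (of_nat p ^ Suc s * cnj (chi (int p)) * fps_nth c i)"
          using eig'[of l] p0 by (simp add: i)
        moreover have "R (p * l) = of_nat p ^ j / of_nat p ^ Suc s * (of_nat p ^ j / of_nat p ^ Suc s * R i)"
          by (simp only: i Rp)
        moreover have "l div p = i"
          using p0 by (simp add: i)
        moreover have "inverse (q * P) * q * (- r' * (- (S * x * c')) * (P / S * (P / S * R'))) + x * P / S * (- r' * c' * R') = 0"
          if "q \<noteq> 0" "P \<noteq> 0" "S \<noteq> 0" for q P S r' x c' R' :: complex
          using that by (simp add: field_simps)
        from this[of "of_nat p" "of_nat p ^ j" "of_nat p ^ Suc s"]
        have "inverse (of_nat p * of_nat p ^ j) * of_nat p * (- r' * (- (of_nat p ^ Suc s * x * c')) *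
            (of_nat p ^ j / of_nat p ^ Suc s * (of_nat p ^ j / of_nat p ^ Suc s * R'))) +
            x * of_nat p ^ j / of_nat p ^ Suc s * (- r' * c' * R') = 0" for r' x c' R' :: complex
          using p0 by simp
        ultimately show ?thesis
          using True by (simp only: power_Suc[of _ j] if_True)
      qed
      finally show "fps_nth ?a l = fps_nth 0 l"
        by simp
    qed
    ultimately have "inverse (of_nat p ^ Suc j) * (\<Sum>b<p. G j ((of_nat 1 * z + of_nat b) / of_nat p))
        + cnj (chi (int p)) * of_nat p ^ j / of_nat p ^ Suc s * G j (of_nat p * z) = 0"
      using qexp_eq_0_iff[OF _ zero_less_one] z by (metis (no_types, lifting) uhp_iff)
    then show ?thesis
      by (simp add: divide_inverse mult.commute)
  qed
  have pk: "of_nat p powi (2 - k - 1) = (1 / of_nat p ^ Suc s :: complex)"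
  proof -
    have "2 - k - 1 = - int (Suc s)"
      using k by simp
    then show ?thesis
      by (simp only: power_int_minus power_int_of_nat inverse_eq_divide)
  qed
  have "hecke (2 - k) chi p (nh_part s r c) z = (\<Sum>j\<le>s. fact s * of_real (Im z) ^ j *
      cnj ((\<Sum>b<p. G j ((z + of_nat b) / of_nat p)) / of_nat p ^ Suc j
      + cnj (chi (int p)) * of_nat p ^ j / of_nat p ^ Suc s * G j (of_nat p * z)))"
  proof -
    have i1: "Im ((z + of_nat b) / of_nat p) = Im z / real p" for b
      by (simp add: Im_divide_of_nat)
    have 1: "\<psi>' * nh_part s r c (of_nat p * z) = (\<Sum>j\<le>s. fact s * of_real (Im z) ^ j * (\<psi>' * of_nat p ^ j * cnj (G j (of_nat p * z))))" for \<psi>'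
      by (simp add: nh_part_def G_def sum_distrib_left power_mult_distrib mult_ac)
    have 2: "1 / of_nat p * (\<Sum>b<p. nh_part s r c ((z + of_nat b) / of_nat p)) =
        (\<Sum>j\<le>s. fact s * of_real (Im z) ^ j * (cnj (\<Sum>b<p. G j ((z + of_nat b) / of_nat p)) / of_nat p ^ Suc j))"
    proof -
      have "nh_part s r c ((z + of_nat b) / of_nat p) =
          (\<Sum>j\<le>s. fact s * of_real (Im z) ^ j / of_nat p ^ j * cnj (G j ((z + of_nat b) / of_nat p)))" for b
        by (simp only: nh_part_def i1 G_def) (simp add: sum_distrib_left power_divide mult.assoc)
      then have "(\<Sum>b<p. nh_part s r c ((z + of_nat b) / of_nat p)) =
          (\<Sum>j\<le>s. \<Sum>b<p. fact s * of_real (Im z) ^ j / of_nat p ^ j * cnj (G j ((z + of_nat b) / of_nat p)))"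
        by (simp only: sum.swap[of _ "{..s}"])
      then show ?thesis
        by (simp add: sum_distrib_left cnj_sum sum_divide_distrib mult_ac)
    qed
    show ?thesis
      unfolding hecke_prime[OF p] \<psi> 1 2 pk sum.distrib [symmetric]
      by (intro sum.cong refl) (simp add: algebra_simps)
  qed
  also have "\<dots> = 0"
    by (intro sum.neutral ballI) (simp only: key atMost_iff complex_cnj_zero mult_zero_right)
  finally show ?thesis .
qed

lemma holomorphicI_dbar:
  assumes "\<And>z. Im z > 0 \<Longrightarrow> \<exists>D. (F has_derivative D) (at z) \<and> D 1 + \<i> * D \<i> = 0"
  shows "F holomorphic_on uhp"
  unfolding holomorphic_on_def
proof
  fix z assume "z \<in> uhp"
  then obtain D where D: "(F has_derivative D) (at z)" "D 1 + \<i> * D \<i> = 0"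
    using assms by auto
  have lin: "linear D"
    using has_derivative_bounded_linear[OF D(1)] by (rule bounded_linear.linear)
  have "\<i> * D \<i> = - D 1"
    using D(2) by (simp add: add_eq_0_iff add.commute)
  then have "\<i> * (\<i> * D \<i>) = \<i> * (- D 1)"
    by simp
  then have Di: "D \<i> = \<i> * D 1"
    by (simp add: mult.assoc [symmetric])
  have Dh: "D h = h * D 1" for h
  proof -
    have "h = Re h *\<^sub>R 1 + Im h *\<^sub>R \<i>"
      by (simp add: complex_eq_iff)
    then have "D h = Re h *\<^sub>R D 1 + Im h *\<^sub>R D \<i>"
      by (metis lin linear_add linear_scale)
    also have "\<dots> = (of_real (Re h) + of_real (Im h) * \<i>) * D 1"
      by (simp add: Di scaleR_conv_of_real algebra_simps)
    also have "of_real (Re h) + of_real (Im h) * \<i> = h"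
      by (simp add: complex_eq_iff)
    finally show ?thesis .
  qed
  have "D = (\<lambda>h. D 1 * h)"
  proof
    show "D h = D 1 * h" for h
      by (subst mult.commute) (rule Dh)
  qed
  then have "(F has_field_derivative D 1) (at z)"
    using D(1) by (simp add: has_field_derivative_def)
  then show "F field_differentiable at z within uhp"
    using field_differentiable_at_within field_differentiable_def by blast
qed

lemma nh_part_period:
  assumes "Im z > 0"
  shows "nh_part s r c (z + 1) = nh_part s r c z"
  using qq_period[of 1 z] by (simp add: nh_part_def)

text \<open>With r the inverse square of the Petersson norm, f and the non-holomorphic part have the
  same d-bar derivative because \<xi> f = r g. Their difference is holomorphic and periodic, and it
  is bounded near oo up to the principal part, so it has a Laurent expansion. By
  \<open>maass_expansion_unique\<close> the coefficients are those of \<open>c_plus\<close>.\<close>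

lemma maass_holomorphic_part:
  assumes k: "2 \<le> k" and N: "N > 0" and chi: "dirichlet_character N chi"
    and f: "f \<in> harmonic_maass_forms (2 - k) N chi" and good: "good_for k N f g"
    and g: "g \<in> cusp_forms k N (\<lambda>d. cnj (chi d))"
  obtains r D where "lexp D (\<lambda>z. f z - nh_part (nat (k - 2)) r (Abs_fps (q_coeff g)) z) (c_plus k f)"
proof -
  define s where "s = nat (k - 2)"
  have ks: "k = int s + 2"
    using k by (simp add: s_def)
  define c where "c = Abs_fps (q_coeff g)"
  have qg: "qexp 1 g c" and c0: "fps_nth c 0 = 0"
    using cusp_forms_qexp[OF g N dirichlet_cnj[OF chi]] by (simp_all add: c_def)
  have rc: "fps_conv_radius c \<ge> 1"
    using qg by (simp add: qexp_def)
  define r where "r = petersson_norm k N g powi (- 2)"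
  define nh where "nh = nh_part s r c"
  define h where "h z = f z - nh z" for z
  have tr: "modular_transform (2 - k) N chi f" and sm: "times_diff_uhp (Suc 0) f"
    using f by (auto simp: harmonic_maass_forms_def smooth_uhp_def simp del: times_diff_uhp.simps)
  have xi: "xi_op (2 - k) f z = of_real r * g z" if "Im z > 0" for z
    using good that by (simp add: good_for_def r_def)
  have hol: "h holomorphic_on uhp"
  proof (rule holomorphicI_dbar)
    fix z assume z: "Im z > 0"
    define Df where "Df = frechet_derivative f (at z)"
    have "f differentiable at z"
      using sm z open_uhp by (auto simp: differentiable_on_eq_differentiable_at)
    then have Df: "(f has_derivative Df) (at z)"
      unfolding Df_def by (simp add: frechet_derivative_works)
    obtain D where D: "(nh has_derivative D) (at z)"
      "D 1 + \<i> * D \<i> = \<i> * of_real r * of_real (Im z) ^ s * cnj (eval_fps c (qq 1 z))"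
      unfolding nh_def using nh_part_deriv[OF rc c0 z] by blast
    have pw: "complex_of_real (Im z powi (2 - k)) = inverse (of_real (Im z) ^ s)"
    proof -
      have "2 - k = - int s"
        using ks by simp
      then show ?thesis
        by (simp only: power_int_minus power_int_of_nat of_real_inverse of_real_power)
    qed
    have "\<i> * inverse (of_real (Im z) ^ s) * cnj (Df 1 + \<i> * Df \<i>) = of_real r * g z"
      using xi[OF z] unfolding xi_op_def dbar_def partial_x_def partial_y_def Df_def [symmetric] pw by (simp add: mult.assoc)
    then have "cnj (\<i> * inverse (of_real (Im z) ^ s) * cnj (Df 1 + \<i> * Df \<i>)) = cnj (of_real r * g z)"
      by (simp only:)
    then have "- \<i> * inverse (of_real (Im z) ^ s) * (Df 1 + \<i> * Df \<i>) = of_real r * cnj (g z)"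
      by simp
    then have "(\<i> * of_real (Im z) ^ s) * (- \<i> * inverse (of_real (Im z) ^ s) * (Df 1 + \<i> * Df \<i>)) =
        (\<i> * of_real (Im z) ^ s) * (of_real r * cnj (g z))"
      by (simp only:)
    moreover have "(\<i> * of_real (Im z) ^ s) * (- \<i> * inverse (of_real (Im z) ^ s) * w) = w" for w
      using z by (simp add: mult_ac)
    ultimately have "Df 1 + \<i> * Df \<i> = \<i> * of_real (Im z) ^ s * (of_real r * cnj (g z))"
      by (simp only:)
    moreover have "g z = eval_fps c (qq 1 z)"
      by (rule qexp_eval[OF qg z])
    ultimately have "(Df 1 - D 1) + \<i> * (Df \<i> - D \<i>) = 0"
      using D(2) by (simp add: algebra_simps)
    moreover have "(h has_derivative (\<lambda>w. Df w - D w)) (at z)"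
      unfolding h_def[abs_def] by (rule has_derivative_diff[OF Df D(1)])
    ultimately show "\<exists>D. (h has_derivative D) (at z) \<and> D 1 + \<i> * D \<i> = 0"
      by blast
  qed
  have per: "h (z + 1) = h z" if "Im z > 0" for z
    using modular_transform_period[OF tr chi that, of 1] nh_part_period[OF that] by (simp add: h_def nh_def)
  obtain P \<epsilon> where "\<epsilon> > 0" and P: "(\<lambda>z. f z - poly P (exp (- 2 * of_real pi * \<i> * z / of_nat 1)))
               \<in> O[filtercomap Im at_top](\<lambda>z. of_real (exp (- \<epsilon> * Im z)) :: complex)"
    using good unfolding good_for_def principal_part_def by blast
  have ex: "exp (- 2 * of_real pi * \<i> * z / of_nat 1) = inverse (qq 1 z)" for z
    by (simp add: qq_def exp_minus [symmetric])
  obtain K where "K > 0" and "eventually (\<lambda>z. cmod (f z - poly P (inverse (qq 1 z))) \<le> K * cmod (complex_of_real (exp (- \<epsilon> * Im z)))) (filtercomap Im at_top)"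
    using landau_o.bigE[OF P] unfolding ex by blast
  then obtain Y1 where Y1: "\<And>z. Im z \<ge> Y1 \<Longrightarrow> cmod (f z - poly P (inverse (qq 1 z))) \<le> K * exp (- \<epsilon> * Im z)"
    by (auto simp: eventually_Im_at_top)
  obtain Y2 B where Y2: "\<And>z. Im z \<ge> Y2 \<Longrightarrow> cmod (nh z) \<le> B"
    unfolding nh_def using nh_part_bounded[OF rc c0] by blast
  obtain e where e: "qexp 1 (\<lambda>z. h z - poly P (inverse (qq 1 z))) e"
  proof (rule qexp_exists[of 1 "\<lambda>z. h z - poly P (inverse (qq 1 z))" "max 0 (max Y1 Y2)" "K + B"])
    show "(\<lambda>z. h z - poly P (inverse (qq 1 z))) holomorphic_on uhp"
      by (intro holomorphic_intros hol holomorphic_qq) (simp_all add: poly_altdef)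
    show "h (z + of_nat 1) - poly P (inverse (qq 1 (z + of_nat 1))) = h z - poly P (inverse (qq 1 z))" if "Im z > 0" for z
      using per[OF that] qq_period[of 1 z] by simp
    fix z assume z: "max 0 (max Y1 Y2) \<le> Im z"
    have "exp (- \<epsilon> * Im z) \<le> 1"
      using z \<open>\<epsilon> > 0\<close> by simp
    then have "K * exp (- \<epsilon> * Im z) \<le> K"
      using \<open>K > 0\<close> by simp
    then have "cmod (f z - poly P (inverse (qq 1 z))) \<le> K"
      using Y1[of z] z by simp
    moreover have "cmod (nh z) \<le> B"
      using Y2[of z] z by simp
    ultimately have "cmod ((f z - poly P (inverse (qq 1 z))) - nh z) \<le> K + B"
      by (rule order_trans[OF norm_triangle_ineq4 add_mono])
    moreover have "h z - poly P (inverse (qq 1 z)) = (f z - poly P (inverse (qq 1 z))) - nh z"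
      by (simp add: h_def)
    ultimately show "cmod (h z - poly P (inverse (qq 1 z))) \<le> K + B"
      by (simp only:)
  qed simp_all
  define D where "D = degree P"
  \<comment> \<open>q^D h is q^D (h - P(1/q)) plus q^D P(1/q), and the last term is the reflected
    polynomial at q.\<close>
  define a where "a = fps_X ^ D * e + fps_of_poly (reflect_poly P)"
  have a: "qexp 1 (\<lambda>z. qq 1 z ^ D * h z) a"
  proof -
    have "qexp 1 (\<lambda>z. poly (reflect_poly P) (qq 1 z)) (fps_of_poly (reflect_poly P))"
      by (simp add: qexp_def)
    then have "qexp 1 (\<lambda>z. qq 1 z ^ D * (h z - poly P (inverse (qq 1 z))) + poly (reflect_poly P) (qq 1 z)) a"
      unfolding a_def by (intro qexp_add qexp_mult qexp_power qexp_qq e) simp_all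
    moreover have "qq 1 z ^ D * (h z - poly P (inverse (qq 1 z))) + poly (reflect_poly P) (qq 1 z) = qq 1 z ^ D * h z" for z
      by (simp add: poly_reflect_poly_nz D_def algebra_simps)
    ultimately show ?thesis
      by simp
  qed
  define cp where "cp n = (if n < - int D then 0 else fps_nth a (nat (n + int D)))" for n
  have "Abs_fps (\<lambda>m. cp (int m - int D)) = a"
    by (simp add: fps_eq_iff cp_def)
  then have lexp: "lexp D h cp"
    using a by (simp add: lexp_def cp_def)
  define cm where "cm n = cnj (fps_nth (nh_fps s r c 0) (nat (- n)))" for n :: int
  have "maass_expansion k f cp cm"
    unfolding maass_expansion_def
  proof (intro conjI ballI)
    show "\<exists>m. \<forall>n<m. cp n = 0"
      by (intro exI[of _ "- int D"]) (simp add: cp_def)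
    fix z assume "z \<in> uhp"
    then have z: "Im z > 0"
      by simp
    have "((\<lambda>m. fps_nth a m * qq 1 z ^ m) has_sum (qq 1 z ^ D * h z)) UNIV"
      by (rule qexp_has_sum[OF a zero_less_one z])
    then have "((\<lambda>m. inverse (qq 1 z ^ D) * (fps_nth a m * qq 1 z ^ m)) has_sum (inverse (qq 1 z ^ D) * (qq 1 z ^ D * h z))) UNIV"
      by (rule has_sum_cmult_right)
    moreover have "inverse (qq 1 z ^ D) * (qq 1 z ^ D * h z) = h z"
      by (simp add: field_simps)
    ultimately have "((\<lambda>m. inverse (qq 1 z ^ D) * (fps_nth a m * qq 1 z ^ m)) has_sum h z) UNIV"
      by (simp only:)
    also have "?this \<longleftrightarrow> ((\<lambda>n. cp n * exp (2 * of_real pi * \<i> * of_int n * z)) has_sum h z) {- int D..}"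
    proof (rule has_sum_reindex_bij_witness[of _ "\<lambda>n. nat (n + int D)" "\<lambda>m. int m - int D"])
      fix m :: nat
      have "exp (2 * of_real pi * \<i> * of_int (int m - int D) * z) = qq 1 z ^ m / qq 1 z ^ D"
        by (simp add: qq_def exp_of_nat_mult [symmetric] exp_diff [symmetric] algebra_simps)
      then show "cp (int m - int D) * exp (2 * of_real pi * \<i> * of_int (int m - int D) * z) = inverse (qq 1 z ^ D) * (fps_nth a m * qq 1 z ^ m)"
        by (simp add: cp_def divide_inverse)
    qed auto
    also have "\<dots> \<longleftrightarrow> ((\<lambda>n. cp n * exp (2 * of_real pi * \<i> * of_int n * z)) has_sum h z) UNIV"
      by (rule has_sum_cong_neutral) (auto simp: cp_def)
    finally have A: "((\<lambda>n. cp n * exp (2 * of_real pi * \<i> * of_int n * z)) has_sum h z) UNIV" .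
    have "real (Suc s) = of_int (k - 1)"
      using ks by simp
    then have B: "((\<lambda>n. cm n * of_real (upper_inc_Gamma (of_int (k - 1)) (4 * pi * \<bar>of_int n\<bar> * Im z))
                * exp (2 * of_real pi * \<i> * of_int n * z)) has_sum nh z) {..<0}"
      using nh_part_has_sum[OF rc c0 z, of s r] unfolding cm_def nh_def by (simp only:)
    show "\<exists>A B. ((\<lambda>n. cp n * exp (2 * of_real pi * \<i> * of_int n * z)) has_sum A) UNIV \<and>
        ((\<lambda>n. cm n * of_real (upper_inc_Gamma (of_int (k - 1)) (4 * pi * \<bar>of_int n\<bar> * Im z))
                * exp (2 * of_real pi * \<i> * of_int n * z)) has_sum B) {..<0} \<and> f z = A + B"
      using A B by (intro exI[of _ "h z"] exI[of _ "nh z"]) (simp add: h_def)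
  qed
  then have "c_plus k f = cp"
    unfolding c_plus_def using maass_expansion_unique[OF k] by (intro the_equality) blast+
  then show ?thesis
    using that[of D r] lexp by (simp add: h_def[abs_def] nh_def s_def c_def)
qed

subsection \<open>Integer matrices of determinant \<open>p\<close>\<close>

text \<open>Conjugation by \<beta> introduces the denominator p, which the factor p in the level
  absorbs.\<close>

lemma Gam_conj:
  assumes \<gamma>: "\<gamma> \<in> Gam (N * p)" and \<beta>: "det \<beta> = int p" and p: "p > 0"
  obtains \<alpha> where "\<alpha> \<in> Gam N" "\<alpha> ** \<beta> = \<beta> ** \<gamma>"
proof -
  have c: "congm (N * p) \<gamma> (mat 1)" and S: "\<gamma> \<in> SL2Z"
    using \<gamma> by (auto simp: Gam_def)
  define a b c' d where abcd: "a = \<beta> $ 1 $ 1" "b = \<beta> $ 1 $ 2" "c' = \<beta> $ 2 $ 1" "d = \<beta> $ 2 $ 2"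
  have pd: "int p = a * d - b * c'"
    using \<beta> by (simp add: abcd det_2)
  have dv: "int (N * p) dvd \<gamma> $ i $ j - (mat 1 :: int^2^2) $ i $ j" for i j
    using c by (simp only: congm_def)
  obtain W where "\<And>i j. \<gamma> $ i $ j - (mat 1 :: int^2^2) $ i $ j = int (N * p) * W i j"
    using dv unfolding dvd_def by metis
  then have g: "\<gamma> $ i $ j = (mat 1 :: int^2^2) $ i $ j + int N * (a * d - b * c') * W i j" for i j
    by (simp add: pd [symmetric] algebra_simps)
  have g4: "\<gamma> $ 1 $ 1 = 1 + int N * (a * d - b * c') * W 1 1" "\<gamma> $ 1 $ 2 = int N * (a * d - b * c') * W 1 2"
    "\<gamma> $ 2 $ 1 = int N * (a * d - b * c') * W 2 1" "\<gamma> $ 2 $ 2 = 1 + int N * (a * d - b * c') * W 2 2"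
    unfolding g by simp_all
  \<comment> \<open>With \<gamma> = 1 + N p W, the conjugate of \<gamma> by \<beta> is 1 + N \<beta>
    W adj(\<beta>); the y are the entries of \<beta> W.\<close>
  define y11 y12 y21 y22 where y: "y11 = a * W 1 1 + b * W 2 1" "y12 = a * W 1 2 + b * W 2 2"
    "y21 = c' * W 1 1 + d * W 2 1" "y22 = c' * W 1 2 + d * W 2 2"
  define \<alpha> where "\<alpha> = mat2 (1 + int N * (y11 * d - y12 * c')) (int N * (y12 * a - y11 * b))
      (int N * (y21 * d - y22 * c')) (1 + int N * (y22 * a - y21 * b))"
  have eq: "\<alpha> ** \<beta> = \<beta> ** \<gamma>"
    by (rule mat2_eqI; simp add: mat2_mult_nth \<alpha>_def abcd [symmetric] g4; simp add: y algebra_simps)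
  have "det (\<alpha> ** \<beta>) = det (\<beta> ** \<gamma>)"
    by (simp only: eq)
  then have "det \<alpha> * det \<beta> = det \<beta> * det \<gamma>"
    by (simp only: det_mul)
  then have "det \<alpha> = 1"
    using S \<beta> p by (simp add: SL2Z_det)
  moreover have "congm N \<alpha> (mat 1)"
    unfolding congm_def forall_2 by (simp add: \<alpha>_def)
  ultimately have "\<alpha> \<in> Gam N"
    by (simp add: Gam_def SL2Z_det)
  then show ?thesis
    using that eq by blast
qed

text \<open>The first column divided by its gcd is completed to \<gamma> by Bezout. A Hecke
  representative followed by a change of cusp thus becomes a change of cusp followed by an affine
  substitution, which acts explicitly on polar parts.\<close>

lemma upper_triangular_decomposition:
  assumes A: "det A = int p" and p: "p > 0"
  obtains \<gamma> and a d :: nat and b :: int where "\<gamma> \<in> SL2Z" "A = \<gamma> ** mat2 (int a) b 0 (int d)" "a * d = p"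
proof -
  define g where "g = gcd (A $ 1 $ 1) (A $ 2 $ 1)"
  have det: "A $ 1 $ 1 * A $ 2 $ 2 - A $ 1 $ 2 * A $ 2 $ 1 = int p"
    using A by (simp add: det_2)
  have g: "g > 0"
  proof -
    have "g \<noteq> 0"
      using det p by (auto simp: g_def)
    moreover have "g \<ge> 0"
      by (simp add: g_def)
    ultimately show ?thesis
      by simp
  qed
  obtain a1 where a1: "A $ 1 $ 1 = g * a1"
    unfolding g_def by (metis dvd_def gcd_dvd1)
  obtain a2 where a2: "A $ 2 $ 1 = g * a2"
    unfolding g_def by (metis dvd_def gcd_dvd2)
  obtain u v where "u * A $ 1 $ 1 + v * A $ 2 $ 1 = g"
    unfolding g_def using bezout_int by blast
  then have "g * (u * a1 + v * a2) = g * 1"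
    by (simp add: a1 a2 algebra_simps)
  then have uv: "u * a1 + v * a2 = 1"
    using g by simp
  define d where "d = a1 * A $ 2 $ 2 - a2 * A $ 1 $ 2"
  have gd: "g * d = int p"
    using det by (simp add: d_def a1 a2 algebra_simps)
  then have d: "d > 0"
    using g p by (metis of_nat_0_less_iff zero_less_mult_pos)
  define \<gamma> where "\<gamma> = mat2 a1 (- v) a2 u"
  have "\<gamma> \<in> SL2Z"
    using uv by (simp add: \<gamma>_def SL2Z_det det_mat2 algebra_simps)
  moreover have "A = \<gamma> ** mat2 (int (nat g)) (u * A $ 1 $ 2 + v * A $ 2 $ 2) 0 (int (nat d))"
  proof (rule mat2_eqI)
    have "a1 * (u * A $ 1 $ 2 + v * A $ 2 $ 2) - v * d = (u * a1 + v * a2) * A $ 1 $ 2"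
      by (simp add: d_def algebra_simps)
    then show "A $ 1 $ 2 = (\<gamma> ** mat2 (int (nat g)) (u * A $ 1 $ 2 + v * A $ 2 $ 2) 0 (int (nat d))) $ 1 $ 2"
      using d by (simp add: mat2_mult_nth \<gamma>_def uv)
    have "a2 * (u * A $ 1 $ 2 + v * A $ 2 $ 2) + u * d = (u * a1 + v * a2) * A $ 2 $ 2"
      by (simp add: d_def algebra_simps)
    then show "A $ 2 $ 2 = (\<gamma> ** mat2 (int (nat g)) (u * A $ 1 $ 2 + v * A $ 2 $ 2) 0 (int (nat d))) $ 2 $ 2"
      using d by (simp add: mat2_mult_nth \<gamma>_def uv)
  qed (use g in \<open>simp_all add: mat2_mult_nth \<gamma>_def a1 a2\<close>)
  moreover have "nat g * nat d = p"
    using gd g d by (metis nat_int nat_mult_distrib less_imp_le)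
  ultimately show ?thesis
    by (rule that)
qed

lemma hecke_slash:
  assumes p: "prime p" and \<psi>: "\<psi> 1 = 1"
  shows "hecke w \<psi> p F z = of_nat p powi (w - 1) * \<psi> (int p) * slash w F (mat2 (int p) 0 0 1) z +
    (\<Sum>b<p. of_nat p powi (w - 1) * slash w F (mat2 1 (int b) 0 (int p)) z)"
proof -
  have p0: "p > 0"
    using p prime_gt_0_nat by auto
  have "of_nat p powi (w - 1) * of_nat p powi (- w) = (of_nat p powi (- 1) :: complex)"
    using p0 by (subst power_int_add [symmetric]) auto
  then have pw: "of_nat p powi (w - 1) * (of_nat p powi (- w) * x) = (1 / of_nat p) * x" for x :: complex
    by (simp add: mult.assoc [symmetric] power_int_minus divide_inverse)
  have "slash w F (mat2 1 (int b) 0 (int p)) z = of_nat p powi (- w) * F ((z + of_nat b) / of_nat p)" for b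
    by (simp add: slash_def aut_factor_def mat_act_def moebius_def)
  moreover have "slash w F (mat2 (int p) 0 0 1) z = F (of_nat p * z)"
    by (simp add: slash_def aut_factor_def mat_act_def moebius_def)
  ultimately show ?thesis
    by (simp add: hecke_prime[OF p] \<psi> pw sum_distrib_left)
qed

text \<open>At level N p every summand is invariant by itself, so the summands do not have to be
  permuted.\<close>

lemma hecke_modular_Gam:
  assumes p: "prime p" and \<psi>: "\<psi> 1 = 1" and inv: "\<And>\<gamma> z. \<gamma> \<in> Gam N \<Longrightarrow> Im z > 0 \<Longrightarrow> slash w F \<gamma> z = F z"
    and \<gamma>: "\<gamma> \<in> Gam (N * p)" and z: "Im z > 0"
  shows "slash w (hecke w \<psi> p F) \<gamma> z = hecke w \<psi> p F z"
proof -
  have p0: "p > 0"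
    using p prime_gt_0_nat by auto
  have \<gamma>S: "\<gamma> \<in> SL2Z"
    using \<gamma> by (rule Gam_SL2Z)
  have inv': "slash w (slash w F \<beta>) \<gamma> z = slash w F \<beta> z" if \<beta>: "det \<beta> = int p" for \<beta>
  proof -
    obtain \<alpha> where \<alpha>: "\<alpha> \<in> Gam N" "\<alpha> ** \<beta> = \<beta> ** \<gamma>"
      using Gam_conj[OF \<gamma> \<beta> p0] .
    have "slash w (slash w F \<beta>) \<gamma> z = slash w F (\<beta> ** \<gamma>) z"
      using \<gamma>S z by (simp add: slash_mult)
    also have "\<dots> = slash w (slash w F \<alpha>) \<beta> z"
      using \<beta> p0 z by (simp add: \<alpha>(2) [symmetric] slash_mult)
    also have "\<dots> = slash w F \<beta> z"
      using \<beta> p0 z by (intro slash_cong inv \<alpha>(1)) auto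
    finally show ?thesis .
  qed
  have H: "hecke w \<psi> p F = (\<lambda>z. of_nat p powi (w - 1) * \<psi> (int p) * slash w F (mat2 (int p) 0 0 1) z +
    (\<Sum>b<p. of_nat p powi (w - 1) * slash w F (mat2 1 (int b) 0 (int p)) z))"
    by (simp add: fun_eq_iff hecke_slash[where \<psi> = \<psi>, OF p \<psi>])
  show ?thesis
    unfolding H slash_add slash_cmult slash_sum by (simp add: inv' det_mat2)
qed

subsection \<open>Polar parts\<close>

lemma principal_part_tendsto:
  assumes "principal_part h P F"
  shows "((\<lambda>z. F z - poly P (inverse (qq h z))) \<longlongrightarrow> 0) (filtercomap Im at_top)"
proof -
  have ex: "exp (- 2 * of_real pi * \<i> * z / of_nat h) = inverse (qq h z)" for z
    by (simp add: qq_def exp_minus [symmetric])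
  obtain \<epsilon> where e: "\<epsilon> > 0" and P: "(\<lambda>z. F z - poly P (inverse (qq h z)))
       \<in> O[filtercomap Im at_top](\<lambda>z. of_real (exp (- \<epsilon> * Im z)) :: complex)"
    using assms unfolding principal_part_def ex by blast
  obtain K where K: "eventually (\<lambda>z. cmod (F z - poly P (inverse (qq h z))) \<le> K * cmod (complex_of_real (exp (- \<epsilon> * Im z)))) (filtercomap Im at_top)"
    using landau_o.bigE[OF P] by blast
  have "((\<lambda>y. exp (- \<epsilon> * y)) \<longlongrightarrow> 0) at_top"
    using e by real_asymp
  then have "((\<lambda>z. exp (- \<epsilon> * Im z)) \<longlongrightarrow> 0) (filtercomap Im at_top)"
    by (rule filterlim_compose) (rule filterlim_filtercomap)
  then have "((\<lambda>z. K * cmod (complex_of_real (exp (- \<epsilon> * Im z)))) \<longlongrightarrow> K * 0) (filtercomap Im at_top)"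
    by (intro tendsto_mult_left) simp
  then show ?thesis
    using Lim_null_comparison[OF K] by simp
qed

lemma qexp_order_of_vanishing:
  assumes G: "qexp h G E" and h: "h > 0" and lim: "((\<lambda>z. G z / qq h z ^ K) \<longlongrightarrow> 0) (filtercomap Im at_top)" and i: "i \<le> K"
  shows "fps_nth E i = 0"
proof (rule ccontr)
  assume ne: "fps_nth E i \<noteq> 0"
  define d where "d = subdegree E"
  have d: "d \<le> K" "E \<noteq> 0"
    using ne i subdegree_leI[of E i] by (auto simp: d_def)
  define E' where "E' = fps_shift d E"
  have E: "E = fps_X ^ d * E'"
    unfolding E'_def d_def by (metis fps_shift_times_fps_X_power mult.commute order_refl)
  have rE: "fps_conv_radius E \<ge> 1"
    using G by (simp add: qexp_def)
  then have q': "qexp h (\<lambda>z. eval_fps E' (qq h z)) E'"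
    by (simp add: qexp_def E'_def)
  have "qexp h (\<lambda>z. qq h z ^ d * eval_fps E' (qq h z)) E"
    unfolding E by (intro qexp_mult qexp_power qexp_qq q' h)
  then have G': "G z = qq h z ^ d * eval_fps E' (qq h z)" if "Im z > 0" for z
    using qexp_eval[OF G that] qexp_eval[of h "\<lambda>z. qq h z ^ d * eval_fps E' (qq h z)" E z] that by simp
  have "((\<lambda>z. qq h z ^ (K - d) * (G z / qq h z ^ K)) \<longlongrightarrow> 0 ^ (K - d) * 0) (filtercomap Im at_top)"
    by (intro tendsto_mult tendsto_power tendsto_qq h lim)
  then have "((\<lambda>z. eval_fps E' (qq h z)) \<longlongrightarrow> 0 ^ (K - d) * 0) (filtercomap Im at_top)"
  proof (rule tendsto_uhp_cong)
    fix z :: complex assume "Im z > 0"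
    moreover have "qq h z ^ K = qq h z ^ (K - d) * qq h z ^ d"
      using d(1) by (simp add: power_add [symmetric])
    ultimately show "qq h z ^ (K - d) * (G z / qq h z ^ K) = eval_fps E' (qq h z)"
      by (simp add: G')
  qed
  then have "fps_nth E' 0 = 0"
    using tendsto_unique[OF filtercomap_Im_at_top_neq_bot qexp_tendsto[OF q' h]] by simp
  then show False
    using d(2) by (simp add: E'_def d_def)
qed

definition Delta_unit :: "complex fps" where
  "Delta_unit = fps_shift 1 Delta_fps"

lemma Delta_unit: "Delta_fps = fps_X * Delta_unit" "fps_nth Delta_unit 0 \<noteq> 0"
proof -
  show "Delta_fps = fps_X * Delta_unit"
    unfolding Delta_unit_def using subdegree_Delta_fps by (metis fps_shift_times_fps_X_power mult.commute order_refl power_one_right)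
  show "fps_nth Delta_unit 0 \<noteq> 0"
    using Delta_fps_nth(2) by (simp add: Delta_unit_def)
qed

definition Delta_quot :: "complex \<Rightarrow> complex" where
  "Delta_quot z = eval_fps Delta_unit (qq 1 z)"

lemma qexp_Delta_quot: "qexp 1 Delta_quot Delta_unit"
proof -
  have "fps_conv_radius Delta_fps \<ge> 1"
    using qexp_Delta by (simp add: qexp_def)
  then show ?thesis
    by (simp add: qexp_def Delta_quot_def Delta_unit_def)
qed

lemma Delta_eq: "Im z > 0 \<Longrightarrow> Delta z = qq 1 z * Delta_quot z"
proof -
  assume z: "Im z > 0"
  have "qexp 1 (\<lambda>z. qq 1 z * Delta_quot z) Delta_fps"
    unfolding Delta_unit(1) by (intro qexp_mult qexp_qq qexp_Delta_quot) simp_all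
  from qexp_eval[OF this z] qexp_eval[OF qexp_Delta z] show ?thesis
    by simp
qed

lemma qq_power_level: "N > 0 \<Longrightarrow> qq 1 z = qq N z ^ N"
  using qq_power[of N 1 z] by simp

lemma Delta_power_eq: "Im z > 0 \<Longrightarrow> N > 0 \<Longrightarrow> Delta z ^ m = qq N z ^ (N * m) * Delta_quot z ^ m"
  by (simp only: Delta_eq qq_power_level[of N] power_mult_distrib power_mult)

definition Delta_unit_level :: "nat \<Rightarrow> nat \<Rightarrow> complex fps" where
  "Delta_unit_level N m = fps_spread N Delta_unit ^ m"

lemma qexp_Delta_quot_power: "N > 0 \<Longrightarrow> qexp N (\<lambda>z. Delta_quot z ^ m) (Delta_unit_level N m)"
  unfolding Delta_unit_level_def using qexp_spread[OF qexp_Delta_quot zero_less_one, of N]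
  by (intro qexp_power) simp_all

lemma Delta_unit_level_0: "fps_nth (Delta_unit_level N m) 0 \<noteq> 0"
  using Delta_unit(2) by (simp add: Delta_unit_level_def fps_power_zeroth fps_spread_nth)

lemma qexp_Delta_power:
  assumes "N > 0"
  shows "qexp N (\<lambda>z. Delta z ^ m) (fps_X ^ (N * m) * Delta_unit_level N m)"
proof (rule qexp_congI)
  show "qexp N (\<lambda>z. qq N z ^ (N * m) * Delta_quot z ^ m) (fps_X ^ (N * m) * Delta_unit_level N m)"
    by (intro qexp_mult qexp_power[of _ "qq N"] qexp_qq qexp_Delta_quot_power assms)
qed (simp add: Delta_power_eq assms)

lemma qexp_reflect_poly:
  assumes h: "h > 0" and K: "degree R \<le> K"
  shows "qexp h (\<lambda>z. qq h z ^ K * poly R (inverse (qq h z))) (fps_X ^ (K - degree R) * fps_of_poly (reflect_poly R))"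
proof -
  have "qexp h (\<lambda>z. poly (reflect_poly R) (qq h z)) (fps_of_poly (reflect_poly R))"
    by (simp add: qexp_def)
  then have "qexp h (\<lambda>z. qq h z ^ (K - degree R) * poly (reflect_poly R) (qq h z)) (fps_X ^ (K - degree R) * fps_of_poly (reflect_poly R))"
    by (intro qexp_mult qexp_power qexp_qq h)
  moreover have "qq h z ^ (K - degree R) * poly (reflect_poly R) (qq h z) = qq h z ^ K * poly R (inverse (qq h z))" for z
    using K by (simp add: poly_reflect_poly_nz mult.assoc [symmetric] power_add [symmetric])
  ultimately show ?thesis
    by simp
qed

context derivation
begin

text \<open>Index i of R belongs to q^(-i). For b = 0 the constant term is killed by \<delta> too; b
  = 1 leaves it arbitrary, as is necessary at cusps other than oo. The common bound B lets a single
  power of \<open>Delta\<close> serve all cusps.\<close>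

definition cpolar :: "nat \<Rightarrow> nat \<Rightarrow> nat \<Rightarrow> (complex \<Rightarrow> complex) \<Rightarrow> bool" where
  "cpolar b h B F \<longleftrightarrow> (\<exists>R. degree R \<le> B \<and> (\<forall>i\<ge>b. \<delta> (coeff R i) = 0) \<and>
     ((\<lambda>z. F z - poly R (inverse (qq h z))) \<longlongrightarrow> 0) (filtercomap Im at_top))"

lemma cpolarE:
  assumes "cpolar b h B F"
  obtains R where "degree R \<le> B" "\<And>i. i \<ge> b \<Longrightarrow> \<delta> (coeff R i) = 0"
    "((\<lambda>z. F z - poly R (inverse (qq h z))) \<longlongrightarrow> 0) (filtercomap Im at_top)"
  using assms by (auto simp: cpolar_def)

lemma cpolarI:
  "degree R \<le> B \<Longrightarrow> (\<And>i. i \<ge> b \<Longrightarrow> \<delta> (coeff R i) = 0) \<Longrightarrow>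
    ((\<lambda>z. F z - poly R (inverse (qq h z))) \<longlongrightarrow> 0) (filtercomap Im at_top) \<Longrightarrow> cpolar b h B F"
  by (auto simp: cpolar_def)

lemma cpolar_weaken: "cpolar b h B F \<Longrightarrow> b \<le> b' \<Longrightarrow> B \<le> B' \<Longrightarrow> cpolar b' h B' F"
  unfolding cpolar_def using order_trans by blast

lemma cpolar_cong:
  assumes F: "cpolar b h B F" and eq: "\<And>z. Im z > 0 \<Longrightarrow> F z = G z"
  shows "cpolar b h B G"
proof -
  obtain R where R: "degree R \<le> B" "\<And>i. i \<ge> b \<Longrightarrow> \<delta> (coeff R i) = 0"
    "((\<lambda>z. F z - poly R (inverse (qq h z))) \<longlongrightarrow> 0) (filtercomap Im at_top)"
    using cpolarE[OF F] by blast
  show ?thesis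
    by (rule cpolarI[OF R(1,2) tendsto_uhp_cong[OF R(3)]]) (simp_all add: eq)
qed

lemma cpolar_add:
  assumes F: "cpolar b h B F" and G: "cpolar b h B G"
  shows "cpolar b h B (\<lambda>z. F z + G z)"
proof -
  obtain R where R: "degree R \<le> B" "\<And>i. i \<ge> b \<Longrightarrow> \<delta> (coeff R i) = 0"
    "((\<lambda>z. F z - poly R (inverse (qq h z))) \<longlongrightarrow> 0) (filtercomap Im at_top)"
    using cpolarE[OF F] by blast
  obtain S where S: "degree S \<le> B" "\<And>i. i \<ge> b \<Longrightarrow> \<delta> (coeff S i) = 0"
    "((\<lambda>z. G z - poly S (inverse (qq h z))) \<longlongrightarrow> 0) (filtercomap Im at_top)"
    using cpolarE[OF G] by blast
  show ?thesis
  proof (rule cpolarI[of "R + S"])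
    show "degree (R + S) \<le> B"
      using R(1) S(1) by (rule degree_add_le)
    show "\<delta> (coeff (R + S) i) = 0" if "i \<ge> b" for i
      using R(2)[OF that] S(2)[OF that] by (simp add: add)
    have "((\<lambda>z. (F z - poly R (inverse (qq h z))) + (G z - poly S (inverse (qq h z)))) \<longlongrightarrow> 0 + 0) (filtercomap Im at_top)"
      by (intro tendsto_add R(3) S(3))
    then show "((\<lambda>z. F z + G z - poly (R + S) (inverse (qq h z))) \<longlongrightarrow> 0) (filtercomap Im at_top)"
      by (simp add: algebra_simps)
  qed
qed

lemma cpolar_cmult:
  assumes F: "cpolar b h B F" and x: "\<delta> x = 0"
  shows "cpolar b h B (\<lambda>z. x * F z)"
proof -
  obtain R where R: "degree R \<le> B" "\<And>i. i \<ge> b \<Longrightarrow> \<delta> (coeff R i) = 0"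
    "((\<lambda>z. F z - poly R (inverse (qq h z))) \<longlongrightarrow> 0) (filtercomap Im at_top)"
    using cpolarE[OF F] by blast
  show ?thesis
  proof (rule cpolarI[of "Polynomial.smult x R"])
    show "degree (Polynomial.smult x R) \<le> B"
      using R(1) degree_smult_le[of x R] by simp
    show "\<delta> (coeff (Polynomial.smult x R) i) = 0" if "i \<ge> b" for i
      using R(2)[OF that] x by (simp add: mult)
    have "((\<lambda>z. x * (F z - poly R (inverse (qq h z)))) \<longlongrightarrow> x * 0) (filtercomap Im at_top)"
      by (intro tendsto_mult_left R(3))
    then show "((\<lambda>z. x * F z - poly (Polynomial.smult x R) (inverse (qq h z))) \<longlongrightarrow> 0) (filtercomap Im at_top)"
      by (simp add: algebra_simps)
  qed
qed

lemma cpolar_sum: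
  assumes "finite I" "\<And>i. i \<in> I \<Longrightarrow> cpolar b h B (F i)"
  shows "cpolar b h B (\<lambda>z. \<Sum>i\<in>I. F i z)"
  using assms
proof (induction I rule: finite_induct)
  case empty
  show ?case
    by (rule cpolarI[of 0]) simp_all
next
  case (insert i I)
  then show ?case
    using cpolar_add[of b h B "F i" "\<lambda>z. \<Sum>i\<in>I. F i z"] by simp
qed

lemma cpolar_affine:
  assumes F: "cpolar b 1 B F" and b: "b \<le> 1" and ad: "a * d = p" and p: "p > 0" and M: "M > 0"
  shows "cpolar b (M * p) (B * (M * p * p)) (\<lambda>z. F ((of_nat a * z + of_int j) / of_nat d))"
proof -
  obtain R where R: "degree R \<le> B" "\<And>i. i \<ge> b \<Longrightarrow> \<delta> (coeff R i) = 0"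
    and lim: "((\<lambda>z. F z - poly R (inverse (qq 1 z))) \<longlongrightarrow> 0) (filtercomap Im at_top)"
    using cpolarE[OF F] by blast
  have pos: "a > 0" "d > 0"
    using ad p by (auto intro: Nat.gr0I)
  \<comment> \<open>Since a / d = a^2 / p, the value of \<open>qq 1\<close> at (a z + j) / d is a
    root of unity times the power e of \<open>qq (M * p) z\<close>.\<close>
  define e where "e = M * a * a"
  have e: "e > 0" "e \<le> M * p * p"
  proof -
    show "e > 0"
      using pos M by (simp add: e_def)
    have "a \<le> p"
      using ad pos by auto
    then show "e \<le> M * p * p"
      unfolding e_def by (intro mult_mono) auto
  qed
  define \<zeta> where "\<zeta> = Ex (of_int (- j) / of_nat d)"
  have \<zeta>: "\<delta> (\<zeta> ^ i) = 0" for i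
    unfolding \<zeta>_def by (intro const_power Ex_rational_const pos)
  define R' where "R' = (\<Sum>i\<le>degree R. monom (coeff R i * \<zeta> ^ i) (e * i))"
  have q: "inverse (qq 1 ((of_nat a * z + of_int j) / of_nat d)) = \<zeta> * inverse (qq (M * p) z) ^ e" for z
  proof -
    have "inverse (qq (M * p) z) ^ e = exp (of_nat e * (- (2 * of_real pi * \<i> * z / of_nat (M * p))))"
      by (simp only: qq_def exp_minus [symmetric] exp_of_nat_mult)
    moreover have "of_nat e * (- (2 * of_real pi * \<i> * z / of_nat (M * p))) = - (2 * of_real pi * \<i> * (of_nat a * z / of_nat d))"
      using pos M by (simp add: e_def ad [symmetric] field_simps)
    moreover have "\<zeta> = exp (- (2 * of_real pi * \<i> * (of_int j / of_nat d)))"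
      by (simp add: \<zeta>_def Ex_def)
    moreover have "- (2 * of_real pi * \<i> * ((of_nat a * z + of_int j) / of_nat d)) =
        - (2 * of_real pi * \<i> * (of_int j / of_nat d)) + - (2 * of_real pi * \<i> * (of_nat a * z / of_nat d))"
      by (simp add: add_divide_distrib algebra_simps)
    ultimately show ?thesis
      by (simp add: qq_def exp_minus [symmetric] exp_add [symmetric])
  qed
  show ?thesis
  proof (rule cpolarI[of R'])
    have "degree (monom (coeff R i * \<zeta> ^ i) (e * i)) \<le> B * (M * p * p)" if "i \<le> degree R" for i
    proof -
      have "e * i \<le> (M * p * p) * B"
        using e(2) that R(1) by (intro mult_mono) auto
      then show ?thesis
        using degree_monom_le[of "coeff R i * \<zeta> ^ i" "e * i"] by (simp add: mult.commute)
    qed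
    then show "degree R' \<le> B * (M * p * p)"
      unfolding R'_def by (intro degree_sum_le) auto
    show "\<delta> (coeff R' l) = 0" if l: "l \<ge> b" for l
    proof -
      have "\<delta> (if e * i = l then coeff R i * \<zeta> ^ i else 0) = 0" for i
      proof (cases "e * i = l")
        case True
        then have "i \<ge> b"
          using l b e(1) by (cases "i = 0") auto
        then show ?thesis
          using R(2) \<zeta> by (simp add: const_mult)
      qed simp
      then show ?thesis
        unfolding R'_def coeff_sum coeff_monom by (intro const_sum)
    qed
    have R': "poly R' (inverse (qq (M * p) z)) = poly R (inverse (qq 1 ((of_nat a * z + of_int j) / of_nat d)))" for z
      unfolding q R'_def poly_sum poly_monom poly_altdef[of R]
      by (simp add: power_mult_distrib power_mult [symmetric] mult.assoc)
    have "filterlim (\<lambda>z. (of_nat a * z + of_int j) / of_nat d) (filtercomap Im at_top) (filtercomap Im at_top)"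
    proof -
      have "filterlim (\<lambda>y. real a / real d * y) at_top at_top"
        by (rule filterlim_tendsto_pos_mult_at_top[OF tendsto_const _ filterlim_ident]) (use pos in simp)
      then have "filterlim (\<lambda>z. real a / real d * Im z) at_top (filtercomap Im at_top)"
        by (rule filterlim_compose) (rule filterlim_filtercomap)
      moreover have "Im ((of_nat a * z + of_int j) / of_nat d) = real a / real d * Im z" for z
        by (simp add: Im_divide_of_nat)
      ultimately show ?thesis
        by (simp add: filterlim_filtercomap_iff o_def)
    qed
    from filterlim_compose[OF lim this]
    show "((\<lambda>z. F ((of_nat a * z + of_int j) / of_nat d) - poly R' (inverse (qq (M * p) z))) \<longlongrightarrow> 0) (filtercomap Im at_top)"
      by (simp only: R')
  qed
qed

lemma cpolar_slash:
  assumes F: "cpolar b 1 B F" and b: "b \<le> 1" and ad: "a * d = p" and p: "p > 0" and M: "M > 0"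
  shows "cpolar b (M * p) (B * (M * p * p)) (slash w F (mat2 (int a) j 0 (int d)))"
proof -
  have "cpolar b (M * p) (B * (M * p * p)) (\<lambda>z. of_nat d powi (- w) * F ((of_nat a * z + of_int j) / of_nat d))"
    by (intro cpolar_cmult cpolar_affine[OF F b ad p M] const_powi) simp
  moreover have "slash w F (mat2 (int a) j 0 (int d)) = (\<lambda>z. of_nat d powi (- w) * F ((of_nat a * z + of_int j) / of_nat d))"
    by (simp add: fun_eq_iff slash_def aut_factor_def mat_act_def moebius_def)
  ultimately show ?thesis
    by simp
qed

lemma fps_delta_power: "fps_delta a = 0 \<Longrightarrow> fps_delta (a ^ m) = 0"
proof (induction m)
  case 0
  show ?case
    by (simp add: fps_delta_eq_0_iff)
qed (simp add: fps_delta_mult)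

lemma fps_delta_X_power: "fps_delta (fps_X ^ m) = 0"
  by (simp add: fps_delta_eq_0_iff fps_X_power_nth)

lemma Delta_unit_level_const: "fps_delta (Delta_unit_level N m) = 0"
proof -
  have "\<delta> (fps_nth Delta_fps n) = 0" for n
    by (rule cform_const1[OF cform_Delta qexp_Delta])
  then have "fps_delta Delta_unit = 0"
    by (simp add: fps_delta_eq_0_iff Delta_unit_def)
  then have "fps_delta (fps_spread N Delta_unit) = 0"
    by (simp add: fps_delta_spread fps_eq_iff fps_spread_nth)
  then show ?thesis
    unfolding Delta_unit_level_def by (rule fps_delta_power)
qed

lemma cpolar_Delta_tendsto:
  assumes H: "cpolar b N B H" and N: "N > 0" and B: "B \<le> N * m"
  shows "\<exists>L. ((\<lambda>z. H z * Delta z ^ m) \<longlongrightarrow> L) (filtercomap Im at_top)"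
proof -
  obtain R where R: "degree R \<le> B"
    and lim: "((\<lambda>z. H z - poly R (inverse (qq N z))) \<longlongrightarrow> 0) (filtercomap Im at_top)"
    using cpolarE[OF H] by blast
  define \<rho> where "\<rho> = fps_X ^ (N * m - degree R) * fps_of_poly (reflect_poly R)"
  have \<rho>: "qexp N (\<lambda>z. qq N z ^ (N * m) * poly R (inverse (qq N z))) \<rho>"
    unfolding \<rho>_def by (rule qexp_reflect_poly[OF N]) (use R B in simp)
  have "((\<lambda>z. ((H z - poly R (inverse (qq N z))) * qq N z ^ (N * m) + qq N z ^ (N * m) * poly R (inverse (qq N z))) * Delta_quot z ^ m)
     \<longlongrightarrow> (0 * 0 ^ (N * m) + fps_nth \<rho> 0) * fps_nth (Delta_unit_level N m) 0) (filtercomap Im at_top)"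
    by (intro tendsto_mult tendsto_add tendsto_power[OF tendsto_qq[OF N]] lim qexp_tendsto[OF \<rho> N] qexp_tendsto[OF qexp_Delta_quot_power N] N)
  then have "((\<lambda>z. H z * Delta z ^ m) \<longlongrightarrow> (0 * 0 ^ (N * m) + fps_nth \<rho> 0) * fps_nth (Delta_unit_level N m) 0) (filtercomap Im at_top)"
    by (rule tendsto_uhp_cong) (simp add: Delta_power_eq[OF _ N, of _ m] algebra_simps)
  then show ?thesis
    by blast
qed

text \<open>The difference of H and its polar part tends to 0, so times \<open>Delta ^ m\<close> it
  vanishes beyond the order N m. Up to that order the coefficients of H Delta^m therefore come from
  the polar part and the constant series of \<open>Delta ^ m\<close>, and those of index at most N m
  - b involve only \<open>coeff R i\<close> with i >= b.\<close>

lemma cpolar_Delta_const: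
  assumes H: "cpolar b N B H" and N: "N > 0" and B: "B \<le> N * m"
    and c: "qexp N (\<lambda>z. H z * Delta z ^ m) c" and i: "i + b \<le> N * m"
  shows "\<delta> (fps_nth c i) = 0"
proof -
  define K where "K = N * m"
  obtain R where R: "degree R \<le> B" "\<And>i. i \<ge> b \<Longrightarrow> \<delta> (coeff R i) = 0"
    and lim: "((\<lambda>z. H z - poly R (inverse (qq N z))) \<longlongrightarrow> 0) (filtercomap Im at_top)"
    using cpolarE[OF H] by blast
  have RK: "degree R \<le> K"
    using R(1) B by (simp add: K_def)
  define \<rho> where "\<rho> = fps_X ^ (K - degree R) * fps_of_poly (reflect_poly R)"
  have \<rho>: "qexp N (\<lambda>z. qq N z ^ K * poly R (inverse (qq N z))) \<rho>"
    unfolding \<rho>_def by (rule qexp_reflect_poly[OF N RK])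
  define V where "V = Delta_unit_level N m"
  have V: "qexp N (\<lambda>z. Delta_quot z ^ m) V"
    unfolding V_def by (rule qexp_Delta_quot_power[OF N])
  have \<rho>nth: "\<delta> (fps_nth \<rho> j) = 0" if "j + b \<le> K" for j
  proof (cases "j < K - degree R")
    case False
    then have "degree R - (j - (K - degree R)) = K - j"
      using RK by simp
    then have "fps_nth \<rho> j = (if degree R < j - (K - degree R) then 0 else coeff R (K - j))"
      using False by (simp add: \<rho>_def fps_X_power_mult_nth coeff_reflect_poly)
    then show ?thesis
      using R(2)[of "K - j"] that by simp
  qed (simp add: \<rho>_def fps_X_power_mult_nth)
  have E: "qexp N (\<lambda>z. H z * Delta z ^ m - Delta_quot z ^ m * (qq N z ^ K * poly R (inverse (qq N z)))) (c - V * \<rho>)"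
    by (intro qexp_diff qexp_mult c V \<rho> N)
  have "((\<lambda>z. (H z - poly R (inverse (qq N z))) * Delta_quot z ^ m) \<longlongrightarrow> 0 * fps_nth V 0) (filtercomap Im at_top)"
    by (intro tendsto_mult lim qexp_tendsto[OF V N])
  then have "((\<lambda>z. (H z * Delta z ^ m - Delta_quot z ^ m * (qq N z ^ K * poly R (inverse (qq N z)))) / qq N z ^ K) \<longlongrightarrow> 0 * fps_nth V 0) (filtercomap Im at_top)"
    by (rule tendsto_uhp_cong) (simp add: Delta_power_eq[OF _ N, of _ m] K_def [symmetric] field_simps)
  then have "fps_nth (c - V * \<rho>) i = 0"
    using qexp_order_of_vanishing[OF E N, of K i] i by (simp add: K_def)
  then have "fps_nth c i = (\<Sum>j=0..i. fps_nth V j * fps_nth \<rho> (i - j))"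
    by (simp add: fps_mult_nth)
  moreover have "\<delta> (fps_nth V j * fps_nth \<rho> (i - j)) = 0" for j
  proof (rule const_mult)
    show "\<delta> (fps_nth V j) = 0"
      using Delta_unit_level_const[of N m] by (simp add: fps_delta_eq_0_iff V_def)
    show "\<delta> (fps_nth \<rho> (i - j)) = 0"
      by (rule \<rho>nth) (use i in \<open>simp add: K_def\<close>)
  qed
  ultimately show ?thesis
    by (simp add: const_sum)
qed

text \<open>
  Multiplying by a power of \<open>Delta\<close> makes \<open>F\<close> a modular form \<open>x\<close>. As the polar parts of \<open>F\<close> are
  killed by \<open>\<delta>\<close>, the form \<open>\<delta> x\<close> is divisible by this power of \<open>Delta\<close>, and the quotient is a form
  of nonpositive weight that vanishes at \<open>\<infinity>\<close>.
\<close>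

theorem weakly_holomorphic_coeff_const:
  assumes N: "N \<ge> 3" and w: "w \<le> 0" and hol: "F holomorphic_on uhp"
    and inv: "\<And>\<gamma> z. \<gamma> \<in> Gam N \<Longrightarrow> Im z > 0 \<Longrightarrow> slash w F \<gamma> z = F z"
    and polar: "\<And>\<gamma>. \<gamma> \<in> SL2Z \<Longrightarrow> cpolar 1 N B (slash w F \<gamma>)" and polar_oo: "cpolar 0 N B F"
    and F: "lexp D F C"
  shows "\<delta> (C n) = 0"
proof -
  have N0: "N > 0"
    using N by simp
  \<comment> \<open>\<open>Delta\<close> has order N in the variable \<open>qq N\<close>, so
    \<open>Delta ^ m\<close> has order N B, which is at least B and cancels all poles.\<close>
  define m where "m = B"
  define K where "K = N * m"
  have BK: "B \<le> N * m"
    using N0 by (simp add: m_def)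
  define x where "x z = F z * Delta z ^ m" for z
  define k where "k = w + int m * 12"
  have Dm1: "(\<lambda>z. Delta z ^ m) \<in> MF (int m * 12) 1"
    by (rule MF_power[OF Delta_MF]) simp
  have sl: "slash k (\<lambda>z. H z * Delta z ^ m) \<gamma> z = slash w H \<gamma> z * Delta z ^ m" if "\<gamma> \<in> SL2Z" "Im z > 0" for H \<gamma> z
    unfolding k_def using that MF1_slash[OF Dm1] by (simp add: slash_prod2)
  have x: "x \<in> MF k N"
  proof (rule MF_I[OF N0])
    show "x holomorphic_on uhp"
      unfolding x_def[abs_def] by (intro holomorphic_intros hol MF_holomorphic[OF Delta_MF]) simp
    show "slash k x \<gamma> z = x z" if "\<gamma> \<in> Gam N" "Im z > 0" for \<gamma> z
      unfolding x_def using that by (simp add: sl inv Gam_SL2Z)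
    fix \<gamma> assume \<gamma>: "\<gamma> \<in> SL2Z"
    obtain L where "((\<lambda>z. slash w F \<gamma> z * Delta z ^ m) \<longlongrightarrow> L) (filtercomap Im at_top)"
      using cpolar_Delta_tendsto[OF polar[OF \<gamma>] N0 BK] by blast
    then have "(slash k x \<gamma> \<longlongrightarrow> L) (filtercomap Im at_top)"
      by (rule tendsto_uhp_cong) (simp add: x_def[abs_def] sl \<gamma>)
    then have "eventually (\<lambda>z. dist (slash k x \<gamma> z) L < 1) (filtercomap Im at_top)"
      by (rule tendstoD) simp
    then obtain Y where Y: "\<And>z. Im z \<ge> Y \<Longrightarrow> dist (slash k x \<gamma> z) L < 1"
      by (auto simp: eventually_Im_at_top)
    have "cmod (slash k x \<gamma> z) \<le> cmod L + 1" if "Im z \<ge> Y" for z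
      using Y[OF that] norm_triangle_sub[of "slash k x \<gamma> z" L] by (simp add: dist_norm)
    then show "\<exists>B Y. \<forall>z. Im z \<ge> Y \<longrightarrow> cmod (slash k x \<gamma> z) \<le> B"
      by blast
  qed
  obtain G where G: "G \<in> MF k N"
    and qG: "\<And>\<gamma> c. \<gamma> \<in> SL2Z \<Longrightarrow> qexp N (slash k x \<gamma>) c \<Longrightarrow> qexp N (slash k G \<gamma>) (fps_delta c)"
    using MF_fps_delta[OF N x] by blast
  define V where "V = Delta_unit_level N m"
  define b where "b = fps_X ^ K * V"
  have b: "qexp N (\<lambda>z. Delta z ^ m) b"
    unfolding b_def K_def V_def by (rule qexp_Delta_power[OF N0])
  have V0: "fps_nth V 0 \<noteq> 0"
    by (simp add: V_def Delta_unit_level_0)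
  have sub: "subdegree b = K"
    by (rule subdegreeI) (use V0 in \<open>simp_all add: b_def fps_X_power_mult_nth\<close>)
  have db: "fps_delta b = 0"
    unfolding b_def V_def by (simp add: fps_delta_mult fps_delta_X_power Delta_unit_level_const)
  have Dnz: "Delta z ^ m \<noteq> 0" if "Im z > 0" for z
    using Delta_nonzero[OF that] by simp
  define y where "y z = G z / Delta z ^ m" for z
  have sly: "slash w y \<gamma> z = slash k G \<gamma> z / Delta z ^ m" if \<gamma>: "\<gamma> \<in> SL2Z" and z: "Im z > 0" for \<gamma> z
  proof -
    have "slash w y \<gamma> z * Delta z ^ m = slash k (\<lambda>z. y z * Delta z ^ m) \<gamma> z"
      by (rule sl[OF \<gamma> z, symmetric])
    also have "\<dots> = slash k G \<gamma> z"
      by (rule slash_cong) (use Dnz \<gamma> z in \<open>simp_all add: y_def\<close>)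
    finally show ?thesis
      using Dnz[OF z] by (simp add: eq_divide_eq)
  qed
  have qy: "\<exists>e. qexp N (slash w y \<gamma>) e \<and> e * b = fps_delta c"
    if \<gamma>: "\<gamma> \<in> SL2Z" and c: "qexp N (slash k x \<gamma>) c" for \<gamma> c
  proof -
    have "qexp N (\<lambda>z. slash w F \<gamma> z * Delta z ^ m) c"
      by (rule qexp_congI[OF c]) (simp add: x_def[abs_def] sl \<gamma>)
    \<comment> \<open>The arbitrary constant term of the polar part affects c only from the index K
      on. The coefficients below K being killed is exactly the divisibility of D c by
      \<open>Delta ^ m\<close>.\<close>
    then have "\<delta> (fps_nth c i) = 0" if "i < K" for i
      using cpolar_Delta_const[OF polar[OF \<gamma>] N0 BK, of c i] that by (simp add: K_def)
    then obtain e where "qexp N (\<lambda>z. slash k G \<gamma> z / Delta z ^ m) e" "e * b = fps_delta c"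
      using qexp_divide[OF qG[OF \<gamma> c] b N0 Dnz] sub by auto
    then show ?thesis
      using qexp_congI[of N "\<lambda>z. slash k G \<gamma> z / Delta z ^ m" e "slash w y \<gamma>"] sly[OF \<gamma>] by blast
  qed
  have y: "y \<in> MF w N"
    unfolding MF_def
  proof (safe)
    show "slash w y \<gamma> z = y z" if "\<gamma> \<in> Gam N" "0 < Im z" for \<gamma> z
      using sly[OF Gam_SL2Z[OF that(1)] that(2)] MF_inv[OF G that] by (simp add: y_def)
    show "\<exists>c. qexp N (slash w y \<gamma>) c" if "\<gamma> \<in> SL2Z" for \<gamma>
      using MF_qexpE[OF x that] qy[OF that] by blast
  qed
  have sl1: "slash k H (mat 1) = H" "slash w H (mat 1) = H" for H
    by (simp_all add: fun_eq_iff)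
  obtain c where c: "qexp N x c"
    using MF_qexp1E[OF x] .
  then obtain e where e: "qexp N y e" "e * b = fps_delta c"
    using qy[OF SL2Z_1, of c] by (auto simp: sl1)
  \<comment> \<open>Index K of c belongs to the constant term of the quotient y at oo; here the
    stronger condition \<open>polar_oo\<close> enters.\<close>
  have "\<delta> (fps_nth c K) = 0"
    using cpolar_Delta_const[OF polar_oo N0 BK, of c K] c by (simp add: x_def[abs_def] K_def)
  then have "fps_nth (e * b) K = 0"
    by (simp add: e(2))
  moreover have "e * b = fps_X ^ K * (e * V)"
    by (simp add: b_def mult_ac)
  ultimately have "fps_nth e 0 * fps_nth V 0 = 0"
    by (simp add: fps_X_power_mult_nth)
  then have "fps_nth e 0 = 0"
    using V0 by simp
  then have "y z = 0" if "Im z > 0" for z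
    using MF_weight_nonpos_eq_0[OF y N0 w e(1) _ that] by simp
  then have "e = 0"
    using qexp_eq_0_iff[OF e(1) N0] by simp
  then have dc: "fps_delta c = 0"
    using e(2) by simp
  define a where "a = Abs_fps (\<lambda>m. C (int m - int D))"
  have "qexp (1 * N) (\<lambda>z. qq 1 z ^ D * F z) (fps_spread N a)"
    unfolding a_def by (rule qexp_spread[OF lexp_qexp[OF F] zero_less_one N0])
  then have "qexp N (\<lambda>z. qq 1 z ^ D * F z * Delta z ^ m) (fps_spread N a * b)"
    using qexp_mult[OF _ b N0] by simp
  moreover have "qexp N (\<lambda>z. qq N z ^ (N * D) * x z) (fps_X ^ (N * D) * c)"
    by (intro qexp_mult qexp_power[of _ "qq N"] qexp_qq c N0)
  moreover have "(\<lambda>z. qq 1 z ^ D * F z * Delta z ^ m) = (\<lambda>z. qq N z ^ (N * D) * x z)"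
    by (rule ext) (simp only: x_def qq_power_level[OF N0] power_mult mult.assoc)
  ultimately have "fps_spread N a * b = fps_X ^ (N * D) * c"
    using qexp_unique[OF _ _ N0] by metis
  then have "fps_delta (fps_spread N a * b) = fps_delta (fps_X ^ (N * D) * c)"
    by simp
  then have "fps_spread N (fps_delta a) * b = 0"
    by (simp add: fps_delta_mult fps_delta_X_power dc db fps_delta_spread)
  moreover have "b \<noteq> 0"
    using V0 by (auto simp: b_def)
  ultimately have "fps_delta a = 0"
    using fps_spread_eq_0D[OF _ N0] by simp
  show ?thesis
  proof (cases "n < - int D")
    case True
    then show ?thesis
      using F by (simp add: lexp_def)
  next
    case False
    then have "fps_nth a (nat (n + int D)) = C n"
      by (simp add: a_def)
    then show ?thesis
      using \<open>fps_delta a = 0\<close> by (metis fps_delta_eq_0_iff)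
  qed
qed

end

subsection \<open>The coefficients of the holomorphic part\<close>

lemma hecke_diff: "prime p \<Longrightarrow> hecke w \<psi> p (\<lambda>z. F z - G z) z = hecke w \<psi> p F z - hecke w \<psi> p G z"
  by (simp add: hecke_prime sum_subtractf algebra_simps)

lemma lexp_holomorphic:
  assumes "lexp D F C"
  shows "F holomorphic_on uhp"
proof -
  have "(\<lambda>z. qq 1 z ^ D * F z) holomorphic_on uhp"
    by (rule qexp_holomorphic[OF lexp_qexp[OF assms]]) simp
  then have "(\<lambda>z. qq 1 z ^ D * F z / qq 1 z ^ D) holomorphic_on uhp"
    by (rule holomorphic_on_divide[OF _ holomorphic_on_power[OF holomorphic_qq]]) simp
  then show ?thesis
    by simp
qed

lemma lexp_cong:
  assumes F: "lexp D F C" and eq: "\<And>z. Im z > 0 \<Longrightarrow> G z = F z"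
  shows "lexp D G C"
proof -
  have "qexp 1 (\<lambda>z. qq 1 z ^ D * G z) (Abs_fps (\<lambda>m. C (int m - int D)))"
    by (rule qexp_congI[OF lexp_qexp[OF F]]) (simp add: eq)
  then show ?thesis
    using F by (simp add: lexp_def)
qed

context derivation
begin

lemma hecke_plus_part_const:
  assumes k: "2 \<le> k" and N: "N > 0" and chi: "dirichlet_character N chi"
    and g: "normalized_newform k N (\<lambda>d. cnj (chi d)) g"
    and f: "f \<in> harmonic_maass_forms (2 - k) N chi" and good: "good_for k N f g"
    and p: "prime p" and gp: "q_coeff g p = 0"
  shows "\<delta> (c_plus k f (int p * n) +
    of_nat p powi (1 - k) * chi (int p) * (if int p dvd n then c_plus k f (n div int p) else 0)) = 0"
proof -
  define s where "s = nat (k - 2)"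
  have ks: "k = int s + 2"
    using k by (simp add: s_def)
  define w where "w = 2 - k"
  have p0: "p > 0"
    using p prime_gt_0_nat by auto
  define c where "c = Abs_fps (q_coeff g)"
  have cusp: "g \<in> cusp_forms k N (\<lambda>d. cnj (chi d))"
    using g by (simp add: normalized_newform_def new_cusp_forms_def)
  have qg: "qexp 1 g c" and c0: "fps_nth c 0 = 0"
    using cusp_forms_qexp[OF cusp N dirichlet_cnj[OF chi]] by (simp_all add: c_def)
  have chi1: "chi 1 = 1"
    by (rule dirichlet_1[OF chi])
  have eig: "hecke_fps k (\<lambda>d. cnj (chi d)) p c = 0"
  proof -
    obtain ev where ev: "\<And>z. Im z > 0 \<Longrightarrow> hecke k (\<lambda>d. cnj (chi d)) p g z = ev * g z"
      using g p0 unfolding normalized_newform_def by (metis One_nat_def Suc_leI uhp_iff)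
    have eq: "hecke_fps k (\<lambda>d. cnj (chi d)) p c = fps_const ev * c"
    proof (rule qexp_unique[OF qexp_hecke[OF qg p0] _ zero_less_one])
      show "qexp 1 (hecke k (\<lambda>d. cnj (chi d)) p g) (fps_const ev * c)"
        by (rule qexp_congI[OF qexp_cmult[OF qg zero_less_one] ev])
    qed
    have "fps_nth (hecke_fps k (\<lambda>d. cnj (chi d)) p c) 1 = fps_nth c p"
      by (rule hecke_fps_nth_1[OF p0]) (simp add: chi1)
    then have "fps_nth (fps_const ev * c) 1 = fps_nth c p"
      by (simp only: eq)
    then have "ev * q_coeff g 1 = q_coeff g p"
      by (simp add: c_def)
    moreover have "q_coeff g 1 = 1"
      using g by (simp add: normalized_newform_def)
    ultimately have "ev = 0"
      using gp by simp
    then show ?thesis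
      by (simp add: eq)
  qed
  have tr: "modular_transform w N chi f"
    using f by (simp add: harmonic_maass_forms_def w_def)
  have invf: "slash w f \<gamma> z = f z" if "\<gamma> \<in> Gam N" "Im z > 0" for \<gamma> z
    by (rule modular_transform_Gam[OF tr chi that])
  obtain r D where lexp: "lexp D (\<lambda>z. f z - nh_part s r c z) (c_plus k f)"
    unfolding s_def c_def using maass_holomorphic_part[OF k N chi f good cusp] .
  define F where "F = hecke w chi p f"
  define C where "C n = c_plus k f (int p * n) +
      of_nat p powi (w - 1) * chi (int p) * (if int p dvd n then c_plus k f (n div int p) else 0)" for n
  have "lexp (p * D) (hecke w chi p (\<lambda>z. f z - nh_part s r c z)) C"
    unfolding C_def by (rule lexp_hecke[where \<psi> = chi, OF lexp p chi1])
  moreover have "F z = hecke w chi p (\<lambda>z. f z - nh_part s r c z) z" if "Im z > 0" for z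
    using hecke_nh_part[where chi = chi, OF p _ chi1 ks eig that] qg by (simp add: F_def hecke_diff[OF p] w_def qexp_def)
  ultimately have FC: "lexp (p * D) F C"
    by (rule lexp_cong)
  obtain P where P: "principal_part 1 P f" "\<And>i. coeff P i \<in> coeff_field g"
    using good by (auto simp: good_for_def)
  have Pc: "\<delta> (coeff P i) = 0" for i
    by (rule coeff_field_const[OF newform_coeff_const[OF g dirichlet_cnj[OF chi] N] P(2)])
  define B where "B = degree P"
  have pol_oo: "cpolar 0 1 B f"
    by (rule cpolarI[of P], simp add: B_def, rule Pc, rule principal_part_tendsto[OF P(1)])
  have pol: "cpolar 1 1 B (slash w f \<gamma>)" if \<gamma>: "\<gamma> \<in> SL2Z" for \<gamma>
  proof (cases "\<gamma> \<in> Gamma0 N")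
    case True
    have "cpolar 0 1 B (\<lambda>z. chi (\<gamma> $ 2 $ 2) * f z)"
      by (rule cpolar_cmult[OF pol_oo dirichlet_const[OF chi N]])
    then have "cpolar 0 1 B (slash w f \<gamma>)"
      by (rule cpolar_cong) (simp add: modular_transform_slash[OF tr True])
    then show ?thesis
      by (rule cpolar_weaken) simp_all
  next
    case False
    then obtain a where "principal_part N [:a:] (slash w f \<gamma>)"
      using good \<gamma> False unfolding good_for_def w_def by blast
    \<comment> \<open>A constant polynomial does not depend on the local parameter, so width N may
      be replaced by 1. Its value a is any complex number, which is why only b = 1 is
      claimed.\<close>
    from principal_part_tendsto[OF this]
    have "((\<lambda>z. slash w f \<gamma> z - poly [:a:] (inverse (qq 1 z))) \<longlongrightarrow> 0) (filtercomap Im at_top)"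
      by simp
    then show ?thesis
      by (intro cpolarI[of "[:a:]"]) (auto simp: coeff_pCons split: nat.split)
  qed
  \<comment> \<open>The factor 3 ensures a level of at least 3, as required by
    \<open>weakly_holomorphic_coeff_const\<close>.\<close>
  define M where "M = 3 * N"
  define B' where "B' = B * (M * p * p)"
  have M: "M > 0"
    using N by (simp add: M_def)
  have pw: "\<delta> (of_nat p powi (w - 1)) = 0"
    by (intro const_powi) simp
  have cchi: "\<delta> (chi a) = 0" for a
    by (rule dirichlet_const[OF chi N])
  \<comment> \<open>Stated for an arbitrary family H so that it serves both f|\<beta> at oo and
    (f|\<beta>)|\<gamma> at the other cusps.\<close>
  have combine: "cpolar b h B'' (\<lambda>z. of_nat p powi (w - 1) * chi (int p) * H (mat2 (int p) 0 0 1) z +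
      (\<Sum>j<p. of_nat p powi (w - 1) * H (mat2 1 (int j) 0 (int p)) z))"
    if "\<And>\<beta>. \<beta> \<in> insert (mat2 (int p) 0 0 1) ((\<lambda>j. mat2 1 (int j) 0 (int p)) ` {..<p}) \<Longrightarrow> cpolar b h B'' (H \<beta>)"
    for b h B'' H
    by (intro cpolar_add cpolar_sum cpolar_cmult that const_mult pw cchi) auto
  have polF_oo: "cpolar 0 (M * p) B' F"
  proof (rule cpolar_cong[OF combine[of 0 "M * p" B' "slash w f"]])
    fix \<beta> assume "\<beta> \<in> insert (mat2 (int p) 0 0 1) ((\<lambda>j. mat2 1 (int j) 0 (int p)) ` {..<p})"
    then consider "\<beta> = mat2 (int p) 0 0 (int 1)" | j where "\<beta> = mat2 (int 1) j 0 (int p)"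
      by auto
    then show "cpolar 0 (M * p) B' (slash w f \<beta>)"
    proof cases
      case 1
      show ?thesis
        unfolding 1 B'_def by (rule cpolar_slash[OF pol_oo _ _ p0 M]) simp_all
    next
      case (2 j)
      show ?thesis
        unfolding 2 B'_def by (rule cpolar_slash[OF pol_oo _ _ p0 M]) simp_all
    qed
  qed (simp add: F_def hecke_slash[where \<psi> = chi, OF p chi1])
  have polF: "cpolar 1 (M * p) B' (slash w F \<gamma>)" if \<gamma>: "\<gamma> \<in> SL2Z" for \<gamma>
  proof (rule cpolar_cong[OF combine[of 1 "M * p" B' "\<lambda>\<beta>. slash w (slash w f \<beta>) \<gamma>"]])
    fix \<beta> assume "\<beta> \<in> insert (mat2 (int p) 0 0 1) ((\<lambda>j. mat2 1 (int j) 0 (int p)) ` {..<p})"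
    then have "det \<beta> = int p"
      by (auto simp: det_mat2)
    then have det: "det (\<beta> ** \<gamma>) = int p"
      using \<gamma> by (simp add: det_mul SL2Z_det)
    obtain \<gamma>' and a d :: nat and j :: int where \<gamma>': "\<gamma>' \<in> SL2Z"
      and dec: "\<beta> ** \<gamma> = \<gamma>' ** mat2 (int a) j 0 (int d)" and ad: "a * d = p"
      using upper_triangular_decomposition[OF det p0] .
    have "det (mat2 (int a) j 0 (int d)) = int p"
      using ad by (simp add: det_mat2 flip: of_nat_mult)
    then have dp: "det (mat2 (int a) j 0 (int d)) > 0"
      using p0 by simp
    have "cpolar 1 (M * p) B' (slash w (slash w f \<gamma>') (mat2 (int a) j 0 (int d)))"
      unfolding B'_def by (rule cpolar_slash[OF pol[OF \<gamma>'] _ ad p0 M]) simp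
    then show "cpolar 1 (M * p) B' (slash w (slash w f \<beta>) \<gamma>)"
    proof (rule cpolar_cong)
      fix z :: complex assume z: "Im z > 0"
      have "slash w (slash w f \<gamma>') (mat2 (int a) j 0 (int d)) z = slash w f (\<beta> ** \<gamma>) z"
        unfolding dec using dp z by (simp add: slash_mult)
      also have "\<dots> = slash w (slash w f \<beta>) \<gamma> z"
        using \<gamma> z by (simp add: slash_mult)
      finally show "slash w (slash w f \<gamma>') (mat2 (int a) j 0 (int d)) z = slash w (slash w f \<beta>) \<gamma> z" .
    qed
  next
    fix z
    have "F = (\<lambda>z. of_nat p powi (w - 1) * chi (int p) * slash w f (mat2 (int p) 0 0 1) z +
      (\<Sum>j<p. of_nat p powi (w - 1) * slash w f (mat2 1 (int j) 0 (int p)) z))"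
      by (simp add: fun_eq_iff F_def hecke_slash[where \<psi> = chi, OF p chi1])
    then show "of_nat p powi (w - 1) * chi (int p) * slash w (slash w f (mat2 (int p) 0 0 1)) \<gamma> z +
      (\<Sum>j<p. of_nat p powi (w - 1) * slash w (slash w f (mat2 1 (int j) 0 (int p))) \<gamma> z) = slash w F \<gamma> z"
      by (simp only: slash_add slash_cmult slash_sum)
  qed
  have "\<delta> (C n) = 0"
  proof (rule weakly_holomorphic_coeff_const[OF _ _ lexp_holomorphic[OF FC] _ polF polF_oo FC])
    have "M * p \<ge> 3 * 1 * 1"
      unfolding M_def using N p0 by (intro mult_mono) auto
    then show "M * p \<ge> 3"
      by simp
    show "w \<le> 0"
      using k by (simp add: w_def)
    fix \<gamma> z assume \<gamma>: "\<gamma> \<in> Gam (M * p)" and z: "Im z > 0"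
    have "N * p dvd M * p"
      by (simp add: M_def)
    then have "\<gamma> \<in> Gam (N * p)"
      using \<gamma> congm_dvd by (auto simp: Gam_def)
    then show "slash w F \<gamma> z = F z"
      unfolding F_def by (intro hecke_modular_Gam[where \<psi> = chi, OF p chi1 invf] z)
  qed
  then show ?thesis
    by (simp add: C_def w_def)
qed

lemma plus_part_const:
  assumes a: "\<And>n. \<delta> (a (int p * n) + x * (if int p dvd n then a (n div int p) else 0)) = 0"
    and x: "\<delta> x = 0" and p: "prime p" and n: "odd (multiplicity (int p) n)"
  shows "\<delta> (a n) = 0"
proof -
  have pi: "prime (int p)"
    using p by simp
  have p0: "int p \<noteq> 0"
    using p prime_gt_0_nat[of p] by auto
  have n0: "n \<noteq> 0"
    using n by auto
  obtain m where m: "n = int p ^ multiplicity (int p) n * m" "\<not> int p dvd m"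
    using multiplicity_decompose'[of n "int p"] n0 pi by (metis not_prime_unit)
  obtain j where j: "multiplicity (int p) n = 2 * j + 1"
    using n by (auto elim: oddE)
  \<comment> \<open>The relation at p^(2j+2) m leads from p^(2j+1) m to p^(2j+3) m. The start j = 0
    is the relation at m, whose second summand is 0 because p does not divide m.\<close>
  have "\<delta> (a (int p ^ (2 * j + 1) * m)) = 0"
  proof (induction j)
    case 0
    show ?case
      using a[of m] m(2) by simp
  next
    case (Suc j)
    have "int p dvd int p ^ (2 * j + 2) * m" "int p ^ (2 * j + 2) * m div int p = int p ^ (2 * j + 1) * m"
      using p0 by simp_all
    moreover have "int p * (int p ^ (2 * j + 2) * m) = int p ^ (2 * Suc j + 1) * m"
      by simp
    ultimately have "\<delta> (a (int p ^ (2 * Suc j + 1) * m) + x * a (int p ^ (2 * j + 1) * m)) = 0"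
      using a[of "int p ^ (2 * j + 2) * m"] by (simp only: if_True)
    moreover have "\<delta> (x * a (int p ^ (2 * j + 1) * m)) = 0"
      using Suc x by (rule const_mult[rotated])
    ultimately show ?case
      by (simp only: add) (simp only: add_0_right)
  qed
  then show ?thesis
    using m(1) j by simp
qed

end

theorem theorem1p4:
  fixes k :: int and N p :: nat and chi :: "int \<Rightarrow> complex"
    and f g :: "complex \<Rightarrow> complex" and n :: int
  assumes "2 \<le> k" and "1 \<le> N"
    and "dirichlet_character N chi"
    and "normalized_newform k N (\<lambda>d. cnj (chi d)) g"
    and "f \<in> harmonic_maass_forms (2 - k) N chi"
    and "good_for k N f g"
    and "prime p" and "\<not> p dvd N"
    and "q_coeff g p = 0"
    and "odd (multiplicity (int p) n)"
  shows "algebraic (c_plus k f n)"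
proof (rule algebraicI_derivation)
  fix \<delta> :: "complex \<Rightarrow> complex"
  assume "derivation \<delta>"
  then interpret derivation \<delta> .
  have N: "N > 0"
    using assms(2) by simp
  show "\<delta> (c_plus k f n) = 0"
  proof (rule plus_part_const[OF _ _ assms(7,10)])
    show "\<delta> (of_nat p powi (1 - k) * chi (int p)) = 0"
      by (intro const_mult const_powi dirichlet_const[OF assms(3) N]) simp
    show "\<delta> (c_plus k f (int p * n) + of_nat p powi (1 - k) * chi (int p) *
        (if int p dvd n then c_plus k f (n div int p) else 0)) = 0" for n
      by (rule hecke_plus_part_const[OF assms(1) N assms(3-7) assms(9)])
  qed
qed

end
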